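(* Let $G$ be a finite group, $\mathcal P$ a finite $G$-poset and $k$ an algebraically closed field of characteristic $p$ dividing the order of $G$. (1) If $\mathfrak P$ is a projective (or injective) $k(G\propto\mathcal P)$-module, then $\mathfrak P_x$ is a projective $k(G\propto[x])$-module for every $\mathfrak P$-object $x$. (2) A $k(G\propto\mathcal P)$-module $\mathfrak M$ is of finite projective (equivalently, finite injective) dimension if and only if $\mathfrak M_x$ is a projective $k(G\propto[x])$-module for every $\mathfrak M$-object $x$. In that case both the projective dimension and the injective dimension of $\mathfrak M$ are bounded by $\dim\mathcal P$. (3) The transporter category algebra $k(G\propto\mathcal P)$ is Gorenstein, i.e. it has finite injective dimension both as left and as right regular module.
   Context: $G\propto\mathcal P$ has the objects of the poset $\mathcal P$ (on which $G$ acts by poset automorphisms); a morphism $x\to y$ is a pair $(g,gx\le y)$ with $g\in G$; composition is $(h,hy\le z)\circ(g,gx\le y)=(hg,(hg)x\le z)$. Its category algebra has the morphisms as $k$-basis, the product of two morphisms being their composite if composable and $0$ otherwise. Modules are finitely generated left modules (unless specified) and are identified with covariant functors to finite-dimensional $k$-vector spaces. $\dim\mathcal P$ is the maximal $n$ such that a chain $x_0<x_1<\cdots<x_n$ exists in $\mathcal P$. For an object $x$, $[x]=Gx$ is its orbit, regarded as a $G$-poset with trivial relations, and $G\propto[x]$ is the corresponding full subcategory of $G\propto\mathcal P$. An object $x$ is an $\mathfrak M$-object if $\mathfrak M(x)\neq0$; $\mathfrak M_x$ is the restriction (truncation) of $\mathfrak M$ to $G\propto[x]$. *)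

theory Defs
  imports
    "HOL-Library.Extended_Nat"
    "HOL-Computational_Algebra.Polynomial"
    "HOL-Algebra.Group_Action"
    "HOL-Algebra.Module"
begin

section \<open>Modules over a not necessarily commutative ring\<close>

text \<open>
  The library locale \<^locale>\<open>module\<close> requires a commutative ring of scalars.  Only its record
  type is reused here; the multiplication and unit fields of that record are ignored.
\<close>

locale left_module = R?: ring R + M?: abelian_group M
  for R (structure) and M :: "('r, 'm) module" (structure) +
  assumes smult_closed:
      "\<lbrakk>a \<in> carrier R; x \<in> carrier M\<rbrakk> \<Longrightarrow> a \<odot>\<^bsub>M\<^esub> x \<in> carrier M"
    and smult_l_distr:
      "\<lbrakk>a \<in> carrier R; b \<in> carrier R; x \<in> carrier M\<rbrakk> \<Longrightarrow>
        (a \<oplus>\<^bsub>R\<^esub> b) \<odot>\<^bsub>M\<^esub> x = a \<odot>\<^bsub>M\<^esub> x \<oplus>\<^bsub>M\<^esub> b \<odot>\<^bsub>M\<^esub> x"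
    and smult_r_distr:
      "\<lbrakk>a \<in> carrier R; x \<in> carrier M; y \<in> carrier M\<rbrakk> \<Longrightarrow>
        a \<odot>\<^bsub>M\<^esub> (x \<oplus>\<^bsub>M\<^esub> y) = a \<odot>\<^bsub>M\<^esub> x \<oplus>\<^bsub>M\<^esub> a \<odot>\<^bsub>M\<^esub> y"
    and smult_assoc:
      "\<lbrakk>a \<in> carrier R; b \<in> carrier R; x \<in> carrier M\<rbrakk> \<Longrightarrow>
        (a \<otimes>\<^bsub>R\<^esub> b) \<odot>\<^bsub>M\<^esub> x = a \<odot>\<^bsub>M\<^esub> (b \<odot>\<^bsub>M\<^esub> x)"
    and smult_one:
      "x \<in> carrier M \<Longrightarrow> \<one>\<^bsub>R\<^esub> \<odot>\<^bsub>M\<^esub> x = x"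

definition fg_module :: "'r ring \<Rightarrow> ('r, 'm) module \<Rightarrow> bool" where
  "fg_module R M \<longleftrightarrow> left_module R M \<and>
     (\<exists>S. finite S \<and> S \<subseteq> carrier M \<and>
       (\<forall>x\<in>carrier M. \<exists>c\<in>S \<rightarrow> carrier R. x = (\<Oplus>\<^bsub>M\<^esub>s\<in>S. c s \<odot>\<^bsub>M\<^esub> s)))"

definition module_hom :: "'r ring \<Rightarrow> ('r, 'm) module \<Rightarrow> ('r, 'n) module \<Rightarrow> ('m \<Rightarrow> 'n) set" where
  "module_hom R M N = {f \<in> carrier M \<rightarrow> carrier N.
     (\<forall>x\<in>carrier M. \<forall>y\<in>carrier M. f (x \<oplus>\<^bsub>M\<^esub> y) = f x \<oplus>\<^bsub>N\<^esub> f y) \<and>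
     (\<forall>a\<in>carrier R. \<forall>x\<in>carrier M. f (a \<odot>\<^bsub>M\<^esub> x) = a \<odot>\<^bsub>N\<^esub> f x)}"

definition module_kernel :: "('r, 'm) module \<Rightarrow> ('r, 'n) module \<Rightarrow> ('m \<Rightarrow> 'n) \<Rightarrow> 'm set" where
  "module_kernel M N f = {x \<in> carrier M. f x = \<zero>\<^bsub>N\<^esub>}"

text \<open>
  Formulas cannot quantify over types, so the modules quantified over in the following definitions
  have carriers inside one fixed type.  No module is lost up to isomorphism: a module generated by
  \<open>n\<close> elements is a quotient of \<open>R\<^sup>n\<close>, so its underlying set embeds into \<open>R\<^sup>n\<close>, and hence into
  \<open>nat \<Rightarrow> 'r\<close>, by choosing representatives.  The module under consideration itself may live on any
  type.  Projectivity, injectivity and resolutions are those of the category of finitely generated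
  modules.
\<close>

type_synonym 'r std_module = "('r, nat \<Rightarrow> 'r) module"

definition projective_module :: "'r ring \<Rightarrow> ('r, 'm) module \<Rightarrow> bool" where
  "projective_module R Q \<longleftrightarrow> fg_module R Q \<and>
     (\<forall>(N :: 'r std_module) (L :: 'r std_module) f g.
        fg_module R N \<and> fg_module R L \<and>
        f \<in> module_hom R N L \<and> f ` carrier N = carrier L \<and> g \<in> module_hom R Q L \<longrightarrow>
        (\<exists>h\<in>module_hom R Q N. \<forall>x\<in>carrier Q. f (h x) = g x))"

definition injective_module :: "'r ring \<Rightarrow> ('r, 'm) module \<Rightarrow> bool" where
  "injective_module R Q \<longleftrightarrow> fg_module R Q \<and>
     (\<forall>(N :: 'r std_module) (L :: 'r std_module) f g.
        fg_module R N \<and> fg_module R L \<and>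
        f \<in> module_hom R N L \<and> inj_on f (carrier N) \<and> g \<in> module_hom R N Q \<longrightarrow>
        (\<exists>h\<in>module_hom R L Q. \<forall>x\<in>carrier N. h (f x) = g x))"

text \<open>An exact sequence \<open>\<dots> \<rightarrow> Q 1 \<rightarrow> Q 0 \<rightarrow> M \<rightarrow> 0\<close> of projectives with \<open>Q i = 0\<close> for \<open>i > n\<close>.\<close>

definition projective_resolution ::
    "'r ring \<Rightarrow> ('r, 'm) module \<Rightarrow> nat \<Rightarrow> (nat \<Rightarrow> 'r std_module) \<Rightarrow>
      (nat \<Rightarrow> (nat \<Rightarrow> 'r) \<Rightarrow> (nat \<Rightarrow> 'r)) \<Rightarrow> ((nat \<Rightarrow> 'r) \<Rightarrow> 'm) \<Rightarrow> bool" where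
  "projective_resolution R M n Q d \<epsilon> \<longleftrightarrow>
     (\<forall>i. projective_module R (Q i)) \<and>
     (\<forall>i>n. carrier (Q i) = {\<zero>\<^bsub>Q i\<^esub>}) \<and>
     \<epsilon> \<in> module_hom R (Q 0) M \<and> (\<forall>i. d i \<in> module_hom R (Q (Suc i)) (Q i)) \<and>
     \<epsilon> ` carrier (Q 0) = carrier M \<and>
     module_kernel (Q 0) M \<epsilon> = d 0 ` carrier (Q 1) \<and>
     (\<forall>i. module_kernel (Q (Suc i)) (Q i) (d i) = d (Suc i) ` carrier (Q (Suc (Suc i))))"

text \<open>An exact sequence \<open>0 \<rightarrow> M \<rightarrow> Q 0 \<rightarrow> Q 1 \<rightarrow> \<dots>\<close> of injectives with \<open>Q i = 0\<close> for \<open>i > n\<close>.\<close>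

definition injective_resolution ::
    "'r ring \<Rightarrow> ('r, 'm) module \<Rightarrow> nat \<Rightarrow> (nat \<Rightarrow> 'r std_module) \<Rightarrow>
      (nat \<Rightarrow> (nat \<Rightarrow> 'r) \<Rightarrow> (nat \<Rightarrow> 'r)) \<Rightarrow> ('m \<Rightarrow> (nat \<Rightarrow> 'r)) \<Rightarrow> bool" where
  "injective_resolution R M n Q d \<eta> \<longleftrightarrow>
     (\<forall>i. injective_module R (Q i)) \<and>
     (\<forall>i>n. carrier (Q i) = {\<zero>\<^bsub>Q i\<^esub>}) \<and>
     \<eta> \<in> module_hom R M (Q 0) \<and> (\<forall>i. d i \<in> module_hom R (Q i) (Q (Suc i))) \<and>
     inj_on \<eta> (carrier M) \<and>
     module_kernel (Q 0) (Q 1) (d 0) = \<eta> ` carrier M \<and>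
     (\<forall>i. module_kernel (Q (Suc i)) (Q (Suc (Suc i))) (d (Suc i)) = d i ` carrier (Q i))"

text \<open>The infimum of the empty set in \<^typ>\<open>enat\<close> is \<open>\<infinity>\<close>; the zero module has dimension \<open>0\<close>.\<close>

definition proj_dim :: "'r ring \<Rightarrow> ('r, 'm) module \<Rightarrow> enat" where
  "proj_dim R M = Inf {enat n | n. \<exists>Q d \<epsilon>. projective_resolution R M n Q d \<epsilon>}"

definition inj_dim :: "'r ring \<Rightarrow> ('r, 'm) module \<Rightarrow> enat" where
  "inj_dim R M = Inf {enat n | n. \<exists>Q d \<eta>. injective_resolution R M n Q d \<eta>}"

definition opposite_ring :: "'r ring \<Rightarrow> 'r ring" where
  "opposite_ring R = R\<lparr>mult := \<lambda>a b. b \<otimes>\<^bsub>R\<^esub> a\<rparr>"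

definition regular_module :: "'r ring \<Rightarrow> ('r, 'r) module" where
  "regular_module R = \<lparr>carrier = carrier R, mult = mult R, one = one R, zero = zero R, add = add R,
     smult = mult R\<rparr>"

text \<open>Right modules are left modules over the opposite ring.\<close>

definition gorenstein :: "'r ring \<Rightarrow> bool" where
  "gorenstein R \<longleftrightarrow> inj_dim R (regular_module R) < \<infinity> \<and>
     inj_dim (opposite_ring R) (regular_module (opposite_ring R)) < \<infinity>"


section \<open>Category algebras\<close>

record ('o, 'a) cat =
  Obj :: "'o set"
  Arr :: "'a set"
  Dom :: "'a \<Rightarrow> 'o"
  Cod :: "'a \<Rightarrow> 'o"
  Ide :: "'o \<Rightarrow> 'a"
  Cmp :: "'a \<Rightarrow> 'a \<Rightarrow> 'a"  \<comment> \<open>\<open>Cmp C f g\<close> is \<open>f \<circ> g\<close>, meaningful if \<open>Dom C f = Cod C g\<close>\<close>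

text \<open>
  An element \<open>\<Sum>f. a f \<cdot> f\<close> of the category algebra of a finite category is encoded by its coefficient
  function \<open>a\<close>, which vanishes off the morphisms.  For a subcategory \<open>D\<close> of \<open>C\<close> the algebra
  of \<open>D\<close> is thereby literally a subset of the algebra of \<open>C\<close>, with the same sum and product
  (but a different unit).
\<close>

definition category_algebra :: "('o, 'a) cat \<Rightarrow> ('a \<Rightarrow> 'k::field) ring" where
  "category_algebra C = \<lparr>
     carrier = {a. \<forall>f. f \<notin> Arr C \<longrightarrow> a f = 0},
     mult = (\<lambda>a b h. \<Sum>(f, g) \<in> {(f, g). f \<in> Arr C \<and> g \<in> Arr C \<and> Dom C f = Cod C g \<and> Cmp C f g = h}.
               a f * b g),
     one = (\<lambda>f. if f \<in> Ide C ` Obj C then 1 else 0),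
     zero = (\<lambda>f. 0),
     add = (\<lambda>a b f. a f + b f)\<rparr>"

definition basis_elt :: "'a \<Rightarrow> 'a \<Rightarrow> 'k::field" where
  "basis_elt f = (\<lambda>h. if h = f then 1 else 0)"

text \<open>
  A module \<open>M\<close> over the category algebra corresponds to the functor with values \<open>M(x) = 1\<^sub>x M\<close>.
  Restricting this functor to a full subcategory \<open>D\<close> gives the module
  \<open>\<Oplus>y\<in>Obj D. M(y) = 1\<^sub>D M\<close>, where \<open>1\<^sub>D = \<Sum>y\<in>Obj D. 1\<^sub>y\<close> is the unit of the algebra of \<open>D\<close>.
\<close>

definition value_at :: "('o, 'a) cat \<Rightarrow> ('a \<Rightarrow> 'k::field, 'm) module \<Rightarrow> 'o \<Rightarrow> 'm set" where
  "value_at C M x = (\<lambda>m. basis_elt (Ide C x) \<odot>\<^bsub>M\<^esub> m) ` carrier M"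

definition truncation :: "('o, 'a) cat \<Rightarrow> ('a \<Rightarrow> 'k::field, 'm) module \<Rightarrow> ('a \<Rightarrow> 'k, 'm) module" where
  "truncation D M = M\<lparr>carrier := (\<lambda>m. \<one>\<^bsub>category_algebra D\<^esub> \<odot>\<^bsub>M\<^esub> m) ` carrier M\<rparr>"


section \<open>Transporter categories\<close>

locale finite_G_poset = group_action G P \<phi>
  for G (structure) and P :: "'p set" and r :: "'p rel" and \<phi> +
  assumes finite_group: "finite (carrier G)"
    and finite_poset: "finite P"
    and poset: "partial_order_on P r"
    and act_automorphism: "\<lbrakk>g \<in> carrier G; x \<in> P; y \<in> P\<rbrakk> \<Longrightarrow> (\<phi> g x, \<phi> g y) \<in> r \<longleftrightarrow> (x, y) \<in> r"

text \<open>The morphism \<open>(g, gx \<le> y)\<close> from \<open>x\<close> to \<open>y\<close> is encoded as the triple \<open>(g, x, y)\<close>.\<close>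

definition transporter_category ::
    "('g, 'e) monoid_scheme \<Rightarrow> 'p set \<Rightarrow> 'p rel \<Rightarrow> ('g \<Rightarrow> 'p \<Rightarrow> 'p) \<Rightarrow> ('p, 'g \<times> 'p \<times> 'p) cat" where
  "transporter_category G P r \<phi> = \<lparr>
     Obj = P,
     Arr = {(g, x, y). g \<in> carrier G \<and> x \<in> P \<and> y \<in> P \<and> (\<phi> g x, y) \<in> r},
     Dom = (\<lambda>(g, x, y). x),
     Cod = (\<lambda>(g, x, y). y),
     Ide = (\<lambda>x. (\<one>\<^bsub>G\<^esub>, x, x)),
     Cmp = (\<lambda>(h, y, z) (g, x, y'). (h \<otimes>\<^bsub>G\<^esub> g, x, z))\<rparr>"

definition orbit_category ::
    "('g, 'e) monoid_scheme \<Rightarrow> ('g \<Rightarrow> 'p \<Rightarrow> 'p) \<Rightarrow> 'p \<Rightarrow> ('p, 'g \<times> 'p \<times> 'p) cat" where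
  "orbit_category G \<phi> x = transporter_category G (orbit G \<phi> x) (Id_on (orbit G \<phi> x)) \<phi>"

text \<open>
  The algebra of this category is a subset of that of the transporter category, so that
  \<^const>\<open>truncation\<close> to it makes sense: inside one orbit of a finite \<open>G\<close>-poset, \<open>g x \<le> y\<close> forces
  \<open>g x = y\<close>.
\<close>

definition poset_dim :: "'p set \<Rightarrow> 'p rel \<Rightarrow> nat" where
  "poset_dim P r = Max {n. \<exists>c :: nat \<Rightarrow> 'p. (\<forall>i\<le>n. c i \<in> P) \<and>
     (\<forall>i<n. (c i, c (Suc i)) \<in> r \<and> c i \<noteq> c (Suc i))}"

end

theory Submission imports Defs begin

text \<open>
  Regard a module as a \<open>k\<close>-space graded by the objects, with an action of \<open>G\<close> and transition maps.
  Call \<open>M\<close> a Higman module if some graded \<open>k\<close>-endomorphism \<open>\<theta>\<close> of \<open>M\<close> has relative trace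
  \<open>\<Sum>\<^sub>g g \<theta> g\<inverse> = 1\<close>.  Relative traces turn graded splittings into \<open>G\<close>-equivariant ones, so this
  property passes to the cokernel of an injection and to the kernel of a surjection between Higman
  modules.  The module \<open>kG \<otimes> M\<close> with the diagonal action is Higman and has \<open>M\<close> as a submodule and as
  a quotient, whence projectives and injectives are Higman; consequently all modules of finite
  projective or injective dimension are.

  Conversely, for a Higman module \<open>M\<close> the left Kan extension \<open>y \<mapsto> \<Oplus>z\<le>y. M(z)\<close> is projective, and the
  kernel of its surjection onto \<open>M\<close> is again Higman and lives strictly higher in the poset; dually,
  \<open>x \<mapsto> \<Oplus>z\<ge>x. M(z)\<close> is injective and the cokernel of the embedding of \<open>M\<close> lives strictly lower.
  Iterating gives resolutions of length at most \<open>dim P\<close>.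

  For a poset with trivial relations Higman modules are just the projective ones, and \<open>M\<close> is Higman
  iff its restriction to each orbit is.  Finally, the regular module is projective, hence Higman, and
  the opposite algebra belongs to the opposite poset.
\<close>

section \<open>Finite sums\<close>

text \<open>The algebra A is generated by the scalars, the identities \<open>t x x\<close>, the
  group elements \<open>hat g\<close> and the proper transition maps; let B be generated by all but
  the last, so that B is the algebra of the disjoint union of the orbits. Equivariant maps can be
  pulled out of relative traces: \<open>tr (f \<theta>) = f (tr \<theta>)\<close>. So if
  \<open>s\<close> is a graded section of a surjection \<open>f\<close> and \<open>\<theta>\<close>
  a graded map of trace 1 on M, then a B-linear map \<open>g\<close> out of M lifts along
  \<open>f\<close> to \<open>tr (s g \<theta>)\<close>; dually, B-linear maps into M extend along
  injections. Graded splittings exist because everything is finite dimensional over k. The obstacle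
  is that such lifts are in general only B-linear. Kan extension removes it, being adjoint to
  restriction to B: A-linear maps out of the left (into the right) Kan extension of M are B-linear
  maps out of (into) M, so the Higman property alone makes it projective (injective). As that
  property does not look at the transition maps of M, it can be decided orbit by orbit.\<close>

lemma sum_delta2:
  assumes "finite I" "finite J" "i \<in> I" "j \<in> J"
  shows "(\<Sum>k\<in>I. \<Sum>l\<in>J. if k = i \<and> l = j then u k l else 0) = (u i j :: 'a::comm_monoid_add)"
proof -
  have "(\<Sum>k\<in>I. \<Sum>l\<in>J. if k = i \<and> l = j then u k l else 0) = (\<Sum>k\<in>I. if k = i then u k j else 0)"
    using assms by (intro sum.cong) (auto simp: sum.delta)
  then show ?thesis using assms by simp
qed

lemma (in abelian_monoid) finsum_Sigma:
  assumes "finite I" "\<And>i. i \<in> I \<Longrightarrow> finite (J i)"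
    and "\<And>i j. i \<in> I \<Longrightarrow> j \<in> J i \<Longrightarrow> f (i, j) \<in> carrier G"
  shows "(\<Oplus>p\<in>(SIGMA i:I. J i). f p) = (\<Oplus>i\<in>I. \<Oplus>j\<in>J i. f (i, j))"
  using assms
proof (induction I rule: finite_induct)
  case (insert i I)
  have "(SIGMA i:insert i I. J i) = Pair i ` J i \<union> (SIGMA i:I. J i)" by auto
  then have "(\<Oplus>p\<in>(SIGMA i:insert i I. J i). f p) =
      (\<Oplus>p\<in>Pair i ` J i. f p) \<oplus> (\<Oplus>p\<in>(SIGMA i:I. J i). f p)"
    using insert by (simp only:) (rule finsum_Un_disjoint, auto)
  also have "(\<Oplus>p\<in>Pair i ` J i. f p) = (\<Oplus>j\<in>J i. f (i, j))"
    using insert by (subst finsum_reindex) (auto simp: inj_on_def)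
  finally show ?case using insert by (simp add: finsum_insert finsum_closed Pi_def)
qed simp

lemma (in abelian_monoid) finsum_swap:
  assumes "finite I" "finite J" "\<And>i j. i \<in> I \<Longrightarrow> j \<in> J \<Longrightarrow> f i j \<in> carrier G"
  shows "(\<Oplus>i\<in>I. \<Oplus>j\<in>J. f i j) = (\<Oplus>j\<in>J. \<Oplus>i\<in>I. f i j)"
proof -
  have "(\<Oplus>i\<in>I. \<Oplus>j\<in>J. f i j) = (\<Oplus>p\<in>I \<times> J. f (fst p) (snd p))"
    using assms by (subst finsum_Sigma) auto
  also have "I \<times> J = prod.swap ` (J \<times> I)" by auto
  also have "(\<Oplus>p\<in>\<dots>. f (fst p) (snd p)) = (\<Oplus>p\<in>J \<times> I. f (snd p) (fst p))"
    using assms by (subst finsum_reindex) auto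
  also have "\<dots> = (\<Oplus>j\<in>J. \<Oplus>i\<in>I. f i j)"
    using assms by (subst finsum_Sigma) auto
  finally show ?thesis .
qed

lemma (in abelian_monoid) finsum_single:
  assumes "finite I" "i \<in> I" "f i \<in> carrier G" "\<And>j. j \<in> I \<Longrightarrow> j \<noteq> i \<Longrightarrow> f j = \<zero>"
  shows "(\<Oplus>j\<in>I. f j) = f i"
proof -
  have "(\<Oplus>j\<in>I. f j) = (\<Oplus>j\<in>I. if i = j then f j else \<zero>)"
    using assms by (intro finsum_cong') auto
  then show ?thesis using assms finsum_singleton[of i I f]
    by (metis (no_types, lifting) Pi_I finsum_singleton zero_closed finsum_cong')
qed

lemma (in abelian_monoid) finsum_support:
  assumes "finite I" "inj_on j J" "j ` J \<subseteq> I" "u \<in> I \<rightarrow> carrier G"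
    and "\<And>i. i \<in> I \<Longrightarrow> i \<notin> j ` J \<Longrightarrow> u i = \<zero>"
  shows "(\<Oplus>i\<in>I. u i) = (\<Oplus>k\<in>J. u (j k))"
proof -
  have "(\<Oplus>i\<in>j ` J. u i) = (\<Oplus>i\<in>I. u i)"
    using assms by (intro add.finprod_mono_neutral_cong_left) auto
  moreover have "(\<Oplus>i\<in>j ` J. u i) = (\<Oplus>k\<in>J. u (j k))"
    using assms(2-4) by (intro finsum_reindex) auto
  ultimately show ?thesis by simp
qed

section \<open>Maps linear over a set of scalars\<close>

text \<open>The set \<open>X\<close> interpolates between additive maps (\<open>X = {}\<close>),
  k-linear, graded and equivariant maps and full module homomorphisms, so one set of lemmas serves
  all of them.\<close>

definition lin :: "'r set \<Rightarrow> ('r, 'm) module \<Rightarrow> ('r, 'n) module \<Rightarrow> ('m \<Rightarrow> 'n) \<Rightarrow> bool" where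
  "lin X M N f \<longleftrightarrow> f \<in> carrier M \<rightarrow> carrier N \<and>
     (\<forall>x\<in>carrier M. \<forall>y\<in>carrier M. f (x \<oplus>\<^bsub>M\<^esub> y) = f x \<oplus>\<^bsub>N\<^esub> f y) \<and>
     (\<forall>a\<in>X. \<forall>x\<in>carrier M. f (a \<odot>\<^bsub>M\<^esub> x) = a \<odot>\<^bsub>N\<^esub> f x)"

lemma module_hom_iff_lin: "f \<in> module_hom R M N \<longleftrightarrow> lin (carrier R) M N f"
  by (auto simp: module_hom_def lin_def)

lemma linI:
  assumes "\<And>x. x \<in> carrier M \<Longrightarrow> f x \<in> carrier N"
    and "\<And>x y. x \<in> carrier M \<Longrightarrow> y \<in> carrier M \<Longrightarrow> f (x \<oplus>\<^bsub>M\<^esub> y) = f x \<oplus>\<^bsub>N\<^esub> f y"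
    and "\<And>a x. a \<in> X \<Longrightarrow> x \<in> carrier M \<Longrightarrow> f (a \<odot>\<^bsub>M\<^esub> x) = a \<odot>\<^bsub>N\<^esub> f x"
  shows "lin X M N f"
  using assms by (auto simp: lin_def)

lemma lin_closed: "lin X M N f \<Longrightarrow> x \<in> carrier M \<Longrightarrow> f x \<in> carrier N"
  and lin_add: "lin X M N f \<Longrightarrow> x \<in> carrier M \<Longrightarrow> y \<in> carrier M \<Longrightarrow> f (x \<oplus>\<^bsub>M\<^esub> y) = f x \<oplus>\<^bsub>N\<^esub> f y"
  and lin_smult: "lin X M N f \<Longrightarrow> a \<in> X \<Longrightarrow> x \<in> carrier M \<Longrightarrow> f (a \<odot>\<^bsub>M\<^esub> x) = a \<odot>\<^bsub>N\<^esub> f x"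
  by (auto simp: lin_def)

lemma lin_mono: "lin Y M N f \<Longrightarrow> X \<subseteq> Y \<Longrightarrow> lin X M N f"
  by (auto simp: lin_def)

lemma lin_id: "lin X M M (\<lambda>x. x)"
  by (auto simp: lin_def)

lemma lin_comp: "lin X M N f \<Longrightarrow> lin X N L g \<Longrightarrow> lin X M L (\<lambda>x. g (f x))"
  by (auto simp: lin_def Pi_def)

lemma additive_zero:
  assumes "abelian_group M" "abelian_group N" "lin X M N f"
  shows "f \<zero>\<^bsub>M\<^esub> = \<zero>\<^bsub>N\<^esub>"
proof -
  interpret M: abelian_group M by fact
  interpret N: abelian_group N by fact
  have "f \<zero>\<^bsub>M\<^esub> \<oplus>\<^bsub>N\<^esub> f \<zero>\<^bsub>M\<^esub> = f \<zero>\<^bsub>M\<^esub> \<oplus>\<^bsub>N\<^esub> \<zero>\<^bsub>N\<^esub>"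
    using lin_add[OF assms(3), of "\<zero>\<^bsub>M\<^esub>" "\<zero>\<^bsub>M\<^esub>"] lin_closed[OF assms(3), of "\<zero>\<^bsub>M\<^esub>"] by simp
  then show ?thesis using lin_closed[OF assms(3), of "\<zero>\<^bsub>M\<^esub>"] by simp
qed

lemma additive_uminus:
  assumes "abelian_group M" "abelian_group N" "lin X M N f" "x \<in> carrier M"
  shows "f (\<ominus>\<^bsub>M\<^esub> x) = \<ominus>\<^bsub>N\<^esub> f x"
proof -
  interpret M: abelian_group M by fact
  interpret N: abelian_group N by fact
  have "f (\<ominus>\<^bsub>M\<^esub> x) \<oplus>\<^bsub>N\<^esub> f x = \<zero>\<^bsub>N\<^esub>"
    using lin_add[OF assms(3), of "\<ominus>\<^bsub>M\<^esub> x" x] additive_zero[OF assms(1-3)] assms(4)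
    by (simp add: M.l_neg)
  then show ?thesis using lin_closed[OF assms(3)] assms(4) by (metis N.minus_equality M.a_inv_closed)
qed

lemma additive_minus:
  assumes "abelian_group M" "abelian_group N" "lin X M N f" "x \<in> carrier M" "y \<in> carrier M"
  shows "f (x \<ominus>\<^bsub>M\<^esub> y) = f x \<ominus>\<^bsub>N\<^esub> f y"
  using assms additive_uminus[OF assms(1-3,5)] lin_add[OF assms(3)]
  by (simp add: a_minus_def abelian_group.a_inv_closed)

lemma (in abelian_group) minus_eq_zero_iff:
  assumes "x \<in> carrier G" "y \<in> carrier G"
  shows "x \<ominus> y = \<zero> \<longleftrightarrow> x = y"
  using assms by (metis a_minus_def minus_equality minus_minus r_neg a_inv_closed)

lemma (in abelian_group) minus_self [simp]: "x \<in> carrier G \<Longrightarrow> x \<ominus> x = \<zero>"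
  by (simp add: a_minus_def r_neg)

lemma additive_finsum:
  assumes "abelian_group M" "abelian_group N" "lin X M N f" "u \<in> I \<rightarrow> carrier M"
  shows "f (\<Oplus>\<^bsub>M\<^esub>i\<in>I. u i) = (\<Oplus>\<^bsub>N\<^esub>i\<in>I. f (u i))"
proof -
  interpret M: abelian_group M by fact
  interpret N: abelian_group N by fact
  note z = additive_zero[OF assms(1-3)]
  show ?thesis using assms(4)
  proof (induction I rule: infinite_finite_induct)
    case (insert i I)
    then show ?case using lin_closed[OF assms(3)] lin_add[OF assms(3)]
      by (simp add: M.finsum_insert N.finsum_insert M.finsum_closed Pi_def)
  qed (simp_all add: z)
qed

lemma left_module_group: "left_module R M \<Longrightarrow> abelian_group M"
  by (simp add: left_module_def)

context left_module begin

lemma lin_smult_self: "a \<in> carrier R \<Longrightarrow> lin {} M M (\<lambda>x. a \<odot>\<^bsub>M\<^esub> x)"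
  by (intro linI) (auto simp: smult_closed smult_r_distr)

lemmas smult_zero_right = additive_zero[OF M.abelian_group_axioms M.abelian_group_axioms lin_smult_self]
lemmas smult_uminus = additive_uminus[OF M.abelian_group_axioms M.abelian_group_axioms lin_smult_self]
lemmas smult_minus = additive_minus[OF M.abelian_group_axioms M.abelian_group_axioms lin_smult_self]
lemmas smult_finsum = additive_finsum[OF M.abelian_group_axioms M.abelian_group_axioms lin_smult_self]

lemma smult_zero_left: "x \<in> carrier M \<Longrightarrow> \<zero>\<^bsub>R\<^esub> \<odot>\<^bsub>M\<^esub> x = \<zero>\<^bsub>M\<^esub>"
  using smult_l_distr[of "\<zero>\<^bsub>R\<^esub>" "\<zero>\<^bsub>R\<^esub>" x] smult_closed[of "\<zero>\<^bsub>R\<^esub>" x]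
  by (metis R.l_zero R.zero_closed M.add.l_cancel_one)

lemma finsum_smult:
  assumes "x \<in> carrier M" "a \<in> I \<rightarrow> carrier R"
  shows "(\<Oplus>\<^bsub>R\<^esub>i\<in>I. a i) \<odot>\<^bsub>M\<^esub> x = (\<Oplus>\<^bsub>M\<^esub>i\<in>I. a i \<odot>\<^bsub>M\<^esub> x)"
  using assms(2)
proof (induction I rule: infinite_finite_induct)
  case (insert i I)
  then show ?case using assms(1)
    by (simp add: M.finsum_insert R.finsum_insert R.finsum_closed Pi_def smult_l_distr smult_closed)
qed (simp_all add: smult_zero_left assms(1))

lemma submodule:
  assumes "K \<subseteq> carrier M" "\<zero>\<^bsub>M\<^esub> \<in> K" "\<And>x y. x \<in> K \<Longrightarrow> y \<in> K \<Longrightarrow> x \<oplus>\<^bsub>M\<^esub> y \<in> K"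
    and "\<And>a x. a \<in> carrier R \<Longrightarrow> x \<in> K \<Longrightarrow> a \<odot>\<^bsub>M\<^esub> x \<in> K"
  shows "left_module R (M\<lparr>carrier := K\<rparr>)"
proof -
  \<comment> \<open>Closure under scalars supplies additive inverses, since -1 acts as
    negation.\<close>
  have neg: "\<exists>y\<in>K. y \<oplus>\<^bsub>M\<^esub> x = \<zero>\<^bsub>M\<^esub>" if "x \<in> K" for x
  proof
    show "(\<ominus>\<^bsub>R\<^esub> \<one>\<^bsub>R\<^esub>) \<odot>\<^bsub>M\<^esub> x \<in> K" using that assms(4) by simp
    have x: "x \<in> carrier M" using that assms(1) by auto
    have "(\<ominus>\<^bsub>R\<^esub> \<one>\<^bsub>R\<^esub>) \<odot>\<^bsub>M\<^esub> x \<oplus>\<^bsub>M\<^esub> \<one>\<^bsub>R\<^esub> \<odot>\<^bsub>M\<^esub> x = \<zero>\<^bsub>M\<^esub>"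
      using x by (subst smult_l_distr[symmetric]) (auto simp: R.l_neg smult_zero_left)
    then show "(\<ominus>\<^bsub>R\<^esub> \<one>\<^bsub>R\<^esub>) \<odot>\<^bsub>M\<^esub> x \<oplus>\<^bsub>M\<^esub> x = \<zero>\<^bsub>M\<^esub>" using x by (simp add: smult_one)
  qed
  have "abelian_group (M\<lparr>carrier := K\<rparr>)"
    using assms(1-3) neg
    by (intro abelian_groupI) (auto simp: M.a_ac subset_iff)
  then show ?thesis
    using assms R.ring_axioms
    by (intro left_module.intro left_module_axioms.intro)
      (auto simp: smult_l_distr smult_r_distr smult_assoc smult_one subset_iff)
qed

end

lemma left_moduleI:
  assumes "ring R" "abelian_group M"
    and "\<And>a x. a \<in> carrier R \<Longrightarrow> x \<in> carrier M \<Longrightarrow> a \<odot>\<^bsub>M\<^esub> x \<in> carrier M"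
    and "\<And>a b x. a \<in> carrier R \<Longrightarrow> b \<in> carrier R \<Longrightarrow> x \<in> carrier M \<Longrightarrow>
        (a \<oplus>\<^bsub>R\<^esub> b) \<odot>\<^bsub>M\<^esub> x = a \<odot>\<^bsub>M\<^esub> x \<oplus>\<^bsub>M\<^esub> b \<odot>\<^bsub>M\<^esub> x"
    and "\<And>a x y. a \<in> carrier R \<Longrightarrow> x \<in> carrier M \<Longrightarrow> y \<in> carrier M \<Longrightarrow>
        a \<odot>\<^bsub>M\<^esub> (x \<oplus>\<^bsub>M\<^esub> y) = a \<odot>\<^bsub>M\<^esub> x \<oplus>\<^bsub>M\<^esub> a \<odot>\<^bsub>M\<^esub> y"
    and "\<And>a b x. a \<in> carrier R \<Longrightarrow> b \<in> carrier R \<Longrightarrow> x \<in> carrier M \<Longrightarrow>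
        (a \<otimes>\<^bsub>R\<^esub> b) \<odot>\<^bsub>M\<^esub> x = a \<odot>\<^bsub>M\<^esub> (b \<odot>\<^bsub>M\<^esub> x)"
    and "\<And>x. x \<in> carrier M \<Longrightarrow> \<one>\<^bsub>R\<^esub> \<odot>\<^bsub>M\<^esub> x = x"
  shows "left_module R M"
  using assms by (intro left_module.intro left_module_axioms.intro) auto

lemma kernel_module:
  assumes "left_module R M" "left_module R N" "lin (carrier R) M N f"
  shows "left_module R (M\<lparr>carrier := module_kernel M N f\<rparr>)"
proof -
  interpret M: left_module R M by fact
  interpret N: left_module R N by fact
  note z = additive_zero[OF M.M.abelian_group_axioms N.M.abelian_group_axioms assms(3)]
  show ?thesis
    by (rule M.submodule)
      (auto simp: module_kernel_def z lin_add[OF assms(3)] lin_smult[OF assms(3)] M.smult_closed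
        N.smult_zero_right)
qed

lemma image_module:
  assumes "left_module R M" "left_module R N" "lin (carrier R) M N f"
  shows "left_module R (N\<lparr>carrier := f ` carrier M\<rparr>)"
proof -
  interpret M: left_module R M by fact
  interpret N: left_module R N by fact
  note z = additive_zero[OF M.M.abelian_group_axioms N.M.abelian_group_axioms assms(3)]
  show ?thesis
  proof (rule N.submodule)
    show "f ` carrier M \<subseteq> carrier N" using lin_closed[OF assms(3)] by auto
    show "\<zero>\<^bsub>N\<^esub> \<in> f ` carrier M" using z M.M.zero_closed by (metis imageI)
    show "x \<oplus>\<^bsub>N\<^esub> y \<in> f ` carrier M" if "x \<in> f ` carrier M" "y \<in> f ` carrier M" for x y
      using that lin_add[OF assms(3)] by (auto simp: image_iff) (metis M.M.a_closed)
    show "a \<odot>\<^bsub>N\<^esub> x \<in> f ` carrier M" if "a \<in> carrier R" "x \<in> f ` carrier M" for a x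
      using that lin_smult[OF assms(3)] by (auto simp: image_iff) (metis M.smult_closed)
  qed
qed

lemma lin_inverse:
  assumes "abelian_group M" "left_module R M" "lin X M N f" "bij_betw f (carrier M) (carrier N)" "X \<subseteq> carrier R"
  shows "lin X N M (inv_into (carrier M) f)"
proof -
  interpret M: left_module R M by fact
  let ?j = "inv_into (carrier M) f"
  have j: "?j y \<in> carrier M" "f (?j y) = y" if "y \<in> carrier N" for y
    using that assms(4) by (auto simp: bij_betw_def inv_into_into f_inv_into_f)
  have inj: "inj_on f (carrier M)" using assms(4) by (simp add: bij_betw_def)
  show ?thesis
  proof (rule linI)
    fix x y assume xy: "x \<in> carrier N" "y \<in> carrier N"
    then have "f (?j x \<oplus>\<^bsub>M\<^esub> ?j y) = x \<oplus>\<^bsub>N\<^esub> y" using j lin_add[OF assms(3)] by simp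
    then show "?j (x \<oplus>\<^bsub>N\<^esub> y) = ?j x \<oplus>\<^bsub>M\<^esub> ?j y"
      using j xy by (metis inj inv_into_f_f M.M.a_closed)
  next
    fix a x assume ax: "a \<in> X" "x \<in> carrier N"
    then have "f (a \<odot>\<^bsub>M\<^esub> ?j x) = a \<odot>\<^bsub>N\<^esub> x" using j lin_smult[OF assms(3)] by simp
    then show "?j (a \<odot>\<^bsub>N\<^esub> x) = a \<odot>\<^bsub>M\<^esub> ?j x"
      using j ax assms(5) by (metis inj inv_into_f_f M.smult_closed subsetD)
  qed (simp add: j)
qed

text \<open>\<open>finsum\<close> refers to the whole record, carrier included, so the two sums are
  different terms; they agree because the inclusion is additive.\<close>

lemma finsum_update_carrier:
  fixes M :: "('r, 'm) module"
  assumes "abelian_group M" "abelian_group (M\<lparr>carrier := K\<rparr>)" "K \<subseteq> carrier M" "u \<in> I \<rightarrow> K"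
  shows "finsum (M\<lparr>carrier := K\<rparr>) u I = finsum M u I"
proof -
  have "lin {} (M\<lparr>carrier := K\<rparr>) M (\<lambda>x. x)" using assms(3) by (auto simp: lin_def)
  from additive_finsum[OF assms(2,1) this, of u I] show ?thesis using assms(4) by simp
qed

text \<open>Realises the quotient of \<open>E\<close> by the kernel of \<open>pr\<close> on the
  image of \<open>pr\<close>, which meets every coset exactly once. The kernel must be stable under
  scalars; \<open>pr\<close> itself is only additive, and becomes the quotient map.\<close>

lemma quotient_module:
  assumes E: "left_module R E" and pr: "lin {} E E pr"
    and idem: "\<And>u. u \<in> carrier E \<Longrightarrow> pr (pr u) = pr u"
    and ker: "\<And>a u. a \<in> carrier R \<Longrightarrow> u \<in> carrier E \<Longrightarrow> pr u = \<zero>\<^bsub>E\<^esub> \<Longrightarrow> pr (a \<odot>\<^bsub>E\<^esub> u) = \<zero>\<^bsub>E\<^esub>"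
  defines "C \<equiv> E\<lparr>carrier := pr ` carrier E, smult := \<lambda>a u. pr (a \<odot>\<^bsub>E\<^esub> u)\<rparr>"
  shows "left_module R C" "lin (carrier R) E C pr"
proof -
  interpret E: left_module R E by fact
  note [simp] = lin_closed[OF pr] E.smult_closed
  note prm = additive_minus[OF E.M.abelian_group_axioms E.M.abelian_group_axioms pr]
  note pr0 = additive_zero[OF E.M.abelian_group_axioms E.M.abelian_group_axioms pr]
  \<comment> \<open>The difference of \<open>u\<close> and \<open>pr u\<close> lies in the kernel of
    \<open>pr\<close>, which is stable under \<open>a\<close>.\<close>
  have key: "pr (a \<odot>\<^bsub>E\<^esub> pr u) = pr (a \<odot>\<^bsub>E\<^esub> u)" if a: "a \<in> carrier R" and u: "u \<in> carrier E" for a u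
  proof -
    have "pr (u \<ominus>\<^bsub>E\<^esub> pr u) = \<zero>\<^bsub>E\<^esub>" using u by (simp add: prm idem)
    then have "pr (a \<odot>\<^bsub>E\<^esub> (u \<ominus>\<^bsub>E\<^esub> pr u)) = \<zero>\<^bsub>E\<^esub>" using a u by (intro ker) auto
    then have "pr (a \<odot>\<^bsub>E\<^esub> u) \<ominus>\<^bsub>E\<^esub> pr (a \<odot>\<^bsub>E\<^esub> pr u) = \<zero>\<^bsub>E\<^esub>" using a u by (simp add: E.smult_minus prm)
    then show ?thesis using a u by (simp add: E.M.minus_eq_zero_iff)
  qed
  have key2: "pr (a \<odot>\<^bsub>E\<^esub> (b \<odot>\<^bsub>E\<^esub> pr u)) = pr (a \<odot>\<^bsub>E\<^esub> (b \<odot>\<^bsub>E\<^esub> u))"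
    if "a \<in> carrier R" "b \<in> carrier R" "u \<in> carrier E" for a b u
    using key[of "a \<otimes>\<^bsub>R\<^esub> b" u] that by (simp add: E.smult_assoc)
  have im_add: "x \<oplus>\<^bsub>E\<^esub> y \<in> pr ` carrier E" if "x \<in> pr ` carrier E" "y \<in> pr ` carrier E" for x y
    using that lin_add[OF pr] by (auto simp: image_iff) (metis E.M.a_closed)
  have fix_pr: "pr x = x" if "x \<in> pr ` carrier E" for x using that idem by auto
  have imE: "x \<in> carrier E" if "x \<in> pr ` carrier E" for x using that by auto
  have "abelian_group C"
  proof (rule abelian_groupI)
    fix x assume "x \<in> carrier C"
    then obtain u where u: "u \<in> carrier E" "x = pr u" by (auto simp: C_def)
    have "pr (\<ominus>\<^bsub>E\<^esub> u) \<oplus>\<^bsub>E\<^esub> pr u = \<zero>\<^bsub>E\<^esub>"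
      using u by (simp add: lin_add[OF pr, symmetric] E.M.l_neg pr0)
    then show "\<exists>y\<in>carrier C. y \<oplus>\<^bsub>C\<^esub> x = \<zero>\<^bsub>C\<^esub>"
      using u by (intro bexI[of _ "pr (\<ominus>\<^bsub>E\<^esub> u)"]) (auto simp: C_def)
  next
    show "\<zero>\<^bsub>C\<^esub> \<in> carrier C" using pr0 by (auto simp: C_def image_iff) (metis E.M.zero_closed)
  qed (use imE in \<open>auto simp: C_def E.M.a_assoc simp del: image_iff intro: im_add E.M.a_comm\<close>)
  then show "left_module R C"
    by (intro left_moduleI E.R.ring_axioms)
      (auto simp: C_def idem key key2 E.smult_l_distr E.smult_r_distr E.smult_assoc E.smult_one lin_add[OF pr])
  show "lin (carrier R) E C pr"
    by (rule linI) (auto simp: C_def lin_add[OF pr] key)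
qed

section \<open>Transport of structure\<close>

definition copy :: "('m \<Rightarrow> 'n) \<Rightarrow> ('r, 'm) module \<Rightarrow> ('r, 'n) module" where
  "copy i M = (let j = inv_into (carrier M) i in
     \<lparr>carrier = i ` carrier M, mult = (\<lambda>u v. i (j u \<otimes>\<^bsub>M\<^esub> j v)), one = i \<one>\<^bsub>M\<^esub>, zero = i \<zero>\<^bsub>M\<^esub>,
      add = (\<lambda>u v. i (j u \<oplus>\<^bsub>M\<^esub> j v)), smult = (\<lambda>a u. i (a \<odot>\<^bsub>M\<^esub> j u))\<rparr>)"

lemma copy_module:
  assumes "left_module R M" "inj_on i (carrier M)"
  shows "left_module R (copy i M)" "lin (carrier R) M (copy i M) i"
    "bij_betw i (carrier M) (carrier (copy i M))"
proof -
  interpret M: left_module R M by fact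
  note [simp] = inv_into_f_f[OF assms(2)]
  have "abelian_group (copy i M)"
  proof (rule abelian_groupI)
    fix x assume "x \<in> carrier (copy i M)"
    then obtain m where m: "m \<in> carrier M" "x = i m" by (auto simp: copy_def Let_def)
    then show "\<exists>y\<in>carrier (copy i M). y \<oplus>\<^bsub>copy i M\<^esub> x = \<zero>\<^bsub>copy i M\<^esub>"
      by (intro bexI[of _ "i (\<ominus>\<^bsub>M\<^esub> m)"]) (auto simp: copy_def Let_def M.M.l_neg)
  qed (auto simp: copy_def Let_def M.M.a_ac)
  then show "left_module R (copy i M)"
    using M.R.ring_axioms
    by (intro left_moduleI)
      (auto simp: copy_def Let_def M.smult_l_distr M.smult_r_distr M.smult_assoc M.smult_one M.smult_closed)
  show "lin (carrier R) M (copy i M) i"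
    by (rule linI) (auto simp: copy_def Let_def)
  show "bij_betw i (carrier M) (carrier (copy i M))"
    using assms(2) by (auto simp: copy_def Let_def bij_betw_def)
qed

section \<open>Spans and finite generation\<close>

text \<open>Inductive generation gives an induction rule in place of coefficient functions. Scalars
  are applied to the generators only, which is enough when \<open>X\<close> is closed under
  multiplication.\<close>

inductive_set mspan :: "'r set \<Rightarrow> ('r, 'm) module \<Rightarrow> 'm set \<Rightarrow> 'm set" for X M S where
  zero: "\<zero>\<^bsub>M\<^esub> \<in> mspan X M S"
| add: "u \<in> mspan X M S \<Longrightarrow> v \<in> mspan X M S \<Longrightarrow> u \<oplus>\<^bsub>M\<^esub> v \<in> mspan X M S"
| smult: "a \<in> X \<Longrightarrow> s \<in> S \<Longrightarrow> a \<odot>\<^bsub>M\<^esub> s \<in> mspan X M S"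

lemma mspan_closed:
  assumes "left_module R M" "X \<subseteq> carrier R" "S \<subseteq> carrier M" "u \<in> mspan X M S"
  shows "u \<in> carrier M"
proof -
  interpret M: left_module R M by fact
  show ?thesis using assms(4)
    by induction (use assms(2,3) in \<open>auto intro!: M.smult_closed\<close>)
qed

lemma mspan_mono:
  assumes "X \<subseteq> Y" "S \<subseteq> T" "u \<in> mspan X M S"
  shows "u \<in> mspan Y M T"
  using assms(3) by induction (use assms(1,2) in \<open>auto intro: mspan.intros\<close>)

lemma mspan_finsum:
  assumes "left_module R M" "X \<subseteq> carrier R" "S \<subseteq> carrier M" "\<And>i. i \<in> I \<Longrightarrow> u i \<in> mspan X M S"
  shows "(\<Oplus>\<^bsub>M\<^esub>i\<in>I. u i) \<in> mspan X M S"
proof -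
  interpret M: left_module R M by fact
  show ?thesis using assms(4)
  proof (induction I rule: infinite_finite_induct)
    case (insert i I)
    then show ?case using mspan_closed[OF assms(1-3)]
      by (simp add: M.M.finsum_insert Pi_def mspan.add)
  qed (auto intro: mspan.zero)
qed

lemma mspan_image:
  assumes "left_module R M" "left_module R N" "lin X M N f" "X \<subseteq> carrier R" "S \<subseteq> carrier M"
    and "u \<in> mspan X M S"
  shows "f u \<in> mspan X N (f ` S)"
proof -
  note z = additive_zero[OF left_module_group left_module_group, OF assms(1-3)]
  show ?thesis using assms(6)
  proof induction
    case zero then show ?case by (simp add: z mspan.zero)
  next
    case (add u v)
    then show ?case using lin_add[OF assms(3)] mspan_closed[OF assms(1,4,5)] mspan.add by metis
  next
    case (smult a s)
    then have "f (a \<odot>\<^bsub>M\<^esub> s) = a \<odot>\<^bsub>N\<^esub> f s" using assms(5) lin_smult[OF assms(3)] by auto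
    with smult show ?case by (auto intro: mspan.smult)
  qed
qed

text \<open>Trades the coefficient functions of the definition for \<open>mspan\<close>, on which
  induction is available.\<close>

lemma fg_module_iff:
  "fg_module R M \<longleftrightarrow> left_module R M \<and> (\<exists>S. finite S \<and> S \<subseteq> carrier M \<and> carrier M \<subseteq> mspan (carrier R) M S)"
proof
  assume fg: "fg_module R M"
  then have M: "left_module R M" by (simp add: fg_module_def)
  from fg obtain S where S: "finite S" "S \<subseteq> carrier M"
    and gen: "\<And>x. x \<in> carrier M \<Longrightarrow> \<exists>c\<in>S \<rightarrow> carrier R. x = (\<Oplus>\<^bsub>M\<^esub>s\<in>S. c s \<odot>\<^bsub>M\<^esub> s)"
    by (auto simp: fg_module_def)
  have "carrier M \<subseteq> mspan (carrier R) M S"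
  proof
    fix x assume "x \<in> carrier M"
    then obtain c where "c \<in> S \<rightarrow> carrier R" "x = (\<Oplus>\<^bsub>M\<^esub>s\<in>S. c s \<odot>\<^bsub>M\<^esub> s)" using gen by blast
    then show "x \<in> mspan (carrier R) M S"
      by (auto intro!: mspan_finsum[OF M] mspan.smult S(2))
  qed
  then show "left_module R M \<and> (\<exists>S. finite S \<and> S \<subseteq> carrier M \<and> carrier M \<subseteq> mspan (carrier R) M S)"
    using M S by blast
next
  assume "left_module R M \<and> (\<exists>S. finite S \<and> S \<subseteq> carrier M \<and> carrier M \<subseteq> mspan (carrier R) M S)"
  then obtain S where M: "left_module R M" and S: "finite S" "S \<subseteq> carrier M" "carrier M \<subseteq> mspan (carrier R) M S" by blast
  interpret M: left_module R M by fact
  have "\<exists>c\<in>S \<rightarrow> carrier R. x = (\<Oplus>\<^bsub>M\<^esub>s\<in>S. c s \<odot>\<^bsub>M\<^esub> s)" if "x \<in> mspan (carrier R) M S" for x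
    using that
  proof induction
    case zero
    have "(\<Oplus>\<^bsub>M\<^esub>s\<in>S. \<zero>\<^bsub>R\<^esub> \<odot>\<^bsub>M\<^esub> s) = (\<Oplus>\<^bsub>M\<^esub>s\<in>S. \<zero>\<^bsub>M\<^esub>)"
      using S(2) by (intro M.M.finsum_cong') (auto simp: M.smult_zero_left)
    then show ?case by (intro bexI[of _ "\<lambda>_. \<zero>\<^bsub>R\<^esub>"]) auto
  next
    case (add u v)
    then obtain c d where c: "c \<in> S \<rightarrow> carrier R" "u = (\<Oplus>\<^bsub>M\<^esub>s\<in>S. c s \<odot>\<^bsub>M\<^esub> s)"
      and d: "d \<in> S \<rightarrow> carrier R" "v = (\<Oplus>\<^bsub>M\<^esub>s\<in>S. d s \<odot>\<^bsub>M\<^esub> s)" by auto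
    have "u \<oplus>\<^bsub>M\<^esub> v = (\<Oplus>\<^bsub>M\<^esub>s\<in>S. c s \<odot>\<^bsub>M\<^esub> s \<oplus>\<^bsub>M\<^esub> d s \<odot>\<^bsub>M\<^esub> s)"
      unfolding c(2) d(2) using S(2) c(1) d(1)
      by (subst M.M.finsum_addf) (auto intro!: M.smult_closed)
    also have "\<dots> = (\<Oplus>\<^bsub>M\<^esub>s\<in>S. (c s \<oplus>\<^bsub>R\<^esub> d s) \<odot>\<^bsub>M\<^esub> s)"
      using S(2) c(1) d(1) by (intro M.M.finsum_cong') (auto intro!: M.smult_closed simp: M.smult_l_distr Pi_def subset_iff)
    finally show ?case using c d by (intro bexI[of _ "\<lambda>s. c s \<oplus>\<^bsub>R\<^esub> d s"]) auto
  next
    case (smult a s)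
    have "(\<Oplus>\<^bsub>M\<^esub>s'\<in>S. (if s' = s then a else \<zero>\<^bsub>R\<^esub>) \<odot>\<^bsub>M\<^esub> s') = a \<odot>\<^bsub>M\<^esub> s"
      using smult S by (subst M.M.finsum_single[of S s]) (auto simp: M.smult_zero_left M.smult_closed)
    then show ?case using smult by (intro bexI[of _ "\<lambda>s'. if s' = s then a else \<zero>\<^bsub>R\<^esub>"]) auto
  qed
  then show "fg_module R M" unfolding fg_module_def using S M by blast
qed

lemma fg_image:
  assumes "fg_module R M" "left_module R N" "lin (carrier R) M N f" "f ` carrier M = carrier N"
  shows "fg_module R N"
proof -
  obtain S where M: "left_module R M" and S: "finite S" "S \<subseteq> carrier M" "carrier M \<subseteq> mspan (carrier R) M S"
    using assms(1) by (auto simp: fg_module_iff)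
  have "carrier N \<subseteq> mspan (carrier R) N (f ` S)"
    using mspan_image[OF M assms(2,3) order_refl S(2)] S(3) by (auto simp: assms(4)[symmetric])
  then show ?thesis unfolding fg_module_iff using assms(2,4) S(1,2) by blast
qed

text \<open>Choose for each element a coefficient vector with respect to a finite generating set.
  Numbering the generators turns it into a function on \<open>nat\<close>, and it determines the
  element.\<close>

lemma fg_std_copy:
  fixes M :: "('r, 'm) module"
  assumes "fg_module R M"
  obtains i :: "'m \<Rightarrow> nat \<Rightarrow> 'r" where "inj_on i (carrier M)"
proof -
  from assms obtain S where S: "finite S" "S \<subseteq> carrier M"
    and gen: "\<And>x. x \<in> carrier M \<Longrightarrow> \<exists>c\<in>S \<rightarrow> carrier R. x = (\<Oplus>\<^bsub>M\<^esub>s\<in>S. c s \<odot>\<^bsub>M\<^esub> s)"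
    and M: "left_module R M"
    by (auto simp: fg_module_def)
  interpret M: left_module R M by fact
  obtain c where c: "\<And>x. x \<in> carrier M \<Longrightarrow> c x \<in> S \<rightarrow> carrier R \<and> x = (\<Oplus>\<^bsub>M\<^esub>s\<in>S. c x s \<odot>\<^bsub>M\<^esub> s)"
    using gen by metis
  obtain idx :: "'m \<Rightarrow> nat" where idx: "inj_on idx S"
    using S(1) finite_imp_inj_to_nat_seg by blast
  define i where "i x = (\<lambda>n. c x (inv_into S idx n))" for x
  have "x = y" if "x \<in> carrier M" "y \<in> carrier M" "i x = i y" for x y
  proof -
    have "c x s = c y s" if "s \<in> S" for s
      using \<open>i x = i y\<close> that idx by (auto simp: i_def fun_eq_iff) (metis inv_into_f_f)
    then have "(\<Oplus>\<^bsub>M\<^esub>s\<in>S. c x s \<odot>\<^bsub>M\<^esub> s) = (\<Oplus>\<^bsub>M\<^esub>s\<in>S. c y s \<odot>\<^bsub>M\<^esub> s)"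
      using c[OF that(2)] S(2) by (intro M.M.finsum_cong') (auto intro!: M.smult_closed)
    then show ?thesis using c that by metis
  qed
  then show thesis by (intro that[of i]) (auto simp: inj_on_def)
qed

lemma std_copy:
  fixes M :: "('r, 'm) module"
  assumes "fg_module R M"
  obtains N :: "'r std_module" and i j where "fg_module R N"
    "lin (carrier R) M N i" "lin (carrier R) N M j" "bij_betw i (carrier M) (carrier N)"
    "bij_betw j (carrier N) (carrier M)"
    "\<And>x. x \<in> carrier M \<Longrightarrow> j (i x) = x" "\<And>y. y \<in> carrier N \<Longrightarrow> i (j y) = y"
proof -
  obtain i :: "'m \<Rightarrow> nat \<Rightarrow> 'r" where i: "inj_on i (carrier M)" using fg_std_copy assms .
  have M: "left_module R M" using assms by (simp add: fg_module_def)
  note c = copy_module[OF M i]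
  show thesis
  proof (rule that)
    show "fg_module R (copy i M)" using fg_image[OF assms c(1,2)] c(3) by (simp add: bij_betw_def)
    show "lin (carrier R) (copy i M) M (inv_into (carrier M) i)"
      using lin_inverse[OF _ M c(2,3)] M by (simp add: left_module_def)
    show "bij_betw (inv_into (carrier M) i) (carrier (copy i M)) (carrier M)"
      using c(3) by (rule bij_betw_inv_into)
    show "inv_into (carrier M) i (i x) = x" if "x \<in> carrier M" for x
      using that i by simp
    show "i (inv_into (carrier M) i y) = y" if "y \<in> carrier (copy i M)" for y
      using that c(3) by (simp add: bij_betw_def f_inv_into_f)
  qed (fact c)+
qed

section \<open>Projective and injective modules\<close>

lemma projective_module_fg: "projective_module R Q \<Longrightarrow> fg_module R Q"
  and injective_module_fg: "injective_module R Q \<Longrightarrow> fg_module R Q"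
  by (simp_all add: projective_module_def injective_module_def)

lemma fg_module_left: "fg_module R M \<Longrightarrow> left_module R M"
  by (simp add: fg_module_def)

text \<open>The definition tests only modules on the type of \<open>std_module\<close>. Replacing
  \<open>N\<close> and \<open>L\<close> by isomorphic copies there makes the lifting property
  available for modules on arbitrary types.\<close>

lemma projective_lift:
  assumes Q: "projective_module R Q" and N: "fg_module R N" and L: "fg_module R L"
    and f: "lin (carrier R) N L f" "f ` carrier N = carrier L" and g: "lin (carrier R) Q L g"
  obtains h where "lin (carrier R) Q N h" "\<And>x. x \<in> carrier Q \<Longrightarrow> f (h x) = g x"
proof -
  obtain N' :: "'a std_module" and i j where N': "fg_module R N'"
    "lin (carrier R) N N' i" "lin (carrier R) N' N j" "bij_betw j (carrier N') (carrier N)"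
    "\<And>y. y \<in> carrier N' \<Longrightarrow> i (j y) = y" using std_copy[OF N] by metis
  obtain L' :: "'a std_module" and k l where L': "fg_module R L'"
    "lin (carrier R) L L' k" "lin (carrier R) L' L l" "bij_betw k (carrier L) (carrier L')"
    "\<And>y. y \<in> carrier L \<Longrightarrow> l (k y) = y" using std_copy[OF L] by metis
  have "(\<lambda>x. k (f (j x))) ` carrier N' = k ` f ` j ` carrier N'" by auto
  also have "\<dots> = carrier L'" using f(2) N'(4) L'(4) by (simp add: bij_betw_def)
  finally have "\<exists>h\<in>module_hom R Q N'. \<forall>x\<in>carrier Q. k (f (j (h x))) = k (g x)"
    using Q N'(1) L'(1) lin_comp[OF lin_comp[OF N'(3) f(1)] L'(2)] lin_comp[OF g L'(2)]
    unfolding projective_module_def module_hom_iff_lin by blast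
  then obtain h where h: "lin (carrier R) Q N' h" "\<And>x. x \<in> carrier Q \<Longrightarrow> k (f (j (h x))) = k (g x)"
    by (auto simp: module_hom_iff_lin)
  show thesis
  proof
    show jh: "lin (carrier R) Q N (\<lambda>x. j (h x))" using h(1) N'(3) by (rule lin_comp)
    show "f (j (h x)) = g x" if "x \<in> carrier Q" for x
      using h(2)[OF that] L'(5) lin_closed[OF f(1) lin_closed[OF jh that]] lin_closed[OF g that] by metis
  qed
qed

text \<open>As for \<open>projective_lift\<close>: the modules tested are replaced by copies on the
  standard type.\<close>

lemma injective_extend:
  assumes Q: "injective_module R Q" and N: "fg_module R N" and L: "fg_module R L"
    and f: "lin (carrier R) N L f" "inj_on f (carrier N)" and g: "lin (carrier R) N Q g"
  obtains h where "lin (carrier R) L Q h" "\<And>x. x \<in> carrier N \<Longrightarrow> h (f x) = g x"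
proof -
  obtain N' :: "'a std_module" and i j where N': "fg_module R N'"
    "lin (carrier R) N N' i" "lin (carrier R) N' N j" "bij_betw j (carrier N') (carrier N)"
    "\<And>y. y \<in> carrier N \<Longrightarrow> j (i y) = y" using std_copy[OF N] by metis
  obtain L' :: "'a std_module" and k l where L': "fg_module R L'"
    "lin (carrier R) L L' k" "lin (carrier R) L' L l" "bij_betw k (carrier L) (carrier L')"
    "\<And>y. y \<in> carrier L \<Longrightarrow> l (k y) = y" using std_copy[OF L] by metis
  have "inj_on (k \<circ> (f \<circ> j)) (carrier N')"
    using f N'(4) L'(4) lin_closed[OF f(1)]
    by (intro comp_inj_on) (auto simp: bij_betw_def intro: inj_on_subset)
  then have "inj_on (\<lambda>x. k (f (j x))) (carrier N')" by (simp add: comp_def)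
  then have "\<exists>h\<in>module_hom R L' Q. \<forall>x\<in>carrier N'. h (k (f (j x))) = g (j x)"
    using Q N'(1) L'(1) lin_comp[OF lin_comp[OF N'(3) f(1)] L'(2)] lin_comp[OF N'(3) g]
    unfolding injective_module_def module_hom_iff_lin by blast
  then obtain h where h: "lin (carrier R) L' Q h" "\<And>x. x \<in> carrier N' \<Longrightarrow> h (k (f (j x))) = g (j x)"
    by (auto simp: module_hom_iff_lin)
  show thesis
  proof
    show "lin (carrier R) L Q (\<lambda>x. h (k x))" using L'(2) h(1) by (rule lin_comp)
    show "h (k (f x)) = g x" if "x \<in> carrier N" for x
      using h(2)[OF lin_closed[OF N'(2) that]] N'(5)[OF that] by simp
  qed
qed

lemma projective_moduleI:
  fixes Q :: "('r, 'm) module"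
  assumes "fg_module R Q"
    and "\<And>(N :: 'r std_module) (L :: 'r std_module) f g. fg_module R N \<Longrightarrow> fg_module R L \<Longrightarrow>
      lin (carrier R) N L f \<Longrightarrow> f ` carrier N = carrier L \<Longrightarrow> lin (carrier R) Q L g \<Longrightarrow>
      \<exists>h. lin (carrier R) Q N h \<and> (\<forall>x\<in>carrier Q. f (h x) = g x)"
  shows "projective_module R Q"
  using assms unfolding projective_module_def module_hom_iff_lin Bex_def by blast

lemma injective_moduleI:
  fixes Q :: "('r, 'm) module"
  assumes "fg_module R Q"
    and "\<And>(N :: 'r std_module) (L :: 'r std_module) f g. fg_module R N \<Longrightarrow> fg_module R L \<Longrightarrow>
      lin (carrier R) N L f \<Longrightarrow> inj_on f (carrier N) \<Longrightarrow> lin (carrier R) N Q g \<Longrightarrow>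
      \<exists>h. lin (carrier R) L Q h \<and> (\<forall>x\<in>carrier N. h (f x) = g x)"
  shows "injective_module R Q"
  using assms unfolding injective_module_def module_hom_iff_lin Bex_def by blast

lemma projective_module_iso:
  assumes "projective_module R M" "lin (carrier R) M N i" "bij_betw i (carrier M) (carrier N)"
    and "left_module R N"
  shows "projective_module R N"
proof (rule projective_moduleI)
  have M: "left_module R M" using assms(1) by (simp add: projective_module_fg fg_module_left)
  show "fg_module R N"
    using fg_image[OF projective_module_fg[OF assms(1)] assms(4,2)] assms(3) by (simp add: bij_betw_def)
  fix K L :: "'a std_module" and f g
  assume *: "fg_module R K" "fg_module R L" "lin (carrier R) K L f" "f ` carrier K = carrier L"
    "lin (carrier R) N L g"
  obtain h where h: "lin (carrier R) M K h" "\<And>x. x \<in> carrier M \<Longrightarrow> f (h x) = g (i x)"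
    using projective_lift[OF assms(1) *(1-4) lin_comp[OF assms(2) *(5)]] by metis
  let ?j = "inv_into (carrier M) i"
  have j: "lin (carrier R) N M ?j"
    using lin_inverse[OF left_module_group[OF M] M assms(2,3)] by simp
  show "\<exists>h. lin (carrier R) N K h \<and> (\<forall>x\<in>carrier N. f (h x) = g x)"
    using lin_comp[OF j h(1)] h(2) lin_closed[OF j] assms(3)
    by (intro exI[of _ "\<lambda>x. h (?j x)"]) (auto simp: bij_betw_def f_inv_into_f)
qed

lemma injective_module_iso:
  assumes "injective_module R M" "lin (carrier R) M N i" "bij_betw i (carrier M) (carrier N)"
    and "left_module R N"
  shows "injective_module R N"
proof (rule injective_moduleI)
  have M: "left_module R M" using assms(1) by (simp add: injective_module_fg fg_module_left)
  show "fg_module R N"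
    using fg_image[OF injective_module_fg[OF assms(1)] assms(4,2)] assms(3) by (simp add: bij_betw_def)
  fix K L :: "'a std_module" and f g
  assume *: "fg_module R K" "fg_module R L" "lin (carrier R) K L f" "inj_on f (carrier K)"
    "lin (carrier R) K N g"
  let ?j = "inv_into (carrier M) i"
  have j: "lin (carrier R) N M ?j"
    using lin_inverse[OF left_module_group[OF M] M assms(2,3)] by simp
  obtain h where h: "lin (carrier R) L M h" "\<And>x. x \<in> carrier K \<Longrightarrow> h (f x) = ?j (g x)"
    using injective_extend[OF assms(1) *(1-4) lin_comp[OF *(5) j]] by metis
  show "\<exists>h. lin (carrier R) L N h \<and> (\<forall>x\<in>carrier K. h (f x) = g x)"
    using lin_comp[OF h(1) assms(2)] h(2) lin_closed[OF *(5)] assms(3)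
    by (intro exI[of _ "\<lambda>x. i (h x)"]) (auto simp: bij_betw_def f_inv_into_f)
qed

definition zero_module :: "'m \<Rightarrow> ('r, 'm) module" where
  "zero_module z = \<lparr>carrier = {z}, mult = (\<lambda>_ _. z), one = z, zero = z, add = (\<lambda>_ _. z), smult = (\<lambda>_ _. z)\<rparr>"

lemma zero_module_simps [simp]:
  "carrier (zero_module z) = {z}" "zero (zero_module z) = z" "add (zero_module z) u v = z"
  "smult (zero_module z) a u = z"
  by (simp_all add: zero_module_def)

lemma zero_module_fg: "ring R \<Longrightarrow> fg_module R (zero_module z)"
  unfolding fg_module_iff
  by (auto intro!: left_moduleI abelian_groupI exI[of _ "{}"])
    (metis mspan.zero zero_module_simps(2))

lemma zero_module_projective: "ring R \<Longrightarrow> projective_module R (zero_module z)"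
proof (rule projective_moduleI, rule zero_module_fg)
  fix N L :: "'a std_module" and f g
  assume *: "ring R" "fg_module R N" "fg_module R L" "lin (carrier R) N L f" "lin (carrier R) (zero_module z) L g"
  interpret N: left_module R N using *(2) by (rule fg_module_left)
  interpret L: left_module R L using *(3) by (rule fg_module_left)
  interpret Z: left_module R "zero_module z" using fg_module_left[OF zero_module_fg[OF *(1)]] .
  have "lin (carrier R) (zero_module z) N (\<lambda>_. \<zero>\<^bsub>N\<^esub>)"
    by (rule linI) (auto simp: N.smult_zero_right)
  then show "\<exists>h. lin (carrier R) (zero_module z) N h \<and> (\<forall>x\<in>carrier (zero_module z). f (h x) = g x)"
    using additive_zero[OF N.M.abelian_group_axioms L.M.abelian_group_axioms *(4)]
      additive_zero[OF Z.M.abelian_group_axioms L.M.abelian_group_axioms *(5)]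
    by (intro exI) auto
qed

lemma zero_module_injective: "ring R \<Longrightarrow> injective_module R (zero_module z)"
proof (rule injective_moduleI, rule zero_module_fg)
  fix N L :: "'a std_module" and f g
  assume *: "lin (carrier R) N (zero_module z) g"
  have "lin (carrier R) L (zero_module z) (\<lambda>_. z)"
    by (rule linI) auto
  then show "\<exists>h. lin (carrier R) L (zero_module z) h \<and> (\<forall>x\<in>carrier N. h (f x) = g x)"
    using lin_closed[OF *] by (intro exI) auto
qed

section \<open>Resolutions\<close>

text \<open>A standard copy of \<open>M\<close> sits in degree 0 and zero modules above it, since a
  resolution must name a module in every degree.\<close>

lemma projective_resolution_zero:
  assumes "projective_module R M"
  shows "\<exists>Q d \<epsilon>. projective_resolution R M 0 Q d \<epsilon>"
proof -
  have M: "left_module R M" using assms by (simp add: projective_module_fg fg_module_left)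
  interpret M: left_module R M by fact
  obtain N :: "'a std_module" and i j where N: "fg_module R N"
    "lin (carrier R) M N i" "lin (carrier R) N M j" "bij_betw i (carrier M) (carrier N)"
    "bij_betw j (carrier N) (carrier M)"
    using std_copy[OF projective_module_fg[OF assms]] by metis
  interpret N: left_module R N using N(1) by (rule fg_module_left)
  note P = projective_module_iso[OF assms N(2,4) N.left_module_axioms]
  let ?Z = "zero_module undefined :: 'a std_module"
  let ?Q = "\<lambda>n. case n of 0 \<Rightarrow> N | Suc _ \<Rightarrow> ?Z"
  let ?d = "\<lambda>n x. \<zero>\<^bsub>?Q n\<^esub>"
  note z = additive_zero[OF N.M.abelian_group_axioms M.M.abelian_group_axioms N(3)]
  have "module_kernel N M j = {\<zero>\<^bsub>N\<^esub>}"
    using z N(5) N.M.zero_closed unfolding module_kernel_def bij_betw_def inj_on_def by force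
  then have "projective_resolution R M 0 ?Q ?d j"
    using P N zero_module_projective[OF M.R.ring_axioms]
    by (auto simp: projective_resolution_def module_hom_iff_lin module_kernel_def bij_betw_def
       lin_def N.smult_zero_right split: nat.splits)
  then show ?thesis by blast
qed

lemma injective_resolution_zero:
  assumes "injective_module R M"
  shows "\<exists>Q d \<eta>. injective_resolution R M 0 Q d \<eta>"
proof -
  have M: "left_module R M" using assms by (simp add: injective_module_fg fg_module_left)
  interpret M: left_module R M by fact
  obtain N :: "'a std_module" and i j where N: "fg_module R N"
    "lin (carrier R) M N i" "lin (carrier R) N M j" "bij_betw i (carrier M) (carrier N)"
    "bij_betw j (carrier N) (carrier M)"
    using std_copy[OF injective_module_fg[OF assms]] by metis
  interpret N: left_module R N using N(1) by (rule fg_module_left)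
  note P = injective_module_iso[OF assms N(2,4) N.left_module_axioms]
  let ?Z = "zero_module undefined :: 'a std_module"
  let ?Q = "\<lambda>n. case n of 0 \<Rightarrow> N | Suc _ \<Rightarrow> ?Z"
  let ?d = "\<lambda>n x. \<zero>\<^bsub>?Q (Suc n)\<^esub>"
  have "injective_resolution R M 0 ?Q ?d i"
    using P N zero_module_injective[OF M.R.ring_axioms]
    by (auto simp: injective_resolution_def module_hom_iff_lin module_kernel_def bij_betw_def
       lin_def N.smult_zero_right split: nat.splits)
  then show ?thesis by blast
qed

text \<open>Splices a resolution of the kernel to the cover: its augmentation, followed by the
  inclusion into \<open>Q\<close>, becomes the first differential.\<close>

lemma projective_resolution_step:
  fixes Q :: "'r std_module" and M :: "('r, 'm) module"
  assumes Q: "projective_module R Q" and \<epsilon>: "lin (carrier R) Q M \<epsilon>" "\<epsilon> ` carrier Q = carrier M"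
    and "\<exists>Q' d \<epsilon>'. projective_resolution R (Q\<lparr>carrier := module_kernel Q M \<epsilon>\<rparr>) n Q' d \<epsilon>'"
  shows "\<exists>Q' d \<epsilon>'. projective_resolution R M (Suc n) Q' d \<epsilon>'"
proof -
  let ?K = "Q\<lparr>carrier := module_kernel Q M \<epsilon>\<rparr>"
  obtain Q' d \<epsilon>' where r: "projective_resolution R ?K n Q' d \<epsilon>'" using assms(4) by blast
  let ?Q = "case_nat Q Q'" and ?d = "case_nat \<epsilon>' d"
  have e: "\<epsilon>' \<in> module_hom R (Q' 0) Q"
    using r by (auto simp: projective_resolution_def module_hom_iff_lin lin_def module_kernel_def)
  have k: "module_kernel (Q' 0) Q \<epsilon>' = module_kernel (Q' 0) ?K \<epsilon>'" by (simp add: module_kernel_def)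
  have "projective_resolution R M (Suc n) ?Q ?d \<epsilon>"
    unfolding projective_resolution_def
  proof (intro conjI allI impI)
    show "?d i \<in> module_hom R (?Q (Suc i)) (?Q i)" for i
      using e r by (cases i) (auto simp: projective_resolution_def)
    show "module_kernel (?Q (Suc i)) (?Q i) (?d i) = ?d (Suc i) ` carrier (?Q (Suc (Suc i)))" for i
      using k r by (cases i) (auto simp: projective_resolution_def)
  qed (use r Q \<epsilon> in \<open>auto simp: projective_resolution_def module_hom_iff_lin split: nat.splits\<close>)
  then show ?thesis by blast
qed

text \<open>Dual splicing. The cokernel is given by any surjection \<open>q\<close> with the right
  kernel; composing \<open>q\<close> with the injective coaugmentation of \<open>C\<close> does not
  change that kernel.\<close>

lemma injective_resolution_step:
  fixes Q :: "'r std_module" and M :: "('r, 'm) module" and C :: "('r, 'c) module"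
  assumes Q: "injective_module R Q" and \<eta>: "lin (carrier R) M Q \<eta>" "inj_on \<eta> (carrier M)"
    and q: "lin (carrier R) Q C q" "q ` carrier Q = carrier C" "module_kernel Q C q = \<eta> ` carrier M"
    and C: "left_module R C" "\<exists>Q' d \<eta>'. injective_resolution R C n Q' d \<eta>'"
  shows "\<exists>Q' d \<eta>'. injective_resolution R M (Suc n) Q' d \<eta>'"
proof -
  obtain Q' d \<eta>' where r: "injective_resolution R C n Q' d \<eta>'" using C by blast
  let ?Q = "case_nat Q Q'" and ?d = "case_nat (\<lambda>x. \<eta>' (q x)) d"
  have \<eta>': "lin (carrier R) C (Q' 0) \<eta>'" "inj_on \<eta>' (carrier C)"
    and Q': "fg_module R (Q' 0)"
    using r by (auto simp: injective_resolution_def module_hom_iff_lin injective_module_fg)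
  interpret C: left_module R C by fact
  interpret Q': left_module R "Q' 0" using Q' by (rule fg_module_left)
  note z = additive_zero[OF C.M.abelian_group_axioms Q'.M.abelian_group_axioms \<eta>'(1)]
  have "\<eta>' (q x) = \<zero>\<^bsub>Q' 0\<^esub> \<longleftrightarrow> q x = \<zero>\<^bsub>C\<^esub>" if "x \<in> carrier Q" for x
    using inj_onD[OF \<eta>'(2), of "q x" "\<zero>\<^bsub>C\<^esub>"] z lin_closed[OF q(1) that] by auto
  then have k: "module_kernel Q (Q' 0) (\<lambda>x. \<eta>' (q x)) = \<eta> ` carrier M"
    unfolding q(3)[symmetric] by (auto simp: module_kernel_def)
  have im: "(\<lambda>x. \<eta>' (q x)) ` carrier Q = \<eta>' ` carrier C" unfolding q(2)[symmetric] by auto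
  have "injective_resolution R M (Suc n) ?Q ?d \<eta>"
    unfolding injective_resolution_def
  proof (intro conjI allI impI)
    show "?d i \<in> module_hom R (?Q i) (?Q (Suc i))" for i
      using lin_comp[OF q(1) \<eta>'(1)] r by (cases i) (auto simp: injective_resolution_def module_hom_iff_lin)
    show "module_kernel (?Q (Suc i)) (?Q (Suc (Suc i))) (?d (Suc i)) = ?d i ` carrier (?Q i)" for i
      using im r by (cases i) (auto simp: injective_resolution_def)
  qed (use r Q \<eta> k in \<open>auto simp: injective_resolution_def module_hom_iff_lin split: nat.splits\<close>)
  then show ?thesis by blast
qed

lemma projective_resolution_iso:
  assumes "projective_resolution R M n Q d \<epsilon>" "left_module R M" "left_module R N"
    and "lin (carrier R) M N i" "bij_betw i (carrier M) (carrier N)"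
  shows "projective_resolution R N n Q d (\<lambda>x. i (\<epsilon> x))"
proof -
  interpret M: left_module R M by fact
  interpret N: left_module R N by fact
  have \<epsilon>: "lin (carrier R) (Q 0) M \<epsilon>" "\<epsilon> ` carrier (Q 0) = carrier M"
    using assms(1) by (auto simp: projective_resolution_def module_hom_iff_lin)
  note z = additive_zero[OF M.M.abelian_group_axioms N.M.abelian_group_axioms assms(4)]
  have "i (\<epsilon> x) = \<zero>\<^bsub>N\<^esub> \<longleftrightarrow> \<epsilon> x = \<zero>\<^bsub>M\<^esub>" if "x \<in> carrier (Q 0)" for x
    using bij_betw_imp_inj_on[OF assms(5), THEN inj_onD, of "\<epsilon> x" "\<zero>\<^bsub>M\<^esub>"] z lin_closed[OF \<epsilon>(1) that] by auto
  then have "module_kernel (Q 0) N (\<lambda>x. i (\<epsilon> x)) = module_kernel (Q 0) M \<epsilon>"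
    by (auto simp: module_kernel_def)
  moreover have "(\<lambda>x. i (\<epsilon> x)) ` carrier (Q 0) = carrier N"
    using \<epsilon>(2) assms(5) by (metis bij_betw_def image_image)
  ultimately show ?thesis
    using assms(1) lin_comp[OF \<epsilon>(1) assms(4)] by (auto simp: projective_resolution_def module_hom_iff_lin)
qed

lemma injective_resolution_iso:
  assumes "injective_resolution R M n Q d \<eta>"
    and "lin (carrier R) N M i" "bij_betw i (carrier N) (carrier M)"
  shows "injective_resolution R N n Q d (\<lambda>x. \<eta> (i x))"
proof -
  have \<eta>: "lin (carrier R) M (Q 0) \<eta>" "inj_on \<eta> (carrier M)"
    using assms(1) by (auto simp: injective_resolution_def module_hom_iff_lin)
  have "(\<lambda>x. \<eta> (i x)) ` carrier N = \<eta> ` carrier M"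
    using assms(3) by (metis bij_betw_def image_image)
  moreover have "inj_on (\<lambda>x. \<eta> (i x)) (carrier N)"
    using comp_inj_on[of i "carrier N" \<eta>] \<eta>(2) assms(3) by (simp add: bij_betw_def comp_def)
  ultimately show ?thesis
    using assms(1) lin_comp[OF assms(2) \<eta>(1)] by (auto simp: injective_resolution_def module_hom_iff_lin)
qed

lemma proj_dim_leI: "\<exists>Q d \<epsilon>. projective_resolution R M n Q d \<epsilon> \<Longrightarrow> proj_dim R M \<le> enat n"
  unfolding proj_dim_def by (rule Inf_lower) blast

lemma inj_dim_leI: "\<exists>Q d \<eta>. injective_resolution R M n Q d \<eta> \<Longrightarrow> inj_dim R M \<le> enat n"
  unfolding inj_dim_def by (rule Inf_lower) blast

lemma proj_dim_finiteE:
  assumes "proj_dim R M < \<infinity>"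
  obtains n Q d \<epsilon> where "projective_resolution R M n Q d \<epsilon>"
  using assms unfolding proj_dim_def Inf_enat_def by (auto split: if_splits)

lemma inj_dim_finiteE:
  assumes "inj_dim R M < \<infinity>"
  obtains n Q d \<eta> where "injective_resolution R M n Q d \<eta>"
  using assms unfolding inj_dim_def Inf_enat_def by (auto split: if_splits)

lemma regular_module_simps [simp]:
  "carrier (regular_module R) = carrier R" "add (regular_module R) = add R"
  "zero (regular_module R) = zero R" "smult (regular_module R) = mult R"
  by (simp_all add: regular_module_def)

text \<open>A map out of the regular module is determined by the image of 1, so it suffices to lift
  that one element.\<close>

lemma regular_module_projective:
  assumes "ring R"
  shows "projective_module R (regular_module R)"
proof (rule projective_moduleI)
  interpret ring R by fact
  have left: "left_module R (regular_module R)"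
    using assms by (intro left_moduleI abelian_groupI)
      (auto simp: a_ac l_distr r_distr m_assoc intro: exI[of _ "\<ominus>\<^bsub>R\<^esub> _"] l_neg)
  have "a \<in> mspan (carrier R) (regular_module R) {\<one>\<^bsub>R\<^esub>}" if "a \<in> carrier R" for a
    using mspan.smult[OF that, of "\<one>\<^bsub>R\<^esub>" "{\<one>\<^bsub>R\<^esub>}" "regular_module R"] that by simp
  then show "fg_module R (regular_module R)"
    using left by (auto simp: fg_module_iff intro!: exI[of _ "{\<one>\<^bsub>R\<^esub>}"])
  fix N L :: "'a std_module" and f g
  assume *: "fg_module R N" "fg_module R L" "lin (carrier R) N L f" "f ` carrier N = carrier L"
    "lin (carrier R) (regular_module R) L g"
  interpret N: left_module R N using *(1) by (rule fg_module_left)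
  have "g \<one>\<^bsub>R\<^esub> \<in> carrier L" using lin_closed[OF *(5)] by simp
  then obtain n where n: "n \<in> carrier N" "f n = g \<one>\<^bsub>R\<^esub>" using *(4) by (metis imageE)
  have "lin (carrier R) (regular_module R) N (\<lambda>a. a \<odot>\<^bsub>N\<^esub> n)"
    by (rule linI) (auto simp: n N.smult_closed N.smult_l_distr N.smult_assoc)
  moreover have "f (a \<odot>\<^bsub>N\<^esub> n) = g a" if "a \<in> carrier R" for a
    using lin_smult[OF *(3) that n(1)] lin_smult[OF *(5) that, of "\<one>\<^bsub>R\<^esub>"] n(2) that by simp
  ultimately show "\<exists>h. lin (carrier R) (regular_module R) N h \<and> (\<forall>x\<in>carrier (regular_module R). f (h x) = g x)"
    by (intro exI[of _ "\<lambda>a. a \<odot>\<^bsub>N\<^esub> n"]) auto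
qed

lemma opposite_ring_simps [simp]:
  "carrier (opposite_ring R) = carrier R" "add (opposite_ring R) = add R" "zero (opposite_ring R) = zero R"
  "one (opposite_ring R) = one R" "mult (opposite_ring R) = (\<lambda>a b. b \<otimes>\<^bsub>R\<^esub> a)"
  by (simp_all add: opposite_ring_def)

lemma opposite_ring: "ring R \<Longrightarrow> ring (opposite_ring R)"
proof -
  assume "ring R"
  then interpret ring R .
  show ?thesis
  proof (rule ringI)
    show "abelian_group (opposite_ring R)"
    proof (rule abelian_groupI)
      fix x assume "x \<in> carrier (opposite_ring R)"
      then show "\<exists>y\<in>carrier (opposite_ring R). y \<oplus>\<^bsub>opposite_ring R\<^esub> x = \<zero>\<^bsub>opposite_ring R\<^esub>"
        by (intro bexI[of _ "\<ominus>\<^bsub>R\<^esub> x"]) (auto simp: l_neg)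
    qed (auto simp: a_ac)
    show "monoid (opposite_ring R)"
      by (rule monoidI) (auto simp: m_assoc)
  qed (auto simp: l_distr r_distr)
qed

section \<open>The transporter category algebra\<close>

text \<open>Elementwise form of \<open>finite_G_poset\<close>, closed under reversing the order and
  under passing to an orbit with trivial relations. Monotonicity of the action suffices: applied to
  \<open>inv g\<close> it shows that the order is reflected as well.\<close>

locale gposet = group G for G (structure) +
  fixes P :: "'p set" and r :: "'p rel" and \<phi> :: "_ \<Rightarrow> 'p \<Rightarrow> 'p"
  assumes finite_G: "finite (carrier G)"
    and finite_P: "finite P"
    and act_closed: "g \<in> carrier G \<Longrightarrow> x \<in> P \<Longrightarrow> \<phi> g x \<in> P"
    and act_one: "x \<in> P \<Longrightarrow> \<phi> \<one> x = x"
    and act_mult: "g \<in> carrier G \<Longrightarrow> h \<in> carrier G \<Longrightarrow> x \<in> P \<Longrightarrow> \<phi> (g \<otimes> h) x = \<phi> g (\<phi> h x)"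
    and rel_P: "(x, y) \<in> r \<Longrightarrow> x \<in> P \<and> y \<in> P"
    and rel_refl: "x \<in> P \<Longrightarrow> (x, x) \<in> r"
    and rel_trans: "(x, y) \<in> r \<Longrightarrow> (y, z) \<in> r \<Longrightarrow> (x, z) \<in> r"
    and rel_antisym: "(x, y) \<in> r \<Longrightarrow> (y, x) \<in> r \<Longrightarrow> x = y"
    and act_mono: "g \<in> carrier G \<Longrightarrow> (x, y) \<in> r \<Longrightarrow> (\<phi> g x, \<phi> g y) \<in> r"
begin

abbreviation "cat \<equiv> transporter_category G P r \<phi>"
abbreviation "ar \<equiv> {(g, x, y). g \<in> carrier G \<and> x \<in> P \<and> y \<in> P \<and> (\<phi> g x, y) \<in> r}"

lemma act_inv: "g \<in> carrier G \<Longrightarrow> x \<in> P \<Longrightarrow> \<phi> (inv g) (\<phi> g x) = x"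
  and act_inv': "g \<in> carrier G \<Longrightarrow> x \<in> P \<Longrightarrow> \<phi> g (\<phi> (inv g) x) = x"
  using act_mult[of "inv g" g x] act_mult[of g "inv g" x] act_one by auto

lemma act_rel_iff: "g \<in> carrier G \<Longrightarrow> x \<in> P \<Longrightarrow> y \<in> P \<Longrightarrow> (\<phi> g x, y) \<in> r \<longleftrightarrow> (x, \<phi> (inv g) y) \<in> r"
  using act_mono[of g x "\<phi> (inv g) y"] act_mono[of "inv g" "\<phi> g x" y] act_inv act_inv' by auto

lemma act_bij: "g \<in> carrier G \<Longrightarrow> bij_betw (\<phi> g) P P"
  by (rule bij_betwI[of _ _ _ "\<phi> (inv g)"]) (auto simp: act_closed act_inv act_inv')

lemma cat_simps [simp]:
  "Arr cat = ar" "Obj cat = P" "Dom cat (g, x, y) = x" "Cod cat (g, x, y) = y" "Ide cat x = (\<one>, x, x)"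
  "Cmp cat (h, y, z) (g, x, y') = (h \<otimes> g, x, z)"
  by (simp_all add: transporter_category_def)

lemma finite_ar: "finite ar"
  by (rule finite_subset[of _ "carrier G \<times> P \<times> P"]) (auto simp: finite_G finite_P)

abbreviation CA :: "(_ \<Rightarrow> 'k::field) ring" where "CA \<equiv> category_algebra cat"

abbreviation composable :: "_ \<Rightarrow> (_ \<times> _) set" where
  "composable k \<equiv> {(f, f'). f \<in> ar \<and> f' \<in> ar \<and> Dom cat f = Cod cat f' \<and> Cmp cat f f' = k}"

lemma CA_simps:
  "carrier CA = {a. \<forall>f. f \<notin> ar \<longrightarrow> a f = 0}"
  "\<one>\<^bsub>CA\<^esub> = (\<lambda>f. if f \<in> (\<lambda>x. (\<one>, x, x)) ` P then 1 else 0)"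
  "\<zero>\<^bsub>CA\<^esub> = (\<lambda>f. 0)" "a \<oplus>\<^bsub>CA\<^esub> b = (\<lambda>f. a f + b f)"
  "(a \<otimes>\<^bsub>CA\<^esub> b) k = (\<Sum>(f, f')\<in>composable k. a f * b f')"
  by (simp_all add: category_algebra_def)

text \<open>A first factor (h, y, z) and the product (g, x, z) determine the second factor, whose
  group element must be \<open>inv h \<otimes> g\<close>. Pairs that are not morphisms have
  coefficient 0, so the product becomes a convolution over all of G and P.\<close>

lemma CA_mult:
  fixes a b :: "_ \<Rightarrow> 'k::field"
  assumes a: "a \<in> carrier CA" and b: "b \<in> carrier CA" and g: "g \<in> carrier G" and x: "x \<in> P" and z: "z \<in> P"
  shows "(a \<otimes>\<^bsub>CA\<^esub> b) (g, x, z) = (\<Sum>h\<in>carrier G. \<Sum>y\<in>P. a (h, y, z) * b (inv h \<otimes> g, x, y))"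
proof -
  have a0: "a (h, y, z) = 0" if "(\<phi> h y, z) \<notin> r" for h y using a that by (simp add: CA_simps)
  have b0: "b (h, x, y) = 0" if "(\<phi> h x, y) \<notin> r" for h y using b that by (simp add: CA_simps)
  have a0': "(\<phi> h y, z) \<in> r" if "a (h, y, z) \<noteq> 0" for h y using a0 that by blast
  have b0': "(\<phi> h x, y) \<in> r" if "b (h, x, y) \<noteq> 0" for h y using b0 that by blast
  have "(a \<otimes>\<^bsub>CA\<^esub> b) (g, x, z) =
    (\<Sum>(h, y)\<in>{(h, y). h \<in> carrier G \<and> y \<in> P \<and> (h, y, z) \<in> ar \<and> (inv h \<otimes> g, x, y) \<in> ar}.
      a (h, y, z) * b (inv h \<otimes> g, x, y))"
    unfolding CA_simps(5)
    by (rule sum.reindex_bij_witness[of _ "\<lambda>(h, y). ((h, y, z), (inv h \<otimes> g, x, y))" "\<lambda>(f, f'). (fst f, fst (snd f))"])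
      (use g x z in \<open>auto simp: m_assoc[symmetric]\<close>)
  also have "\<dots> = (\<Sum>(h, y)\<in>carrier G \<times> P. a (h, y, z) * b (inv h \<otimes> g, x, y))"
    by (rule sum.mono_neutral_left) (use g x z in \<open>auto simp: finite_G finite_P dest: a0' b0'\<close>)
  also have "\<dots> = (\<Sum>h\<in>carrier G. \<Sum>y\<in>P. a (h, y, z) * b (inv h \<otimes> g, x, y))"
    by (simp add: sum.cartesian_product)
  finally show ?thesis .
qed

lemma composable_closed: "p \<in> composable k \<Longrightarrow> k \<in> ar"
proof -
  assume "p \<in> composable k"
  then obtain h g x y z where *: "k = (h \<otimes> g, x, z)" "h \<in> carrier G" "g \<in> carrier G" "x \<in> P" "z \<in> P"
    "(\<phi> g x, y) \<in> r" "(\<phi> h y, z) \<in> r"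
    by auto
  then have "(\<phi> (h \<otimes> g) x, z) \<in> r"
    using act_mono[of h "\<phi> g x" y] rel_trans by (simp add: act_mult)
  then show ?thesis using * by simp
qed

lemma CA_closed: "(a::_ \<Rightarrow> 'k::field) \<otimes>\<^bsub>CA\<^esub> b \<in> carrier CA"
proof -
  have "(a \<otimes>\<^bsub>CA\<^esub> b) k = 0" if "k \<notin> ar" for k
  proof -
    have "composable k = {}" by (rule equals0I) (use composable_closed[of _ k] that in iprover)
    then show ?thesis unfolding CA_simps(5) by (simp only: sum.empty)
  qed
  then show ?thesis unfolding CA_simps(1) by blast
qed

lemma CA_eqI:
  assumes "a \<in> carrier CA" "b \<in> carrier CA"
    and "\<And>g x y. g \<in> carrier G \<Longrightarrow> x \<in> P \<Longrightarrow> y \<in> P \<Longrightarrow> (\<phi> g x, y) \<in> r \<Longrightarrow> a (g, x, y) = b (g, x, y)"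
  shows "a = (b :: _ \<Rightarrow> 'k::field)"
proof
  fix f show "a f = b f"
    using assms by (cases f; cases "f \<in> ar") (auto simp: CA_simps)
qed

lemma one_CA: "g \<in> carrier G \<Longrightarrow> x \<in> P \<Longrightarrow> \<one>\<^bsub>CA\<^esub> (g, x, y) = (if g = \<one> \<and> x = y then 1 else 0 :: 'k::field)"
  by (auto simp: CA_simps)

lemma one_CA_closed: "\<one>\<^bsub>CA\<^esub> \<in> carrier (CA :: (_ \<Rightarrow> 'k::field) ring)"
  by (auto simp: CA_simps act_one rel_refl)

lemma CA_ring: "ring (CA :: (_ \<Rightarrow> 'k::field) ring)"
proof (rule ringI)
  show "abelian_group (CA :: (_ \<Rightarrow> 'k) ring)"
  proof (rule abelian_groupI)
    fix a :: "_ \<Rightarrow> 'k" assume "a \<in> carrier CA"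
    then show "\<exists>b\<in>carrier CA. b \<oplus>\<^bsub>CA\<^esub> a = \<zero>\<^bsub>CA\<^esub>"
      by (intro bexI[of _ "\<lambda>f. - a f"]) (auto simp: CA_simps)
  qed (auto simp: CA_simps add.assoc add.commute)
  show "monoid (CA :: (_ \<Rightarrow> 'k) ring)"
  proof (rule monoidI)
    fix a b c :: "_ \<Rightarrow> 'k" assume abc: "a \<in> carrier CA" "b \<in> carrier CA" "c \<in> carrier CA"
    show "a \<otimes>\<^bsub>CA\<^esub> b \<otimes>\<^bsub>CA\<^esub> c = a \<otimes>\<^bsub>CA\<^esub> (b \<otimes>\<^bsub>CA\<^esub> c)"
    proof (rule CA_eqI[OF CA_closed CA_closed])
      fix g x w assume *: "g \<in> carrier G" "x \<in> P" "w \<in> P"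
      have "(a \<otimes>\<^bsub>CA\<^esub> b \<otimes>\<^bsub>CA\<^esub> c) (g, x, w) = (\<Sum>h\<in>carrier G. \<Sum>y\<in>P. \<Sum>k\<in>carrier G. \<Sum>z\<in>P.
          a (k, z, w) * b (inv k \<otimes> h, y, z) * c (inv h \<otimes> g, x, y))"
        using * abc by (simp add: CA_mult CA_closed sum_distrib_right)
      also have "\<dots> = (\<Sum>h\<in>carrier G. \<Sum>k\<in>carrier G. \<Sum>z\<in>P. \<Sum>y\<in>P.
          a (k, z, w) * b (inv k \<otimes> h, y, z) * c (inv h \<otimes> g, x, y))"
        by (rule sum.cong[OF refl], subst sum.swap, rule sum.cong[OF refl], rule sum.swap)
      also have "\<dots> = (\<Sum>k\<in>carrier G. \<Sum>h\<in>carrier G. \<Sum>z\<in>P. \<Sum>y\<in>P.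
          a (k, z, w) * b (inv k \<otimes> h, y, z) * c (inv h \<otimes> g, x, y))"
        by (rule sum.swap)
      \<comment> \<open>For fixed \<open>k\<close> the substitution of \<open>k \<otimes> h\<close>
        for \<open>h\<close> frees the middle factor from \<open>k\<close>.\<close>
      also have "\<dots> = (\<Sum>k\<in>carrier G. \<Sum>h\<in>carrier G. \<Sum>z\<in>P. \<Sum>y\<in>P.
          a (k, z, w) * b (h, y, z) * c (inv h \<otimes> (inv k \<otimes> g), x, y))"
      proof (rule sum.cong[OF refl])
        fix k assume k: "k \<in> carrier G"
        have e: "inv k \<otimes> (k \<otimes> h) = h" "k \<otimes> (inv k \<otimes> h) = h"
          "inv (inv k \<otimes> h) \<otimes> (inv k \<otimes> g) = inv h \<otimes> g" if "h \<in> carrier G" for h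
          using k * that by (simp_all add: m_assoc[symmetric] inv_mult_group)
            (simp add: m_assoc)
        show "(\<Sum>h\<in>carrier G. \<Sum>z\<in>P. \<Sum>y\<in>P. a (k, z, w) * b (inv k \<otimes> h, y, z) * c (inv h \<otimes> g, x, y)) =
          (\<Sum>h\<in>carrier G. \<Sum>z\<in>P. \<Sum>y\<in>P. a (k, z, w) * b (h, y, z) * c (inv h \<otimes> (inv k \<otimes> g), x, y))"
          by (rule sum.reindex_bij_witness[of _ "\<lambda>h. k \<otimes> h" "\<lambda>h. inv k \<otimes> h"])
            (use k in \<open>simp_all add: e\<close>)
      qed
      also have "\<dots> = (\<Sum>k\<in>carrier G. \<Sum>z\<in>P. \<Sum>h\<in>carrier G. \<Sum>y\<in>P.
          a (k, z, w) * (b (h, y, z) * c (inv h \<otimes> (inv k \<otimes> g), x, y)))"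
        by (subst (2) sum.swap) (simp only: mult.assoc)
      also have "\<dots> = (a \<otimes>\<^bsub>CA\<^esub> (b \<otimes>\<^bsub>CA\<^esub> c)) (g, x, w)"
        using * abc by (simp add: CA_mult CA_closed sum_distrib_left)
      finally show "(a \<otimes>\<^bsub>CA\<^esub> b \<otimes>\<^bsub>CA\<^esub> c) (g, x, w) = (a \<otimes>\<^bsub>CA\<^esub> (b \<otimes>\<^bsub>CA\<^esub> c)) (g, x, w)" .
    qed
  next
    fix a :: "_ \<Rightarrow> 'k" assume a: "a \<in> carrier CA"
    show "\<one>\<^bsub>CA\<^esub> \<otimes>\<^bsub>CA\<^esub> a = a"
    proof (rule CA_eqI[OF CA_closed a])
      fix g x z assume *: "g \<in> carrier G" "x \<in> P" "z \<in> P"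
      have "(\<one>\<^bsub>CA\<^esub> \<otimes>\<^bsub>CA\<^esub> a) (g, x, z) = (\<Sum>h\<in>carrier G. \<Sum>y\<in>P. if h = \<one> \<and> y = z then a (inv h \<otimes> g, x, y) else 0)"
        using * a by (simp add: CA_mult one_CA_closed one_CA if_distrib[of "\<lambda>t. t * _"] cong: if_cong sum.cong)
      then show "(\<one>\<^bsub>CA\<^esub> \<otimes>\<^bsub>CA\<^esub> a) (g, x, z) = a (g, x, z)"
        using * by (simp add: sum_delta2 finite_G finite_P)
    qed
    show "a \<otimes>\<^bsub>CA\<^esub> \<one>\<^bsub>CA\<^esub> = a"
    proof (rule CA_eqI[OF CA_closed a])
      fix g x z assume *: "g \<in> carrier G" "x \<in> P" "z \<in> P"
      have "inv h \<otimes> g = \<one> \<longleftrightarrow> h = g" if "h \<in> carrier G" for h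
        using that * by (metis inv_closed inv_equality inv_inv l_inv)
      then have "(a \<otimes>\<^bsub>CA\<^esub> \<one>\<^bsub>CA\<^esub>) (g, x, z) = (\<Sum>h\<in>carrier G. \<Sum>y\<in>P. if h = g \<and> y = x then a (h, y, z) else 0)"
        using * a by (auto simp: CA_mult one_CA_closed one_CA intro!: sum.cong)
      then show "(a \<otimes>\<^bsub>CA\<^esub> \<one>\<^bsub>CA\<^esub>) (g, x, z) = a (g, x, z)"
        using * by (simp add: sum_delta2 finite_G finite_P)
    qed
  qed (rule CA_closed, rule one_CA_closed)
  fix a b c :: "_ \<Rightarrow> 'k"
  show "(a \<oplus>\<^bsub>CA\<^esub> b) \<otimes>\<^bsub>CA\<^esub> c = a \<otimes>\<^bsub>CA\<^esub> c \<oplus>\<^bsub>CA\<^esub> b \<otimes>\<^bsub>CA\<^esub> c"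
    by (rule ext) (simp only: CA_simps(4,5) distrib_right sum.distrib split_def)
  show "c \<otimes>\<^bsub>CA\<^esub> (a \<oplus>\<^bsub>CA\<^esub> b) = c \<otimes>\<^bsub>CA\<^esub> a \<oplus>\<^bsub>CA\<^esub> c \<otimes>\<^bsub>CA\<^esub> b"
    by (rule ext) (simp only: CA_simps(4,5) distrib_left sum.distrib split_def)
qed

lemma dual: "gposet G P (r\<inverse>) \<phi>"
  by unfold_locales (auto simp: finite_G finite_P act_closed act_one act_mult rel_refl act_mono dest: rel_P
      intro: rel_trans rel_antisym)

end

text \<open>
  The algebra is only required to be isomorphic to a category algebra, so that the locale also
  applies to opposite algebras.
\<close>

locale talg = gposet G P r \<phi> + A: ring A
  for G :: "('g, 'e) monoid_scheme" (structure) and P :: "'p set" and r :: "'p rel" and \<phi> and A :: "'r ring" +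
  fixes \<psi> :: "'r \<Rightarrow> 'g \<times> 'p \<times> 'p \<Rightarrow> 'k::field"
  assumes \<psi>_hom: "\<psi> \<in> ring_hom A (category_algebra (transporter_category G P r \<phi>))"
    and \<psi>_bij: "bij_betw \<psi> (carrier A) (carrier (category_algebra (transporter_category G P r \<phi>)))"
begin

lemma \<psi>_closed: "a \<in> carrier A \<Longrightarrow> \<psi> a \<in> carrier CA"
  and \<psi>_add: "a \<in> carrier A \<Longrightarrow> b \<in> carrier A \<Longrightarrow> \<psi> (a \<oplus>\<^bsub>A\<^esub> b) f = \<psi> a f + \<psi> b f"
  and \<psi>_mult_CA: "a \<in> carrier A \<Longrightarrow> b \<in> carrier A \<Longrightarrow> \<psi> (a \<otimes>\<^bsub>A\<^esub> b) = \<psi> a \<otimes>\<^bsub>CA\<^esub> \<psi> b"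
  and \<psi>_one: "\<psi> \<one>\<^bsub>A\<^esub> = \<one>\<^bsub>CA\<^esub>"
  using \<psi>_hom by (auto simp: ring_hom_def CA_simps(4))

lemma \<psi>_mult:
  assumes "a \<in> carrier A" "b \<in> carrier A" "g \<in> carrier G" "x \<in> P" "z \<in> P"
  shows "\<psi> (a \<otimes>\<^bsub>A\<^esub> b) (g, x, z) = (\<Sum>h\<in>carrier G. \<Sum>y\<in>P. \<psi> a (h, y, z) * \<psi> b (inv h \<otimes> g, x, y))"
  using assms by (simp add: \<psi>_mult_CA CA_mult \<psi>_closed)

lemma \<psi>_zero: "\<psi> \<zero>\<^bsub>A\<^esub> f = 0"
  using \<psi>_add[of "\<zero>\<^bsub>A\<^esub>" "\<zero>\<^bsub>A\<^esub>" f] by (metis A.l_zero A.zero_closed add_cancel_right_right)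

lemma \<psi>_off: "a \<in> carrier A \<Longrightarrow> f \<notin> ar \<Longrightarrow> \<psi> a f = 0"
  using \<psi>_closed[of a] unfolding CA_simps(1) by blast

lemma \<psi>_eqI:
  assumes "a \<in> carrier A" "b \<in> carrier A"
    and "\<And>g x y. g \<in> carrier G \<Longrightarrow> x \<in> P \<Longrightarrow> y \<in> P \<Longrightarrow> (\<phi> g x, y) \<in> r \<Longrightarrow> \<psi> a (g, x, y) = \<psi> b (g, x, y)"
  shows "a = b"
proof -
  have "\<psi> a = \<psi> b" using assms by (intro CA_eqI \<psi>_closed)
  then show ?thesis using \<psi>_bij assms(1,2) by (auto simp: bij_betw_def dest: inj_onD)
qed

lemma \<psi>_finsum:
  assumes "finite I" "u \<in> I \<rightarrow> carrier A"
  shows "\<psi> (\<Oplus>\<^bsub>A\<^esub>i\<in>I. u i) f = (\<Sum>i\<in>I. \<psi> (u i) f)"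
  using assms
proof (induction I rule: finite_induct)
  case (insert i I)
  then show ?case by (simp add: A.finsum_insert \<psi>_add A.finsum_closed Pi_def)
qed (simp add: \<psi>_zero)

definition el :: "('g \<times> 'p \<times> 'p \<Rightarrow> 'k) \<Rightarrow> 'r" where
  "el = inv_into (carrier A) \<psi>"

lemma el:
  assumes "w \<in> carrier CA"
  shows "el w \<in> carrier A" "\<psi> (el w) = w"
  using assms \<psi>_bij by (auto simp: el_def bij_betw_def inv_into_into f_inv_into_f)

text \<open>The k-structure of modules is encoded by the action of these central elements, as the
  record of A knows nothing of k.\<close>

definition \<kappa> :: "'k \<Rightarrow> 'r" where
  "\<kappa> c = el (\<lambda>(g, x, y). if g = \<one> \<and> x = y \<and> x \<in> P then c else 0)"

text \<open>The image of \<open>g\<close> under the ring homomorphism from the group algebra: the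
  sum over x of the isomorphisms from x to gx.\<close>

definition hat :: "'g \<Rightarrow> 'r" where
  "hat g = el (\<lambda>(h, x, y). if h = g \<and> x \<in> P \<and> y = \<phi> g x then 1 else 0)"

text \<open>Extended by 0 to incomparable pairs, so that sums such as \<open>dn_sum\<close> can run
  over all of \<open>P\<close>.\<close>

definition t :: "'p \<Rightarrow> 'p \<Rightarrow> 'r" where
  "t x y = el (\<lambda>(g, u, v). if (x, y) \<in> r \<and> g = \<one> \<and> u = x \<and> v = y then 1 else 0)"

text \<open>Factors a basis morphism into the isomorphism from x to gx and the transition from gx to
  y, so that a module need only specify these two kinds of maps.\<close>

definition bs :: "'g \<times> 'p \<times> 'p \<Rightarrow> 'r" where
  "bs = (\<lambda>(g, x, y). t (\<phi> g x) y \<otimes>\<^bsub>A\<^esub> hat g)"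

lemma \<kappa>: "\<kappa> c \<in> carrier A" "\<psi> (\<kappa> c) (g, x, y) = (if g = \<one> \<and> x = y \<and> x \<in> P then c else 0)"
proof -
  have *: "(\<lambda>(g, x, y). if g = \<one> \<and> x = y \<and> x \<in> P then c else 0) \<in> carrier CA"
    by (auto simp: CA_simps act_one rel_refl)
  show "\<kappa> c \<in> carrier A" "\<psi> (\<kappa> c) (g, x, y) = (if g = \<one> \<and> x = y \<and> x \<in> P then c else 0)"
    unfolding \<kappa>_def using el[OF *] by auto
qed

lemma hat:
  assumes "g \<in> carrier G"
  shows "hat g \<in> carrier A" "\<psi> (hat g) (h, x, y) = (if h = g \<and> x \<in> P \<and> y = \<phi> g x then 1 else 0)"
proof -
  have *: "(\<lambda>(h, x, y). if h = g \<and> x \<in> P \<and> y = \<phi> g x then 1 else 0) \<in> carrier CA"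
    using assms by (auto simp: CA_simps act_closed rel_refl)
  show "hat g \<in> carrier A" "\<psi> (hat g) (h, x, y) = (if h = g \<and> x \<in> P \<and> y = \<phi> g x then 1 else 0)"
    unfolding hat_def using el[OF *] by auto
qed

lemma t: "t x y \<in> carrier A" "\<psi> (t x y) (g, u, v) = (if (x, y) \<in> r \<and> g = \<one> \<and> u = x \<and> v = y then 1 else 0)"
proof -
  have *: "(\<lambda>(g, u, v). if (x, y) \<in> r \<and> g = \<one> \<and> u = x \<and> v = y then 1 else 0) \<in> carrier CA"
    using rel_P by (auto simp: CA_simps act_one)
  show "t x y \<in> carrier A" "\<psi> (t x y) (g, u, v) = (if (x, y) \<in> r \<and> g = \<one> \<and> u = x \<and> v = y then 1 else 0)"
    unfolding t_def using el[OF *] by auto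
qed

lemmas gen_closed [simp, intro] = \<kappa>(1) hat(1) t(1)

lemma bs_closed [simp, intro]: "f \<in> ar \<Longrightarrow> bs f \<in> carrier A"
  by (auto simp: bs_def)

section \<open>Coefficients of products with the generators\<close>

lemma \<psi>_\<kappa>_mult:
  assumes "a \<in> carrier A"
  shows "\<psi> (\<kappa> c \<otimes>\<^bsub>A\<^esub> a) f = c * \<psi> a f"
proof (cases "f \<in> ar")
  case True
  then obtain g x z where f: "f = (g, x, z)" "g \<in> carrier G" "x \<in> P" "z \<in> P" by auto
  have "\<psi> (\<kappa> c \<otimes>\<^bsub>A\<^esub> a) f =
      (\<Sum>h\<in>carrier G. \<Sum>y\<in>P. if h = \<one> \<and> y = z then c * \<psi> a (inv h \<otimes> g, x, y) else 0)"
    using f assms by (auto simp: \<psi>_mult \<kappa> intro!: sum.cong)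
  then show ?thesis using f by (simp add: sum_delta2 finite_G finite_P)
qed (simp add: \<psi>_off assms del: mem_Collect_eq)

lemma \<psi>_mult_\<kappa>:
  assumes "a \<in> carrier A"
  shows "\<psi> (a \<otimes>\<^bsub>A\<^esub> \<kappa> c) f = c * \<psi> a f"
proof (cases "f \<in> ar")
  case True
  then obtain g x z where f: "f = (g, x, z)" "g \<in> carrier G" "x \<in> P" "z \<in> P" by auto
  have "inv h \<otimes> g = \<one> \<longleftrightarrow> h = g" if "h \<in> carrier G" for h
    using that f by (metis inv_closed inv_equality inv_inv l_inv)
  then have "\<psi> (a \<otimes>\<^bsub>A\<^esub> \<kappa> c) f =
      (\<Sum>h\<in>carrier G. \<Sum>y\<in>P. if h = g \<and> y = x then c * \<psi> a (h, y, z) else 0)"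
    using f assms by (auto simp: \<psi>_mult \<kappa> intro!: sum.cong)
  then show ?thesis using f by (simp add: sum_delta2 finite_G finite_P)
qed (simp add: \<psi>_off assms del: mem_Collect_eq)

lemma \<psi>_hat_mult:
  assumes "a \<in> carrier A" "g \<in> carrier G" "h \<in> carrier G" "x \<in> P" "z \<in> P"
  shows "\<psi> (hat g \<otimes>\<^bsub>A\<^esub> a) (h, x, z) = \<psi> a (inv g \<otimes> h, x, \<phi> (inv g) z)"
proof -
  have "\<psi> (hat g \<otimes>\<^bsub>A\<^esub> a) (h, x, z) =
      (\<Sum>k\<in>carrier G. \<Sum>y\<in>P. if k = g \<and> y = \<phi> (inv g) z then \<psi> a (inv k \<otimes> h, x, y) else 0)"
    using assms by (auto simp: \<psi>_mult hat act_inv act_inv' intro!: sum.cong)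
  then show ?thesis using assms by (simp add: sum_delta2 finite_G finite_P act_closed)
qed

lemma \<psi>_t_mult:
  assumes "a \<in> carrier A" "h \<in> carrier G" "x \<in> P" "z \<in> P"
  shows "\<psi> (t u v \<otimes>\<^bsub>A\<^esub> a) (h, x, z) = (if (u, v) \<in> r \<and> z = v then \<psi> a (h, x, u) else 0)"
proof (cases "(u, v) \<in> r \<and> z = v")
  case True
  then have "\<psi> (t u v \<otimes>\<^bsub>A\<^esub> a) (h, x, z) =
      (\<Sum>k\<in>carrier G. \<Sum>y\<in>P. if k = \<one> \<and> y = u then \<psi> a (inv k \<otimes> h, x, y) else 0)"
    using assms by (auto simp: \<psi>_mult t intro!: sum.cong)
  moreover have "u \<in> P" using True rel_P by blast
  ultimately show ?thesis using assms True by (simp add: sum_delta2 finite_G finite_P)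
next
  case False
  then have "\<psi> (t u v \<otimes>\<^bsub>A\<^esub> a) (h, x, z) = 0"
    using assms by (auto simp: \<psi>_mult t intro!: sum.neutral)
  then show ?thesis using False by auto
qed

section \<open>Relations among the generators\<close>

lemma \<kappa>_add: "\<kappa> (c + d) = \<kappa> c \<oplus>\<^bsub>A\<^esub> \<kappa> d"
  by (rule \<psi>_eqI) (auto simp: \<psi>_add \<kappa>)

lemma \<kappa>_mult: "\<kappa> (c * d) = \<kappa> c \<otimes>\<^bsub>A\<^esub> \<kappa> d"
  by (rule \<psi>_eqI) (auto simp: \<psi>_\<kappa>_mult \<kappa>)

lemma \<kappa>_one: "\<kappa> 1 = \<one>\<^bsub>A\<^esub>"
  by (rule \<psi>_eqI) (auto simp: \<psi>_one one_CA \<kappa>)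

lemma \<kappa>_zero: "\<kappa> 0 = \<zero>\<^bsub>A\<^esub>"
  by (rule \<psi>_eqI) (auto simp: \<psi>_zero \<kappa>)

lemma \<kappa>_central: "a \<in> carrier A \<Longrightarrow> \<kappa> c \<otimes>\<^bsub>A\<^esub> a = a \<otimes>\<^bsub>A\<^esub> \<kappa> c"
  by (rule \<psi>_eqI) (auto simp: \<psi>_\<kappa>_mult \<psi>_mult_\<kappa>)

lemma inv_mult_eq: "g \<in> carrier G \<Longrightarrow> h \<in> carrier G \<Longrightarrow> k \<in> carrier G \<Longrightarrow> inv g \<otimes> h = k \<longleftrightarrow> h = g \<otimes> k"
  by (metis inv_closed inv_solve_left inv_inv)

lemma act_inv_eq_iff: "g \<in> carrier G \<Longrightarrow> x \<in> P \<Longrightarrow> y \<in> P \<Longrightarrow> \<phi> (inv g) y = x \<longleftrightarrow> y = \<phi> g x"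
  using act_inv act_inv' by auto

lemma hat_mult: "g \<in> carrier G \<Longrightarrow> h \<in> carrier G \<Longrightarrow> hat (g \<otimes> h) = hat g \<otimes>\<^bsub>A\<^esub> hat h"
  by (rule \<psi>_eqI) (auto simp: \<psi>_hat_mult hat inv_mult_eq act_mult act_closed act_inv_eq_iff)

lemma hat_one: "hat \<one> = \<one>\<^bsub>A\<^esub>"
  by (rule \<psi>_eqI) (auto simp: \<psi>_one one_CA hat act_one)

text \<open>The commutation rule of a skew group algebra. The action preserves and reflects the
  order, so the rule also holds when both transitions are 0.\<close>

lemma hat_t:
  assumes "g \<in> carrier G" "x \<in> P" "y \<in> P"
  shows "hat g \<otimes>\<^bsub>A\<^esub> t x y = t (\<phi> g x) (\<phi> g y) \<otimes>\<^bsub>A\<^esub> hat g"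
proof -
  have "(\<phi> g x, \<phi> g y) \<in> r \<longleftrightarrow> (x, y) \<in> r"
    using assms act_mono[of g x y] act_mono[of "inv g" "\<phi> g x" "\<phi> g y"] by (auto simp: act_inv)
  moreover have "\<phi> g x = \<phi> g u \<longleftrightarrow> u = x" if "u \<in> P" for u
    using assms that by (metis act_inv)
  ultimately show ?thesis
    using assms
    by (intro \<psi>_eqI) (auto simp: \<psi>_hat_mult \<psi>_t_mult hat t inv_mult_eq act_closed act_inv act_inv')
qed

lemma t_mult: "(x, y) \<in> r \<Longrightarrow> (y, z) \<in> r \<Longrightarrow> t y z \<otimes>\<^bsub>A\<^esub> t x y = t x z"
  by (rule \<psi>_eqI) (auto simp: \<psi>_t_mult t dest: rel_trans)

lemma t_mult_zero: "y \<noteq> y' \<Longrightarrow> t y' z \<otimes>\<^bsub>A\<^esub> t x y = \<zero>\<^bsub>A\<^esub>"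
  by (rule \<psi>_eqI) (auto simp: \<psi>_t_mult t \<psi>_zero)

lemma t_zero: "(x, y) \<notin> r \<Longrightarrow> t x y = \<zero>\<^bsub>A\<^esub>"
  by (rule \<psi>_eqI) (auto simp: t \<psi>_zero)

lemma one_sum: "(\<Oplus>\<^bsub>A\<^esub>x\<in>P. t x x) = \<one>\<^bsub>A\<^esub>"
  by (rule \<psi>_eqI)
    (auto simp: \<psi>_finsum finite_P t \<psi>_one one_CA rel_refl if_distrib[of "\<lambda>t. t = _"] sum.delta' cong: if_cong
       intro!: sum.neutral A.finsum_closed)

lemma \<psi>_bs:
  assumes "f \<in> ar" "f' \<in> ar"
  shows "\<psi> (bs f) f' = (if f' = f then 1 else 0)"
proof -
  obtain g x y h u w where f: "f = (g, x, y)" "f' = (h, u, w)" by (metis prod_cases3)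
  have "\<phi> g x = \<phi> g u \<longleftrightarrow> u = x"
    using assms f by auto (metis act_inv)
  then show ?thesis using assms f by (auto simp: bs_def \<psi>_t_mult hat act_closed)
qed

text \<open>The reason why linearity over A may be tested on scalars, \<open>hat g\<close> and
  \<open>t x y\<close>, and why A is finite dimensional over k.\<close>

lemma decomp:
  assumes "a \<in> carrier A"
  shows "a = (\<Oplus>\<^bsub>A\<^esub>f\<in>ar. \<kappa> (\<psi> a f) \<otimes>\<^bsub>A\<^esub> bs f)"
proof (rule \<psi>_eqI[OF assms])
  show "(\<Oplus>\<^bsub>A\<^esub>f\<in>ar. \<kappa> (\<psi> a f) \<otimes>\<^bsub>A\<^esub> bs f) \<in> carrier A"
    by (intro A.finsum_closed Pi_I A.m_closed \<kappa> bs_closed)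
  fix g x y assume "g \<in> carrier G" "x \<in> P" "y \<in> P" "(\<phi> g x, y) \<in> r"
  then have f: "(g, x, y) \<in> ar" by simp
  have "\<psi> (\<Oplus>\<^bsub>A\<^esub>f\<in>ar. \<kappa> (\<psi> a f) \<otimes>\<^bsub>A\<^esub> bs f) (g, x, y) = (\<Sum>f\<in>ar. \<psi> (\<kappa> (\<psi> a f) \<otimes>\<^bsub>A\<^esub> bs f) (g, x, y))"
    by (intro \<psi>_finsum finite_ar Pi_I A.m_closed \<kappa> bs_closed)
  also have "\<dots> = (\<Sum>f\<in>ar. if (g, x, y) = f then \<psi> a f else 0)"
    by (rule sum.cong[OF refl]) (subst \<psi>_\<kappa>_mult, erule bs_closed, subst \<psi>_bs[OF _ f], assumption, simp)
  also have "\<dots> = \<psi> a (g, x, y)" by (subst sum.delta'[OF finite_ar]) (use f in \<open>simp del: mem_Collect_eq\<close>)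
  finally show "\<psi> a (g, x, y) = \<psi> (\<Oplus>\<^bsub>A\<^esub>f\<in>ar. \<kappa> (\<psi> a f) \<otimes>\<^bsub>A\<^esub> bs f) (g, x, y)" by simp
qed

text \<open>
  Linear over \<open>D_gens\<close> means \<open>k\<close>-linear and grading preserving, linear over \<open>B_gens\<close> in addition
  \<open>G\<close>-equivariant.
\<close>

abbreviation "D_gens \<equiv> range \<kappa> \<union> (\<lambda>x. t x x) ` P"
abbreviation "B_gens \<equiv> D_gens \<union> hat ` carrier G"

lemma B_gens_closed: "B_gens \<subseteq> carrier A" by auto

text \<open>By \<open>decomp\<close> every element of A is a sum of products of a scalar, a
  transition and a group element; each factor passes through \<open>f\<close> in turn.\<close>

lemma lin_all:
  assumes M: "left_module A M" and N: "left_module A N"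
    and f: "lin (range \<kappa> \<union> hat ` carrier G) M N f"
    and ft: "\<And>x y m. (x, y) \<in> r \<Longrightarrow> m \<in> carrier M \<Longrightarrow> f (t x y \<odot>\<^bsub>M\<^esub> m) = t x y \<odot>\<^bsub>N\<^esub> f m"
  shows "lin (carrier A) M N f"
proof (rule linI)
  interpret M: left_module A M by fact
  interpret N: left_module A N by fact
  fix a m assume a: "a \<in> carrier A" and m: "m \<in> carrier M"
  have bs: "f (bs k \<odot>\<^bsub>M\<^esub> m) = bs k \<odot>\<^bsub>N\<^esub> f m" if k: "k \<in> ar" for k
  proof -
    obtain g x y where "k = (g, x, y)" by (cases k)
    then show ?thesis
      using k m ft[of "\<phi> g x" y "hat g \<odot>\<^bsub>M\<^esub> m"] lin_smult[OF f, of "hat g" m] lin_closed[OF f m]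
      by (simp add: bs_def M.smult_assoc N.smult_assoc M.smult_closed)
  qed
  have "a \<odot>\<^bsub>M\<^esub> m = (\<Oplus>\<^bsub>M\<^esub>k\<in>ar. (\<kappa> (\<psi> a k) \<otimes>\<^bsub>A\<^esub> bs k) \<odot>\<^bsub>M\<^esub> m)"
    by (subst decomp[OF a]) (rule M.finsum_smult[OF m], intro Pi_I A.m_closed \<kappa> bs_closed)
  also have "\<dots> = (\<Oplus>\<^bsub>M\<^esub>k\<in>ar. \<kappa> (\<psi> a k) \<odot>\<^bsub>M\<^esub> (bs k \<odot>\<^bsub>M\<^esub> m))"
    by (rule M.M.finsum_cong') (auto simp del: mem_Collect_eq simp: m M.smult_assoc M.smult_closed)
  finally have "f (a \<odot>\<^bsub>M\<^esub> m) = (\<Oplus>\<^bsub>N\<^esub>k\<in>ar. f (\<kappa> (\<psi> a k) \<odot>\<^bsub>M\<^esub> (bs k \<odot>\<^bsub>M\<^esub> m)))"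
    using additive_finsum[OF M.M.abelian_group_axioms N.M.abelian_group_axioms f,
        of "\<lambda>k. \<kappa> (\<psi> a k) \<odot>\<^bsub>M\<^esub> (bs k \<odot>\<^bsub>M\<^esub> m)" ar]
    by (auto simp del: mem_Collect_eq simp: m M.smult_closed Pi_iff)
  also have "\<dots> = (\<Oplus>\<^bsub>N\<^esub>k\<in>ar. (\<kappa> (\<psi> a k) \<otimes>\<^bsub>A\<^esub> bs k) \<odot>\<^bsub>N\<^esub> f m)"
    by (rule N.M.finsum_cong')
      (auto simp del: mem_Collect_eq simp: m bs lin_smult[OF f] lin_closed[OF f] M.smult_closed N.smult_closed N.smult_assoc)
  also have "\<dots> = a \<odot>\<^bsub>N\<^esub> f m"
    by (subst (2) decomp[OF a]) (rule N.finsum_smult[symmetric, OF lin_closed[OF f m]], intro Pi_I A.m_closed \<kappa> bs_closed)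
  finally show "f (a \<odot>\<^bsub>M\<^esub> m) = a \<odot>\<^bsub>N\<^esub> f m" .
qed (auto simp: lin_closed[OF f] lin_add[OF f])

text \<open>Modules are built as functors: scalars, a G-action and transition maps subject to the
  relations of the category. This spares each later construction the action of an arbitrary algebra
  element. The last hypothesis says that \<open>V\<close> is the sum of its values at the
  objects.\<close>

lemma rep_module:
  fixes V :: "('r, 'v) module"
  assumes V: "abelian_group V"
    and sc: "\<And>c. lin {} V V (sc c)"
    and sc_add: "\<And>c d u. u \<in> carrier V \<Longrightarrow> sc (c + d) u = sc c u \<oplus>\<^bsub>V\<^esub> sc d u"
    and sc_mult: "\<And>c d u. u \<in> carrier V \<Longrightarrow> sc (c * d) u = sc c (sc d u)"
    and sc_one: "\<And>u. u \<in> carrier V \<Longrightarrow> sc 1 u = u"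
    and \<gamma>: "\<And>g. g \<in> carrier G \<Longrightarrow> lin {} V V (\<gamma> g)"
    and \<gamma>_sc: "\<And>g c u. g \<in> carrier G \<Longrightarrow> u \<in> carrier V \<Longrightarrow> \<gamma> g (sc c u) = sc c (\<gamma> g u)"
    and \<gamma>_mult: "\<And>g h u. g \<in> carrier G \<Longrightarrow> h \<in> carrier G \<Longrightarrow> u \<in> carrier V \<Longrightarrow> \<gamma> (g \<otimes> h) u = \<gamma> g (\<gamma> h u)"
    and \<gamma>_one: "\<And>u. u \<in> carrier V \<Longrightarrow> \<gamma> \<one> u = u"
    and \<tau>: "\<And>x y. (x, y) \<in> r \<Longrightarrow> lin {} V V (\<tau> x y)"
    and \<tau>_sc: "\<And>x y c u. (x, y) \<in> r \<Longrightarrow> u \<in> carrier V \<Longrightarrow> \<tau> x y (sc c u) = sc c (\<tau> x y u)"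
    and \<tau>_mult: "\<And>x y z u. (x, y) \<in> r \<Longrightarrow> (y, z) \<in> r \<Longrightarrow> u \<in> carrier V \<Longrightarrow> \<tau> y z (\<tau> x y u) = \<tau> x z u"
    and \<tau>_mult_zero: "\<And>x y y' z u. (x, y) \<in> r \<Longrightarrow> (y', z) \<in> r \<Longrightarrow> y \<noteq> y' \<Longrightarrow> u \<in> carrier V \<Longrightarrow>
        \<tau> y' z (\<tau> x y u) = \<zero>\<^bsub>V\<^esub>"
    and \<gamma>_\<tau>: "\<And>g x y u. g \<in> carrier G \<Longrightarrow> (x, y) \<in> r \<Longrightarrow> u \<in> carrier V \<Longrightarrow>
        \<gamma> g (\<tau> x y u) = \<tau> (\<phi> g x) (\<phi> g y) (\<gamma> g u)"
    and \<tau>_sum: "\<And>u. u \<in> carrier V \<Longrightarrow> (\<Oplus>\<^bsub>V\<^esub>x\<in>P. \<tau> x x u) = u"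
  obtains s where "left_module A (V\<lparr>smult := s\<rparr>)"
    "\<And>c u. u \<in> carrier V \<Longrightarrow> s (\<kappa> c) u = sc c u"
    "\<And>g u. g \<in> carrier G \<Longrightarrow> u \<in> carrier V \<Longrightarrow> s (hat g) u = \<gamma> g u"
    "\<And>x y u. (x, y) \<in> r \<Longrightarrow> u \<in> carrier V \<Longrightarrow> s (t x y) u = \<tau> x y u"
proof -
  interpret V: abelian_group V by fact
  \<comment> \<open>A morphism (g, gx \<le> y) acts by \<open>g\<close>, followed by the transition
    from gx to y.\<close>
  define \<rho> where "\<rho> = (\<lambda>(g, x, y) u. \<tau> (\<phi> g x) y (\<gamma> g u))"
  define s where "s a u = (\<Oplus>\<^bsub>V\<^esub>f\<in>ar. sc (\<psi> a f) (\<rho> f u))" for a u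
  have \<rho>: "lin {} V V (\<rho> f)" if "f \<in> ar" for f
    using that lin_comp[OF \<gamma> \<tau>] by (auto simp: \<rho>_def)
  note [simp] = lin_closed[OF sc] lin_closed[OF \<rho>]
  note Pi_I [intro!]
  note ad = additive_finsum[OF V V]
  have \<rho>_sc: "\<rho> f (sc c u) = sc c (\<rho> f u)" if "f \<in> ar" "u \<in> carrier V" for f c u
    using that lin_closed[OF \<gamma>] by (auto simp: \<rho>_def \<gamma>_sc \<tau>_sc)
  have sc_zero: "sc 0 u = \<zero>\<^bsub>V\<^esub>" if "u \<in> carrier V" for u
    using sc_add[OF that, of 0 0] that by simp
  have sc_sum: "sc (\<Sum>i\<in>I. c i) u = (\<Oplus>\<^bsub>V\<^esub>i\<in>I. sc (c i) u)" if "u \<in> carrier V" for c u and I :: "(('g \<times> 'p \<times> 'p) \<times> ('g \<times> 'p \<times> 'p)) set"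
    by (induction I rule: infinite_finite_induct) (use that in \<open>simp_all add: sc_zero sc_add\<close>)
  \<comment> \<open>Equivariance moves \<open>\<gamma> h\<close> past the transition map. The two
    transitions then meet at \<open>\<phi> h y'\<close> and \<open>\<phi> h y\<close>, which agree
    exactly when \<open>y = y'\<close>, and they compose or annihilate each other
    accordingly.\<close>
  have \<rho>_mult: "\<rho> f (\<rho> f' u) = (if Dom cat f = Cod cat f' then \<rho> (Cmp cat f f') u else \<zero>\<^bsub>V\<^esub>)"
    if "f \<in> ar" "f' \<in> ar" "u \<in> carrier V" for f f' u
  proof -
    obtain h y z g x y' where f: "f = (h, y, z)" "f' = (g, x, y')" by (metis prod_cases3)
    have "(\<phi> h (\<phi> g x), \<phi> h y') \<in> r" using that f by (auto intro: act_mono)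
    moreover have "\<phi> h y = \<phi> h y' \<longleftrightarrow> y = y'" using that f by auto (metis act_inv)
    ultimately show ?thesis
      using that f lin_closed[OF \<gamma>] \<gamma>_\<tau>[of h "\<phi> g x" y' "\<gamma> g u"]
        \<tau>_mult[of "\<phi> h (\<phi> g x)" "\<phi> h y'" z "\<gamma> h (\<gamma> g u)"]
        \<tau>_mult_zero[of "\<phi> h (\<phi> g x)" "\<phi> h y'" "\<phi> h y" z "\<gamma> h (\<gamma> g u)"]
      by (auto simp: \<rho>_def \<gamma>_mult act_mult)
  qed
  have s_closed: "s a u \<in> carrier V" if "u \<in> carrier V" for a u
    unfolding s_def using that by (intro V.finsum_closed) (simp del: mem_Collect_eq)
  have s_add: "s (a \<oplus>\<^bsub>A\<^esub> b) u = s a u \<oplus>\<^bsub>V\<^esub> s b u" if "u \<in> carrier V" "a \<in> carrier A" "b \<in> carrier A" for a b u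
  proof -
    have "s (a \<oplus>\<^bsub>A\<^esub> b) u = (\<Oplus>\<^bsub>V\<^esub>f\<in>ar. sc (\<psi> a f) (\<rho> f u) \<oplus>\<^bsub>V\<^esub> sc (\<psi> b f) (\<rho> f u))"
      unfolding s_def using that
      by (intro V.finsum_cong'[OF refl] Pi_I) (simp_all del: mem_Collect_eq add: \<psi>_add sc_add)
    also have "\<dots> = s a u \<oplus>\<^bsub>V\<^esub> s b u"
      unfolding s_def using that by (intro V.finsum_addf) (simp_all del: mem_Collect_eq add: Pi_iff)
    finally show ?thesis .
  qed
  have s_add2: "s a (u \<oplus>\<^bsub>V\<^esub> v) = s a u \<oplus>\<^bsub>V\<^esub> s a v" if "u \<in> carrier V" "v \<in> carrier V" for a u v
  proof -
    have "s a (u \<oplus>\<^bsub>V\<^esub> v) = (\<Oplus>\<^bsub>V\<^esub>f\<in>ar. sc (\<psi> a f) (\<rho> f u) \<oplus>\<^bsub>V\<^esub> sc (\<psi> a f) (\<rho> f v))"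
      unfolding s_def using that
      by (intro V.finsum_cong'[OF refl] Pi_I) (simp_all del: mem_Collect_eq add: lin_add[OF \<rho>] lin_add[OF sc])
    also have "\<dots> = s a u \<oplus>\<^bsub>V\<^esub> s a v"
      unfolding s_def using that by (intro V.finsum_addf) (simp_all del: mem_Collect_eq add: Pi_iff)
    finally show ?thesis .
  qed
  have s_mult: "s (a \<otimes>\<^bsub>A\<^esub> b) u = s a (s b u)" if u: "u \<in> carrier V" and a: "a \<in> carrier A" and b: "b \<in> carrier A" for a b u
  proof -
    define F where "F = (\<lambda>p. sc (\<psi> a (fst p) * \<psi> b (snd p)) (\<rho> (fst p) (\<rho> (snd p) u)))"
    have F: "F p \<in> carrier V" if "p \<in> ar \<times> ar" for p
      using that u unfolding F_def by (auto simp del: mem_Collect_eq simp: mem_Times_iff)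
    have fin: "finite (composable k)" for k
      by (rule finite_subset[of _ "ar \<times> ar"]) (use finite_ar in auto)
    have "s (a \<otimes>\<^bsub>A\<^esub> b) u = (\<Oplus>\<^bsub>V\<^esub>k\<in>ar. \<Oplus>\<^bsub>V\<^esub>p\<in>composable k. F p)"
      unfolding s_def
    proof (rule V.finsum_cong'[OF refl])
      show "(\<lambda>k. \<Oplus>\<^bsub>V\<^esub>p\<in>composable k. F p) \<in> ar \<rightarrow> carrier V"
        by (intro Pi_I V.finsum_closed F) auto
      fix k assume k: "k \<in> ar"
      have "sc (\<psi> (a \<otimes>\<^bsub>A\<^esub> b) k) (\<rho> k u) = (\<Oplus>\<^bsub>V\<^esub>p\<in>composable k. sc (\<psi> a (fst p) * \<psi> b (snd p)) (\<rho> k u))"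
        unfolding \<psi>_mult_CA[OF a b] CA_simps(5) using k u
        by (subst sc_sum) (auto simp del: mem_Collect_eq simp: case_prod_beta)
      also have "\<dots> = (\<Oplus>\<^bsub>V\<^esub>p\<in>composable k. F p)"
        by (rule V.finsum_cong'[OF refl]) (auto simp del: cat_simps intro!: F, auto simp: F_def \<rho>_mult u simp del: cat_simps)
      finally show "sc (\<psi> (a \<otimes>\<^bsub>A\<^esub> b) k) (\<rho> k u) = (\<Oplus>\<^bsub>V\<^esub>p\<in>composable k. F p)" .
    qed
    also have "\<dots> = (\<Oplus>\<^bsub>V\<^esub>q\<in>(SIGMA k:ar. composable k). F (snd q))"
      by (subst V.finsum_Sigma[OF finite_ar fin]) (auto intro!: F)
    \<comment> \<open>Each composable pair lies over exactly one composite, and the remaining pairs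
      contribute 0 by \<open>\<rho>_mult\<close>.\<close>
    also have "\<dots> = (\<Oplus>\<^bsub>V\<^esub>p\<in>ar \<times> ar. F p)"
    proof -
      let ?S = "SIGMA k:ar. composable k"
      have "snd ` ?S \<subseteq> ar \<times> ar" by auto
      moreover have "F p = \<zero>\<^bsub>V\<^esub>" if p: "p \<in> ar \<times> ar" "p \<notin> snd ` ?S" for p
      proof -
        obtain f f' where p': "p = (f, f')" by (cases p)
        have "Dom cat f \<noteq> Cod cat f'"
        proof
          assume "Dom cat f = Cod cat f'"
          then have c: "p \<in> composable (Cmp cat f f')" using p p' by blast
          then have "(Cmp cat f f', p) \<in> ?S" using composable_closed[OF c] by blast
          then show False using p(2) by force
        qed
        then show ?thesis using p p' u \<rho>_mult[of f f' u]
          by (simp add: F_def mem_Times_iff del: mem_Collect_eq)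
            (metis additive_zero[OF V V sc])
      qed
      moreover have "inj_on snd ?S" by (auto simp: inj_on_def)
      ultimately show ?thesis
        using V.finsum_support[of "ar \<times> ar" snd ?S F] F finite_ar by (simp add: Pi_iff)
    qed
    also have "\<dots> = (\<Oplus>\<^bsub>V\<^esub>f\<in>ar. \<Oplus>\<^bsub>V\<^esub>f'\<in>ar. F (f, f'))"
      using F by (intro V.finsum_Sigma finite_ar) auto
    also have "\<dots> = s a (s b u)"
      unfolding s_def[of a]
    proof (rule V.finsum_cong'[OF refl])
      show "(\<lambda>f. sc (\<psi> a f) (\<rho> f (s b u))) \<in> ar \<rightarrow> carrier V"
        using s_closed[OF u] by (auto simp del: mem_Collect_eq)
      fix f assume f: "f \<in> ar"
      have "sc (\<psi> a f) (\<rho> f (s b u)) = (\<Oplus>\<^bsub>V\<^esub>f'\<in>ar. sc (\<psi> a f) (\<rho> f (sc (\<psi> b f') (\<rho> f' u))))"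
        unfolding s_def using f u
        by (subst ad[OF \<rho>[OF f]], simp del: mem_Collect_eq add: Pi_iff, subst ad[OF sc])
          (auto simp del: mem_Collect_eq)
      also have "\<dots> = (\<Oplus>\<^bsub>V\<^esub>f'\<in>ar. F (f, f'))"
        using f u by (intro V.finsum_cong'[OF refl] Pi_I F)
          (auto simp del: mem_Collect_eq simp: F_def \<rho>_sc sc_mult)
      finally show "(\<Oplus>\<^bsub>V\<^esub>f'\<in>ar. F (f, f')) = sc (\<psi> a f) (\<rho> f (s b u))" by simp
    qed
    finally show ?thesis .
  qed
  have \<rho>_el: "s (\<kappa> c \<otimes>\<^bsub>A\<^esub> a) u = sc c (s a u)" if "u \<in> carrier V" "a \<in> carrier A" for c a u
    unfolding s_def using that
    by (subst ad[OF sc], simp del: mem_Collect_eq add: Pi_iff, intro V.finsum_cong' Pi_I)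
      (simp_all del: mem_Collect_eq add: \<psi>_\<kappa>_mult sc_mult)
  \<comment> \<open>Only the isomorphisms (g, x, gx) have nonzero coefficient. As
    \<open>\<phi> g\<close> permutes \<open>P\<close>, their actions add up to the sum of all
    identities applied to \<open>\<gamma> g u\<close>.\<close>
  have s_hat: "s (hat g) u = \<gamma> g u" if g: "g \<in> carrier G" and u: "u \<in> carrier V" for g u
  proof -
    let ?j = "\<lambda>x. (g, x, \<phi> g x)"
    have j: "?j ` P \<subseteq> ar" using g by (auto simp: act_closed rel_refl)
    have "s (hat g) u = (\<Oplus>\<^bsub>V\<^esub>x\<in>P. sc (\<psi> (hat g) (?j x)) (\<rho> (?j x) u))"
      unfolding s_def
    proof (rule V.finsum_support[OF finite_ar _ j])
      fix f assume f: "f \<in> ar" "f \<notin> ?j ` P"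
      then have "\<psi> (hat g) f = 0" using g by (cases f) (auto simp: hat)
      then show "sc (\<psi> (hat g) f) (\<rho> f u) = \<zero>\<^bsub>V\<^esub>" using f u by (simp add: sc_zero del: mem_Collect_eq)
    qed (auto simp: inj_on_def u simp del: mem_Collect_eq)
    also have "\<dots> = (\<Oplus>\<^bsub>V\<^esub>x\<in>P. \<tau> (\<phi> g x) (\<phi> g x) (\<gamma> g u))"
      using g u lin_closed[OF \<gamma>[OF g] u] lin_closed[OF \<tau>[OF rel_refl]] act_closed
      by (intro V.finsum_cong'[OF refl]) (auto simp: hat \<rho>_def sc_one)
    also have "\<dots> = (\<Oplus>\<^bsub>V\<^esub>x\<in>\<phi> g ` P. \<tau> x x (\<gamma> g u))"
      using g u lin_closed[OF \<gamma>[OF g] u] lin_closed[OF \<tau>[OF rel_refl]] act_closed act_bij[OF g]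
      by (subst V.finsum_reindex) (auto simp: bij_betw_def)
    also have "\<dots> = \<gamma> g u" using act_bij[OF g] \<tau>_sum lin_closed[OF \<gamma>[OF g] u] by (simp add: bij_betw_def)
    finally show ?thesis .
  qed
  have s_one: "s \<one>\<^bsub>A\<^esub> u = u" if "u \<in> carrier V" for u
    using s_hat[of \<one> u] that by (simp add: hat_one \<gamma>_one)
  show thesis
  proof
    show "left_module A (V\<lparr>smult := s\<rparr>)"
      using V by (intro left_moduleI A.ring_axioms)
        (auto simp: s_closed s_add s_add2 s_mult s_one abelian_group_def abelian_monoid_def
          abelian_group_axioms_def)
    show "s (\<kappa> c) u = sc c u" if "u \<in> carrier V" for c u
      using \<rho>_el[OF that, of "\<one>\<^bsub>A\<^esub>" c] that by (simp add: s_one)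
    show "s (t x y) u = \<tau> x y u" if xy: "(x, y) \<in> r" and u: "u \<in> carrier V" for x y u
    proof -
      have f: "(\<one>, x, y) \<in> ar" using xy rel_P by (auto simp: act_one)
      have "s (t x y) u = sc (\<psi> (t x y) (\<one>, x, y)) (\<rho> (\<one>, x, y) u)"
        unfolding s_def
      proof (rule V.finsum_single[OF finite_ar f])
        fix f assume f: "f \<in> ar" "f \<noteq> (\<one>, x, y)"
        then have "\<psi> (t x y) f = 0" by (cases f) (auto simp: t)
        then show "sc (\<psi> (t x y) f) (\<rho> f u) = \<zero>\<^bsub>V\<^esub>" using f u by (simp add: sc_zero del: mem_Collect_eq)
      qed (use f u in \<open>simp del: mem_Collect_eq\<close>)
      also have "\<dots> = \<tau> x y u"
        using xy u rel_P[OF xy] lin_closed[OF \<tau>[OF xy] u] by (simp add: t \<rho>_def sc_one \<gamma>_one act_one)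
      finally show ?thesis .
    qed
  qed (simp_all add: s_hat)
qed

lemma t_idem [simp]: "t x x \<otimes>\<^bsub>A\<^esub> t x x = t x x"
  by (cases "(x, x) \<in> r") (simp_all add: t_mult t_zero)

lemma t_cod [simp]: "t y y \<otimes>\<^bsub>A\<^esub> t x y = t x y"
  by (cases "(x, y) \<in> r") (use rel_P rel_refl in \<open>auto simp: t_mult t_zero\<close>)

lemma one_act:
  assumes "left_module A M" "m \<in> carrier M"
  shows "(\<Oplus>\<^bsub>M\<^esub>x\<in>P. t x x \<odot>\<^bsub>M\<^esub> m) = m"
proof -
  interpret M: left_module A M by fact
  show ?thesis
    using M.finsum_smult[OF assms(2), of "\<lambda>x. t x x" P] assms(2) by (simp add: one_sum M.smult_one)
qed

section \<open>Finite dimension over k and graded projections\<close>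

definition kfin :: "('r, 'm) module \<Rightarrow> bool" where
  "kfin M \<longleftrightarrow> (\<exists>S. finite S \<and> S \<subseteq> carrier M \<and> carrier M \<subseteq> mspan (range \<kappa>) M S)"

text \<open>A is finite dimensional over k, so the products of the basis morphisms with finitely
  many generators span over the scalars.\<close>

lemma fg_iff_kfin: "fg_module A M \<longleftrightarrow> left_module A M \<and> kfin M"
proof
  assume fg: "fg_module A M"
  then obtain S where M: "left_module A M" and S: "finite S" "S \<subseteq> carrier M" "carrier M \<subseteq> mspan (carrier A) M S"
    by (auto simp: fg_module_iff)
  interpret M: left_module A M by fact
  let ?S = "(\<lambda>(f, s). bs f \<odot>\<^bsub>M\<^esub> s) ` (ar \<times> S)"
  have S': "finite ?S" "?S \<subseteq> carrier M"
    using finite_ar S by (auto simp del: mem_Collect_eq intro!: M.smult_closed)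
  have "u \<in> mspan (range \<kappa>) M ?S" if "u \<in> mspan (carrier A) M S" for u
    using that
  proof induction
    case (smult a s)
    then have s: "s \<in> carrier M" using S by auto
    have "a \<odot>\<^bsub>M\<^esub> s = (\<Oplus>\<^bsub>M\<^esub>f\<in>ar. (\<kappa> (\<psi> a f) \<otimes>\<^bsub>A\<^esub> bs f) \<odot>\<^bsub>M\<^esub> s)"
      by (subst decomp[OF smult(1)]) (rule M.finsum_smult[OF s], intro Pi_I A.m_closed \<kappa> bs_closed)
    also have "\<dots> = (\<Oplus>\<^bsub>M\<^esub>f\<in>ar. \<kappa> (\<psi> a f) \<odot>\<^bsub>M\<^esub> (bs f \<odot>\<^bsub>M\<^esub> s))"
      by (rule M.M.finsum_cong') (auto simp del: mem_Collect_eq simp: s M.smult_assoc M.smult_closed)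
    also have "\<dots> \<in> mspan (range \<kappa>) M ?S"
      by (rule mspan_finsum[OF M _ S'(2)])
        (use smult in \<open>auto simp del: mem_Collect_eq intro!: mspan.smult\<close>)
    finally show ?case .
  qed (auto intro: mspan.intros)
  then show "left_module A M \<and> kfin M"
    unfolding kfin_def using M S' S(3) by blast
next
  assume "left_module A M \<and> kfin M"
  then obtain S where M: "left_module A M" and S: "finite S" "S \<subseteq> carrier M" "carrier M \<subseteq> mspan (range \<kappa>) M S"
    by (auto simp: kfin_def)
  have "mspan (range \<kappa>) M S \<subseteq> mspan (carrier A) M S" using mspan_mono[of "range \<kappa>" "carrier A" S S _ M] by auto
  then show "fg_module A M"
    unfolding fg_module_iff using M S by (meson order_trans)
qed

lemma kfin_image:
  assumes "kfin M" "left_module A M" "left_module A N" "lin (range \<kappa>) M N f" "f ` carrier M = carrier N"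
  shows "kfin N"
proof -
  obtain S where S: "finite S" "S \<subseteq> carrier M" "carrier M \<subseteq> mspan (range \<kappa>) M S"
    using assms(1) by (auto simp: kfin_def)
  have "carrier N \<subseteq> mspan (range \<kappa>) N (f ` S)"
    using mspan_image[OF assms(2-4) _ S(2)] S(3) by (auto simp: assms(5)[symmetric])
  moreover have "f ` S \<subseteq> carrier N" using S(2) assms(5) by auto
  ultimately show ?thesis unfolding kfin_def using S(1) by blast
qed

definition subspace :: "'r set \<Rightarrow> ('r, 'm) module \<Rightarrow> 'm set \<Rightarrow> bool" where
  "subspace X M W \<longleftrightarrow> W \<subseteq> carrier M \<and> \<zero>\<^bsub>M\<^esub> \<in> W \<and> (\<forall>x\<in>W. \<forall>y\<in>W. x \<oplus>\<^bsub>M\<^esub> y \<in> W) \<and>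
     (\<forall>a\<in>X. \<forall>x\<in>W. a \<odot>\<^bsub>M\<^esub> x \<in> W)"

lemma subspaceD:
  assumes "subspace X M W"
  shows "W \<subseteq> carrier M" "\<zero>\<^bsub>M\<^esub> \<in> W" "x \<in> W \<Longrightarrow> y \<in> W \<Longrightarrow> x \<oplus>\<^bsub>M\<^esub> y \<in> W"
    "a \<in> X \<Longrightarrow> x \<in> W \<Longrightarrow> a \<odot>\<^bsub>M\<^esub> x \<in> W"
  using assms by (auto simp: subspace_def)

lemma mspan_subspace:
  assumes "subspace X M W" "u \<in> mspan X M W"
  shows "u \<in> W"
  using assms(2) by induction (auto intro: subspaceD[OF assms(1)])

text \<open>Basis extension by induction on the spanning set, with \<open>W\<close> generalised:
  adjoin \<open>s\<close> to \<open>W\<close>, project onto the larger space by the induction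
  hypothesis, then discard the multiple of \<open>s\<close>.\<close>

lemma k_projection:
  assumes M: "left_module A M" and "finite S"
  shows "subspace (range \<kappa>) M W \<Longrightarrow> S \<subseteq> carrier M \<Longrightarrow> carrier M \<subseteq> mspan (range \<kappa>) M (W \<union> S) \<Longrightarrow>
    \<exists>\<pi>. lin (range \<kappa>) M M \<pi> \<and> \<pi> ` carrier M \<subseteq> W \<and> (\<forall>w\<in>W. \<pi> w = w)"
  using \<open>finite S\<close>
proof (induction S arbitrary: W rule: finite_induct)
  case empty
  then have "carrier M \<subseteq> W" using mspan_subspace[OF empty(1)] by auto
  then show ?case by (intro exI[of _ "\<lambda>x. x"]) (auto intro: lin_id)
next
  case (insert s S)
  interpret M: left_module A M by fact
  note W = subspaceD[OF insert.prems(1)]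
  have s: "s \<in> carrier M" and S: "S \<subseteq> carrier M" using insert.prems by auto
  show ?case
  proof (cases "s \<in> W")
    case True
    then show ?thesis using insert by (simp add: insert_absorb)
  next
    case False
    define W' where "W' = {w \<oplus>\<^bsub>M\<^esub> \<kappa> c \<odot>\<^bsub>M\<^esub> s | w c. w \<in> W}"
    have sW: "\<kappa> c \<odot>\<^bsub>M\<^esub> s \<in> carrier M" for c using s by (auto intro: M.smult_closed)
    have wW: "w \<in> carrier M" if "w \<in> W" for w using that W(1) by auto
    have z: "\<kappa> 0 \<odot>\<^bsub>M\<^esub> s = \<zero>\<^bsub>M\<^esub>" using s by (simp add: \<kappa>_zero M.smult_zero_left)
    have k: "\<kappa> c \<odot>\<^bsub>M\<^esub> (\<kappa> d \<odot>\<^bsub>M\<^esub> s) = \<kappa> (c * d) \<odot>\<^bsub>M\<^esub> s" for c d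
      using s by (simp add: \<kappa>_mult M.smult_assoc)
    have k2: "\<kappa> (c + d) \<odot>\<^bsub>M\<^esub> s = \<kappa> c \<odot>\<^bsub>M\<^esub> s \<oplus>\<^bsub>M\<^esub> \<kappa> d \<odot>\<^bsub>M\<^esub> s" for c d
      using s by (simp add: \<kappa>_add M.smult_l_distr)
    have plus: "(w \<oplus>\<^bsub>M\<^esub> \<kappa> c \<odot>\<^bsub>M\<^esub> s) \<oplus>\<^bsub>M\<^esub> (w' \<oplus>\<^bsub>M\<^esub> \<kappa> d \<odot>\<^bsub>M\<^esub> s) = (w \<oplus>\<^bsub>M\<^esub> w') \<oplus>\<^bsub>M\<^esub> \<kappa> (c + d) \<odot>\<^bsub>M\<^esub> s"
      if "w \<in> W" "w' \<in> W" for w w' c d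
      using that wW sW by (simp add: k2 M.M.a_ac)
    have times: "\<kappa> c \<odot>\<^bsub>M\<^esub> (w \<oplus>\<^bsub>M\<^esub> \<kappa> d \<odot>\<^bsub>M\<^esub> s) = \<kappa> c \<odot>\<^bsub>M\<^esub> w \<oplus>\<^bsub>M\<^esub> \<kappa> (c * d) \<odot>\<^bsub>M\<^esub> s" if "w \<in> W" for w c d
      using that wW sW by (simp add: M.smult_r_distr k)
    have W': "subspace (range \<kappa>) M W'"
      unfolding subspace_def
    proof (intro conjI ballI)
      show "W' \<subseteq> carrier M" using wW sW by (auto simp: W'_def)
      show "\<zero>\<^bsub>M\<^esub> \<in> W'" unfolding W'_def using W(2) z by (intro CollectI exI[of _ "\<zero>\<^bsub>M\<^esub>"] exI[of _ 0]) simp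
      show "x \<oplus>\<^bsub>M\<^esub> y \<in> W'" if "x \<in> W'" "y \<in> W'" for x y
        using that W(3) plus unfolding W'_def by blast
      show "a \<odot>\<^bsub>M\<^esub> x \<in> W'" if "a \<in> range \<kappa>" "x \<in> W'" for a x
        using that W(4) times unfolding W'_def by blast
    qed
    have WW': "W \<subseteq> W'"
    proof
      fix w assume "w \<in> W"
      then show "w \<in> W'" unfolding W'_def using z wW by (intro CollectI exI[of _ w] exI[of _ 0]) simp
    qed
    have sW': "s \<in> W'" unfolding W'_def using W(2) s
      by (intro CollectI exI[of _ "\<zero>\<^bsub>M\<^esub>"] exI[of _ 1]) (simp add: \<kappa>_one M.smult_one)
    have "carrier M \<subseteq> mspan (range \<kappa>) M (W' \<union> S)"
      using insert.prems(3) WW' sW' mspan_mono[of "range \<kappa>" "range \<kappa>" "W \<union> insert s S" "W' \<union> S" _ M] by blast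
    then obtain \<pi> where \<pi>: "lin (range \<kappa>) M M \<pi>" "\<pi> ` carrier M \<subseteq> W'" "\<And>w. w \<in> W' \<Longrightarrow> \<pi> w = w"
      using insert.IH[OF W' S] by blast
    \<comment> \<open>Two different coefficients of \<open>s\<close> would put a nonzero multiple of
      \<open>s\<close> into \<open>W\<close>, and dividing by \<open>c - d\<close> would give
      \<open>s\<close> itself.\<close>
    have uniq: "w = w'" if eq: "w \<oplus>\<^bsub>M\<^esub> \<kappa> c \<odot>\<^bsub>M\<^esub> s = w' \<oplus>\<^bsub>M\<^esub> \<kappa> d \<odot>\<^bsub>M\<^esub> s" and w: "w \<in> W" "w' \<in> W" for w w' c d
    proof -
      have cd: "c = d"
      proof (rule ccontr)
        assume "c \<noteq> d"
        have nw: "\<kappa> (-1) \<odot>\<^bsub>M\<^esub> w \<oplus>\<^bsub>M\<^esub> w = \<zero>\<^bsub>M\<^esub>"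
          using wW[OF w(1)] M.smult_l_distr[of "\<kappa> (-1)" "\<kappa> 1" w]
          by (simp add: \<kappa>_add[symmetric])
            (simp add: \<kappa>_zero M.smult_zero_left M.smult_one \<kappa>_one)
        have "\<kappa> (-1) \<odot>\<^bsub>M\<^esub> w \<oplus>\<^bsub>M\<^esub> (w \<oplus>\<^bsub>M\<^esub> \<kappa> c \<odot>\<^bsub>M\<^esub> s) \<oplus>\<^bsub>M\<^esub> \<kappa> (- d) \<odot>\<^bsub>M\<^esub> s =
            \<kappa> (-1) \<odot>\<^bsub>M\<^esub> w \<oplus>\<^bsub>M\<^esub> (w' \<oplus>\<^bsub>M\<^esub> \<kappa> d \<odot>\<^bsub>M\<^esub> s) \<oplus>\<^bsub>M\<^esub> \<kappa> (- d) \<odot>\<^bsub>M\<^esub> s"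
          using eq by simp
        moreover have "\<kappa> (-1) \<odot>\<^bsub>M\<^esub> w \<oplus>\<^bsub>M\<^esub> (w \<oplus>\<^bsub>M\<^esub> \<kappa> c \<odot>\<^bsub>M\<^esub> s) \<oplus>\<^bsub>M\<^esub> \<kappa> (- d) \<odot>\<^bsub>M\<^esub> s =
            (\<kappa> (-1) \<odot>\<^bsub>M\<^esub> w \<oplus>\<^bsub>M\<^esub> w) \<oplus>\<^bsub>M\<^esub> (\<kappa> c \<odot>\<^bsub>M\<^esub> s \<oplus>\<^bsub>M\<^esub> \<kappa> (- d) \<odot>\<^bsub>M\<^esub> s)"
          using wW[OF w(1)] wW[OF W(4)[of "\<kappa> (-1)" w]] w sW by (simp add: M.M.a_ac)
        moreover have "\<dots> = \<kappa> (c - d) \<odot>\<^bsub>M\<^esub> s"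
          using nw sW k2[of c "-d"] by simp
        moreover have "\<kappa> (-1) \<odot>\<^bsub>M\<^esub> w \<oplus>\<^bsub>M\<^esub> (w' \<oplus>\<^bsub>M\<^esub> \<kappa> d \<odot>\<^bsub>M\<^esub> s) \<oplus>\<^bsub>M\<^esub> \<kappa> (- d) \<odot>\<^bsub>M\<^esub> s =
            \<kappa> (-1) \<odot>\<^bsub>M\<^esub> w \<oplus>\<^bsub>M\<^esub> w' \<oplus>\<^bsub>M\<^esub> (\<kappa> d \<odot>\<^bsub>M\<^esub> s \<oplus>\<^bsub>M\<^esub> \<kappa> (- d) \<odot>\<^bsub>M\<^esub> s)"
          using wW[OF w(2)] wW[OF W(4)[of "\<kappa> (-1)" w]] w sW by (simp add: M.M.a_ac)
        moreover have "\<dots> = \<kappa> (-1) \<odot>\<^bsub>M\<^esub> w \<oplus>\<^bsub>M\<^esub> w'"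
          using k2[of d "-d", symmetric] z wW[OF w(2)] wW[OF W(4)[of "\<kappa> (-1)" w]] w by simp
        ultimately have "\<kappa> (c - d) \<odot>\<^bsub>M\<^esub> s \<in> W" using w W(3,4) by auto
        then have "\<kappa> (inverse (c - d)) \<odot>\<^bsub>M\<^esub> (\<kappa> (c - d) \<odot>\<^bsub>M\<^esub> s) \<in> W" using W(4) by blast
        then show False using k[of "inverse (c - d)" "c - d"] \<open>c \<noteq> d\<close> False s
          by (simp add: \<kappa>_one M.smult_one)
      qed
      then show ?thesis using eq wW[OF w(1)] wW[OF w(2)] sW by simp
    qed
    define p where "p v = (THE w. w \<in> W \<and> (\<exists>c. v = w \<oplus>\<^bsub>M\<^esub> \<kappa> c \<odot>\<^bsub>M\<^esub> s))" for v
    have p: "p (w \<oplus>\<^bsub>M\<^esub> \<kappa> c \<odot>\<^bsub>M\<^esub> s) = w" if "w \<in> W" for w c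
      unfolding p_def using that uniq by (intro the_equality) blast+
    have pW: "p v \<in> W \<and> (\<exists>c. v = p v \<oplus>\<^bsub>M\<^esub> \<kappa> c \<odot>\<^bsub>M\<^esub> s)" if v: "v \<in> W'" for v
      using v p unfolding W'_def by force
    have p_add: "p (u \<oplus>\<^bsub>M\<^esub> v) = p u \<oplus>\<^bsub>M\<^esub> p v" if "u \<in> W'" "v \<in> W'" for u v
      using pW[OF that(1)] pW[OF that(2)] plus p W(3) by metis
    have p_smult: "p (\<kappa> c \<odot>\<^bsub>M\<^esub> v) = \<kappa> c \<odot>\<^bsub>M\<^esub> p v" if "v \<in> W'" for c v
      using pW[OF that] times p W(4) by (metis rangeI)
    show ?thesis
    proof (intro exI[of _ "\<lambda>x. p (\<pi> x)"] conjI ballI)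
      have \<pi>W: "\<pi> x \<in> W'" if "x \<in> carrier M" for x using \<pi>(2) that by auto
      show "lin (range \<kappa>) M M (\<lambda>x. p (\<pi> x))"
        by (rule linI) (use \<pi>W pW wW in \<open>auto simp: lin_add[OF \<pi>(1)] lin_smult[OF \<pi>(1)] p_add p_smult\<close>)
      show "(\<lambda>x. p (\<pi> x)) ` carrier M \<subseteq> W" using \<pi>W pW by auto
      show "p (\<pi> w) = w" if "w \<in> W" for w
        using that \<pi>(3)[of w] WW' p[OF that, of 0] z wW[OF that] by auto
    qed
  qed
qed

lemma kfin_projection:
  assumes M: "left_module A M" "kfin M" and W: "subspace (range \<kappa>) M W"
  obtains \<pi> where "lin (range \<kappa>) M M \<pi>" "\<pi> ` carrier M \<subseteq> W" "\<And>w. w \<in> W \<Longrightarrow> \<pi> w = w"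
proof -
  obtain S where S: "finite S" "S \<subseteq> carrier M" "carrier M \<subseteq> mspan (range \<kappa>) M S"
    using M(2) by (auto simp: kfin_def)
  have "carrier M \<subseteq> mspan (range \<kappa>) M (W \<union> S)"
    using S(3) mspan_mono[of "range \<kappa>" "range \<kappa>" S "W \<union> S"] by blast
  then show thesis using k_projection[OF M(1) S(1) W S(2)] that by blast
qed

text \<open>A submodule is the image of \<open>M\<close> under a k-linear projection, hence spanned
  over k by the images of a finite spanning set.\<close>

lemma submodule_fg:
  assumes "fg_module A M" "left_module A (M\<lparr>carrier := W\<rparr>)" "W \<subseteq> carrier M"
  shows "fg_module A (M\<lparr>carrier := W\<rparr>)"
proof -
  have M: "left_module A M" "kfin M" using assms(1) by (auto simp: fg_iff_kfin)
  interpret W: left_module A "M\<lparr>carrier := W\<rparr>" by fact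
  have "subspace (range \<kappa>) M W"
    unfolding subspace_def
    using assms(3) W.M.zero_closed W.M.a_closed W.smult_closed[OF \<kappa>(1)] by auto
  then obtain \<pi> where \<pi>: "lin (range \<kappa>) M M \<pi>" "\<pi> ` carrier M \<subseteq> W" "\<And>w. w \<in> W \<Longrightarrow> \<pi> w = w"
    using kfin_projection[OF M] by metis
  have "lin (range \<kappa>) M (M\<lparr>carrier := W\<rparr>) \<pi>" using \<pi>(1,2) by (auto simp: lin_def)
  moreover have "\<pi> ` carrier M = W"
    using \<pi>(2,3) assms(3) by (metis image_iff subsetD subsetI subset_antisym)
  ultimately have "kfin (M\<lparr>carrier := W\<rparr>)"
    using kfin_image[OF M(2,1) assms(2)] by simp
  then show ?thesis using assms(2) by (simp add: fg_iff_kfin)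
qed

lemma t_orth: "x \<noteq> y \<Longrightarrow> t x x \<otimes>\<^bsub>A\<^esub> t y y = \<zero>\<^bsub>A\<^esub>"
  by (simp add: t_mult_zero)

text \<open>Keep the diagonal blocks of a k-linear projection with respect to the grading. Since
  \<open>W\<close> is itself graded, the result still maps into \<open>W\<close> and still fixes
  it.\<close>

lemma D_projection:
  fixes M :: "('r, 'm) module"
  assumes M: "left_module A M" "kfin M" and W: "subspace D_gens M W"
  obtains \<pi> where "lin D_gens M M \<pi>" "\<pi> ` carrier M \<subseteq> W" "\<And>w. w \<in> W \<Longrightarrow> \<pi> w = w"
proof -
  interpret M: left_module A M by fact
  note W' = subspaceD[OF W]
  have "subspace (range \<kappa>) M W" using W by (auto simp: subspace_def)
  then obtain \<pi> where \<pi>: "lin (range \<kappa>) M M \<pi>" "\<pi> ` carrier M \<subseteq> W" "\<And>w. w \<in> W \<Longrightarrow> \<pi> w = w"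
    using kfin_projection[OF M] by metis
  define \<pi>' where "\<pi>' m = (\<Oplus>\<^bsub>M\<^esub>x\<in>P. t x x \<odot>\<^bsub>M\<^esub> \<pi> (t x x \<odot>\<^bsub>M\<^esub> m))" for m
  note [simp] = lin_closed[OF \<pi>(1)] M.smult_closed
  have W_sum: "(\<Oplus>\<^bsub>M\<^esub>x\<in>I. u x) \<in> W" if "\<And>x. x \<in> I \<Longrightarrow> u x \<in> W" for I and u :: "'p \<Rightarrow> 'm"
    using that
  proof (induction I rule: infinite_finite_induct)
    case (insert i I)
    then have "u \<in> I \<rightarrow> carrier M" "u i \<in> carrier M" using W'(1) by auto
    with insert show ?case by (simp add: M.M.finsum_insert W'(3))
  qed (simp_all add: W'(2))
  show thesis
  proof
    show "lin D_gens M M \<pi>'"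
    proof (rule linI)
      fix m assume m: "m \<in> carrier M"
      show "\<pi>' m \<in> carrier M" using m by (auto simp: \<pi>'_def intro!: M.M.finsum_closed)
      fix n assume n: "n \<in> carrier M"
      show "\<pi>' (m \<oplus>\<^bsub>M\<^esub> n) = \<pi>' m \<oplus>\<^bsub>M\<^esub> \<pi>' n"
        unfolding \<pi>'_def using m n
        by (subst M.M.finsum_addf[symmetric])
          (auto simp: M.smult_r_distr lin_add[OF \<pi>(1)] simp del: M.M.add.finprod_multf M.M.finsum_addf)
    next
      fix a m assume a: "a \<in> D_gens" and m: "m \<in> carrier M"
      have aA: "a \<in> carrier A" using a by auto
      have "t x x \<odot>\<^bsub>M\<^esub> \<pi> (t x x \<odot>\<^bsub>M\<^esub> (a \<odot>\<^bsub>M\<^esub> m)) = a \<odot>\<^bsub>M\<^esub> (t x x \<odot>\<^bsub>M\<^esub> \<pi> (t x x \<odot>\<^bsub>M\<^esub> m))" for x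
      proof (cases "a \<in> range \<kappa>")
        case True
        then obtain c where c: "a = \<kappa> c" by auto
        have "t x x \<odot>\<^bsub>M\<^esub> (\<kappa> c \<odot>\<^bsub>M\<^esub> n) = \<kappa> c \<odot>\<^bsub>M\<^esub> (t x x \<odot>\<^bsub>M\<^esub> n)" if "n \<in> carrier M" for n
          using that by (simp add: M.smult_assoc[symmetric] \<kappa>_central)
        then show ?thesis using m c lin_smult[OF \<pi>(1)] by simp
      next
        case False
        then obtain y where y: "a = t y y" using a by auto
        have *: "t x x \<odot>\<^bsub>M\<^esub> (t y y \<odot>\<^bsub>M\<^esub> n) = (if x = y then t x x \<odot>\<^bsub>M\<^esub> n else \<zero>\<^bsub>M\<^esub>)" if "n \<in> carrier M" for n x y
          using that by (simp add: M.smult_assoc[symmetric] t_orth M.smult_zero_left)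
        have "\<pi> \<zero>\<^bsub>M\<^esub> = \<zero>\<^bsub>M\<^esub>" using \<pi>(3) W'(2) by simp
        then show ?thesis using m y by (simp add: * M.smult_zero_right)
      qed
      then show "\<pi>' (a \<odot>\<^bsub>M\<^esub> m) = a \<odot>\<^bsub>M\<^esub> \<pi>' m"
        unfolding \<pi>'_def using aA m by (subst M.smult_finsum) auto
    qed
    show "\<pi>' ` carrier M \<subseteq> W"
      unfolding \<pi>'_def using \<pi>(2) by (auto intro!: W_sum W'(4))
    show "\<pi>' w = w" if "w \<in> W" for w
    proof -
      have w: "w \<in> carrier M" using that W'(1) by auto
      have "\<pi>' w = (\<Oplus>\<^bsub>M\<^esub>x\<in>P. t x x \<odot>\<^bsub>M\<^esub> w)"
        unfolding \<pi>'_def using w that by (intro M.M.finsum_cong') (auto simp: \<pi>(3) W'(4) M.smult_assoc[symmetric])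
      then show ?thesis using one_act[OF M(1) w] by simp
    qed
  qed
qed

lemma hom_image_subspace:
  assumes "left_module A N" "left_module A M" "lin (carrier A) N M f"
  shows "subspace (carrier A) M (f ` carrier N)"
proof -
  interpret I: left_module A "M\<lparr>carrier := f ` carrier N\<rparr>" using image_module[OF assms] .
  show ?thesis
    using I.M.zero_closed I.M.a_closed I.smult_closed lin_closed[OF assms(3)] by (auto simp: subspace_def)
qed

lemma kernel_subspace:
  assumes "left_module A N" "left_module A M" "lin (carrier A) N M f"
  shows "subspace (carrier A) N (module_kernel N M f)"
proof -
  interpret I: left_module A "N\<lparr>carrier := module_kernel N M f\<rparr>" using kernel_module[OF assms] .
  show ?thesis
    using I.M.zero_closed I.M.a_closed I.smult_closed by (auto simp: subspace_def module_kernel_def)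
qed

lemma subspace_mono: "subspace Y M W \<Longrightarrow> X \<subseteq> Y \<Longrightarrow> subspace X M W"
  by (auto simp: subspace_def)

text \<open>Every injection splits as a map of graded k-spaces: project onto the image, then invert
  \<open>f\<close> there.\<close>

lemma inj_retraction:
  assumes N: "left_module A N" and M: "fg_module A M"
    and f: "lin (carrier A) N M f" "inj_on f (carrier N)"
  obtains \<rho> where "lin D_gens M N \<rho>" "\<And>n. n \<in> carrier N \<Longrightarrow> \<rho> (f n) = n"
proof -
  have M': "left_module A M" "kfin M" using M by (auto simp: fg_iff_kfin)
  interpret N: left_module A N by fact
  have sub: "subspace D_gens M (f ` carrier N)"
    using hom_image_subspace[OF N M'(1) f(1)] by (rule subspace_mono) auto
  obtain \<pi> where \<pi>: "lin D_gens M M \<pi>" "\<pi> ` carrier M \<subseteq> f ` carrier N" "\<And>w. w \<in> f ` carrier N \<Longrightarrow> \<pi> w = w"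
    by (rule D_projection[OF M' sub]) (rule that; assumption)
  let ?N = "M\<lparr>carrier := f ` carrier N\<rparr>"
  have "lin (carrier A) N ?N f" using f by (auto simp: lin_def)
  then have "lin (carrier A) ?N N (inv_into (carrier N) f)"
    by (rule lin_inverse[OF N.M.abelian_group_axioms N]) (use f in \<open>auto simp: bij_betw_def\<close>)
  then have "lin D_gens ?N N (inv_into (carrier N) f)" by (rule lin_mono) auto
  moreover have "lin D_gens M ?N \<pi>" using \<pi>(1,2) by (auto simp: lin_def)
  ultimately have "lin D_gens M N (\<lambda>x. inv_into (carrier N) f (\<pi> x))" by (rule lin_comp[rotated])
  then show thesis by (rule that) (use f \<pi>(3) in simp)
qed

text \<open>Let \<open>\<pi>\<close> be a graded projection onto the kernel. Then identity minus
  \<open>\<pi>\<close> is constant on the fibres of \<open>f\<close>, so composing it with any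
  choice of preimages gives a graded linear map.\<close>

lemma surj_section:
  assumes N: "fg_module A N" and M: "left_module A M"
    and f: "lin (carrier A) N M f" "f ` carrier N = carrier M"
  obtains s where "lin D_gens M N s" "\<And>m. m \<in> carrier M \<Longrightarrow> f (s m) = m"
proof -
  have N': "left_module A N" "kfin N" using N by (auto simp: fg_iff_kfin)
  interpret N: left_module A N by fact
  interpret M: left_module A M by fact
  note sub = kernel_subspace[OF N'(1) M f(1)]
  have sub: "subspace D_gens N (module_kernel N M f)"
    using sub by (rule subspace_mono) auto
  obtain \<pi> where \<pi>: "lin D_gens N N \<pi>" "\<pi> ` carrier N \<subseteq> module_kernel N M f"
      "\<And>w. w \<in> module_kernel N M f \<Longrightarrow> \<pi> w = w"
    by (rule D_projection[OF N' sub]) (rule that; assumption)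
  define q where "q n = n \<ominus>\<^bsub>N\<^esub> \<pi> n" for n
  have \<pi>c: "\<pi> n \<in> carrier N" "f (\<pi> n) = \<zero>\<^bsub>M\<^esub>" if "n \<in> carrier N" for n
    using \<pi>(2) that by (auto simp: module_kernel_def)
  have D: "a \<in> carrier A" if "a \<in> D_gens" for a using that by auto
  have q: "lin D_gens N N q"
  proof (rule linI)
    fix x y assume "x \<in> carrier N" "y \<in> carrier N"
    then show "q (x \<oplus>\<^bsub>N\<^esub> y) = q x \<oplus>\<^bsub>N\<^esub> q y"
      by (simp add: q_def lin_add[OF \<pi>(1)] \<pi>c a_minus_def N.M.minus_add N.M.a_ac)
  next
    fix a x assume "a \<in> D_gens" "x \<in> carrier N"
    then show "q (a \<odot>\<^bsub>N\<^esub> x) = a \<odot>\<^bsub>N\<^esub> q x"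
      using D[of a] lin_smult[OF \<pi>(1), of a x] by (simp add: q_def \<pi>c N.smult_minus)
  qed (simp add: q_def \<pi>c)
  have fq: "f (q n) = f n" if "n \<in> carrier N" for n
    using that lin_closed[OF f(1) that]
    by (simp add: q_def additive_minus[OF N.M.abelian_group_axioms M.M.abelian_group_axioms f(1)] \<pi>c)
      (simp add: a_minus_def)
  have q_eq: "q n = q n'" if n: "n \<in> carrier N" "n' \<in> carrier N" "f n = f n'" for n n'
  proof -
    have "n \<ominus>\<^bsub>N\<^esub> n' \<in> module_kernel N M f"
      using n lin_closed[OF f(1)] additive_minus[OF N.M.abelian_group_axioms M.M.abelian_group_axioms f(1)]
      by (simp add: module_kernel_def)
    then have "q (n \<ominus>\<^bsub>N\<^esub> n') = \<zero>\<^bsub>N\<^esub>" using \<pi>(3) n by (simp add: q_def a_minus_def N.M.r_neg)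
    then have "q n \<ominus>\<^bsub>N\<^esub> q n' = \<zero>\<^bsub>N\<^esub>"
      using n additive_minus[OF N.M.abelian_group_axioms N.M.abelian_group_axioms q] by simp
    then show ?thesis using lin_closed[OF q] n
      by (metis N.M.minus_eq_zero_iff)
  qed
  define j where "j = inv_into (carrier N) f"
  have j: "j m \<in> carrier N" "f (j m) = m" if "m \<in> carrier M" for m
    using that f(2) by (auto simp: j_def inv_into_into f_inv_into_f)
  show thesis
  proof
    show "lin D_gens M N (\<lambda>m. q (j m))"
    proof (rule linI)
      fix x y assume xy: "x \<in> carrier M" "y \<in> carrier M"
      have "q (j (x \<oplus>\<^bsub>M\<^esub> y)) = q (j x \<oplus>\<^bsub>N\<^esub> j y)"
        using xy j lin_add[OF f(1)] by (intro q_eq) auto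
      then show "q (j (x \<oplus>\<^bsub>M\<^esub> y)) = q (j x) \<oplus>\<^bsub>N\<^esub> q (j y)" using j xy lin_add[OF q] by simp
    next
      fix a x assume ax: "a \<in> D_gens" "x \<in> carrier M"
      have "q (j (a \<odot>\<^bsub>M\<^esub> x)) = q (a \<odot>\<^bsub>N\<^esub> j x)"
        using ax j lin_smult[OF f(1) D] D M.smult_closed N.smult_closed by (intro q_eq) auto
      then show "q (j (a \<odot>\<^bsub>M\<^esub> x)) = a \<odot>\<^bsub>N\<^esub> q (j x)" using j ax lin_smult[OF q] by simp
    qed (use j lin_closed[OF q] in simp)
    show "f (q (j m)) = m" if "m \<in> carrier M" for m using that j fq by simp
  qed
qed

section \<open>Higman's criterion\<close>

definition tr :: "('r, 'm) module \<Rightarrow> ('r, 'n) module \<Rightarrow> ('m \<Rightarrow> 'n) \<Rightarrow> 'm \<Rightarrow> 'n" where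
  "tr M N h m = (\<Oplus>\<^bsub>N\<^esub>g\<in>carrier G. hat g \<odot>\<^bsub>N\<^esub> h (hat (inv g) \<odot>\<^bsub>M\<^esub> m))"

text \<open>Only \<open>D_gens\<close> and the operators \<open>hat g\<close> occur, so the
  condition depends on \<open>M\<close> only through its restrictions to the orbits.\<close>

definition higman :: "('r, 'm) module \<Rightarrow> bool" where
  "higman M \<longleftrightarrow> (\<exists>\<theta>. lin D_gens M M \<theta> \<and> (\<forall>m\<in>carrier M. tr M M \<theta> m = m))"

text \<open>Scalars are central. The idempotent at x is moved by \<open>inv g\<close> to the one at
  \<open>\<phi> (inv g) x\<close>, passes through the graded map \<open>h\<close>, and is moved
  back. Finally \<open>hat k\<close> is absorbed by the substitution of \<open>k \<otimes> g\<close>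
  for \<open>g\<close>.\<close>

lemma tr_lin:
  assumes M: "left_module A M" and N: "left_module A N" and h: "lin D_gens M N h"
  shows "lin B_gens M N (tr M N h)"
proof -
  interpret M: left_module A M by fact
  interpret N: left_module A N by fact
  note [simp] = M.smult_closed N.smult_closed lin_closed[OF h]
  have closed: "hat g \<odot>\<^bsub>N\<^esub> h (hat (inv g) \<odot>\<^bsub>M\<^esub> m) \<in> carrier N" if "g \<in> carrier G" "m \<in> carrier M" for g m
    using that by simp
  show ?thesis
  proof (rule linI)
    fix m assume m: "m \<in> carrier M"
    show "tr M N h m \<in> carrier N" using m by (auto simp: tr_def intro!: N.M.finsum_closed)
    fix n assume n: "n \<in> carrier M"
    have "tr M N h (m \<oplus>\<^bsub>M\<^esub> n) = (\<Oplus>\<^bsub>N\<^esub>g\<in>carrier G. hat g \<odot>\<^bsub>N\<^esub> h (hat (inv g) \<odot>\<^bsub>M\<^esub> m) \<oplus>\<^bsub>N\<^esub>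
        hat g \<odot>\<^bsub>N\<^esub> h (hat (inv g) \<odot>\<^bsub>M\<^esub> n))"
      unfolding tr_def using m n
      by (intro N.M.finsum_cong') (auto simp: M.smult_r_distr N.smult_r_distr lin_add[OF h])
    then show "tr M N h (m \<oplus>\<^bsub>M\<^esub> n) = tr M N h m \<oplus>\<^bsub>N\<^esub> tr M N h n"
      unfolding tr_def using m n by (simp add: N.M.finsum_addf Pi_iff)
  next
    fix a m assume a: "a \<in> B_gens" and m: "m \<in> carrier M"
    have aA: "a \<in> carrier A" using a by auto
    consider c where "a = \<kappa> c" | x where "a = t x x" "x \<in> P" | k where "a = hat k" "k \<in> carrier G"
      using a by auto
    then have "tr M N h (a \<odot>\<^bsub>M\<^esub> m) = (\<Oplus>\<^bsub>N\<^esub>g\<in>carrier G. a \<odot>\<^bsub>N\<^esub> (hat g \<odot>\<^bsub>N\<^esub> h (hat (inv g) \<odot>\<^bsub>M\<^esub> m)))"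
    proof cases
      case (1 c)
      have "hat g \<odot>\<^bsub>N\<^esub> h (hat (inv g) \<odot>\<^bsub>M\<^esub> (\<kappa> c \<odot>\<^bsub>M\<^esub> m)) = \<kappa> c \<odot>\<^bsub>N\<^esub> (hat g \<odot>\<^bsub>N\<^esub> h (hat (inv g) \<odot>\<^bsub>M\<^esub> m))"
        if g: "g \<in> carrier G" for g
      proof -
        have "hat (inv g) \<odot>\<^bsub>M\<^esub> (\<kappa> c \<odot>\<^bsub>M\<^esub> m) = \<kappa> c \<odot>\<^bsub>M\<^esub> (hat (inv g) \<odot>\<^bsub>M\<^esub> m)"
          using m g by (simp add: M.smult_assoc[symmetric] \<kappa>_central)
        moreover have "hat g \<odot>\<^bsub>N\<^esub> (\<kappa> c \<odot>\<^bsub>N\<^esub> n) = \<kappa> c \<odot>\<^bsub>N\<^esub> (hat g \<odot>\<^bsub>N\<^esub> n)" if "n \<in> carrier N" for n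
          using that g by (simp add: N.smult_assoc[symmetric] \<kappa>_central)
        ultimately show ?thesis using m g lin_smult[OF h] by simp
      qed
      then show ?thesis unfolding tr_def 1 using m by (intro N.M.finsum_cong') auto
    next
      case (2 x)
      have "hat g \<odot>\<^bsub>N\<^esub> h (hat (inv g) \<odot>\<^bsub>M\<^esub> (t x x \<odot>\<^bsub>M\<^esub> m)) = t x x \<odot>\<^bsub>N\<^esub> (hat g \<odot>\<^bsub>N\<^esub> h (hat (inv g) \<odot>\<^bsub>M\<^esub> m))"
        if g: "g \<in> carrier G" for g
      proof -
        let ?y = "\<phi> (inv g) x"
        have y: "?y \<in> P" using 2 g by (simp add: act_closed)
        have "hat (inv g) \<odot>\<^bsub>M\<^esub> (t x x \<odot>\<^bsub>M\<^esub> m) = t ?y ?y \<odot>\<^bsub>M\<^esub> (hat (inv g) \<odot>\<^bsub>M\<^esub> m)"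
          using m g 2 by (simp add: M.smult_assoc[symmetric] hat_t)
        moreover have "hat g \<odot>\<^bsub>N\<^esub> (t ?y ?y \<odot>\<^bsub>N\<^esub> n) = t x x \<odot>\<^bsub>N\<^esub> (hat g \<odot>\<^bsub>N\<^esub> n)" if "n \<in> carrier N" for n
          using that g 2 y by (simp add: N.smult_assoc[symmetric] hat_t act_inv')
        ultimately show ?thesis using m g y lin_smult[OF h] by simp
      qed
      then show ?thesis unfolding tr_def 2 using m by (intro N.M.finsum_cong') auto
    next
      case (3 k)
      have "tr M N h (hat k \<odot>\<^bsub>M\<^esub> m) = (\<Oplus>\<^bsub>N\<^esub>g\<in>(\<lambda>g. k \<otimes> g) ` carrier G. hat g \<odot>\<^bsub>N\<^esub> h (hat (inv g) \<odot>\<^bsub>M\<^esub> (hat k \<odot>\<^bsub>M\<^esub> m)))"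
        unfolding tr_def using 3(2) by (simp add: surj_const_mult)
      also have "\<dots> = (\<Oplus>\<^bsub>N\<^esub>g\<in>carrier G. hat (k \<otimes> g) \<odot>\<^bsub>N\<^esub> h (hat (inv (k \<otimes> g)) \<odot>\<^bsub>M\<^esub> (hat k \<odot>\<^bsub>M\<^esub> m)))"
        using 3 m by (intro N.M.finsum_reindex) (auto simp: inj_on_def)
      also have "\<dots> = (\<Oplus>\<^bsub>N\<^esub>g\<in>carrier G. hat k \<odot>\<^bsub>N\<^esub> (hat g \<odot>\<^bsub>N\<^esub> h (hat (inv g) \<odot>\<^bsub>M\<^esub> m)))"
      proof (rule N.M.finsum_cong'[OF refl])
        fix g assume g: "g \<in> carrier G"
        have "hat (inv (k \<otimes> g)) \<odot>\<^bsub>M\<^esub> (hat k \<odot>\<^bsub>M\<^esub> m) = hat (inv g) \<odot>\<^bsub>M\<^esub> m"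
          using g 3 m by (simp add: M.smult_assoc[symmetric] hat_mult[symmetric] inv_mult_group m_assoc)
        then show "hat (k \<otimes> g) \<odot>\<^bsub>N\<^esub> h (hat (inv (k \<otimes> g)) \<odot>\<^bsub>M\<^esub> (hat k \<odot>\<^bsub>M\<^esub> m)) =
            hat k \<odot>\<^bsub>N\<^esub> (hat g \<odot>\<^bsub>N\<^esub> h (hat (inv g) \<odot>\<^bsub>M\<^esub> m))"
          using g 3 m by (simp add: hat_mult N.smult_assoc)
      qed (use 3 m in auto)
      finally show ?thesis unfolding 3 .
    qed
    also have "\<dots> = a \<odot>\<^bsub>N\<^esub> tr M N h m"
      unfolding tr_def using m by (intro N.smult_finsum[OF aA, symmetric]) auto
    finally show "tr M N h (a \<odot>\<^bsub>M\<^esub> m) = a \<odot>\<^bsub>N\<^esub> tr M N h m" .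
  qed
qed

text \<open>With \<open>tr_comp_right\<close> this makes traces a two-sided ideal among the
  equivariant graded maps: composing with an equivariant map commutes with taking the trace.\<close>

lemma tr_comp_left:
  assumes "left_module A N" "left_module A L" "lin B_gens N L f"
    and "\<And>m. m \<in> carrier M \<Longrightarrow> h m \<in> carrier N" "left_module A M" "m \<in> carrier M"
  shows "tr M L (\<lambda>m. f (h m)) m = f (tr M N h m)"
proof -
  interpret N: left_module A N by fact
  interpret L: left_module A L by fact
  interpret M: left_module A M by fact
  note [simp] = M.smult_closed N.smult_closed assms(4)
  have "f (tr M N h m) = (\<Oplus>\<^bsub>L\<^esub>g\<in>carrier G. f (hat g \<odot>\<^bsub>N\<^esub> h (hat (inv g) \<odot>\<^bsub>M\<^esub> m)))"
    unfolding tr_def using assms(6)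
    by (intro additive_finsum[OF N.M.abelian_group_axioms L.M.abelian_group_axioms assms(3)]) auto
  also have "\<dots> = tr M L (\<lambda>m. f (h m)) m"
    unfolding tr_def using assms(6) lin_smult[OF assms(3)] lin_closed[OF assms(3)] L.smult_closed
    by (intro L.M.finsum_cong') auto
  finally show ?thesis by simp
qed

lemma tr_comp_right:
  assumes "left_module A M" "left_module A L" "lin B_gens M N f"
    and "\<And>m. m \<in> carrier N \<Longrightarrow> h m \<in> carrier L" "left_module A N" "m \<in> carrier M"
  shows "tr M L (\<lambda>m. h (f m)) m = tr N L h (f m)"
proof -
  interpret M: left_module A M by fact
  interpret L: left_module A L by fact
  interpret N: left_module A N by fact
  show ?thesis
    unfolding tr_def using assms(6)
    by (intro L.M.finsum_cong' refl Pi_I)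
      (auto simp: lin_smult[OF assms(3)] lin_closed[OF assms(3)] M.smult_closed N.smult_closed
        intro!: L.smult_closed assms(4))
qed

lemma tr_cong:
  assumes "left_module A M" "left_module A N" "m \<in> carrier M" "\<And>m. m \<in> carrier M \<Longrightarrow> h m = h' m \<and> h' m \<in> carrier N"
  shows "tr M N h m = tr M N h' m"
proof -
  interpret M: left_module A M by fact
  interpret N: left_module A N by fact
  show ?thesis unfolding tr_def using assms(3,4)
    by (intro N.M.finsum_cong') (auto intro!: N.smult_closed simp: M.smult_closed)
qed

section \<open>Lifting, extension and closure properties of Higman modules\<close>

lemma lin_BD: "lin B_gens M N f \<Longrightarrow> lin D_gens M N f"
  by (erule lin_mono) auto

lemma lin_AB: "lin (carrier A) M N f \<Longrightarrow> lin B_gens M N f"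
  by (erule lin_mono) auto

text \<open>The extension is the trace of \<open>\<theta> g \<rho>\<close>, where
  \<open>\<rho>\<close> is a graded retraction of \<open>f\<close>. Composing with \<open>f\<close>
  cancels \<open>\<rho>\<close> inside the trace, and the trace of \<open>\<theta> g\<close> is the
  trace of \<open>\<theta>\<close> followed after \<open>g\<close>, that is,
  \<open>g\<close>.\<close>

lemma higman_extend:
  assumes M: "left_module A M" "higman M" and N: "left_module A N" "fg_module A N'"
    and f: "lin (carrier A) N N' f" "inj_on f (carrier N)" and g: "lin B_gens N M g"
  obtains h where "lin B_gens N' M h" "\<And>n. n \<in> carrier N \<Longrightarrow> h (f n) = g n"
proof -
  obtain \<theta> where \<theta>: "lin D_gens M M \<theta>" "\<And>m. m \<in> carrier M \<Longrightarrow> tr M M \<theta> m = m"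
    using M(2) by (auto simp: higman_def)
  obtain \<rho> where \<rho>: "lin D_gens N' N \<rho>" "\<And>n. n \<in> carrier N \<Longrightarrow> \<rho> (f n) = n"
    by (rule inj_retraction[OF N f]) (rule that; assumption)
  have N': "left_module A N'" using N(2) by (simp add: fg_iff_kfin)
  let ?h = "\<lambda>n. \<theta> (g (\<rho> n))"
  have h: "lin D_gens N' M ?h" using lin_comp[OF lin_comp[OF \<rho>(1) lin_BD[OF g]] \<theta>(1)] .
  show thesis
  proof
    show "lin B_gens N' M (tr N' M ?h)" using tr_lin[OF N' M(1) h] .
    fix n assume n: "n \<in> carrier N"
    have "tr N' M ?h (f n) = tr N M (\<lambda>n. ?h (f n)) n"
      using tr_comp_right[OF N(1) M(1) lin_AB[OF f(1)], of ?h] lin_closed[OF h] N' n by simp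
    also have "\<dots> = tr N M (\<lambda>n. \<theta> (g n)) n"
      using \<rho>(2) lin_closed[OF \<theta>(1) lin_closed[OF g]] by (intro tr_cong[OF N(1) M(1) n]) auto
    also have "\<dots> = tr M M \<theta> (g n)"
      by (rule tr_comp_right[OF N(1) M(1) g lin_closed[OF \<theta>(1)] M(1) n])
    finally show "tr N' M ?h (f n) = g n" using \<theta>(2) lin_closed[OF g n] by simp
  qed
qed

text \<open>Dual to \<open>higman_extend\<close>: the lift is the trace of
  \<open>s g \<theta>\<close> with a graded section \<open>s\<close> of \<open>f\<close>.\<close>

lemma higman_lift:
  assumes M: "left_module A M" "higman M" and N: "fg_module A N" "left_module A N'"
    and f: "lin (carrier A) N N' f" "f ` carrier N = carrier N'" and g: "lin B_gens M N' g"
  obtains h where "lin B_gens M N h" "\<And>m. m \<in> carrier M \<Longrightarrow> f (h m) = g m"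
proof -
  obtain \<theta> where \<theta>: "lin D_gens M M \<theta>" "\<And>m. m \<in> carrier M \<Longrightarrow> tr M M \<theta> m = m"
    using M(2) by (auto simp: higman_def)
  obtain s where s: "lin D_gens N' N s" "\<And>n. n \<in> carrier N' \<Longrightarrow> f (s n) = n"
    by (rule surj_section[OF N f]) (rule that; assumption)
  have N': "left_module A N" using N(1) by (simp add: fg_iff_kfin)
  let ?h = "\<lambda>m. s (g (\<theta> m))"
  have h: "lin D_gens M N ?h" using lin_comp[OF lin_comp[OF \<theta>(1) lin_BD[OF g]] s(1)] .
  show thesis
  proof
    show "lin B_gens M N (tr M N ?h)" using tr_lin[OF M(1) N' h] .
    fix m assume m: "m \<in> carrier M"
    have "f (tr M N ?h m) = tr M N' (\<lambda>m. f (?h m)) m"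
      using tr_comp_left[OF N' N(2) lin_AB[OF f(1)], of M ?h] lin_closed[OF h] M(1) m by simp
    also have "\<dots> = tr M N' (\<lambda>m. g (\<theta> m)) m"
      using s(2) lin_closed[OF g lin_closed[OF \<theta>(1)]] by (intro tr_cong[OF M(1) N(2) m]) auto
    also have "\<dots> = g (tr M M \<theta> m)"
      by (rule tr_comp_left[OF M(1) N(2) g lin_closed[OF \<theta>(1)] M(1) m])
    finally show "f (tr M N ?h m) = g m" using \<theta>(2)[OF m] by simp
  qed
qed

text \<open>The trace of \<open>q \<theta> s\<close> is \<open>q (tr \<theta>) s\<close>, which is
  the identity. It suffices that the retraction be B-linear, that is, a retraction after restriction
  to the orbits.\<close>

lemma higman_retract:
  assumes M: "left_module A M" and E: "left_module A E" "higman E"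
    and s: "lin B_gens M E s" and q: "lin B_gens E M q" and qs: "\<And>m. m \<in> carrier M \<Longrightarrow> q (s m) = m"
  shows "higman M"
proof -
  obtain \<theta> where \<theta>: "lin D_gens E E \<theta>" "\<And>m. m \<in> carrier E \<Longrightarrow> tr E E \<theta> m = m"
    using E(2) by (auto simp: higman_def)
  have "lin D_gens M M (\<lambda>m. q (\<theta> (s m)))"
    using lin_comp[OF lin_comp[OF lin_BD[OF s] \<theta>(1)] lin_BD[OF q]] .
  moreover have "tr M M (\<lambda>m. q (\<theta> (s m))) m = m" if m: "m \<in> carrier M" for m
  proof -
    have "tr M M (\<lambda>m. q (\<theta> (s m))) m = q (tr M E (\<lambda>m. \<theta> (s m)) m)"
      using lin_closed[OF \<theta>(1) lin_closed[OF s]] by (intro tr_comp_left[OF E(1) M q _ M m]) auto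
    also have "tr M E (\<lambda>m. \<theta> (s m)) m = tr E E \<theta> (s m)"
      by (rule tr_comp_right[OF M E(1) s lin_closed[OF \<theta>(1)] E(1) m])
    finally show ?thesis using \<theta>(2) lin_closed[OF s m] qs[OF m] by simp
  qed
  ultimately show ?thesis unfolding higman_def by blast
qed

text \<open>Extending the identity of \<open>K\<close> along \<open>f\<close> gives an equivariant
  retraction \<open>\<rho>\<close>. Then identity minus \<open>f \<rho>\<close> kills the image of
  \<open>f\<close> and descends to an equivariant section of \<open>q\<close>, so \<open>M\<close>
  is a retract of \<open>E\<close>.\<close>

lemma higman_cokernel:
  assumes K: "left_module A K" "higman K" and E: "fg_module A E" "higman E" and M: "left_module A M"
    and f: "lin (carrier A) K E f" "inj_on f (carrier K)"
    and q: "lin (carrier A) E M q" "q ` carrier E = carrier M" "module_kernel E M q = f ` carrier K"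
  shows "higman M"
proof -
  have E': "left_module A E" using E(1) by (simp add: fg_iff_kfin)
  interpret K: left_module A K by fact
  interpret E: left_module A E by fact
  interpret M: left_module A M by fact
  obtain \<rho> where \<rho>: "lin B_gens E K \<rho>" "\<And>n. n \<in> carrier K \<Longrightarrow> \<rho> (f n) = n"
    by (rule higman_extend[OF K K(1) E(1) f lin_id]) (rule that; assumption)
  define p where "p e = e \<ominus>\<^bsub>E\<^esub> f (\<rho> e)" for e
  have f\<rho>: "lin B_gens E E (\<lambda>e. f (\<rho> e))" using lin_comp[OF \<rho>(1) lin_AB[OF f(1)]] .
  note f\<rho>c = lin_closed[OF f\<rho>]
  have p: "lin B_gens E E p"
  proof (rule linI)
    fix x y assume "x \<in> carrier E" "y \<in> carrier E"
    then show "p (x \<oplus>\<^bsub>E\<^esub> y) = p x \<oplus>\<^bsub>E\<^esub> p y"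
      by (simp add: p_def lin_add[OF f\<rho>] f\<rho>c a_minus_def E.M.minus_add E.M.a_ac)
  next
    fix a x assume a: "a \<in> B_gens" and x: "x \<in> carrier E"
    have aA: "a \<in> carrier A" using a B_gens_closed by (rule rev_subsetD)
    show "p (a \<odot>\<^bsub>E\<^esub> x) = a \<odot>\<^bsub>E\<^esub> p x"
      using x lin_smult[OF f\<rho> a x] by (simp only: p_def E.smult_minus[OF aA] f\<rho>c)
  qed (simp add: p_def f\<rho>c)
  note qm = additive_minus[OF E.M.abelian_group_axioms M.M.abelian_group_axioms q(1)]
  have qf: "q (f k) = \<zero>\<^bsub>M\<^esub>" if "k \<in> carrier K" for k using q(3) that by (auto simp: module_kernel_def)
  have qp: "q (p e) = q e" if "e \<in> carrier E" for e
    using that qf lin_closed[OF \<rho>(1)] lin_closed[OF q(1)]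
    by (simp add: p_def qm f\<rho>c) (simp add: a_minus_def)
  have p_eq: "p e = p e'" if e: "e \<in> carrier E" "e' \<in> carrier E" "q e = q e'" for e e'
  proof -
    have "e \<ominus>\<^bsub>E\<^esub> e' \<in> module_kernel E M q"
      using e lin_closed[OF q(1)] by (simp add: module_kernel_def qm)
    then obtain k where k: "k \<in> carrier K" "e \<ominus>\<^bsub>E\<^esub> e' = f k" using q(3) by auto
    then have "p (e \<ominus>\<^bsub>E\<^esub> e') = \<zero>\<^bsub>E\<^esub>"
      using \<rho>(2) lin_closed[OF f(1)] by (simp add: p_def a_minus_def E.M.r_neg)
    then have "p e \<ominus>\<^bsub>E\<^esub> p e' = \<zero>\<^bsub>E\<^esub>"
      using e additive_minus[OF E.M.abelian_group_axioms E.M.abelian_group_axioms p] by simp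
    then show ?thesis using lin_closed[OF p] e by (metis E.M.minus_eq_zero_iff)
  qed
  define j where "j = inv_into (carrier E) q"
  have j: "j m \<in> carrier E" "q (j m) = m" if "m \<in> carrier M" for m
    using that q(2) by (auto simp: j_def inv_into_into f_inv_into_f)
  have s: "lin B_gens M E (\<lambda>m. p (j m))"
  proof (rule linI)
    fix x y assume xy: "x \<in> carrier M" "y \<in> carrier M"
    have "p (j (x \<oplus>\<^bsub>M\<^esub> y)) = p (j x \<oplus>\<^bsub>E\<^esub> j y)"
      using xy j lin_add[OF q(1)] by (intro p_eq) auto
    then show "p (j (x \<oplus>\<^bsub>M\<^esub> y)) = p (j x) \<oplus>\<^bsub>E\<^esub> p (j y)" using j xy lin_add[OF p] by simp
  next
    fix a x assume ax: "a \<in> B_gens" "x \<in> carrier M"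
    then have a: "a \<in> carrier A" using B_gens_closed by auto
    have "p (j (a \<odot>\<^bsub>M\<^esub> x)) = p (a \<odot>\<^bsub>E\<^esub> j x)"
      using ax j lin_smult[OF q(1) a] a M.smult_closed E.smult_closed by (intro p_eq) auto
    then show "p (j (a \<odot>\<^bsub>M\<^esub> x)) = a \<odot>\<^bsub>E\<^esub> p (j x)" using j ax lin_smult[OF p] by simp
  qed (use j lin_closed[OF p] in simp)
  show ?thesis
    by (rule higman_retract[OF M E' E(2) s lin_AB[OF q(1)]]) (use qp j in simp)
qed

text \<open>Lifting the identity of \<open>M\<close> along \<open>q\<close> gives an equivariant
  section \<open>s\<close>. Then identity minus \<open>s q\<close> projects \<open>E\<close>
  equivariantly onto the kernel.\<close>

lemma higman_kernel:
  assumes K: "left_module A K" and E: "fg_module A E" "higman E" and M: "left_module A M" "higman M"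
    and f: "lin (carrier A) K E f" "inj_on f (carrier K)"
    and q: "lin (carrier A) E M q" "q ` carrier E = carrier M" "module_kernel E M q = f ` carrier K"
  shows "higman K"
proof -
  have E': "left_module A E" using E(1) by (simp add: fg_iff_kfin)
  interpret K: left_module A K by fact
  interpret E: left_module A E by fact
  interpret M: left_module A M by fact
  obtain s where s: "lin B_gens M E s" "\<And>m. m \<in> carrier M \<Longrightarrow> q (s m) = m"
    by (rule higman_lift[OF M E(1) M(1) q(1,2) lin_id]) (rule that; assumption)
  define p where "p e = e \<ominus>\<^bsub>E\<^esub> s (q e)" for e
  have sq: "lin B_gens E E (\<lambda>e. s (q e))" using lin_comp[OF lin_AB[OF q(1)] s(1)] .
  note sqc = lin_closed[OF sq]
  let ?K = "E\<lparr>carrier := f ` carrier K\<rparr>"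
  have p: "lin B_gens E ?K p"
  proof (rule linI)
    fix x assume x: "x \<in> carrier E"
    then have "p x \<in> module_kernel E M q"
      using s(2) lin_closed[OF q(1)]
      by (simp add: module_kernel_def p_def sqc a_minus_def M.M.r_neg
          additive_minus[OF E.M.abelian_group_axioms M.M.abelian_group_axioms q(1), unfolded a_minus_def])
    then show "p x \<in> carrier ?K" using q(3) by simp
    fix y assume "y \<in> carrier E"
    with x show "p (x \<oplus>\<^bsub>E\<^esub> y) = p x \<oplus>\<^bsub>?K\<^esub> p y"
      by (simp add: p_def lin_add[OF sq] sqc a_minus_def E.M.minus_add E.M.a_ac)
  next
    fix a x assume a: "a \<in> B_gens" and x: "x \<in> carrier E"
    have aA: "a \<in> carrier A" using a B_gens_closed by (rule rev_subsetD)
    show "p (a \<odot>\<^bsub>E\<^esub> x) = a \<odot>\<^bsub>?K\<^esub> p x"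
      using x lin_smult[OF sq a x] by (simp add: p_def E.smult_minus[OF aA] sqc del: Un_iff)
  qed
  have "lin (carrier A) K ?K f" using f by (auto simp: lin_def)
  then have "lin (carrier A) ?K K (inv_into (carrier K) f)"
    by (rule lin_inverse[OF K.M.abelian_group_axioms K]) (use f in \<open>auto simp: bij_betw_def\<close>)
  then have pK: "lin B_gens E K (\<lambda>e. inv_into (carrier K) f (p e))"
    using lin_comp[OF p lin_AB] by blast
  have "inv_into (carrier K) f (p (f k)) = k" if k: "k \<in> carrier K" for k
  proof -
    have "q (f k) = \<zero>\<^bsub>M\<^esub>" using q(3) k by (auto simp: module_kernel_def)
    then have "p (f k) = f k"
      using additive_zero[OF M.M.abelian_group_axioms E.M.abelian_group_axioms s(1)] lin_closed[OF f(1) k]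
      by (simp add: p_def a_minus_def)
    then show ?thesis using f(2) k by simp
  qed
  then show ?thesis by (rule higman_retract[OF K E' E(2) lin_AB[OF f(1)] pK])
qed

lemma lin_B_discrete:
  assumes "r \<subseteq> Id" "left_module A M" "left_module A N" "lin B_gens M N f"
  shows "lin (carrier A) M N f"
proof (rule lin_all[OF assms(2,3)])
  show "lin (range \<kappa> \<union> hat ` carrier G) M N f" by (rule lin_mono[OF assms(4)]) auto
  show "f (t x y \<odot>\<^bsub>M\<^esub> m) = t x y \<odot>\<^bsub>N\<^esub> f m" if "(x, y) \<in> r" "m \<in> carrier M" for x y m
    using that assms(1) rel_P[OF that(1)] by (intro lin_smult[OF assms(4)]) auto
qed

text \<open>With trivial relations B is all of A, so the B-linear lifts of
  \<open>higman_lift\<close> are already module homomorphisms.\<close>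

lemma higman_discrete_projective:
  assumes "r \<subseteq> Id" "fg_module A M" "higman M"
  shows "projective_module A M"
proof (rule projective_moduleI[OF assms(2)])
  fix N L :: "'r std_module" and f g
  assume *: "fg_module A N" "fg_module A L" "lin (carrier A) N L f" "f ` carrier N = carrier L" "lin (carrier A) M L g"
  have M: "left_module A M" and N: "left_module A N" and L: "left_module A L"
    using assms(2) *(1,2) by (auto intro: fg_module_left)
  obtain h where h: "lin B_gens M N h" "\<And>m. m \<in> carrier M \<Longrightarrow> f (h m) = g m"
    by (rule higman_lift[OF M assms(3) *(1) L *(3,4) lin_AB[OF *(5)]]) (rule that; assumption)
  show "\<exists>h. lin (carrier A) M N h \<and> (\<forall>x\<in>carrier M. f (h x) = g x)"
    using lin_B_discrete[OF assms(1) M N h(1)] h(2) by blast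
qed

section \<open>Modules of functions\<close>

lemma subspace_uminus:
  assumes "left_module A M" "subspace (range \<kappa>) M W" "x \<in> W"
  shows "\<ominus>\<^bsub>M\<^esub> x \<in> W"
proof -
  interpret M: left_module A M by fact
  have x: "x \<in> carrier M" using assms(2,3) by (auto simp: subspace_def)
  have "\<kappa> (-1) \<odot>\<^bsub>M\<^esub> x \<oplus>\<^bsub>M\<^esub> \<kappa> 1 \<odot>\<^bsub>M\<^esub> x = \<zero>\<^bsub>M\<^esub>"
    using M.smult_l_distr[of "\<kappa> (-1)" "\<kappa> 1" x] x by (simp add: \<kappa>_add[symmetric] \<kappa>_zero M.smult_zero_left)
  then have "\<kappa> (-1) \<odot>\<^bsub>M\<^esub> x = \<ominus>\<^bsub>M\<^esub> x"
    using x by (metis M.M.minus_equality M.smult_closed M.smult_one \<kappa>(1) \<kappa>_one)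
  then show ?thesis using subspaceD(4)[OF assms(2) _ assms(3)] by (metis rangeI)
qed

text \<open>Only the additive group matters here; \<open>mult\<close>, \<open>one\<close> and
  \<open>smult\<close> are placeholders, and \<open>rep_module\<close> later replaces
  \<open>smult\<close> by an action.\<close>

definition fungrp :: "('r, 'm) module \<Rightarrow> ('i \<Rightarrow> 'm set) \<Rightarrow> ('r, 'i \<Rightarrow> 'm) module" where
  "fungrp M V = \<lparr>carrier = {u. \<forall>i. u i \<in> V i}, mult = (\<lambda>u v. u), one = (\<lambda>i. \<zero>\<^bsub>M\<^esub>), zero = (\<lambda>i. \<zero>\<^bsub>M\<^esub>),
     add = (\<lambda>u v i. u i \<oplus>\<^bsub>M\<^esub> v i), smult = (\<lambda>a u. u)\<rparr>"

lemma fungrp_simps [simp]: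
  "carrier (fungrp M V) = {u. \<forall>i. u i \<in> V i}" "zero (fungrp M V) = (\<lambda>i. \<zero>\<^bsub>M\<^esub>)"
  "add (fungrp M V) = (\<lambda>u v i. u i \<oplus>\<^bsub>M\<^esub> v i)"
  by (simp_all add: fungrp_def)

lemma fungrp_group:
  assumes M: "left_module A M" and V: "\<And>i. subspace (range \<kappa>) M (V i)"
  shows "abelian_group (fungrp M V)"
proof -
  interpret M: left_module A M by fact
  have c: "u i \<in> carrier M" if "\<forall>i. u i \<in> V i" for u i using that subspaceD(1)[OF V] by blast
  show ?thesis
  proof (rule abelian_groupI)
    fix u assume "u \<in> carrier (fungrp M V)"
    then show "\<exists>v\<in>carrier (fungrp M V). v \<oplus>\<^bsub>fungrp M V\<^esub> u = \<zero>\<^bsub>fungrp M V\<^esub>"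
      by (intro bexI[of _ "\<lambda>i. \<ominus>\<^bsub>M\<^esub> u i"]) (auto simp: fun_eq_iff c M.M.l_neg intro: subspace_uminus[OF M V])
  qed (auto simp: fun_eq_iff c M.M.a_assoc intro: subspaceD[OF V] M.M.a_comm[OF c c])
qed

text \<open>Isolates what \<open>kG \<otimes> M\<close> and the Kan extensions have in common, so
  that finite sums and finite dimension are treated once for all of them.\<close>

definition pointwise :: "('r, 'm) module \<Rightarrow> ('i \<Rightarrow> 'm set) \<Rightarrow> ('r, 'i \<Rightarrow> 'm) module \<Rightarrow> bool" where
  "pointwise M V E \<longleftrightarrow> carrier E = {u. \<forall>i. u i \<in> V i} \<and> zero E = (\<lambda>i. \<zero>\<^bsub>M\<^esub>) \<and>
     add E = (\<lambda>u v i. u i \<oplus>\<^bsub>M\<^esub> v i) \<and> (\<forall>c. \<forall>u\<in>carrier E. \<kappa> c \<odot>\<^bsub>E\<^esub> u = (\<lambda>i. \<kappa> c \<odot>\<^bsub>M\<^esub> u i))"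

lemma pointwise_finsum:
  assumes M: "left_module A M" and E: "left_module A E" and pw: "pointwise M V E"
    and V: "\<And>i. V i \<subseteq> carrier M" and u: "\<And>j. j \<in> J \<Longrightarrow> u j \<in> carrier E"
  shows "(\<Oplus>\<^bsub>E\<^esub>j\<in>J. u j) i = (\<Oplus>\<^bsub>M\<^esub>j\<in>J. u j i)"
proof -
  interpret M: left_module A M by fact
  interpret E: left_module A E by fact
  have c: "v i \<in> carrier M" if "v \<in> carrier E" for v
    using that pw V by (auto simp: pointwise_def)
  show ?thesis
    using u
  proof (induction J rule: infinite_finite_induct)
    case (insert j J)
    then have "(\<Oplus>\<^bsub>E\<^esub>j\<in>insert j J. u j) i = u j i \<oplus>\<^bsub>M\<^esub> (\<Oplus>\<^bsub>E\<^esub>j\<in>J. u j) i"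
      using pw by (simp add: E.M.finsum_insert Pi_iff pointwise_def)
    then show ?case using insert c by (simp add: M.M.finsum_insert Pi_iff)
  qed (use pw in \<open>auto simp: pointwise_def\<close>)
qed

text \<open>A finite direct sum of subspaces of \<open>M\<close>. Each summand is the image of a
  k-linear projection of \<open>M\<close>, so a spanning set of \<open>M\<close>, projected and
  placed at each index, spans the sum.\<close>

lemma pointwise_kfin:
  assumes M: "left_module A M" "kfin M" and E: "left_module A E" and pw: "pointwise M V E"
    and V: "\<And>i. subspace (range \<kappa>) M (V i)" and I: "finite I" "\<And>i. i \<notin> I \<Longrightarrow> V i \<subseteq> {\<zero>\<^bsub>M\<^esub>}"
  shows "kfin E"
proof -
  interpret M: left_module A M by fact
  interpret E: left_module A E by fact
  have "\<exists>\<pi>. lin (range \<kappa>) M M \<pi> \<and> \<pi> ` carrier M \<subseteq> V i \<and> (\<forall>w\<in>V i. \<pi> w = w)" for i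
    by (rule kfin_projection[OF M V[of i]]) blast
  then obtain \<pi> where \<pi>: "\<And>i. lin (range \<kappa>) M M (\<pi> i)" "\<And>i. \<pi> i ` carrier M \<subseteq> V i"
    "\<And>i w. w \<in> V i \<Longrightarrow> \<pi> i w = w" by metis
  obtain S where S: "finite S" "S \<subseteq> carrier M" "carrier M \<subseteq> mspan (range \<kappa>) M S"
    using M(2) by (auto simp: kfin_def)
  define sg where "sg i m = (\<lambda>j. if j = i then \<pi> i m else \<zero>\<^bsub>M\<^esub>)" for i m
  have z: "\<zero>\<^bsub>M\<^esub> \<in> V i" for i using subspaceD(2)[OF V] .
  have cE: "carrier E = {u. \<forall>i. u i \<in> V i}" using pw by (simp add: pointwise_def)
  have sgc: "sg i m \<in> carrier E" if "m \<in> carrier M" for i m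
    using that \<pi>(2) z by (auto simp: sg_def cE)
  have sg: "lin (range \<kappa>) M E (sg i)" for i
  proof (rule linI)
    fix m n assume "m \<in> carrier M" "n \<in> carrier M"
    then show "sg i (m \<oplus>\<^bsub>M\<^esub> n) = sg i m \<oplus>\<^bsub>E\<^esub> sg i n"
      using pw by (auto simp: sg_def pointwise_def lin_add[OF \<pi>(1)])
  next
    fix a m assume "a \<in> range \<kappa>" "m \<in> carrier M"
    then show "sg i (a \<odot>\<^bsub>M\<^esub> m) = a \<odot>\<^bsub>E\<^esub> sg i m"
      using pw sgc[of m i] lin_smult[OF \<pi>(1)] by (auto simp: pointwise_def M.smult_zero_right) (auto simp: sg_def M.smult_zero_right)
  qed (rule sgc)
  let ?S = "\<Union>i\<in>I. sg i ` S"
  have S': "?S \<subseteq> carrier E" using S(2) sgc by auto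
  have "u \<in> mspan (range \<kappa>) E ?S" if u: "u \<in> carrier E" for u
  proof -
    have Vc: "V i \<subseteq> carrier M" for i using subspaceD(1)[OF V] .
    have uc: "u i \<in> V i" "u i \<in> carrier M" for i using u Vc by (auto simp: cE)
    have "(\<Oplus>\<^bsub>E\<^esub>i\<in>I. sg i (u i)) j = u j" for j
    proof -
      have "(\<Oplus>\<^bsub>E\<^esub>i\<in>I. sg i (u i)) j = (\<Oplus>\<^bsub>M\<^esub>i\<in>I. sg i (u i) j)"
        using sgc uc by (intro pointwise_finsum[OF M(1) E pw Vc]) auto
      also have "\<dots> = u j"
      proof (cases "j \<in> I")
        case True
        then have "(\<Oplus>\<^bsub>M\<^esub>i\<in>I. sg i (u i) j) = sg j (u j) j"
          using I(1) \<pi>(3)[OF uc(1)] uc(2) by (intro M.M.finsum_single) (auto simp: sg_def)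
        then show ?thesis using \<pi>(3)[OF uc(1)] by (simp add: sg_def)
      next
        case False
        then have "(\<Oplus>\<^bsub>M\<^esub>i\<in>I. sg i (u i) j) = (\<Oplus>\<^bsub>M\<^esub>i\<in>I. \<zero>\<^bsub>M\<^esub>)"
          by (intro M.M.finsum_cong') (auto simp: sg_def)
        then show ?thesis using I(2)[OF False] uc(1)[of j] by auto
      qed
      finally show ?thesis .
    qed
    then have "u = (\<Oplus>\<^bsub>E\<^esub>i\<in>I. sg i (u i))" by auto
    moreover have "sg i (u i) \<in> mspan (range \<kappa>) E ?S" if "i \<in> I" for i
    proof -
      have "sg i (u i) \<in> mspan (range \<kappa>) E (sg i ` S)"
        using S(3) uc(2) by (intro mspan_image[OF M(1) E sg _ S(2)]) auto
      then show ?thesis by (rule mspan_mono[OF order_refl, rotated]) (use that in auto)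
    qed
    ultimately show ?thesis using mspan_finsum[OF E _ S', of "range \<kappa>" I "\<lambda>i. sg i (u i)"] by auto
  qed
  then show ?thesis unfolding kfin_def using S' S(1) I(1) by (intro exI[of _ ?S]) auto
qed

lemma carrier_subspace: "left_module A M \<Longrightarrow> X \<subseteq> carrier A \<Longrightarrow> subspace X M (carrier M)"
  and zero_subspace: "left_module A M \<Longrightarrow> X \<subseteq> carrier A \<Longrightarrow> subspace X M {\<zero>\<^bsub>M\<^esub>}"
proof -
  assume M: "left_module A M" "X \<subseteq> carrier A"
  interpret M: left_module A M by (rule M(1))
  show "subspace X M (carrier M)" "subspace X M {\<zero>\<^bsub>M\<^esub>}"
    using M(2) by (auto simp: subspace_def M.smult_zero_right subset_iff intro: M.smult_closed)
qed

text \<open>The functions \<open>G \<rightarrow> M\<close> with the diagonal action, that is, \<open>kG \<otimes> M\<close>.\<close>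

lemma group_functions:
  fixes M :: "('r, 'm) module"
  assumes fg: "fg_module A M"
  obtains E :: "('r, 'g \<Rightarrow> 'm) module" and \<iota> \<pi> where "fg_module A E" "higman E"
    "lin (carrier A) M E \<iota>" "inj_on \<iota> (carrier M)" "lin (carrier A) E M \<pi>" "\<pi> ` carrier E = carrier M"
proof -
  have M: "left_module A M" "kfin M" using fg by (auto simp: fg_iff_kfin)
  interpret M: left_module A M by fact
  note [simp] = M.smult_closed
  define V where "V h = (if h \<in> carrier G then carrier M else {\<zero>\<^bsub>M\<^esub>})" for h
  have V: "subspace (range \<kappa>) M (V h)" for h
    using carrier_subspace[OF M(1), of "range \<kappa>"] zero_subspace[OF M(1), of "range \<kappa>"] by (auto simp: V_def)
  have Vc: "V h \<subseteq> carrier M" for h using subspaceD(1)[OF V] .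
  let ?V = "fungrp M V"
  have V_iff: "u \<in> carrier ?V \<longleftrightarrow> (\<forall>h. u h \<in> carrier M) \<and> (\<forall>h. h \<notin> carrier G \<longrightarrow> u h = \<zero>\<^bsub>M\<^esub>)" for u
    by (auto simp: V_def) (metis M.M.zero_closed empty_iff insert_iff)+
  have a: "a \<odot>\<^bsub>M\<^esub> \<zero>\<^bsub>M\<^esub> = \<zero>\<^bsub>M\<^esub>" if "a \<in> carrier A" for a using that by (rule M.smult_zero_right)
  \<comment> \<open>In the diagonal action \<open>g\<close> acts on the values and translates the
    argument. Functions are set to 0 off \<open>carrier G\<close>, so that they form the finite sum
    indexed by G and equality can be checked at every argument.\<close>
  let ?sc = "\<lambda>c u h. \<kappa> c \<odot>\<^bsub>M\<^esub> u h"
    and ?\<gamma> = "\<lambda>g u h. if h \<in> carrier G then hat g \<odot>\<^bsub>M\<^esub> u (inv g \<otimes> h) else \<zero>\<^bsub>M\<^esub>"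
    and ?\<tau> = "\<lambda>x y u h. t x y \<odot>\<^bsub>M\<^esub> u h"
  note [simp del] = fungrp_simps(1)
  have grp: "abelian_group ?V" by (rule fungrp_group[OF M(1) V])
  have pwV: "(\<Oplus>\<^bsub>?V\<^esub>j\<in>J. u j) h = (\<Oplus>\<^bsub>M\<^esub>j\<in>J. u j h)" if "\<And>j. j \<in> J \<Longrightarrow> u j \<in> carrier ?V" for J h and u :: "'p \<Rightarrow> 'g \<Rightarrow> 'm"
  proof -
    interpret V: abelian_group ?V by (rule grp)
    show ?thesis using that
    proof (induction J rule: infinite_finite_induct)
      case (insert j J)
      then show ?case by (simp add: V.finsum_insert M.M.finsum_insert Pi_iff V_iff)
    qed auto
  qed
  obtain s where s: "left_module A (?V\<lparr>smult := s\<rparr>)"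
    "\<And>c u. u \<in> carrier ?V \<Longrightarrow> s (\<kappa> c) u = ?sc c u"
    "\<And>g u. g \<in> carrier G \<Longrightarrow> u \<in> carrier ?V \<Longrightarrow> s (hat g) u = ?\<gamma> g u"
    "\<And>x y u. (x, y) \<in> r \<Longrightarrow> u \<in> carrier ?V \<Longrightarrow> s (t x y) u = ?\<tau> x y u"
  proof (rule rep_module[of ?V ?sc ?\<gamma> ?\<tau>])
    show "abelian_group ?V" by (rule grp)
    show "lin {} ?V ?V (?sc c)" for c
      by (rule linI) (auto simp: V_iff a M.smult_r_distr)
    show "lin {} ?V ?V (?\<gamma> g)" if "g \<in> carrier G" for g
      by (rule linI) (use that in \<open>auto simp: V_iff a M.smult_r_distr fun_eq_iff\<close>)
    show "lin {} ?V ?V (?\<tau> x y)" for x y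
      by (rule linI) (auto simp: V_iff a M.smult_r_distr)
    fix u assume u: "u \<in> carrier ?V"
    show "?sc (c + d) u = ?sc c u \<oplus>\<^bsub>?V\<^esub> ?sc d u" "?sc (c * d) u = ?sc c (?sc d u)" "?sc 1 u = u" for c d
      using u by (auto simp: V_iff \<kappa>_add \<kappa>_mult \<kappa>_one M.smult_l_distr M.smult_assoc M.smult_one fun_eq_iff)
    show "?\<gamma> g (?sc c u) = ?sc c (?\<gamma> g u)" if "g \<in> carrier G" for g c
      using u that by (auto simp: V_iff fun_eq_iff a M.smult_assoc[symmetric] \<kappa>_central)
    show "?\<gamma> (g \<otimes> h) u = ?\<gamma> g (?\<gamma> h u)" if "g \<in> carrier G" "h \<in> carrier G" for g h
      using u that by (auto simp: V_iff fun_eq_iff hat_mult M.smult_assoc inv_mult_group m_assoc)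
    show "?\<gamma> \<one> u = u" using u by (auto simp: V_iff fun_eq_iff hat_one M.smult_one)
    show "?\<tau> x y (?sc c u) = ?sc c (?\<tau> x y u)" for x y c
      using u by (auto simp: V_iff fun_eq_iff M.smult_assoc[symmetric] \<kappa>_central)
    show "?\<tau> y z (?\<tau> x y u) = ?\<tau> x z u" if "(x, y) \<in> r" "(y, z) \<in> r" for x y z
      using u that by (auto simp: V_iff fun_eq_iff M.smult_assoc[symmetric] t_mult)
    show "?\<tau> y' z (?\<tau> x y u) = \<zero>\<^bsub>?V\<^esub>" if "y \<noteq> y'" for x y y' z
      using u that by (auto simp: V_iff fun_eq_iff M.smult_assoc[symmetric] t_mult_zero M.smult_zero_left)
    show "?\<gamma> g (?\<tau> x y u) = ?\<tau> (\<phi> g x) (\<phi> g y) (?\<gamma> g u)" if "g \<in> carrier G" "(x, y) \<in> r" for g x y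
      using u that rel_P[OF that(2)] by (auto simp: V_iff fun_eq_iff M.smult_assoc[symmetric] hat_t a)
    show "(\<Oplus>\<^bsub>?V\<^esub>x\<in>P. ?\<tau> x x u) = u"
    proof
      fix h
      have "(\<Oplus>\<^bsub>?V\<^esub>x\<in>P. ?\<tau> x x u) h = (\<Oplus>\<^bsub>M\<^esub>x\<in>P. ?\<tau> x x u h)"
        using u by (intro pwV) (auto simp: V_iff a)
      then show "(\<Oplus>\<^bsub>?V\<^esub>x\<in>P. ?\<tau> x x u) h = u h" using one_act[OF M(1)] u by (simp add: V_iff)
    qed
  qed (rule that; assumption)
  let ?E = "?V\<lparr>smult := s\<rparr>"
  have E: "left_module A ?E" by (rule s(1))
  interpret E: left_module A ?E by (rule E)
  have pw: "pointwise M V ?E" using s(2) by (simp add: pointwise_def fungrp_simps(1))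
  have fgE: "fg_module A ?E"
    unfolding fg_iff_kfin
    using pointwise_kfin[OF M E pw V finite_G] E by (auto simp: V_def)
  have E_iff: "u \<in> carrier ?E \<longleftrightarrow> (\<forall>h. u h \<in> carrier M) \<and> (\<forall>h. h \<notin> carrier G \<longrightarrow> u h = \<zero>\<^bsub>M\<^esub>)" for u
    using V_iff[of u] by simp
  have s': "(s (t x x) u) = (\<lambda>h. t x x \<odot>\<^bsub>M\<^esub> u h)" if "u \<in> carrier ?V" "x \<in> P" for u x
    using s(4)[OF rel_refl] that by simp
  \<comment> \<open>The projection onto the component at 1. Its conjugate by \<open>g\<close> is the
    projection onto the component at \<open>g\<close>, and these add up to the identity.\<close>
  define \<theta> where "\<theta> u = (\<lambda>h. if h = \<one> then u h else \<zero>\<^bsub>M\<^esub>)" for u :: "'g \<Rightarrow> 'm"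
  have \<theta>: "lin D_gens ?E ?E \<theta>"
  proof (rule linI)
    show "\<theta> x \<in> carrier ?E" if "x \<in> carrier ?E" for x using that by (auto simp: V_iff \<theta>_def)
    then show "\<theta> (b \<odot>\<^bsub>?E\<^esub> x) = b \<odot>\<^bsub>?E\<^esub> \<theta> x" if "b \<in> D_gens" "x \<in> carrier ?E" for b x
      using that s(2) s' by (auto simp: \<theta>_def a fun_eq_iff)
  qed (auto simp: \<theta>_def fun_eq_iff)
  have "tr ?E ?E \<theta> u = u" if u: "u \<in> carrier ?E" for u
  proof
    fix h
    have [simp]: "\<theta> v \<in> carrier ?V" if "v \<in> carrier ?V" for v using lin_closed[OF \<theta>] that by simp
    have [simp]: "s a v \<in> carrier ?V" if "v \<in> carrier ?V" "a \<in> carrier A" for v a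
      using E.smult_closed that by simp
    have "hat g \<odot>\<^bsub>?E\<^esub> \<theta> (hat (inv g) \<odot>\<^bsub>?E\<^esub> u) = (\<lambda>h. if h = g then u g else \<zero>\<^bsub>M\<^esub>)" if g: "g \<in> carrier G" for g
    proof -
      have "hat g \<odot>\<^bsub>?E\<^esub> \<theta> (hat (inv g) \<odot>\<^bsub>?E\<^esub> u) = ?\<gamma> g (\<theta> (?\<gamma> (inv g) u))"
      proof -
        have e1: "s (hat (inv g)) u = ?\<gamma> (inv g) u" using g u by (intro s(3)) auto
        have e2: "s (hat g) (\<theta> (s (hat (inv g)) u)) = ?\<gamma> g (\<theta> (s (hat (inv g)) u))"
          using g u by (intro s(3)) auto
        have "hat g \<odot>\<^bsub>?E\<^esub> \<theta> (hat (inv g) \<odot>\<^bsub>?E\<^esub> u) = s (hat g) (\<theta> (s (hat (inv g)) u))" by simp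
        then show ?thesis unfolding e2 unfolding e1 .
      qed
      also have "\<dots> = (\<lambda>h. if h = g then u g else \<zero>\<^bsub>M\<^esub>)"
      proof
        fix h
        have "hat g \<odot>\<^bsub>M\<^esub> (hat (inv g) \<odot>\<^bsub>M\<^esub> u g) = u g"
          using g u by (simp add: V_iff M.smult_assoc[symmetric] hat_mult[symmetric] hat_one M.smult_one)
        then show "?\<gamma> g (\<theta> (?\<gamma> (inv g) u)) h = (if h = g then u g else \<zero>\<^bsub>M\<^esub>)"
          using g u by (auto simp: \<theta>_def a inv_mult_eq V_iff)
      qed
      finally show ?thesis .
    qed
    then have "tr ?E ?E \<theta> u = (\<Oplus>\<^bsub>?E\<^esub>g\<in>carrier G. (\<lambda>h. if h = g then u g else \<zero>\<^bsub>M\<^esub>))"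
      unfolding tr_def using u by (intro E.M.finsum_cong') (auto simp: V_iff)
    then have "tr ?E ?E \<theta> u h = (\<Oplus>\<^bsub>M\<^esub>g\<in>carrier G. if h = g then u g else \<zero>\<^bsub>M\<^esub>)"
      using u by (subst pointwise_finsum[OF M(1) E pw Vc, symmetric]) (auto simp: V_iff)
    also have "\<dots> = u h"
    proof (cases "h \<in> carrier G")
      case True
      then show ?thesis using u M.M.finsum_single[of "carrier G" h "\<lambda>g. if h = g then u g else \<zero>\<^bsub>M\<^esub>"]
        by (simp add: V_iff finite_G)
    next
      case False
      then have "(\<Oplus>\<^bsub>M\<^esub>g\<in>carrier G. if h = g then u g else \<zero>\<^bsub>M\<^esub>) = (\<Oplus>\<^bsub>M\<^esub>g\<in>carrier G. \<zero>\<^bsub>M\<^esub>)"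
        by (intro M.M.finsum_cong') auto
      then show ?thesis using u False by (simp add: V_iff)
    qed
    finally show "tr ?E ?E \<theta> u h = u h" .
  qed
  then have higman: "higman ?E" unfolding higman_def using \<theta> by blast
  \<comment> \<open>Constant functions are unchanged by translation of the argument, so this
    embedding is equivariant.\<close>
  define \<iota> where "\<iota> m = (\<lambda>h. if h \<in> carrier G then m else \<zero>\<^bsub>M\<^esub>)" for m
  have \<iota>c: "\<iota> m \<in> carrier ?V" if "m \<in> carrier M" for m using that by (auto simp: V_iff \<iota>_def)
  have \<iota>: "lin (carrier A) M ?E \<iota>"
  proof (rule lin_all[OF M(1) E])
    show "lin (range \<kappa> \<union> hat ` carrier G) M ?E \<iota>"
    proof (rule linI)
      fix b m assume "b \<in> range \<kappa> \<union> hat ` carrier G" "m \<in> carrier M"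
      then show "\<iota> (b \<odot>\<^bsub>M\<^esub> m) = b \<odot>\<^bsub>?E\<^esub> \<iota> m"
        using \<iota>c[of m] by (auto simp: s(2,3)) (auto simp: \<iota>_def a fun_eq_iff)
    qed (auto simp: \<iota>c, auto simp: \<iota>_def fun_eq_iff)
    show "\<iota> (t x y \<odot>\<^bsub>M\<^esub> m) = t x y \<odot>\<^bsub>?E\<^esub> \<iota> m" if "(x, y) \<in> r" "m \<in> carrier M" for x y m
      using s(4)[OF that(1) \<iota>c[OF that(2)]] by (auto simp: \<iota>_def a fun_eq_iff)
  qed
  have \<iota>inj: "inj_on \<iota> (carrier M)"
  proof (rule inj_onI)
    fix m n assume "\<iota> m = \<iota> n"
    then have "\<iota> m \<one> = \<iota> n \<one>" by simp
    then show "m = n" by (simp add: \<iota>_def)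
  qed
  \<comment> \<open>Summation over G is invariant under translation, hence equivariant; it is onto
    already on the functions concentrated at 1.\<close>
  define \<pi> where "\<pi> u = (\<Oplus>\<^bsub>M\<^esub>h\<in>carrier G. u h)" for u
  have \<pi>: "lin (carrier A) ?E M \<pi>"
  proof (rule lin_all[OF E M(1)])
    show "lin (range \<kappa> \<union> hat ` carrier G) ?E M \<pi>"
    proof (rule linI)
      show "\<pi> u \<in> carrier M" if "u \<in> carrier ?E" for u
        using that by (auto simp: V_iff \<pi>_def intro!: M.M.finsum_closed)
      show "\<pi> (u \<oplus>\<^bsub>?E\<^esub> v) = \<pi> u \<oplus>\<^bsub>M\<^esub> \<pi> v" if "u \<in> carrier ?E" "v \<in> carrier ?E" for u v
        using that by (auto simp: V_iff \<pi>_def M.M.finsum_addf Pi_iff)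
      fix b u assume b: "b \<in> range \<kappa> \<union> hat ` carrier G" and u: "u \<in> carrier ?E"
      show "\<pi> (b \<odot>\<^bsub>?E\<^esub> u) = b \<odot>\<^bsub>M\<^esub> \<pi> u"
      proof (cases "b \<in> range \<kappa>")
        case True
        then obtain c where "b = \<kappa> c" by auto
        then show ?thesis using u s(2)[of u c] M.smult_finsum[of b u "carrier G"] by (auto simp: \<pi>_def V_iff)
      next
        case False
        then obtain g where g: "b = hat g" "g \<in> carrier G" using b by auto
        have "\<pi> (b \<odot>\<^bsub>?E\<^esub> u) = (\<Oplus>\<^bsub>M\<^esub>h\<in>(\<lambda>h. g \<otimes> h) ` carrier G. ?\<gamma> g u h)"
          using g u s(3)[of g u] by (simp add: \<pi>_def surj_const_mult)
        also have "\<dots> = (\<Oplus>\<^bsub>M\<^esub>h\<in>carrier G. ?\<gamma> g u (g \<otimes> h))"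
          using g u by (intro M.M.finsum_reindex) (auto simp: inj_on_def V_iff)
        also have "\<dots> = (\<Oplus>\<^bsub>M\<^esub>h\<in>carrier G. hat g \<odot>\<^bsub>M\<^esub> u h)"
          using g u by (intro M.M.finsum_cong') (auto simp: V_iff m_assoc[symmetric])
        also have "\<dots> = b \<odot>\<^bsub>M\<^esub> \<pi> u"
          using g u M.smult_finsum[of b u "carrier G"] by (auto simp: \<pi>_def V_iff)
        finally show ?thesis .
      qed
    qed
    show "\<pi> (t x y \<odot>\<^bsub>?E\<^esub> u) = t x y \<odot>\<^bsub>M\<^esub> \<pi> u" if "(x, y) \<in> r" "u \<in> carrier ?E" for x y u
      using that s(4)[OF that(1), of u] M.smult_finsum[of "t x y" u "carrier G"] by (auto simp: \<pi>_def V_iff)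
  qed
  have "m \<in> \<pi> ` carrier ?E" if m: "m \<in> carrier M" for m
  proof
    show "(\<lambda>h. if h = \<one> then m else \<zero>\<^bsub>M\<^esub>) \<in> carrier ?E" using m by (auto simp: V_iff)
    show "m = \<pi> (\<lambda>h. if h = \<one> then m else \<zero>\<^bsub>M\<^esub>)"
      unfolding \<pi>_def using m finite_G by (subst M.M.finsum_single[of _ \<one>]) auto
  qed
  then have "\<pi> ` carrier ?E = carrier M" using lin_closed[OF \<pi>] by auto
  with fgE higman \<iota> \<iota>inj \<pi> show thesis by (rule that)
qed

text \<open>Projectivity splits the surjection from \<open>kG \<otimes> Q\<close>, so
  \<open>Q\<close> is a retract of a Higman module.\<close>

lemma projective_higman:
  fixes Q :: "('r, 'm) module"
  assumes "projective_module A Q"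
  shows "higman Q"
proof -
  note fg = projective_module_fg[OF assms]
  have Q: "left_module A Q" using fg by (rule fg_module_left)
  obtain E :: "('r, 'g \<Rightarrow> 'm) module" and \<iota> \<pi> where E: "fg_module A E" "higman E"
    "lin (carrier A) E Q \<pi>" "\<pi> ` carrier E = carrier Q"
    using group_functions[OF fg] by metis
  obtain s where s: "lin (carrier A) Q E s" "\<And>x. x \<in> carrier Q \<Longrightarrow> \<pi> (s x) = x"
    using projective_lift[OF assms E(1) fg E(3,4) lin_id] by metis
  show ?thesis
    by (rule higman_retract[OF Q fg_module_left[OF E(1)] E(2) lin_AB[OF s(1)] lin_AB[OF E(3)]]) (rule s(2))
qed

lemma injective_higman:
  fixes Q :: "('r, 'm) module"
  assumes "injective_module A Q"
  shows "higman Q"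
proof -
  note fg = injective_module_fg[OF assms]
  have Q: "left_module A Q" using fg by (rule fg_module_left)
  obtain E :: "('r, 'g \<Rightarrow> 'm) module" and \<iota> \<pi> where E: "fg_module A E" "higman E"
    "lin (carrier A) Q E \<iota>" "inj_on \<iota> (carrier Q)"
    using group_functions[OF fg] by metis
  obtain q where q: "lin (carrier A) E Q q" "\<And>x. x \<in> carrier Q \<Longrightarrow> q (\<iota> x) = x"
    using injective_extend[OF assms fg E(1) E(3,4) lin_id] by metis
  show ?thesis
    by (rule higman_retract[OF Q fg_module_left[OF E(1)] E(2) lin_AB[OF E(3)] lin_AB[OF q(1)]]) (rule q(2))
qed

section \<open>Kan extensions\<close>

text \<open>The idempotent that cuts a module down to the sum of its values at the objects in
  \<open>T\<close>.\<close>

definition es :: "'p set \<Rightarrow> 'r" where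
  "es T = el (\<lambda>(g, x, y). if g = \<one> \<and> x = y \<and> x \<in> T \<and> x \<in> P then 1 else 0)"

text \<open>Collects all transitions into \<open>y\<close>: it maps the sum of the M(z), z \<le> y,
  to M(y), which is the counit of the left Kan extension at \<open>y\<close>.\<close>

definition dn :: "'p \<Rightarrow> 'r" where
  "dn y = el (\<lambda>(g, u, v). if g = \<one> \<and> v = y \<and> (u, y) \<in> r then 1 else 0)"

text \<open>Distributes M(x) to all M(z) with x \<le> z, which is the unit of the right Kan
  extension at \<open>x\<close>.\<close>

definition up :: "'p \<Rightarrow> 'r" where
  "up x = el (\<lambda>(g, u, v). if g = \<one> \<and> u = x \<and> (x, v) \<in> r then 1 else 0)"

abbreviation "lo y \<equiv> {z. (z, y) \<in> r}"
abbreviation "hi x \<equiv> {z. (x, z) \<in> r}"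

lemma es: "es T \<in> carrier A" "\<psi> (es T) (g, x, y) = (if g = \<one> \<and> x = y \<and> x \<in> T \<and> x \<in> P then 1 else 0)"
proof -
  have *: "(\<lambda>(g, x, y). if g = \<one> \<and> x = y \<and> x \<in> T \<and> x \<in> P then 1 else 0) \<in> carrier CA"
    by (auto simp: CA_simps act_one rel_refl)
  show "es T \<in> carrier A" "\<psi> (es T) (g, x, y) = (if g = \<one> \<and> x = y \<and> x \<in> T \<and> x \<in> P then 1 else 0)"
    unfolding es_def using el[OF *] by auto
qed

lemma dn: "dn y \<in> carrier A" "\<psi> (dn y) (g, u, v) = (if g = \<one> \<and> v = y \<and> (u, y) \<in> r then 1 else 0)"
proof -
  have *: "(\<lambda>(g, u, v). if g = \<one> \<and> v = y \<and> (u, y) \<in> r then 1 else 0) \<in> carrier CA"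
    using rel_P by (auto simp: CA_simps act_one)
  show "dn y \<in> carrier A" "\<psi> (dn y) (g, u, v) = (if g = \<one> \<and> v = y \<and> (u, y) \<in> r then 1 else 0)"
    unfolding dn_def using el[OF *] by auto
qed

lemma up: "up x \<in> carrier A" "\<psi> (up x) (g, u, v) = (if g = \<one> \<and> u = x \<and> (x, v) \<in> r then 1 else 0)"
proof -
  have *: "(\<lambda>(g, u, v). if g = \<one> \<and> u = x \<and> (x, v) \<in> r then 1 else 0) \<in> carrier CA"
    using rel_P by (auto simp: CA_simps act_one)
  show "up x \<in> carrier A" "\<psi> (up x) (g, u, v) = (if g = \<one> \<and> u = x \<and> (x, v) \<in> r then 1 else 0)"
    unfolding up_def using el[OF *] by auto
qed

lemmas [simp, intro] = es(1) dn(1) up(1)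

section \<open>Multiplication rules for \<open>es\<close>, \<open>dn\<close> and
  \<open>up\<close>\<close>

lemma inv_mult_eq': "g \<in> carrier G \<Longrightarrow> h \<in> carrier G \<Longrightarrow> k \<in> carrier G \<Longrightarrow> inv k \<otimes> h = g \<longleftrightarrow> k = h \<otimes> inv g"
  by (metis inv_closed inv_mult_eq inv_solve_right m_closed)

lemma mult_inv_eq_one: "g \<in> carrier G \<Longrightarrow> h \<in> carrier G \<Longrightarrow> h \<otimes> inv g = \<one> \<longleftrightarrow> h = g"
  by (metis inv_solve_right l_one one_closed)

lemma \<psi>_es_mult:
  assumes "a \<in> carrier A" "h \<in> carrier G" "x \<in> P" "z \<in> P"
  shows "\<psi> (es T \<otimes>\<^bsub>A\<^esub> a) (h, x, z) = (if z \<in> T then \<psi> a (h, x, z) else 0)"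
proof -
  have "\<psi> (es T \<otimes>\<^bsub>A\<^esub> a) (h, x, z) =
      (\<Sum>k\<in>carrier G. \<Sum>y\<in>P. if k = \<one> \<and> y = z then if z \<in> T then \<psi> a (inv k \<otimes> h, x, y) else 0 else 0)"
    using assms by (auto simp: \<psi>_mult es intro!: sum.cong)
  then show ?thesis using assms by (simp add: sum_delta2 finite_G finite_P)
qed

lemma \<psi>_mult_es:
  assumes "a \<in> carrier A" "h \<in> carrier G" "x \<in> P" "z \<in> P"
  shows "\<psi> (a \<otimes>\<^bsub>A\<^esub> es T) (h, x, z) = (if x \<in> T then \<psi> a (h, x, z) else 0)"
proof -
  have "\<psi> (a \<otimes>\<^bsub>A\<^esub> es T) (h, x, z) =
      (\<Sum>k\<in>carrier G. \<Sum>y\<in>P. if k = h \<and> y = x then if x \<in> T then \<psi> a (k, y, z) else 0 else 0)"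
    using assms by (auto simp: \<psi>_mult es inv_mult_eq' intro!: sum.cong)
  then show ?thesis using assms by (simp add: sum_delta2 finite_G finite_P)
qed

lemma \<psi>_mult_hat:
  assumes "a \<in> carrier A" "g \<in> carrier G" "h \<in> carrier G" "x \<in> P" "z \<in> P"
  shows "\<psi> (a \<otimes>\<^bsub>A\<^esub> hat g) (h, x, z) = \<psi> a (h \<otimes> inv g, \<phi> g x, z)"
proof -
  have "\<psi> (a \<otimes>\<^bsub>A\<^esub> hat g) (h, x, z) =
      (\<Sum>k\<in>carrier G. \<Sum>y\<in>P. if k = h \<otimes> inv g \<and> y = \<phi> g x then \<psi> a (k, y, z) else 0)"
    using assms by (auto simp: \<psi>_mult hat inv_mult_eq' intro!: sum.cong)
  then show ?thesis using assms by (simp add: sum_delta2 finite_G finite_P act_closed)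
qed

lemma \<psi>_mult_t:
  assumes "a \<in> carrier A" "h \<in> carrier G" "x \<in> P" "z \<in> P" "(u, v) \<in> r"
  shows "\<psi> (a \<otimes>\<^bsub>A\<^esub> t u v) (h, x, z) = (if x = u then \<psi> a (h, v, z) else 0)"
proof -
  have "\<psi> (a \<otimes>\<^bsub>A\<^esub> t u v) (h, x, z) =
      (\<Sum>k\<in>carrier G. \<Sum>y\<in>P. if k = h \<and> y = v then if x = u then \<psi> a (k, y, z) else 0 else 0)"
    using assms by (auto simp: \<psi>_mult t inv_mult_eq' intro!: sum.cong)
  then show ?thesis using assms rel_P[OF assms(5)] by (simp add: sum_delta2 finite_G finite_P)
qed

lemma es_mult: "es T \<otimes>\<^bsub>A\<^esub> es U = es (T \<inter> U)"
  by (rule \<psi>_eqI) (auto simp: \<psi>_es_mult es)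

lemma es_t: "es T \<otimes>\<^bsub>A\<^esub> t x y = (if y \<in> T then t x y else \<zero>\<^bsub>A\<^esub>)"
  by (rule \<psi>_eqI) (auto simp: \<psi>_es_mult t \<psi>_zero)

lemma t_es: "t x y \<otimes>\<^bsub>A\<^esub> es T = (if x \<in> T then t x y else \<zero>\<^bsub>A\<^esub>)"
  by (rule \<psi>_eqI) (auto simp: \<psi>_mult_es t \<psi>_zero)

lemma hat_es:
  assumes "g \<in> carrier G" "\<And>z. z \<in> P \<Longrightarrow> z \<in> T \<longleftrightarrow> \<phi> g z \<in> U"
  shows "hat g \<otimes>\<^bsub>A\<^esub> es T = es U \<otimes>\<^bsub>A\<^esub> hat g"
proof (rule \<psi>_eqI)
  fix h x y assume *: "h \<in> carrier G" "x \<in> P" "y \<in> P"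
  have "\<phi> (inv g) y = x \<longleftrightarrow> y = \<phi> g x" using * assms(1) by (simp add: act_inv_eq_iff)
  then show "\<psi> (hat g \<otimes>\<^bsub>A\<^esub> es T) (h, x, y) = \<psi> (es U \<otimes>\<^bsub>A\<^esub> hat g) (h, x, y)"
    using * assms(1) assms(2)[OF *(2)] by (auto simp: \<psi>_hat_mult \<psi>_es_mult es hat inv_mult_eq act_closed)
qed (use assms in auto)

lemma es_sum: "es T = (\<Oplus>\<^bsub>A\<^esub>z\<in>T \<inter> P. t z z)"
proof (rule \<psi>_eqI)
  fix h x y assume *: "h \<in> carrier G" "x \<in> P" "y \<in> P"
  have "\<psi> (\<Oplus>\<^bsub>A\<^esub>z\<in>T \<inter> P. t z z) (h, x, y) = (\<Sum>z\<in>T \<inter> P. if x = z then if h = \<one> \<and> x = y then 1 else 0 else 0)"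
    by (subst \<psi>_finsum, use finite_P in blast, use t(1) in blast, rule sum.cong[OF refl])
      (auto simp: t rel_refl)
  also have "\<dots> = \<psi> (es T) (h, x, y)" using * finite_P by (simp add: es)
  finally show "\<psi> (es T) (h, x, y) = \<psi> (\<Oplus>\<^bsub>A\<^esub>z\<in>T \<inter> P. t z z) (h, x, y)" by simp
qed (auto intro: A.finsum_closed)

lemma dn_sum: "dn y = (\<Oplus>\<^bsub>A\<^esub>z\<in>P. t z y)"
proof (rule \<psi>_eqI)
  fix h x w assume *: "h \<in> carrier G" "x \<in> P" "w \<in> P"
  have "\<psi> (\<Oplus>\<^bsub>A\<^esub>z\<in>P. t z y) (h, x, w) = (\<Sum>z\<in>P. if x = z then if h = \<one> \<and> w = y \<and> (x, y) \<in> r then 1 else 0 else 0)"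
    by (subst \<psi>_finsum, use finite_P in blast, use t(1) in blast, rule sum.cong[OF refl])
      (auto simp: t)
  also have "\<dots> = \<psi> (dn y) (h, x, w)" using * finite_P by (simp add: dn)
  finally show "\<psi> (dn y) (h, x, w) = \<psi> (\<Oplus>\<^bsub>A\<^esub>z\<in>P. t z y) (h, x, w)" by simp
qed (auto intro: A.finsum_closed)

lemma up_sum: "up x = (\<Oplus>\<^bsub>A\<^esub>z\<in>P. t x z)"
proof (rule \<psi>_eqI)
  fix h u w assume *: "h \<in> carrier G" "u \<in> P" "w \<in> P"
  have "\<psi> (\<Oplus>\<^bsub>A\<^esub>z\<in>P. t x z) (h, u, w) = (\<Sum>z\<in>P. if w = z then if h = \<one> \<and> u = x \<and> (x, w) \<in> r then 1 else 0 else 0)"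
    by (subst \<psi>_finsum, use finite_P in blast, use t(1) in blast, rule sum.cong[OF refl])
      (auto simp: t)
  also have "\<dots> = \<psi> (up x) (h, u, w)" using * finite_P by (simp add: up)
  finally show "\<psi> (up x) (h, u, w) = \<psi> (\<Oplus>\<^bsub>A\<^esub>z\<in>P. t x z) (h, u, w)" by simp
qed (auto intro: A.finsum_closed)

lemma act_rel: "g \<in> carrier G \<Longrightarrow> x \<in> P \<Longrightarrow> y \<in> P \<Longrightarrow> (\<phi> g x, \<phi> g y) \<in> r \<longleftrightarrow> (x, y) \<in> r"
  using act_rel_iff[of g x "\<phi> g y"] by (simp add: act_inv act_closed)

text \<open>Naturality of the counit: following the transitions into x by x \<le> y gives the part
  of \<open>dn y\<close> that starts at objects below x.\<close>

lemma t_dn: "(x, y) \<in> r \<Longrightarrow> t x y \<otimes>\<^bsub>A\<^esub> dn w = (if w = x then dn y \<otimes>\<^bsub>A\<^esub> es (lo x) else \<zero>\<^bsub>A\<^esub>)"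
  by (rule \<psi>_eqI) (auto simp: \<psi>_t_mult \<psi>_mult_es dn \<psi>_zero dest: rel_trans)

lemma dn_t: "y \<in> P \<Longrightarrow> dn y \<otimes>\<^bsub>A\<^esub> t y y = t y y"
  by (rule \<psi>_eqI) (auto simp: \<psi>_mult_t rel_refl dn t)

lemma dn_lo: "dn y \<otimes>\<^bsub>A\<^esub> es (lo y) = dn y"
  by (rule \<psi>_eqI) (auto simp: \<psi>_mult_es dn)

lemma hat_dn: "g \<in> carrier G \<Longrightarrow> y \<in> P \<Longrightarrow> hat g \<otimes>\<^bsub>A\<^esub> dn y = dn (\<phi> g y) \<otimes>\<^bsub>A\<^esub> hat g"
  by (rule \<psi>_eqI)
    (auto simp: \<psi>_hat_mult \<psi>_mult_hat dn inv_mult_eq act_inv_eq_iff act_closed act_rel mult_inv_eq_one)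

text \<open>Naturality of the unit, dual to \<open>t_dn\<close>: preceding the transitions out of y
  by x \<le> y gives the part of \<open>up x\<close> that ends above y.\<close>

lemma up_t: "(x, y) \<in> r \<Longrightarrow> up w \<otimes>\<^bsub>A\<^esub> t x y = (if w = y then es (hi y) \<otimes>\<^bsub>A\<^esub> up x else \<zero>\<^bsub>A\<^esub>)"
  by (rule \<psi>_eqI) (auto simp: \<psi>_mult_t \<psi>_es_mult up \<psi>_zero dest: rel_trans)

lemma t_up: "x \<in> P \<Longrightarrow> t x x \<otimes>\<^bsub>A\<^esub> up x = t x x"
  by (rule \<psi>_eqI) (auto simp: \<psi>_t_mult rel_refl up t)

lemma hi_up: "es (hi x) \<otimes>\<^bsub>A\<^esub> up x = up x"
  by (rule \<psi>_eqI) (auto simp: \<psi>_es_mult up)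

lemma hat_up: "g \<in> carrier G \<Longrightarrow> x \<in> P \<Longrightarrow> hat g \<otimes>\<^bsub>A\<^esub> up x = up (\<phi> g x) \<otimes>\<^bsub>A\<^esub> hat g"
  by (rule \<psi>_eqI)
    (auto simp: \<psi>_hat_mult \<psi>_mult_hat up inv_mult_eq act_closed mult_inv_eq_one act_rel_iff
       dest: act_inv_eq_iff, (metis act_inv act_inv' act_rel_iff)+)

text \<open>
  For \<open>S = lo\<close> this is the left, for \<open>S = hi\<close> the right Kan extension of the restriction of \<open>M\<close> to
  the transporter category of the discrete poset: its value at \<open>y\<close> is the sum of the \<open>M(z)\<close>, \<open>z \<in> S y\<close>.
\<close>

definition kan_val :: "('p \<Rightarrow> 'p set) \<Rightarrow> ('r, 'm) module \<Rightarrow> 'p \<Rightarrow> 'm set" where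
  "kan_val S M y = (if y \<in> P then {m \<in> carrier M. es (S y) \<odot>\<^bsub>M\<^esub> m = m} else {\<zero>\<^bsub>M\<^esub>})"

text \<open>A predicate, since \<open>rep_module\<close> only asserts the existence of an action. As
  M is the sum of its values, an element of the Kan extension at y is an element of M fixed by
  \<open>es (S y)\<close>. The transition from x to y is the projection to \<open>S y\<close>: for
  \<open>lo\<close> it is an inclusion, for \<open>hi\<close> it forgets the objects not above
  y.\<close>

definition kan :: "('p \<Rightarrow> 'p set) \<Rightarrow> ('r, 'm) module \<Rightarrow> ('r, 'p \<Rightarrow> 'm) module \<Rightarrow> bool" where
  "kan S M E \<longleftrightarrow> left_module A E \<and> pointwise M (kan_val S M) E \<and>
     (\<forall>g\<in>carrier G. \<forall>u\<in>carrier E. hat g \<odot>\<^bsub>E\<^esub> u = (\<lambda>w. if w \<in> P then hat g \<odot>\<^bsub>M\<^esub> u (\<phi> (inv g) w) else \<zero>\<^bsub>M\<^esub>)) \<and>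
     (\<forall>x y. (x, y) \<in> r \<longrightarrow> (\<forall>u\<in>carrier E. t x y \<odot>\<^bsub>E\<^esub> u = (\<lambda>w. if w = y then es (S y) \<odot>\<^bsub>M\<^esub> u x else \<zero>\<^bsub>M\<^esub>)))"

text \<open>The second condition makes projections compose: for x \<le> y \<le> z, passing from
  \<open>S x\<close> to \<open>S z\<close> loses nothing in \<open>S y\<close>. It holds for
  \<open>lo\<close> because \<open>S x\<close> lies in \<open>S y\<close>, for \<open>hi\<close>
  because \<open>S z\<close> does.\<close>

definition admissible :: "('p \<Rightarrow> 'p set) \<Rightarrow> bool" where
  "admissible S \<longleftrightarrow> (\<forall>g\<in>carrier G. \<forall>x\<in>P. \<forall>z\<in>P. z \<in> S x \<longleftrightarrow> \<phi> g z \<in> S (\<phi> g x)) \<and>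
     (\<forall>x y z. (x, y) \<in> r \<longrightarrow> (y, z) \<in> r \<longrightarrow> S x \<inter> S z \<subseteq> S y)"

lemma admissible_lo: "admissible lo"
  unfolding admissible_def by (auto simp: act_rel dest: rel_trans)

lemma admissible_hi: "admissible hi"
  unfolding admissible_def by (auto simp: act_rel dest: rel_trans)

lemma kan_val_subspace:
  assumes "left_module A M"
  shows "subspace (range \<kappa>) M (kan_val S M y)"
proof -
  interpret M: left_module A M by fact
  show ?thesis
    by (auto simp: subspace_def kan_val_def M.smult_zero_right M.smult_r_distr M.smult_closed
      M.smult_assoc[symmetric] \<kappa>_central[symmetric]) (simp add: M.smult_assoc)
qed

lemma kan_exists:
  fixes M :: "('r, 'm) module"
  assumes M: "left_module A M" and S: "admissible S"
  obtains E where "kan S M E"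
proof -
  interpret M: left_module A M by fact
  note [simp] = M.smult_closed
  let ?V = "fungrp M (kan_val S M)"
  note V = kan_val_subspace[OF M, of S]
  have V_iff: "u \<in> carrier ?V \<longleftrightarrow> (\<forall>y. u y \<in> carrier M) \<and> (\<forall>y\<in>P. es (S y) \<odot>\<^bsub>M\<^esub> u y = u y) \<and>
    (\<forall>y. y \<notin> P \<longrightarrow> u y = \<zero>\<^bsub>M\<^esub>)" for u
    by (auto simp: kan_val_def) (metis M.M.zero_closed)+
  note [simp del] = fungrp_simps(1)
  have a: "a \<odot>\<^bsub>M\<^esub> \<zero>\<^bsub>M\<^esub> = \<zero>\<^bsub>M\<^esub>" if "a \<in> carrier A" for a using that by (rule M.smult_zero_right)
  have S_conv: "S z \<inter> (S y \<inter> S x) = S z \<inter> S x" if "(x, y) \<in> r" "(y, z) \<in> r" for x y z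
    using S that unfolding admissible_def by blast
  have hatS: "hat g \<odot>\<^bsub>M\<^esub> (es (S x) \<odot>\<^bsub>M\<^esub> m) = es (S (\<phi> g x)) \<odot>\<^bsub>M\<^esub> (hat g \<odot>\<^bsub>M\<^esub> m)"
    if "g \<in> carrier G" "x \<in> P" "m \<in> carrier M" for g x m
    using that hat_es[of g "S x" "S (\<phi> g x)"] S by (simp add: M.smult_assoc[symmetric] admissible_def)
  have hatS': "es (S w) \<odot>\<^bsub>M\<^esub> (hat g \<odot>\<^bsub>M\<^esub> m) = hat g \<odot>\<^bsub>M\<^esub> (es (S (\<phi> (inv g) w)) \<odot>\<^bsub>M\<^esub> m)"
    if "g \<in> carrier G" "w \<in> P" "m \<in> carrier M" for g w m
    using hatS[of g "\<phi> (inv g) w" m] that by (simp add: act_closed act_inv')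
  have esk: "es T \<odot>\<^bsub>M\<^esub> (\<kappa> c \<odot>\<^bsub>M\<^esub> m) = \<kappa> c \<odot>\<^bsub>M\<^esub> (es T \<odot>\<^bsub>M\<^esub> m)" if "m \<in> carrier M" for T c m
    using that by (simp add: M.smult_assoc[symmetric] \<kappa>_central)
  have hatk: "hat g \<odot>\<^bsub>M\<^esub> (\<kappa> c \<odot>\<^bsub>M\<^esub> m) = \<kappa> c \<odot>\<^bsub>M\<^esub> (hat g \<odot>\<^bsub>M\<^esub> m)" if "m \<in> carrier M" "g \<in> carrier G" for g c m
    using that by (simp add: M.smult_assoc[symmetric] \<kappa>_central)
  have eses: "es T \<odot>\<^bsub>M\<^esub> (es U \<odot>\<^bsub>M\<^esub> m) = es (T \<inter> U) \<odot>\<^bsub>M\<^esub> m" if "m \<in> carrier M" for T U m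
    using that by (simp add: M.smult_assoc[symmetric] es_mult)
  let ?sc = "\<lambda>c u y. \<kappa> c \<odot>\<^bsub>M\<^esub> u y"
    and ?\<gamma> = "\<lambda>g u w. if w \<in> P then hat g \<odot>\<^bsub>M\<^esub> u (\<phi> (inv g) w) else \<zero>\<^bsub>M\<^esub>"
    and ?\<tau> = "\<lambda>x y u w. if w = y then es (S y) \<odot>\<^bsub>M\<^esub> u x else \<zero>\<^bsub>M\<^esub>"
  have grp: "abelian_group ?V" by (rule fungrp_group[OF M V])
  have pwV: "(\<Oplus>\<^bsub>?V\<^esub>j\<in>J. u j) h = (\<Oplus>\<^bsub>M\<^esub>j\<in>J. u j h)" if "\<And>j. j \<in> J \<Longrightarrow> u j \<in> carrier ?V"
    for J h and u :: "'p \<Rightarrow> 'p \<Rightarrow> 'm"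
  proof -
    interpret V: abelian_group ?V by (rule grp)
    show ?thesis using that
    proof (induction J rule: infinite_finite_induct)
      case (insert j J)
      then show ?case by (simp add: V.finsum_insert M.M.finsum_insert Pi_iff V_iff)
    qed auto
  qed
  have \<tau>c: "?\<tau> x y u \<in> carrier ?V" if "(x, y) \<in> r" "u \<in> carrier ?V" for x y u
    using that rel_P[OF that(1)] by (auto simp: V_iff a eses)
  obtain s where s: "left_module A (?V\<lparr>smult := s\<rparr>)"
    "\<And>c u. u \<in> carrier ?V \<Longrightarrow> s (\<kappa> c) u = ?sc c u"
    "\<And>g u. g \<in> carrier G \<Longrightarrow> u \<in> carrier ?V \<Longrightarrow> s (hat g) u = ?\<gamma> g u"
    "\<And>x y u. (x, y) \<in> r \<Longrightarrow> u \<in> carrier ?V \<Longrightarrow> s (t x y) u = ?\<tau> x y u"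
  proof (rule rep_module[of ?V ?sc ?\<gamma> ?\<tau>])
    show "abelian_group ?V" by (rule grp)
    show "lin {} ?V ?V (?sc c)" for c
      by (rule linI) (auto simp: V_iff a M.smult_r_distr esk)
    show "lin {} ?V ?V (?\<gamma> g)" if "g \<in> carrier G" for g
      by (rule linI) (use that in \<open>auto simp: V_iff a M.smult_r_distr fun_eq_iff hatS' act_closed\<close>)
    show "lin {} ?V ?V (?\<tau> x y)" if "(x, y) \<in> r" for x y
      by (rule linI) (use \<tau>c that in \<open>auto simp: M.smult_r_distr fun_eq_iff, auto simp: V_iff M.smult_r_distr\<close>)
    fix u assume u: "u \<in> carrier ?V"
    show "?sc (c + d) u = ?sc c u \<oplus>\<^bsub>?V\<^esub> ?sc d u" "?sc (c * d) u = ?sc c (?sc d u)" "?sc 1 u = u" for c d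
      using u by (auto simp: V_iff \<kappa>_add \<kappa>_mult \<kappa>_one M.smult_l_distr M.smult_assoc M.smult_one fun_eq_iff)
    show "?\<gamma> g (?sc c u) = ?sc c (?\<gamma> g u)" if "g \<in> carrier G" for g c
      using u that by (auto simp: V_iff fun_eq_iff a hatk)
    show "?\<gamma> (g \<otimes> h) u = ?\<gamma> g (?\<gamma> h u)" if "g \<in> carrier G" "h \<in> carrier G" for g h
      using u that by (auto simp: V_iff fun_eq_iff hat_mult M.smult_assoc inv_mult_group act_mult act_closed)
    show "?\<gamma> \<one> u = u" using u by (auto simp: V_iff fun_eq_iff hat_one M.smult_one act_one)
    show "?\<tau> x y (?sc c u) = ?sc c (?\<tau> x y u)" for x y c
      using u by (auto simp: V_iff fun_eq_iff esk a)
    show "?\<tau> y z (?\<tau> x y u) = ?\<tau> x z u" if "(x, y) \<in> r" "(y, z) \<in> r" for x y z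
    proof -
      have "es (S x) \<odot>\<^bsub>M\<^esub> u x = u x" using u rel_P[OF that(1)] by (simp add: V_iff)
      moreover have "es (S z) \<odot>\<^bsub>M\<^esub> (es (S y) \<odot>\<^bsub>M\<^esub> (es (S x) \<odot>\<^bsub>M\<^esub> u x)) = es (S z) \<odot>\<^bsub>M\<^esub> (es (S x) \<odot>\<^bsub>M\<^esub> u x)"
        using u S_conv[OF that] by (simp add: V_iff eses)
      ultimately show ?thesis by (auto simp: fun_eq_iff)
    qed
    show "?\<tau> y' z (?\<tau> x y u) = \<zero>\<^bsub>?V\<^esub>" if "y \<noteq> y'" for x y y' z
      using u that by (auto simp: V_iff fun_eq_iff a)
    show "?\<gamma> g (?\<tau> x y u) = ?\<tau> (\<phi> g x) (\<phi> g y) (?\<gamma> g u)" if "g \<in> carrier G" "(x, y) \<in> r" for g x y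
      using u that rel_P[OF that(2)]
      by (auto simp: V_iff fun_eq_iff hatS a act_closed act_inv act_inv_eq_iff)
    show "(\<Oplus>\<^bsub>?V\<^esub>x\<in>P. ?\<tau> x x u) = u"
    proof
      fix h
      have "(\<Oplus>\<^bsub>?V\<^esub>x\<in>P. ?\<tau> x x u) h = (\<Oplus>\<^bsub>M\<^esub>x\<in>P. ?\<tau> x x u h)"
        using u \<tau>c[OF rel_refl] by (intro pwV) auto
      also have "\<dots> = u h"
      proof (cases "h \<in> P")
        case True
        then show ?thesis using u finite_P by (subst M.M.finsum_single[of P h]) (auto simp: V_iff)
      next
        case False
        then have "(\<Oplus>\<^bsub>M\<^esub>x\<in>P. ?\<tau> x x u h) = (\<Oplus>\<^bsub>M\<^esub>x\<in>P. \<zero>\<^bsub>M\<^esub>)" by (intro M.M.finsum_cong') auto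
        then show ?thesis using u False by (simp add: V_iff)
      qed
      finally show "(\<Oplus>\<^bsub>?V\<^esub>x\<in>P. ?\<tau> x x u) h = u h" .
    qed
  qed (rule that; assumption)
  have "kan S M (?V\<lparr>smult := s\<rparr>)"
    unfolding kan_def pointwise_def using s by (simp add: fungrp_simps(1))
  then show thesis by (rule that)
qed

lemma kanD:
  assumes "kan S M E"
  shows "left_module A E" "pointwise M (kan_val S M) E"
    "\<And>g u. g \<in> carrier G \<Longrightarrow> u \<in> carrier E \<Longrightarrow>
        hat g \<odot>\<^bsub>E\<^esub> u = (\<lambda>w. if w \<in> P then hat g \<odot>\<^bsub>M\<^esub> u (\<phi> (inv g) w) else \<zero>\<^bsub>M\<^esub>)"
    "\<And>x y u. (x, y) \<in> r \<Longrightarrow> u \<in> carrier E \<Longrightarrow> t x y \<odot>\<^bsub>E\<^esub> u = (\<lambda>w. if w = y then es (S y) \<odot>\<^bsub>M\<^esub> u x else \<zero>\<^bsub>M\<^esub>)"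
    "\<And>c u. u \<in> carrier E \<Longrightarrow> \<kappa> c \<odot>\<^bsub>E\<^esub> u = (\<lambda>i. \<kappa> c \<odot>\<^bsub>M\<^esub> u i)"
    "\<And>u v. u \<oplus>\<^bsub>E\<^esub> v = (\<lambda>i. u i \<oplus>\<^bsub>M\<^esub> v i)" "\<zero>\<^bsub>E\<^esub> = (\<lambda>i. \<zero>\<^bsub>M\<^esub>)"
  using assms by (auto simp: kan_def pointwise_def)

lemma kan_carrier:
  assumes "left_module A M" "kan S M E"
  shows "u \<in> carrier E \<longleftrightarrow> (\<forall>y. u y \<in> carrier M) \<and> (\<forall>y\<in>P. es (S y) \<odot>\<^bsub>M\<^esub> u y = u y) \<and>
    (\<forall>y. y \<notin> P \<longrightarrow> u y = \<zero>\<^bsub>M\<^esub>)"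
proof -
  interpret M: left_module A M by fact
  show ?thesis
    using kanD(2)[OF assms(2)] by (auto simp: pointwise_def kan_val_def) (metis M.M.zero_closed)+
qed

lemma kan_fg:
  assumes "fg_module A M" "kan S M E"
  shows "fg_module A E"
proof -
  have M: "left_module A M" "kfin M" using assms(1) by (auto simp: fg_iff_kfin)
  show ?thesis
    using pointwise_kfin[OF M kanD(1,2)[OF assms(2)] kan_val_subspace[OF M(1)] finite_P] kanD(1)[OF assms(2)]
    by (auto simp: fg_iff_kfin kan_val_def)
qed

lemma kan_finsum:
  assumes "left_module A M" "kan S M E" "\<And>j. j \<in> J \<Longrightarrow> u j \<in> carrier E"
  shows "(\<Oplus>\<^bsub>E\<^esub>j\<in>J. u j) i = (\<Oplus>\<^bsub>M\<^esub>j\<in>J. u j i)"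
  using kan_val_subspace[OF assms(1), THEN subspaceD(1)]
  by (intro pointwise_finsum[OF assms(1) kanD(1,2)[OF assms(2)]] assms(3)) auto

lemma lin_es:
  assumes "left_module A M" "left_module A N" "lin D_gens M N f" "m \<in> carrier M"
  shows "f (es T \<odot>\<^bsub>M\<^esub> m) = es T \<odot>\<^bsub>N\<^esub> f m"
proof -
  interpret M: left_module A M by fact
  interpret N: left_module A N by fact
  have "f (es T \<odot>\<^bsub>M\<^esub> m) = f (\<Oplus>\<^bsub>M\<^esub>z\<in>T \<inter> P. t z z \<odot>\<^bsub>M\<^esub> m)"
    using assms(4) by (simp add: es_sum M.finsum_smult)
  also have "\<dots> = (\<Oplus>\<^bsub>N\<^esub>z\<in>T \<inter> P. f (t z z \<odot>\<^bsub>M\<^esub> m))"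
    using assms(4) by (intro additive_finsum[OF M.M.abelian_group_axioms N.M.abelian_group_axioms assms(3)])
      (auto intro: M.smult_closed)
  also have "\<dots> = (\<Oplus>\<^bsub>N\<^esub>z\<in>T \<inter> P. t z z \<odot>\<^bsub>N\<^esub> f m)"
    using assms(4) lin_smult[OF assms(3)] lin_closed[OF assms(3)]
    by (intro N.M.finsum_cong') (auto intro: N.smult_closed)
  also have "\<dots> = es T \<odot>\<^bsub>N\<^esub> f m"
    using lin_closed[OF assms(3,4)] by (simp add: es_sum N.finsum_smult)
  finally show ?thesis .
qed

text \<open>One half of the adjunction. The element \<open>u y\<close> is spread over the objects
  below y; \<open>h\<close> carries it to N respecting the objects, and \<open>dn y\<close> pushes
  all its components up to N(y).\<close>

lemma left_kan_ext:
  assumes M: "left_module A M" and N: "left_module A N" and E: "kan lo M E" and h: "lin B_gens M N h"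
  shows "lin (carrier A) E N (\<lambda>u. \<Oplus>\<^bsub>N\<^esub>y\<in>P. dn y \<odot>\<^bsub>N\<^esub> h (u y))"
proof -
  interpret M: left_module A M by fact
  interpret N: left_module A N by fact
  interpret E: left_module A E using kanD(1)[OF E] .
  note [simp] = M.smult_closed N.smult_closed lin_closed[OF h]
  note E_iff = kan_carrier[OF M E]
  note E' = kanD(3-7)[OF E]
  have h0: "h \<zero>\<^bsub>M\<^esub> = \<zero>\<^bsub>N\<^esub>" using additive_zero[OF M.M.abelian_group_axioms N.M.abelian_group_axioms h] .
  have uM: "u y \<in> carrier M" if "u \<in> carrier E" for u y using that by (simp add: E_iff)
  have cl: "dn y \<odot>\<^bsub>N\<^esub> h (u y) \<in> carrier N" if "u \<in> carrier E" for u y using uM[OF that] by simp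
  show ?thesis
  proof (rule lin_all[OF E.left_module_axioms N])
    show "lin (range \<kappa> \<union> hat ` carrier G) E N (\<lambda>u. \<Oplus>\<^bsub>N\<^esub>y\<in>P. dn y \<odot>\<^bsub>N\<^esub> h (u y))"
    proof (rule linI)
      show "(\<Oplus>\<^bsub>N\<^esub>y\<in>P. dn y \<odot>\<^bsub>N\<^esub> h (u y)) \<in> carrier N" if "u \<in> carrier E" for u
        using cl[OF that] by (auto intro: N.M.finsum_closed)
      fix u v assume u: "u \<in> carrier E" and v: "v \<in> carrier E"
      have "(\<Oplus>\<^bsub>N\<^esub>y\<in>P. dn y \<odot>\<^bsub>N\<^esub> h ((u \<oplus>\<^bsub>E\<^esub> v) y)) = (\<Oplus>\<^bsub>N\<^esub>y\<in>P. dn y \<odot>\<^bsub>N\<^esub> h (u y) \<oplus>\<^bsub>N\<^esub> dn y \<odot>\<^bsub>N\<^esub> h (v y))"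
        using uM[OF u] uM[OF v] by (intro N.M.finsum_cong') (auto simp: E' lin_add[OF h] N.smult_r_distr)
      then show "(\<Oplus>\<^bsub>N\<^esub>y\<in>P. dn y \<odot>\<^bsub>N\<^esub> h ((u \<oplus>\<^bsub>E\<^esub> v) y)) =
          (\<Oplus>\<^bsub>N\<^esub>y\<in>P. dn y \<odot>\<^bsub>N\<^esub> h (u y)) \<oplus>\<^bsub>N\<^esub> (\<Oplus>\<^bsub>N\<^esub>y\<in>P. dn y \<odot>\<^bsub>N\<^esub> h (v y))"
        using cl[OF u] cl[OF v] by (simp add: N.M.finsum_addf Pi_iff)
    next
      fix b u assume b: "b \<in> range \<kappa> \<union> hat ` carrier G" and u: "u \<in> carrier E"
      have bA: "b \<in> carrier A" using b by auto
      show "(\<Oplus>\<^bsub>N\<^esub>y\<in>P. dn y \<odot>\<^bsub>N\<^esub> h ((b \<odot>\<^bsub>E\<^esub> u) y)) = b \<odot>\<^bsub>N\<^esub> (\<Oplus>\<^bsub>N\<^esub>y\<in>P. dn y \<odot>\<^bsub>N\<^esub> h (u y))"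
      proof (cases "b \<in> range \<kappa>")
        case True
        then obtain c where c: "b = \<kappa> c" by auto
        have "dn y \<odot>\<^bsub>N\<^esub> h (\<kappa> c \<odot>\<^bsub>M\<^esub> u y) = \<kappa> c \<odot>\<^bsub>N\<^esub> (dn y \<odot>\<^bsub>N\<^esub> h (u y))" for y
          using uM[OF u] lin_smult[OF h] by (simp add: N.smult_assoc[symmetric] \<kappa>_central)
        then show ?thesis using u cl[OF u] by (simp add: c E' N.smult_finsum[of "\<kappa> c"] Pi_iff)
      next
        case False
        then obtain g where g: "b = hat g" "g \<in> carrier G" using b by auto
        have "(\<Oplus>\<^bsub>N\<^esub>y\<in>P. dn y \<odot>\<^bsub>N\<^esub> h ((b \<odot>\<^bsub>E\<^esub> u) y)) = (\<Oplus>\<^bsub>N\<^esub>y\<in>\<phi> g ` P. dn y \<odot>\<^bsub>N\<^esub> h ((b \<odot>\<^bsub>E\<^esub> u) y))"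
          using act_bij[OF g(2)] by (simp add: bij_betw_def)
        also have "\<dots> = (\<Oplus>\<^bsub>N\<^esub>y\<in>P. dn (\<phi> g y) \<odot>\<^bsub>N\<^esub> h ((b \<odot>\<^bsub>E\<^esub> u) (\<phi> g y)))"
          using act_bij[OF g(2)] cl[OF E.smult_closed[OF bA u]] by (intro N.M.finsum_reindex) (auto simp: bij_betw_def)
        also have "\<dots> = (\<Oplus>\<^bsub>N\<^esub>y\<in>P. b \<odot>\<^bsub>N\<^esub> (dn y \<odot>\<^bsub>N\<^esub> h (u y)))"
        proof (rule N.M.finsum_cong'[OF refl])
          fix y assume y: "y \<in> P"
          have "dn (\<phi> g y) \<odot>\<^bsub>N\<^esub> h ((b \<odot>\<^bsub>E\<^esub> u) (\<phi> g y)) = dn (\<phi> g y) \<odot>\<^bsub>N\<^esub> (hat g \<odot>\<^bsub>N\<^esub> h (u y))"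
            using g y u uM[OF u] by (simp add: E' act_closed act_inv lin_smult[OF h])
          then show "dn (\<phi> g y) \<odot>\<^bsub>N\<^esub> h ((b \<odot>\<^bsub>E\<^esub> u) (\<phi> g y)) = b \<odot>\<^bsub>N\<^esub> (dn y \<odot>\<^bsub>N\<^esub> h (u y))"
            using g y uM[OF u] by (simp add: N.smult_assoc[symmetric] hat_dn)
        qed (use bA cl[OF u] in auto)
        finally show ?thesis using cl[OF u] bA by (simp add: N.smult_finsum[of b] Pi_iff)
      qed
    qed
    fix x y u assume xy: "(x, y) \<in> r" and u: "u \<in> carrier E"
    have P: "x \<in> P" "y \<in> P" using rel_P[OF xy] by auto
    \<comment> \<open>As \<open>h\<close> is graded, \<open>h (u x)\<close> still lives below x.
      This allows \<open>dn y\<close> to be restricted to the objects below x, where it factors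
      through x by \<open>t_dn\<close>.\<close>
    have es_u: "es (lo x) \<odot>\<^bsub>N\<^esub> h (u x) = h (u x)"
      using lin_es[OF M N lin_BD[OF h] uM[OF u], of "lo x" x] u P by (simp add: E_iff)
    have "(\<Oplus>\<^bsub>N\<^esub>w\<in>P. dn w \<odot>\<^bsub>N\<^esub> h ((t x y \<odot>\<^bsub>E\<^esub> u) w)) = dn y \<odot>\<^bsub>N\<^esub> h ((t x y \<odot>\<^bsub>E\<^esub> u) y)"
      using P finite_P uM[OF u] xy u
      by (intro N.M.finsum_single) (auto simp: E' h0 N.smult_zero_right)
    also have "\<dots> = dn y \<odot>\<^bsub>N\<^esub> (es (lo y) \<odot>\<^bsub>N\<^esub> h (u x))"
      using xy u uM[OF u] lin_es[OF M N lin_BD[OF h] uM[OF u], of "lo y" x] by (simp add: E')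
    also have "\<dots> = dn y \<odot>\<^bsub>N\<^esub> h (u x)"
      using uM[OF u] by (simp add: N.smult_assoc[symmetric] dn_lo)
    also have "\<dots> = dn y \<odot>\<^bsub>N\<^esub> (es (lo x) \<odot>\<^bsub>N\<^esub> h (u x))" by (simp add: es_u)
    also have "\<dots> = t x y \<odot>\<^bsub>N\<^esub> (dn x \<odot>\<^bsub>N\<^esub> h (u x))"
      using uM[OF u] by (simp add: N.smult_assoc[symmetric] t_dn[OF xy])
    also have "\<dots> = (\<Oplus>\<^bsub>N\<^esub>w\<in>P. t x y \<odot>\<^bsub>N\<^esub> (dn w \<odot>\<^bsub>N\<^esub> h (u w)))"
      using P finite_P uM[OF u]
      by (intro N.M.finsum_single[symmetric])
        (auto simp: N.smult_assoc[symmetric] t_dn[OF xy] N.smult_zero_left)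
    also have "\<dots> = t x y \<odot>\<^bsub>N\<^esub> (\<Oplus>\<^bsub>N\<^esub>w\<in>P. dn w \<odot>\<^bsub>N\<^esub> h (u w))"
      using cl[OF u] by (intro N.smult_finsum[symmetric]) auto
    finally show "(\<Oplus>\<^bsub>N\<^esub>w\<in>P. dn w \<odot>\<^bsub>N\<^esub> h ((t x y \<odot>\<^bsub>E\<^esub> u) w)) = t x y \<odot>\<^bsub>N\<^esub> (\<Oplus>\<^bsub>N\<^esub>w\<in>P. dn w \<odot>\<^bsub>N\<^esub> h (u w))" .
  qed
qed

text \<open>The dual half: the value at x records the images under \<open>h\<close> of the component
  of \<open>n\<close> at x, transported to every object above x.\<close>

lemma right_kan_ext:
  assumes M: "left_module A M" and N: "left_module A N" and E: "kan hi M E" and h: "lin B_gens N M h"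
  shows "lin (carrier A) N E (\<lambda>n x. if x \<in> P then h (up x \<odot>\<^bsub>N\<^esub> n) else \<zero>\<^bsub>M\<^esub>)" (is "lin _ _ _ ?f")
proof -
  interpret M: left_module A M by fact
  interpret N: left_module A N by fact
  interpret E: left_module A E using kanD(1)[OF E] .
  note [simp] = M.smult_closed N.smult_closed lin_closed[OF h]
  note E_iff = kan_carrier[OF M E]
  note E' = kanD(3-7)[OF E]
  have h_es: "h (es T \<odot>\<^bsub>N\<^esub> n) = es T \<odot>\<^bsub>M\<^esub> h n" if "n \<in> carrier N" for n T
    using lin_es[OF N M lin_BD[OF h] that] .
  have cl: "?f n \<in> carrier E" if "n \<in> carrier N" for n
  proof -
    have "es (hi y) \<odot>\<^bsub>M\<^esub> h (up y \<odot>\<^bsub>N\<^esub> n) = h (up y \<odot>\<^bsub>N\<^esub> n)" for y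
      using that by (simp add: h_es[symmetric] N.smult_assoc[symmetric] hi_up)
    then show ?thesis using that by (auto simp: E_iff)
  qed
  show ?thesis
  proof (rule lin_all[OF N E.left_module_axioms])
    show "lin (range \<kappa> \<union> hat ` carrier G) N E ?f"
    proof (rule linI)
      fix n m assume n: "n \<in> carrier N" and m: "m \<in> carrier N"
      show "?f (n \<oplus>\<^bsub>N\<^esub> m) = ?f n \<oplus>\<^bsub>E\<^esub> ?f m"
        using n m by (auto simp: fun_eq_iff E' lin_add[OF h] N.smult_r_distr)
    next
      fix b n assume b: "b \<in> range \<kappa> \<union> hat ` carrier G" and n: "n \<in> carrier N"
      have bA: "b \<in> carrier A" using b by auto
      show "?f (b \<odot>\<^bsub>N\<^esub> n) = b \<odot>\<^bsub>E\<^esub> ?f n"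
      proof (cases "b \<in> range \<kappa>")
        case True
        then obtain c where c: "b = \<kappa> c" by auto
        have "h (up y \<odot>\<^bsub>N\<^esub> (\<kappa> c \<odot>\<^bsub>N\<^esub> n)) = \<kappa> c \<odot>\<^bsub>M\<^esub> h (up y \<odot>\<^bsub>N\<^esub> n)" for y
          using n lin_smult[OF h, of "\<kappa> c" "up y \<odot>\<^bsub>N\<^esub> n"]
          by (simp add: N.smult_assoc[symmetric] \<kappa>_central)
        then show ?thesis using cl[OF n] by (auto simp: c E' fun_eq_iff M.smult_zero_right)
      next
        case False
        then obtain g where g: "b = hat g" "g \<in> carrier G" using b by auto
        have "h (up w \<odot>\<^bsub>N\<^esub> (hat g \<odot>\<^bsub>N\<^esub> n)) = hat g \<odot>\<^bsub>M\<^esub> h (up (\<phi> (inv g) w) \<odot>\<^bsub>N\<^esub> n)" if w: "w \<in> P" for w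
        proof -
          have "hat g \<odot>\<^bsub>M\<^esub> h (up (\<phi> (inv g) w) \<odot>\<^bsub>N\<^esub> n) = h (hat g \<odot>\<^bsub>N\<^esub> (up (\<phi> (inv g) w) \<odot>\<^bsub>N\<^esub> n))"
            using g n lin_smult[OF h] by simp
          then show ?thesis
            using g n w by (simp add: N.smult_assoc[symmetric] hat_up act_closed act_inv')
        qed
        then show ?thesis using cl[OF n] g by (auto simp: E' fun_eq_iff act_closed)
      qed
    qed (rule cl)
    fix x y n assume xy: "(x, y) \<in> r" and n: "n \<in> carrier N"
    have P: "x \<in> P" "y \<in> P" using rel_P[OF xy] by auto
    have "h (up w \<odot>\<^bsub>N\<^esub> (t x y \<odot>\<^bsub>N\<^esub> n)) = (if w = y then es (hi y) \<odot>\<^bsub>M\<^esub> h (up x \<odot>\<^bsub>N\<^esub> n) else \<zero>\<^bsub>M\<^esub>)" for w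
      using n additive_zero[OF N.M.abelian_group_axioms M.M.abelian_group_axioms h]
      by (auto simp: N.smult_assoc[symmetric] up_t[OF xy] N.smult_zero_left) (simp add: N.smult_assoc h_es)
    then show "?f (t x y \<odot>\<^bsub>N\<^esub> n) = t x y \<odot>\<^bsub>E\<^esub> ?f n"
      using cl[OF n] xy P by (auto simp: E' fun_eq_iff)
  qed
qed

text \<open>The condition that M(x) be nonzero, in terms of the algebra;
  \<open>value_at_supp\<close> makes the connection.\<close>

definition supp :: "('r, 'm) module \<Rightarrow> 'p \<Rightarrow> bool" where
  "supp M x \<longleftrightarrow> (\<exists>m\<in>carrier M. t x x \<odot>\<^bsub>M\<^esub> m \<noteq> \<zero>\<^bsub>M\<^esub>)"

lemma supp_zero:
  assumes "left_module A M" "\<And>x. x \<in> P \<Longrightarrow> \<not> supp M x" "m \<in> carrier M"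
  shows "m = \<zero>\<^bsub>M\<^esub>"
proof -
  interpret M: left_module A M by fact
  have "(\<Oplus>\<^bsub>M\<^esub>x\<in>P. t x x \<odot>\<^bsub>M\<^esub> m) = (\<Oplus>\<^bsub>M\<^esub>x\<in>P. \<zero>\<^bsub>M\<^esub>)"
    using assms(2,3) by (intro M.M.finsum_cong') (auto simp: supp_def)
  then show ?thesis using one_act[OF assms(1,3)] by simp
qed

lemma supp_inj:
  assumes "lin (carrier A) M N f" "inj_on f (carrier M)" "left_module A M" "left_module A N" "supp M x"
  shows "supp N x"
proof -
  interpret M: left_module A M by fact
  interpret N: left_module A N by fact
  obtain m where m: "m \<in> carrier M" "t x x \<odot>\<^bsub>M\<^esub> m \<noteq> \<zero>\<^bsub>M\<^esub>" using assms(5) by (auto simp: supp_def)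
  have "f (t x x \<odot>\<^bsub>M\<^esub> m) \<noteq> f \<zero>\<^bsub>M\<^esub>"
    using m inj_onD[OF assms(2)] by (metis M.M.zero_closed M.smult_closed t(1))
  then have "t x x \<odot>\<^bsub>N\<^esub> f m \<noteq> \<zero>\<^bsub>N\<^esub>"
    using additive_zero[OF M.M.abelian_group_axioms N.M.abelian_group_axioms assms(1)] m lin_smult[OF assms(1)] by simp
  then show ?thesis unfolding supp_def using lin_closed[OF assms(1) m(1)] by blast
qed

text \<open>To lift a map out of the Kan extension, restrict it along the unit \<open>\<eta>\<close>
  to a B-linear map out of \<open>M\<close>, lift that by \<open>higman_lift\<close>, and return by
  \<open>left_kan_ext\<close>. Where \<open>M\<close> vanishes strictly below y, the Kan extension
  at y is just M(y), so the kernel of \<open>\<epsilon>\<close> vanishes there.\<close>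

lemma left_kan_cover:
  fixes M :: "('r, 'm) module"
  assumes fg: "fg_module A M" and hM: "higman M"
  obtains E :: "('r, 'p \<Rightarrow> 'm) module" and \<epsilon> where "projective_module A E" "lin (carrier A) E M \<epsilon>"
    "\<epsilon> ` carrier E = carrier M"
    "\<And>u y. u \<in> module_kernel E M \<epsilon> \<Longrightarrow> y \<in> P \<Longrightarrow> t y y \<odot>\<^bsub>E\<^esub> u \<noteq> \<zero>\<^bsub>E\<^esub> \<Longrightarrow> \<exists>z. (z, y) \<in> r \<and> z \<noteq> y \<and> supp M z"
proof -
  have M: "left_module A M" using fg by (rule fg_module_left)
  interpret M: left_module A M by fact
  obtain E where E: "kan lo M E" using kan_exists[OF M admissible_lo] .
  interpret E: left_module A E using kanD(1)[OF E] .
  note [simp] = M.smult_closed E.smult_closed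
  note E_iff = kan_carrier[OF M E]
  note E' = kanD(3-7)[OF E]
  have fgE: "fg_module A E" by (rule kan_fg[OF fg E])
  have uM: "u y \<in> carrier M" if "u \<in> carrier E" for u y using that by (simp add: E_iff)
  \<comment> \<open>The unit of the adjunction, M(y) as the top summand at y. It does not respect
    proper transitions: a transition in E keeps the summand M(y) and never applies the one of
    M.\<close>
  define \<eta> where "\<eta> m = (\<lambda>y. if y \<in> P then t y y \<odot>\<^bsub>M\<^esub> m else \<zero>\<^bsub>M\<^esub>)" for m
  have \<eta>c: "\<eta> m \<in> carrier E" if "m \<in> carrier M" for m
    using that by (auto simp: E_iff \<eta>_def M.smult_assoc[symmetric] es_t rel_refl)
  have \<eta>: "lin B_gens M E \<eta>"
  proof (rule linI)
    fix b m assume b: "b \<in> B_gens" and m: "m \<in> carrier M"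
    consider c where "b = \<kappa> c" | x where "b = t x x" "x \<in> P" | g where "b = hat g" "g \<in> carrier G"
      using b by auto
    then show "\<eta> (b \<odot>\<^bsub>M\<^esub> m) = b \<odot>\<^bsub>E\<^esub> \<eta> m"
    proof cases
      case (1 c)
      have "t y y \<odot>\<^bsub>M\<^esub> (\<kappa> c \<odot>\<^bsub>M\<^esub> m) = \<kappa> c \<odot>\<^bsub>M\<^esub> (t y y \<odot>\<^bsub>M\<^esub> m)" for y
        using m by (simp add: M.smult_assoc[symmetric] \<kappa>_central)
      then show ?thesis unfolding 1 using \<eta>c[OF m] by (simp add: E') (auto simp: \<eta>_def M.smult_zero_right)
    next
      case (2 x)
      have "t y y \<odot>\<^bsub>M\<^esub> (t x x \<odot>\<^bsub>M\<^esub> m) = (if y = x then es (lo x) \<odot>\<^bsub>M\<^esub> (t x x \<odot>\<^bsub>M\<^esub> m) else \<zero>\<^bsub>M\<^esub>)" for y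
        using m 2 by (auto simp: M.smult_assoc[symmetric] es_t rel_refl t_orth M.smult_zero_left)
      then show ?thesis unfolding 2 using \<eta>c[OF m] 2 rel_refl[of x] by (simp add: E') (auto simp: \<eta>_def)
    next
      case (3 g)
      have "t y y \<odot>\<^bsub>M\<^esub> (hat g \<odot>\<^bsub>M\<^esub> m) = hat g \<odot>\<^bsub>M\<^esub> (t (\<phi> (inv g) y) (\<phi> (inv g) y) \<odot>\<^bsub>M\<^esub> m)" if "y \<in> P" for y
        using m 3 that by (simp add: M.smult_assoc[symmetric] hat_t act_closed act_inv')
      then show ?thesis unfolding 3 using \<eta>c[OF m] 3 by (simp add: E') (auto simp: \<eta>_def act_closed)
    qed
  qed (auto simp: \<eta>c, auto simp: \<eta>_def E' fun_eq_iff M.smult_r_distr)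
  \<comment> \<open>The unit puts the component of \<open>u y\<close> at z into the value at z, and
    \<open>dn y\<close> carries it to y unchanged. Only the z below y survive, which is all of
    \<open>u y\<close>.\<close>
  have recover: "(\<Oplus>\<^bsub>E\<^esub>y\<in>P. dn y \<odot>\<^bsub>E\<^esub> \<eta> (u y)) = u" if u: "u \<in> carrier E" for u
  proof
    fix w
    have dnE: "(dn y \<odot>\<^bsub>E\<^esub> \<eta> (u y)) w = (if w = y then u w else \<zero>\<^bsub>M\<^esub>)" if y: "y \<in> P" for y
    proof -
      have uy: "u y \<in> carrier M" "\<eta> (u y) \<in> carrier E" using uM[OF u] \<eta>c by auto
      have "dn y \<odot>\<^bsub>E\<^esub> \<eta> (u y) = (\<Oplus>\<^bsub>E\<^esub>z\<in>P. t z y \<odot>\<^bsub>E\<^esub> \<eta> (u y))"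
        using uy by (simp add: dn_sum E.finsum_smult)
      then have "(dn y \<odot>\<^bsub>E\<^esub> \<eta> (u y)) w = (\<Oplus>\<^bsub>M\<^esub>z\<in>P. (t z y \<odot>\<^bsub>E\<^esub> \<eta> (u y)) w)"
        using uy by (simp add: kan_finsum[OF M E])
      also have "\<dots> = (\<Oplus>\<^bsub>M\<^esub>z\<in>P. if w = y then es (lo y) \<odot>\<^bsub>M\<^esub> (t z z \<odot>\<^bsub>M\<^esub> u y) else \<zero>\<^bsub>M\<^esub>)"
      proof (rule M.M.finsum_cong'[OF refl])
        fix z assume z: "z \<in> P"
        show "(t z y \<odot>\<^bsub>E\<^esub> \<eta> (u y)) w = (if w = y then es (lo y) \<odot>\<^bsub>M\<^esub> (t z z \<odot>\<^bsub>M\<^esub> u y) else \<zero>\<^bsub>M\<^esub>)"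
        proof (cases "(z, y) \<in> r")
          case True
          then show ?thesis using uy z by (simp add: E') (auto simp: \<eta>_def)
        next
          case False
          then have "es (lo y) \<odot>\<^bsub>M\<^esub> (t z z \<odot>\<^bsub>M\<^esub> u y) = \<zero>\<^bsub>M\<^esub>"
            using uy by (simp add: M.smult_assoc[symmetric] es_t M.smult_zero_left)
          then show ?thesis using False uy by (simp add: t_zero E.smult_zero_left E')
        qed
      qed (use uy in auto)
      also have "\<dots> = (if w = y then u w else \<zero>\<^bsub>M\<^esub>)"
      proof (cases "w = y")
        case True
        have "(\<Oplus>\<^bsub>M\<^esub>z\<in>P. es (lo y) \<odot>\<^bsub>M\<^esub> (t z z \<odot>\<^bsub>M\<^esub> u y)) = es (lo y) \<odot>\<^bsub>M\<^esub> (\<Oplus>\<^bsub>M\<^esub>z\<in>P. t z z \<odot>\<^bsub>M\<^esub> u y)"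
          using uy by (intro M.smult_finsum[symmetric]) auto
        also have "\<dots> = u y" using one_act[OF M uy(1)] u y by (simp add: E_iff)
        finally show ?thesis using True by simp
      qed simp
      finally show ?thesis .
    qed
    have "(\<Oplus>\<^bsub>E\<^esub>y\<in>P. dn y \<odot>\<^bsub>E\<^esub> \<eta> (u y)) w = (\<Oplus>\<^bsub>M\<^esub>y\<in>P. (dn y \<odot>\<^bsub>E\<^esub> \<eta> (u y)) w)"
      using uM[OF u] \<eta>c by (intro kan_finsum[OF M E]) auto
    also have "\<dots> = (\<Oplus>\<^bsub>M\<^esub>y\<in>P. if w = y then u w else \<zero>\<^bsub>M\<^esub>)"
      using uM[OF u] by (intro M.M.finsum_cong') (auto simp: dnE)
    also have "\<dots> = u w"
    proof (cases "w \<in> P")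
      case True
      then show ?thesis using uM[OF u] finite_P by (subst M.M.finsum_single[of P w]) auto
    next
      case False
      then have "(\<Oplus>\<^bsub>M\<^esub>y\<in>P. if w = y then u w else \<zero>\<^bsub>M\<^esub>) = (\<Oplus>\<^bsub>M\<^esub>y\<in>P. \<zero>\<^bsub>M\<^esub>)" by (intro M.M.finsum_cong') auto
      then show ?thesis using u False by (simp add: E_iff)
    qed
    finally show "(\<Oplus>\<^bsub>E\<^esub>y\<in>P. dn y \<odot>\<^bsub>E\<^esub> \<eta> (u y)) w = u w" .
  qed
  have proj: "projective_module A E"
  proof (rule projective_moduleI[OF fgE])
    fix N L :: "'r std_module" and f g
    assume *: "fg_module A N" "fg_module A L" "lin (carrier A) N L f" "f ` carrier N = carrier L" "lin (carrier A) E L g"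
    have N: "left_module A N" and L: "left_module A L" using *(1,2) by (auto intro: fg_module_left)
    interpret N: left_module A N by fact
    interpret L: left_module A L by fact
    obtain h where h: "lin B_gens M N h" "\<And>m. m \<in> carrier M \<Longrightarrow> f (h m) = g (\<eta> m)"
      by (rule higman_lift[OF M hM *(1) L *(3,4) lin_comp[OF \<eta> lin_AB[OF *(5)]]]) (rule that; assumption)
    let ?h = "\<lambda>u. \<Oplus>\<^bsub>N\<^esub>y\<in>P. dn y \<odot>\<^bsub>N\<^esub> h (u y)"
    have "f (?h u) = g u" if u: "u \<in> carrier E" for u
    proof -
      note c = uM[OF u] lin_closed[OF h(1) uM[OF u]]
      have "f (?h u) = (\<Oplus>\<^bsub>L\<^esub>y\<in>P. f (dn y \<odot>\<^bsub>N\<^esub> h (u y)))"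
        using c by (intro additive_finsum[OF N.M.abelian_group_axioms L.M.abelian_group_axioms *(3)]) (auto intro: N.smult_closed)
      also have "\<dots> = (\<Oplus>\<^bsub>L\<^esub>y\<in>P. g (dn y \<odot>\<^bsub>E\<^esub> \<eta> (u y)))"
        using c \<eta>c lin_closed[OF *(5)]
        by (intro L.M.finsum_cong') (auto simp: lin_smult[OF *(3)] lin_smult[OF *(5)] h(2) intro!: L.smult_closed)
      also have "\<dots> = g (\<Oplus>\<^bsub>E\<^esub>y\<in>P. dn y \<odot>\<^bsub>E\<^esub> \<eta> (u y))"
        using c \<eta>c by (intro additive_finsum[OF E.M.abelian_group_axioms L.M.abelian_group_axioms *(5), symmetric]) auto
      also have "\<dots> = g u" using recover[OF u] by simp
      finally show ?thesis .
    qed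
    then show "\<exists>h. lin (carrier A) E N h \<and> (\<forall>x\<in>carrier E. f (h x) = g x)"
      using left_kan_ext[OF M N E h(1)] by blast
  qed
  define \<epsilon> where "\<epsilon> = (\<lambda>u. \<Oplus>\<^bsub>M\<^esub>y\<in>P. dn y \<odot>\<^bsub>M\<^esub> u y)"
  have \<epsilon>: "lin (carrier A) E M \<epsilon>" unfolding \<epsilon>_def by (rule left_kan_ext[OF M M E lin_id])
  have "\<epsilon> (\<eta> m) = m" if m: "m \<in> carrier M" for m
  proof -
    have "\<epsilon> (\<eta> m) = (\<Oplus>\<^bsub>M\<^esub>y\<in>P. t y y \<odot>\<^bsub>M\<^esub> m)"
      unfolding \<epsilon>_def using m by (intro M.M.finsum_cong') (auto simp: \<eta>_def M.smult_assoc[symmetric] dn_t)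
    then show ?thesis using one_act[OF M m] by simp
  qed
  then have surj: "\<epsilon> ` carrier E = carrier M" using lin_closed[OF \<epsilon>] \<eta>c by (metis image_eqI image_subsetI subsetI subset_antisym)
  have "\<exists>z. (z, y) \<in> r \<and> z \<noteq> y \<and> supp M z"
    if u: "u \<in> module_kernel E M \<epsilon>" and y: "y \<in> P" and nz: "t y y \<odot>\<^bsub>E\<^esub> u \<noteq> \<zero>\<^bsub>E\<^esub>" for u y
  proof (rule ccontr)
    assume no: "\<not> (\<exists>z. (z, y) \<in> r \<and> z \<noteq> y \<and> supp M z)"
    have uE: "u \<in> carrier E" "\<epsilon> u = \<zero>\<^bsub>M\<^esub>" using u by (auto simp: module_kernel_def)
    \<comment> \<open>With nothing in \<open>M\<close> strictly below y, the element
      \<open>u y\<close> lies in M(y), and there \<open>\<epsilon>\<close> acts as the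
      identity.\<close>
    have "u y = es (lo y) \<odot>\<^bsub>M\<^esub> u y" using uE y by (simp add: E_iff)
    also have "\<dots> = (\<Oplus>\<^bsub>M\<^esub>z\<in>lo y \<inter> P. t z z \<odot>\<^bsub>M\<^esub> u y)"
      using uM[OF uE(1)] by (simp add: es_sum M.finsum_smult)
    also have "\<dots> = t y y \<odot>\<^bsub>M\<^esub> u y"
      using no y rel_refl finite_P uM[OF uE(1)] by (intro M.M.finsum_single) (auto simp: supp_def)
    finally have uy: "t y y \<odot>\<^bsub>M\<^esub> u y = u y" by simp
    have tu: "t y y \<odot>\<^bsub>E\<^esub> u = (\<lambda>w. if w = y then u y else \<zero>\<^bsub>M\<^esub>)"
      using y rel_refl uE by (simp add: E') (auto simp: E_iff)
    have "\<epsilon> (t y y \<odot>\<^bsub>E\<^esub> u) = dn y \<odot>\<^bsub>M\<^esub> u y"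
      unfolding tu \<epsilon>_def using y finite_P uM[OF uE(1)] by (subst M.M.finsum_single[of P y]) (auto simp: M.smult_zero_right)
    also have "\<dots> = dn y \<odot>\<^bsub>M\<^esub> (t y y \<odot>\<^bsub>M\<^esub> u y)" by (simp add: uy)
    also have "\<dots> = u y" using uM[OF uE(1)] y uy
      by (subst M.smult_assoc[symmetric]) (simp_all add: dn_t)
    finally have "u y = \<zero>\<^bsub>M\<^esub>" using lin_smult[OF \<epsilon> t(1) uE(1)] uE(2) by (simp add: M.smult_zero_right)
    then show False using nz by (auto simp: tu E' fun_eq_iff split: if_splits)
  qed
  with proj \<epsilon> surj show thesis by (rule that)
qed

text \<open>Dual to \<open>left_kan_cover\<close>, with counit \<open>ev\<close>. As
  \<open>ev\<close> is an additive retraction of \<open>\<mu>\<close>, the cokernel can be realised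
  on a complement of the image of \<open>\<mu>\<close> inside \<open>E\<close>, by
  \<open>quotient_module\<close>.\<close>

lemma right_kan_hull:
  fixes M :: "('r, 'm) module"
  assumes fg: "fg_module A M" and hM: "higman M"
  obtains E C :: "('r, 'p \<Rightarrow> 'm) module" and \<mu> q where "injective_module A E" "lin (carrier A) M E \<mu>"
    "inj_on \<mu> (carrier M)" "fg_module A C" "lin (carrier A) E C q" "q ` carrier E = carrier C"
    "module_kernel E C q = \<mu> ` carrier M"
    "\<And>x. x \<in> P \<Longrightarrow> supp C x \<Longrightarrow> \<exists>y. (x, y) \<in> r \<and> y \<noteq> x \<and> supp M y"
proof -
  have M: "left_module A M" using fg by (rule fg_module_left)
  interpret M: left_module A M by fact
  obtain E where E: "kan hi M E" using kan_exists[OF M admissible_hi] .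
  interpret E: left_module A E using kanD(1)[OF E] .
  note [simp] = M.smult_closed E.smult_closed
  note E_iff = kan_carrier[OF M E]
  note E' = kanD(3-7)[OF E]
  have fgE: "fg_module A E" by (rule kan_fg[OF fg E])
  have uM: "u y \<in> carrier M" if "u \<in> carrier E" for u y using that by (simp add: E_iff)
  \<comment> \<open>The counit: at x it reads off the component in M(x) of an element of the sum of
    the M(z), z \<ge> x. It is B-linear but need not respect proper transitions.\<close>
  define ev where "ev u = (\<Oplus>\<^bsub>M\<^esub>x\<in>P. t x x \<odot>\<^bsub>M\<^esub> u x)" for u
  have cl: "t x x \<odot>\<^bsub>M\<^esub> u x \<in> carrier M" if "u \<in> carrier E" for u x using uM[OF that] by simp
  have ev: "lin B_gens E M ev"
  proof (rule linI)
    show "ev u \<in> carrier M" if "u \<in> carrier E" for u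
      using cl[OF that] by (auto simp: ev_def intro: M.M.finsum_closed)
    fix u v assume u: "u \<in> carrier E" and v: "v \<in> carrier E"
    have "ev (u \<oplus>\<^bsub>E\<^esub> v) = (\<Oplus>\<^bsub>M\<^esub>x\<in>P. t x x \<odot>\<^bsub>M\<^esub> u x \<oplus>\<^bsub>M\<^esub> t x x \<odot>\<^bsub>M\<^esub> v x)"
      unfolding ev_def using uM[OF u] uM[OF v] by (intro M.M.finsum_cong') (auto simp: E' M.smult_r_distr)
    then show "ev (u \<oplus>\<^bsub>E\<^esub> v) = ev u \<oplus>\<^bsub>M\<^esub> ev v"
      using cl[OF u] cl[OF v] by (simp add: ev_def M.M.finsum_addf Pi_iff)
  next
    fix b u assume b: "b \<in> B_gens" and u: "u \<in> carrier E"
    have bA: "b \<in> carrier A" using b B_gens_closed by (rule rev_subsetD)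
    consider c where "b = \<kappa> c" | x where "b = t x x" "x \<in> P" | g where "b = hat g" "g \<in> carrier G"
      using b by auto
    then have "ev (b \<odot>\<^bsub>E\<^esub> u) = (\<Oplus>\<^bsub>M\<^esub>x\<in>P. b \<odot>\<^bsub>M\<^esub> (t x x \<odot>\<^bsub>M\<^esub> u x))"
    proof cases
      case (1 c)
      have "t x x \<odot>\<^bsub>M\<^esub> (\<kappa> c \<odot>\<^bsub>M\<^esub> u x) = \<kappa> c \<odot>\<^bsub>M\<^esub> (t x x \<odot>\<^bsub>M\<^esub> u x)" for x
        using uM[OF u] by (simp add: M.smult_assoc[symmetric] \<kappa>_central)
      then show ?thesis unfolding 1 ev_def using u by (simp add: E')
    next
      case (2 x)
      have ux: "es (hi x) \<odot>\<^bsub>M\<^esub> u x = u x" using u 2 by (simp add: E_iff)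
      show ?thesis
        unfolding 2 ev_def
      proof (rule M.M.finsum_cong'[OF refl])
        fix w assume w: "w \<in> P"
        show "t w w \<odot>\<^bsub>M\<^esub> (t x x \<odot>\<^bsub>E\<^esub> u) w = t x x \<odot>\<^bsub>M\<^esub> (t w w \<odot>\<^bsub>M\<^esub> u w)"
          using u ux uM[OF u] 2 rel_refl[of x]
          by (cases "w = x") (simp_all add: E' M.smult_assoc[symmetric] t_orth M.smult_zero_left M.smult_zero_right)
      qed (use cl[OF u] in auto)
    next
      case (3 g)
      have "ev (b \<odot>\<^bsub>E\<^esub> u) = (\<Oplus>\<^bsub>M\<^esub>x\<in>\<phi> g ` P. t x x \<odot>\<^bsub>M\<^esub> (b \<odot>\<^bsub>E\<^esub> u) x)"
        unfolding ev_def using act_bij[OF 3(2)] by (simp add: bij_betw_def)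
      also have "\<dots> = (\<Oplus>\<^bsub>M\<^esub>x\<in>P. t (\<phi> g x) (\<phi> g x) \<odot>\<^bsub>M\<^esub> (b \<odot>\<^bsub>E\<^esub> u) (\<phi> g x))"
        using act_bij[OF 3(2)] cl[OF E.smult_closed[OF bA u]] by (intro M.M.finsum_reindex) (auto simp: bij_betw_def)
      also have "\<dots> = (\<Oplus>\<^bsub>M\<^esub>x\<in>P. b \<odot>\<^bsub>M\<^esub> (t x x \<odot>\<^bsub>M\<^esub> u x))"
        using 3 u uM[OF u] bA
        by (intro M.M.finsum_cong') (auto simp: E' act_closed act_inv M.smult_assoc[symmetric] hat_t)
      finally show ?thesis .
    qed
    then show "ev (b \<odot>\<^bsub>E\<^esub> u) = b \<odot>\<^bsub>M\<^esub> ev u"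
      using cl[OF u] M.smult_finsum[OF bA, of "\<lambda>x. t x x \<odot>\<^bsub>M\<^esub> u x" P] by (simp add: ev_def)
  qed
  \<comment> \<open>The element \<open>up x\<close> sends \<open>u x\<close> to every w \<ge> x,
    where \<open>ev\<close> picks its component at w; together these components are
    \<open>u x\<close>.\<close>
  have recover: "ev (up x \<odot>\<^bsub>E\<^esub> u) = u x" if u: "u \<in> carrier E" and x: "x \<in> P" for u x
  proof -
    have "(up x \<odot>\<^bsub>E\<^esub> u) w = (if (x, w) \<in> r then es (hi w) \<odot>\<^bsub>M\<^esub> u x else \<zero>\<^bsub>M\<^esub>)" if w: "w \<in> P" for w
    proof -
      have "up x \<odot>\<^bsub>E\<^esub> u = (\<Oplus>\<^bsub>E\<^esub>z\<in>P. t x z \<odot>\<^bsub>E\<^esub> u)"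
        using u by (simp add: up_sum E.finsum_smult)
      then have "(up x \<odot>\<^bsub>E\<^esub> u) w = (\<Oplus>\<^bsub>M\<^esub>z\<in>P. (t x z \<odot>\<^bsub>E\<^esub> u) w)" using u by (simp add: kan_finsum[OF M E])
      also have "\<dots> = (t x w \<odot>\<^bsub>E\<^esub> u) w"
      proof (rule M.M.finsum_single[OF finite_P w])
        show "(t x w \<odot>\<^bsub>E\<^esub> u) w \<in> carrier M" using uM u by simp
        show "(t x z \<odot>\<^bsub>E\<^esub> u) w = \<zero>\<^bsub>M\<^esub>" if "z \<noteq> w" for z
          using that u by (cases "(x, z) \<in> r") (simp_all add: E' t_zero E.smult_zero_left)
      qed
      also have "\<dots> = (if (x, w) \<in> r then es (hi w) \<odot>\<^bsub>M\<^esub> u x else \<zero>\<^bsub>M\<^esub>)"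
        using u by (cases "(x, w) \<in> r") (simp_all add: E' t_zero E.smult_zero_left)
      finally show ?thesis .
    qed
    then have "ev (up x \<odot>\<^bsub>E\<^esub> u) = (\<Oplus>\<^bsub>M\<^esub>w\<in>P. t w w \<odot>\<^bsub>M\<^esub> u x)"
      unfolding ev_def
    proof (intro M.M.finsum_cong'[OF refl])
      fix w assume w: "w \<in> P" and *: "\<And>w. w \<in> P \<Longrightarrow> (up x \<odot>\<^bsub>E\<^esub> u) w = (if (x, w) \<in> r then es (hi w) \<odot>\<^bsub>M\<^esub> u x else \<zero>\<^bsub>M\<^esub>)"
      have "t w w \<odot>\<^bsub>M\<^esub> u x = t w w \<odot>\<^bsub>M\<^esub> (es (hi x) \<odot>\<^bsub>M\<^esub> u x)" using u x by (simp add: E_iff)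
      then have "t w w \<odot>\<^bsub>M\<^esub> u x = \<zero>\<^bsub>M\<^esub>" if "(x, w) \<notin> r"
        using uM[OF u] that by (simp add: M.smult_assoc[symmetric] t_es M.smult_zero_left)
      then show "t w w \<odot>\<^bsub>M\<^esub> (up x \<odot>\<^bsub>E\<^esub> u) w = t w w \<odot>\<^bsub>M\<^esub> u x"
        using w uM[OF u] rel_refl[OF w] by (auto simp: * M.smult_assoc[symmetric] t_es M.smult_zero_right)
    qed (use uM[OF u] in auto)
    then show ?thesis using one_act[OF M] uM[OF u] by simp
  qed
  have inj: "injective_module A E"
  proof (rule injective_moduleI[OF fgE])
    fix N L :: "'r std_module" and f g
    assume *: "fg_module A N" "fg_module A L" "lin (carrier A) N L f" "inj_on f (carrier N)" "lin (carrier A) N E g"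
    have N: "left_module A N" and L: "left_module A L" using *(1,2) by (auto intro: fg_module_left)
    interpret N: left_module A N by fact
    interpret L: left_module A L by fact
    obtain h where h: "lin B_gens L M h" "\<And>n. n \<in> carrier N \<Longrightarrow> h (f n) = ev (g n)"
      by (rule higman_extend[OF M hM N *(2-4) lin_comp[OF lin_AB[OF *(5)] ev]]) (rule that; assumption)
    let ?h = "\<lambda>n x. if x \<in> P then h (up x \<odot>\<^bsub>L\<^esub> n) else \<zero>\<^bsub>M\<^esub>"
    have "?h (f n) = g n" if n: "n \<in> carrier N" for n
    proof
      fix x
      have gn: "g n \<in> carrier E" using lin_closed[OF *(5) n] .
      show "?h (f n) x = g n x"
      proof (cases "x \<in> P")
        case True
        have "h (up x \<odot>\<^bsub>L\<^esub> f n) = h (f (up x \<odot>\<^bsub>N\<^esub> n))" using n by (simp add: lin_smult[OF *(3)])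
        also have "\<dots> = ev (up x \<odot>\<^bsub>E\<^esub> g n)" using n by (simp add: h(2) N.smult_closed lin_smult[OF *(5)])
        finally show ?thesis using True recover[OF gn True] by simp
      next
        case False
        then show ?thesis using gn by (simp add: E_iff)
      qed
    qed
    then show "\<exists>h. lin (carrier A) L E h \<and> (\<forall>x\<in>carrier N. h (f x) = g x)"
      using right_kan_ext[OF M L E h(1)] by blast
  qed
  define \<mu> where "\<mu> = (\<lambda>m x. if x \<in> P then up x \<odot>\<^bsub>M\<^esub> m else \<zero>\<^bsub>M\<^esub>)"
  have \<mu>: "lin (carrier A) M E \<mu>" unfolding \<mu>_def by (rule right_kan_ext[OF M M E lin_id])
  note \<mu>c = lin_closed[OF \<mu>]
  have ev\<mu>: "ev (\<mu> m) = m" if m: "m \<in> carrier M" for m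
  proof -
    have "ev (\<mu> m) = (\<Oplus>\<^bsub>M\<^esub>x\<in>P. t x x \<odot>\<^bsub>M\<^esub> m)"
      unfolding ev_def using m by (intro M.M.finsum_cong') (auto simp: \<mu>_def M.smult_assoc[symmetric] t_up)
    then show ?thesis using one_act[OF M m] by simp
  qed
  have inj\<mu>: "inj_on \<mu> (carrier M)" using ev\<mu> by (metis inj_onI)
  \<comment> \<open>Idempotent because \<open>ev\<close> retracts \<open>\<mu>\<close>, with the
    image of \<open>\<mu>\<close> as kernel.\<close>
  define pr where "pr u = u \<ominus>\<^bsub>E\<^esub> \<mu> (ev u)" for u
  have \<mu>ev: "lin {} E E (\<lambda>u. \<mu> (ev u))"
    by (rule lin_comp[OF lin_mono[OF ev] lin_mono[OF \<mu>]]) auto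
  note \<mu>evc = lin_closed[OF \<mu>ev]
  have pr: "lin {} E E pr"
  proof (rule linI)
    fix u v assume "u \<in> carrier E" "v \<in> carrier E"
    then show "pr (u \<oplus>\<^bsub>E\<^esub> v) = pr u \<oplus>\<^bsub>E\<^esub> pr v"
      by (simp add: pr_def lin_add[OF \<mu>ev] \<mu>evc a_minus_def E.M.minus_add E.M.a_ac)
  qed (auto simp: pr_def \<mu>evc)
  have pr\<mu>: "pr (\<mu> m) = \<zero>\<^bsub>E\<^esub>" if "m \<in> carrier M" for m
    using that by (simp add: pr_def ev\<mu> \<mu>c)
  have pr0: "pr u = \<zero>\<^bsub>E\<^esub> \<longleftrightarrow> u \<in> \<mu> ` carrier M" if u: "u \<in> carrier E" for u
  proof
    assume "pr u = \<zero>\<^bsub>E\<^esub>"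
    then have "u = \<mu> (ev u)" using u \<mu>evc by (simp add: pr_def E.M.minus_eq_zero_iff)
    then show "u \<in> \<mu> ` carrier M" using lin_closed[OF ev u] by blast
  qed (auto simp: pr\<mu>)
  have idem: "pr (pr u) = pr u" if u: "u \<in> carrier E" for u
  proof -
    have "pr (pr u) = pr u \<ominus>\<^bsub>E\<^esub> pr (\<mu> (ev u))"
      using additive_minus[OF E.M.abelian_group_axioms E.M.abelian_group_axioms pr u \<mu>evc[OF u]] by (simp add: pr_def)
    then show ?thesis using lin_closed[OF pr u] pr\<mu>[OF lin_closed[OF ev u]] by (simp add: a_minus_def)
  qed
  have ker: "pr (a \<odot>\<^bsub>E\<^esub> u) = \<zero>\<^bsub>E\<^esub>" if a: "a \<in> carrier A" and u: "u \<in> carrier E" and z: "pr u = \<zero>\<^bsub>E\<^esub>" for a u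
  proof -
    obtain m where m: "m \<in> carrier M" "u = \<mu> m" using pr0[OF u] z by auto
    then show ?thesis using pr\<mu>[of "a \<odot>\<^bsub>M\<^esub> m"] a lin_smult[OF \<mu> a m(1)] by simp
  qed
  let ?C = "E\<lparr>carrier := pr ` carrier E, smult := \<lambda>a u. pr (a \<odot>\<^bsub>E\<^esub> u)\<rparr>"
  note C = quotient_module[OF E.left_module_axioms pr idem ker]
  have q: "pr ` carrier E = carrier ?C" by simp
  have fgC: "fg_module A ?C" by (rule fg_image[OF fgE C q])
  have kerC: "module_kernel E ?C pr = \<mu> ` carrier M"
    using pr0 \<mu>c by (auto simp: module_kernel_def)
  have "\<exists>y. (x, y) \<in> r \<and> y \<noteq> x \<and> supp M y" if x: "x \<in> P" and s: "supp ?C x" for x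
  proof (rule ccontr)
    assume no: "\<not> (\<exists>y. (x, y) \<in> r \<and> y \<noteq> x \<and> supp M y)"
    obtain c where "c \<in> pr ` carrier E" and nz: "pr (t x x \<odot>\<^bsub>E\<^esub> c) \<noteq> \<zero>\<^bsub>E\<^esub>"
      using s by (auto simp: supp_def)
    then have c: "c \<in> carrier E" using lin_closed[OF pr] by auto
    have cx: "c x \<in> carrier M" "es (hi x) \<odot>\<^bsub>M\<^esub> c x = c x" using c x by (simp_all add: E_iff)
    \<comment> \<open>With nothing in \<open>M\<close> strictly above x, \<open>up x\<close> acts as
      the identity morphism at x. Hence the part of \<open>c\<close> at x is
      \<open>\<mu> (c x)\<close> and dies in the cokernel.\<close>
    have single: "up x \<odot>\<^bsub>M\<^esub> m = t x x \<odot>\<^bsub>M\<^esub> m" if m: "m \<in> carrier M" for m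
    proof -
      have tz: "t x z \<odot>\<^bsub>M\<^esub> m = \<zero>\<^bsub>M\<^esub>" if "z \<noteq> x" for z
      proof (cases "(x, z) \<in> r")
        case True
        then have "t z z \<odot>\<^bsub>M\<^esub> (t x z \<odot>\<^bsub>M\<^esub> m) = \<zero>\<^bsub>M\<^esub>" using no that m by (auto simp: supp_def)
        then show ?thesis using m by (simp add: M.smult_assoc[symmetric])
      qed (simp add: t_zero m M.smult_zero_left)
      have "up x \<odot>\<^bsub>M\<^esub> m = (\<Oplus>\<^bsub>M\<^esub>z\<in>P. t x z \<odot>\<^bsub>M\<^esub> m)" using m by (simp add: up_sum M.finsum_smult)
      also have "\<dots> = t x x \<odot>\<^bsub>M\<^esub> m" using x finite_P tz m by (intro M.M.finsum_single) auto
      finally show ?thesis .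
    qed
    have "c x = (\<Oplus>\<^bsub>M\<^esub>z\<in>hi x \<inter> P. t z z \<odot>\<^bsub>M\<^esub> c x)"
      using cx by (simp add: es_sum M.finsum_smult)
    also have "\<dots> = t x x \<odot>\<^bsub>M\<^esub> c x"
      using no x rel_refl finite_P cx by (intro M.M.finsum_single) (auto simp: supp_def)
    finally have tcx: "t x x \<odot>\<^bsub>M\<^esub> c x = c x" by simp
    have up0: "up w \<odot>\<^bsub>M\<^esub> c x = (if w = x then c x else \<zero>\<^bsub>M\<^esub>)" for w
    proof (cases "w = x")
      case True
      then show ?thesis using single[OF cx(1)] tcx by simp
    next
      case False
      have "up w \<odot>\<^bsub>M\<^esub> (t x x \<odot>\<^bsub>M\<^esub> c x) = \<zero>\<^bsub>M\<^esub>"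
        using False cx up_t[OF rel_refl[OF x], of w] by (simp add: M.smult_assoc[symmetric] M.smult_zero_left)
      then show ?thesis using False tcx by simp
    qed
    have "t x x \<odot>\<^bsub>E\<^esub> c = \<mu> (c x)"
      using c x cx rel_refl[OF x] by (auto simp: E' \<mu>_def fun_eq_iff up0)
    then show False using nz pr\<mu>[OF cx(1)] by simp
  qed
  with inj \<mu> inj\<mu> fgC C(2) q kerC show thesis by (rule that)
qed

section \<open>Homological dimensions\<close>

text \<open>The recursion matches the dimension shift: the kernel of a cover lives strictly higher,
  so each syzygy uses up one step of a chain.\<close>

primrec up_chain :: "nat \<Rightarrow> 'p \<Rightarrow> bool" where
  "up_chain 0 x \<longleftrightarrow> True"
| "up_chain (Suc n) x \<longleftrightarrow> (\<exists>y. (x, y) \<in> r \<and> y \<noteq> x \<and> up_chain n y)"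

primrec down_chain :: "nat \<Rightarrow> 'p \<Rightarrow> bool" where
  "down_chain 0 x \<longleftrightarrow> True"
| "down_chain (Suc n) x \<longleftrightarrow> (\<exists>y. (y, x) \<in> r \<and> y \<noteq> x \<and> down_chain n y)"

text \<open>Each object in the support of the kernel lies strictly above one in the support of
  \<open>M\<close>, so a chain starting there would extend downwards by one step to a chain that is
  excluded for \<open>M\<close>.\<close>

lemma higman_projective_resolution:
  fixes M :: "'r std_module"
  assumes "fg_module A M" "higman M" "\<And>x. x \<in> P \<Longrightarrow> supp M x \<Longrightarrow> \<not> up_chain (Suc n) x"
  shows "\<exists>Q d \<epsilon>. projective_resolution A M n Q d \<epsilon>"
  using assms
proof (induction n arbitrary: M)
  \<comment> \<open>No strict chain of one step starts in the support of \<open>M\<close>, so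
    nothing lies strictly above it; the kernel vanishes and the cover is an isomorphism.\<close>
  case (0 M)
  note step = left_kan_cover[OF 0(1,2)]
  obtain E :: "('r, 'p \<Rightarrow> nat \<Rightarrow> 'r) module" and \<epsilon> where E: "projective_module A E" "lin (carrier A) E M \<epsilon>"
    "\<epsilon> ` carrier E = carrier M"
    and ker: "\<And>u y. u \<in> module_kernel E M \<epsilon> \<Longrightarrow> y \<in> P \<Longrightarrow> t y y \<odot>\<^bsub>E\<^esub> u \<noteq> \<zero>\<^bsub>E\<^esub> \<Longrightarrow> \<exists>z. (z, y) \<in> r \<and> z \<noteq> y \<and> supp M z"
    by (rule step) (rule that; assumption)
  have M: "left_module A M" using 0(1) by (rule fg_module_left)
  have E': "left_module A E" using E(1) by (simp add: projective_module_fg fg_module_left)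
  interpret M: left_module A M by fact
  interpret E: left_module A E by fact
  have "t y y \<odot>\<^bsub>E\<^esub> u = \<zero>\<^bsub>E\<^esub>" if "u \<in> module_kernel E M \<epsilon>" "y \<in> P" for u y
    using ker[OF that] 0(3) rel_P by fastforce
  then have k0: "u = \<zero>\<^bsub>E\<^esub>" if u: "u \<in> module_kernel E M \<epsilon>" for u
    using u one_act[OF E', of u] E.M.finsum_zero by (simp add: module_kernel_def cong: E.M.finsum_cong)
  have "inj_on \<epsilon> (carrier E)"
  proof (rule inj_onI)
    fix u v assume uv: "u \<in> carrier E" "v \<in> carrier E" "\<epsilon> u = \<epsilon> v"
    then have "u \<ominus>\<^bsub>E\<^esub> v \<in> module_kernel E M \<epsilon>"
      using lin_closed[OF E(2)]
      by (simp add: module_kernel_def additive_minus[OF E.M.abelian_group_axioms M.M.abelian_group_axioms E(2)])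
    then show "u = v" using k0 uv E.M.minus_eq_zero_iff by blast
  qed
  then have "projective_module A M"
    using projective_module_iso[OF E(1,2) _ M] E(3) by (simp add: bij_betw_def)
  then show ?case by (rule projective_resolution_zero)
next
  case (Suc n M)
  note step = left_kan_cover[OF Suc.prems(1,2)]
  obtain E :: "('r, 'p \<Rightarrow> nat \<Rightarrow> 'r) module" and \<epsilon> where E: "projective_module A E" "lin (carrier A) E M \<epsilon>"
    "\<epsilon> ` carrier E = carrier M"
    and ker: "\<And>u y. u \<in> module_kernel E M \<epsilon> \<Longrightarrow> y \<in> P \<Longrightarrow> t y y \<odot>\<^bsub>E\<^esub> u \<noteq> \<zero>\<^bsub>E\<^esub> \<Longrightarrow> \<exists>z. (z, y) \<in> r \<and> z \<noteq> y \<and> supp M z"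
    by (rule step) (rule that; assumption)
  have M: "left_module A M" using Suc.prems(1) by (rule fg_module_left)
  have E': "left_module A E" using E(1) by (simp add: projective_module_fg fg_module_left)
  \<comment> \<open>The cover lives on functions with values in the carrier of \<open>M\<close>.
    Copying it back to the standard type keeps the kernel within reach of the induction
    hypothesis.\<close>
  obtain Q :: "'r std_module" and i j where Q: "fg_module A Q" "lin (carrier A) E Q i" "lin (carrier A) Q E j"
    "bij_betw i (carrier E) (carrier Q)" "bij_betw j (carrier Q) (carrier E)"
    using std_copy[OF projective_module_fg[OF E(1)]] by metis
  have Q': "left_module A Q" using Q(1) by (rule fg_module_left)
  have pQ: "projective_module A Q" by (rule projective_module_iso[OF E(1) Q(2,4) Q'])
  let ?\<epsilon> = "\<lambda>x. \<epsilon> (j x)"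
  have \<epsilon>: "lin (carrier A) Q M ?\<epsilon>" by (rule lin_comp[OF Q(3) E(2)])
  have surj: "?\<epsilon> ` carrier Q = carrier M" using Q(5) E(3) by (metis bij_betw_def image_image)
  let ?K = "Q\<lparr>carrier := module_kernel Q M ?\<epsilon>\<rparr>"
  have K: "left_module A ?K" by (rule kernel_module[OF Q' M \<epsilon>])
  have sub: "module_kernel Q M ?\<epsilon> \<subseteq> carrier Q" by (auto simp: module_kernel_def)
  have fgK: "fg_module A ?K" by (rule submodule_fg[OF Q(1) K sub])
  have incl: "lin (carrier A) ?K Q (\<lambda>x. x)" using sub by (auto simp: lin_def)
  have hK: "higman ?K"
    by (rule higman_kernel[OF K Q(1) projective_higman[OF pQ] M Suc.prems(2) incl _ \<epsilon> surj]) auto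
  have "\<not> up_chain (Suc n) y" if y: "y \<in> P" "supp ?K y" for y
  proof
    assume up: "up_chain (Suc n) y"
    obtain u where u: "u \<in> module_kernel Q M ?\<epsilon>" "t y y \<odot>\<^bsub>Q\<^esub> u \<noteq> \<zero>\<^bsub>Q\<^esub>" using y(2) by (auto simp: supp_def)
    then have uQ: "u \<in> carrier Q" using sub by auto
    interpret Q: left_module A Q by fact
    have "j (t y y \<odot>\<^bsub>Q\<^esub> u) \<noteq> j \<zero>\<^bsub>Q\<^esub>"
      using u uQ bij_betw_imp_inj_on[OF Q(5), THEN inj_onD] Q.smult_closed by fastforce
    then have "t y y \<odot>\<^bsub>E\<^esub> j u \<noteq> \<zero>\<^bsub>E\<^esub>"
      using additive_zero[OF left_module_group[OF Q'] left_module_group[OF E'] Q(3)] uQ lin_smult[OF Q(3)] by simp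
    moreover have "j u \<in> module_kernel E M \<epsilon>" using u(1) lin_closed[OF Q(3)] by (auto simp: module_kernel_def)
    ultimately obtain z where z: "(z, y) \<in> r" "z \<noteq> y" "supp M z" using ker y(1) by blast
    then have "up_chain (Suc (Suc n)) z" using up by auto
    then show False using Suc.prems(3)[of z] z rel_P[OF z(1)] by simp
  qed
  then have "\<exists>Q d \<epsilon>. projective_resolution A ?K n Q d \<epsilon>" by (rule Suc.IH[OF fgK hK])
  then show ?case by (rule projective_resolution_step[OF pQ \<epsilon> surj])
qed

text \<open>Dual induction on the cokernels, whose support lies strictly below that of
  \<open>M\<close>. Both the hull and the cokernel are copied back to the standard type.\<close>

lemma higman_injective_resolution:
  fixes M :: "'r std_module"
  assumes "fg_module A M" "higman M" "\<And>x. x \<in> P \<Longrightarrow> supp M x \<Longrightarrow> \<not> down_chain (Suc n) x"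
  shows "\<exists>Q d \<eta>. injective_resolution A M n Q d \<eta>"
  using assms
proof (induction n arbitrary: M)
  case (0 M)
  note step = right_kan_hull[OF 0(1,2)]
  obtain E C :: "('r, 'p \<Rightarrow> nat \<Rightarrow> 'r) module" and \<mu> q where E: "injective_module A E" "lin (carrier A) M E \<mu>"
    "inj_on \<mu> (carrier M)" "fg_module A C" "lin (carrier A) E C q" "q ` carrier E = carrier C"
    "module_kernel E C q = \<mu> ` carrier M"
    and sC: "\<And>x. x \<in> P \<Longrightarrow> supp C x \<Longrightarrow> \<exists>y. (x, y) \<in> r \<and> y \<noteq> x \<and> supp M y"
    by (rule step) (rule that; assumption)
  have M: "left_module A M" using 0(1) by (rule fg_module_left)
  have E': "left_module A E" using E(1) by (simp add: injective_module_fg fg_module_left)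
  have C: "left_module A C" using E(4) by (rule fg_module_left)
  interpret C: left_module A C by fact
  have "\<not> supp C x" if "x \<in> P" for x
    using sC[OF that] 0(3) rel_P by fastforce
  then have "c = \<zero>\<^bsub>C\<^esub>" if "c \<in> carrier C" for c
    using supp_zero[OF C _ that] by blast
  then have "carrier E \<subseteq> module_kernel E C q" using lin_closed[OF E(5)] by (auto simp: module_kernel_def)
  then have surj: "\<mu> ` carrier M = carrier E" using E(7) by (auto simp: module_kernel_def)
  then have bij: "bij_betw \<mu> (carrier M) (carrier E)" using E(3) by (simp add: bij_betw_def)
  have "injective_module A M"
    using injective_module_iso[OF E(1) lin_inverse[OF left_module_group[OF M] M E(2) bij] bij_betw_inv_into[OF bij] M] by simp
  then show ?case by (rule injective_resolution_zero)
next
  case (Suc n M)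
  note step = right_kan_hull[OF Suc.prems(1,2)]
  obtain E C :: "('r, 'p \<Rightarrow> nat \<Rightarrow> 'r) module" and \<mu> q where E: "injective_module A E" "lin (carrier A) M E \<mu>"
    "inj_on \<mu> (carrier M)" "fg_module A C" "lin (carrier A) E C q" "q ` carrier E = carrier C"
    "module_kernel E C q = \<mu> ` carrier M"
    and sC: "\<And>x. x \<in> P \<Longrightarrow> supp C x \<Longrightarrow> \<exists>y. (x, y) \<in> r \<and> y \<noteq> x \<and> supp M y"
    by (rule step) (rule that; assumption)
  have M: "left_module A M" using Suc.prems(1) by (rule fg_module_left)
  have E': "left_module A E" using E(1) by (simp add: injective_module_fg fg_module_left)
  have C: "left_module A C" using E(4) by (rule fg_module_left)
  obtain Q :: "'r std_module" and i j where Q: "fg_module A Q" "lin (carrier A) E Q i" "lin (carrier A) Q E j"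
    "bij_betw i (carrier E) (carrier Q)" "bij_betw j (carrier Q) (carrier E)"
    "\<And>x. x \<in> carrier E \<Longrightarrow> j (i x) = x" "\<And>y. y \<in> carrier Q \<Longrightarrow> i (j y) = y"
    using std_copy[OF injective_module_fg[OF E(1)]] by metis
  obtain C' :: "'r std_module" and k l where C': "fg_module A C'" "lin (carrier A) C C' k" "lin (carrier A) C' C l"
    "bij_betw k (carrier C) (carrier C')" "bij_betw l (carrier C') (carrier C)"
    using std_copy[OF E(4)] by metis
  have Q': "left_module A Q" and C'': "left_module A C'" using Q(1) C'(1) by (auto intro: fg_module_left)
  interpret C: left_module A C by fact
  interpret C': left_module A C' by fact
  have iQ: "injective_module A Q" by (rule injective_module_iso[OF E(1) Q(2,4) Q'])
  let ?\<mu> = "\<lambda>x. i (\<mu> x)" and ?q = "\<lambda>x. k (q (j x))"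
  have \<mu>: "lin (carrier A) M Q ?\<mu>" by (rule lin_comp[OF E(2) Q(2)])
  have inj: "inj_on ?\<mu> (carrier M)"
  proof -
    have "\<mu> ` carrier M \<subseteq> carrier E" using lin_closed[OF E(2)] by auto
    then show ?thesis
      using comp_inj_on[OF E(3), of i] inj_on_subset[OF bij_betw_imp_inj_on[OF Q(4)]] by (simp add: comp_def)
  qed
  have q: "lin (carrier A) Q C' ?q" by (rule lin_comp[OF lin_comp[OF Q(3) E(5)] C'(2)])
  have surj: "?q ` carrier Q = carrier C'"
    using Q(5) E(6) C'(4) by (metis bij_betw_def image_image)
  have k0: "k c = \<zero>\<^bsub>C'\<^esub> \<longleftrightarrow> c = \<zero>\<^bsub>C\<^esub>" if "c \<in> carrier C" for c
    using bij_betw_imp_inj_on[OF C'(4), THEN inj_onD, of c "\<zero>\<^bsub>C\<^esub>"] that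
      additive_zero[OF C.M.abelian_group_axioms C'.M.abelian_group_axioms C'(2)] by auto
  have ker: "module_kernel Q C' ?q = ?\<mu> ` carrier M"
  proof (intro subset_antisym subsetI)
    fix x assume x: "x \<in> module_kernel Q C' ?q"
    then have xQ: "x \<in> carrier Q" and "q (j x) = \<zero>\<^bsub>C\<^esub>"
      using k0 lin_closed[OF E(5) lin_closed[OF Q(3)]] by (auto simp: module_kernel_def)
    then have "j x \<in> \<mu> ` carrier M" using E(7) lin_closed[OF Q(3)] by (auto simp: module_kernel_def)
    then obtain m where "m \<in> carrier M" "j x = \<mu> m" by auto
    then show "x \<in> ?\<mu> ` carrier M" using Q(7)[OF xQ] by (metis image_eqI)
  next
    fix x assume "x \<in> ?\<mu> ` carrier M"
    then obtain m where m: "m \<in> carrier M" "x = i (\<mu> m)" by auto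
    have "q (\<mu> m) = \<zero>\<^bsub>C\<^esub>" using E(7) m(1) by (auto simp: module_kernel_def)
    then show "x \<in> module_kernel Q C' ?q"
      using m Q(6)[OF lin_closed[OF E(2) m(1)]] k0[OF C.M.zero_closed] lin_closed[OF \<mu> m(1)]
      by (auto simp: module_kernel_def)
  qed
  have hC: "higman C'"
    by (rule higman_cokernel[OF M Suc.prems(2) Q(1) injective_higman[OF iQ] C'' \<mu> inj q surj ker])
  have "\<not> down_chain (Suc n) x" if x: "x \<in> P" "supp C' x" for x
  proof
    assume down: "down_chain (Suc n) x"
    have "supp C x" by (rule supp_inj[OF C'(3) bij_betw_imp_inj_on[OF C'(5)] C'' C x(2)])
    then obtain y where y: "(x, y) \<in> r" "y \<noteq> x" "supp M y" using sC x(1) by blast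
    then have "down_chain (Suc (Suc n)) y" using down by auto
    then show False using Suc.prems(3)[of y] y rel_P[OF y(1)] by simp
  qed
  then have "\<exists>Q d \<eta>. injective_resolution A C' n Q d \<eta>" by (rule Suc.IH[OF C'(1) hC])
  then show ?case by (rule injective_resolution_step[OF iQ \<mu> inj q surj ker C''])
qed

section \<open>Chains and the dimension of the poset\<close>

lemma up_chain_strict:
  "x \<in> P \<Longrightarrow> up_chain n x \<Longrightarrow> \<exists>c. c 0 = x \<and> (\<forall>i\<le>n. c i \<in> P) \<and> (\<forall>i<n. (c i, c (Suc i)) \<in> r \<and> c i \<noteq> c (Suc i))"
proof (induction n arbitrary: x)
  case 0
  then show ?case by (intro exI[of _ "\<lambda>_. x"]) simp
next
  case (Suc n x)
  then obtain y where y: "(x, y) \<in> r" "y \<noteq> x" "up_chain n y" by auto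
  then obtain c where c: "c 0 = y" "\<forall>i\<le>n. c i \<in> P" "\<forall>i<n. (c i, c (Suc i)) \<in> r \<and> c i \<noteq> c (Suc i)"
    using Suc.IH[of y] rel_P by blast
  show ?case
    using c y Suc.prems(1)
    by (intro exI[of _ "case_nat x c"]) (auto split: nat.splits)
qed

lemma down_chain_strict:
  "x \<in> P \<Longrightarrow> down_chain n x \<Longrightarrow> \<exists>c. c n = x \<and> (\<forall>i\<le>n. c i \<in> P) \<and> (\<forall>i<n. (c i, c (Suc i)) \<in> r \<and> c i \<noteq> c (Suc i))"
proof (induction n arbitrary: x)
  case 0
  then show ?case by (intro exI[of _ "\<lambda>_. x"]) simp
next
  case (Suc n x)
  then obtain y where y: "(y, x) \<in> r" "y \<noteq> x" "down_chain n y" by auto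
  then obtain c where c: "c n = y" "\<forall>i\<le>n. c i \<in> P" "\<forall>i<n. (c i, c (Suc i)) \<in> r \<and> c i \<noteq> c (Suc i)"
    using Suc.IH[of y] rel_P by blast
  have "(if i \<le> n then c i else x, if Suc i \<le> n then c (Suc i) else x) \<in> r \<and>
      (if i \<le> n then c i else x) \<noteq> (if Suc i \<le> n then c (Suc i) else x)" if "i < Suc n" for i
    using c y that by (cases "i = n") auto
  then show ?case
    using c y Suc.prems(1)
    by (intro exI[of _ "\<lambda>i. if i \<le> n then c i else x"]) auto
qed

text \<open>A strict chain visits distinct elements, so its length is bounded by the cardinality of
  \<open>P\<close>. This makes the set in \<open>poset_dim\<close> finite and its \<open>Max\<close>
  an upper bound.\<close>

lemma strict_chain_length:
  assumes "\<forall>i\<le>n. c i \<in> P" "\<forall>i<n. (c i, c (Suc i)) \<in> r \<and> c i \<noteq> c (Suc i)"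
  shows "n \<le> poset_dim P r"
proof -
  let ?L = "{n. \<exists>c. (\<forall>i\<le>n. c i \<in> P) \<and> (\<forall>i<n. (c i, c (Suc i)) \<in> r \<and> c i \<noteq> c (Suc i))}"
  have "?L \<subseteq> {..card P}"
  proof
    fix n assume "n \<in> ?L"
    then obtain c where c: "\<forall>i\<le>n. c i \<in> P" "\<forall>i<n. (c i, c (Suc i)) \<in> r \<and> c i \<noteq> c (Suc i)" by auto
    \<comment> \<open>Consecutive inequality alone does not exclude a return to an earlier element;
      antisymmetry does.\<close>
    have lt: "(c i, c (i + d)) \<in> r \<and> (d > 0 \<longrightarrow> c i \<noteq> c (i + d))" if "i + d \<le> n" for i d
      using that
    proof (induction d)
      case 0
      then show ?case using c(1) rel_refl by simp
    next
      case (Suc d)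
      then have *: "(c i, c (i + d)) \<in> r" "(c (i + d), c (Suc (i + d))) \<in> r" "c (i + d) \<noteq> c (Suc (i + d))"
        using c(2) by auto
      then show ?case using rel_trans[OF *(1,2)] rel_antisym[of "c (i + d)" "c (Suc (i + d))"] by auto
    qed
    have "inj_on c {..n}"
    proof (rule linorder_inj_onI)
      fix i j assume "i < j" "i \<in> {..n}" "j \<in> {..n}"
      then show "c i \<noteq> c j" using lt[of i "j - i"] by simp
    qed auto
    then have "card {..n} \<le> card P" using c(1) finite_P by (intro card_inj_on_le[of c]) auto
    then show "n \<in> {..card P}" by simp
  qed
  then have "finite ?L" by (rule finite_subset) simp
  then show ?thesis unfolding poset_dim_def using assms by (intro Max_ge) auto
qed

lemma no_long_chain:
  assumes "x \<in> P"
  shows "\<not> up_chain (Suc (poset_dim P r)) x" "\<not> down_chain (Suc (poset_dim P r)) x"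
  using up_chain_strict[OF assms] down_chain_strict[OF assms] strict_chain_length Suc_n_not_le_n by metis+

theorem higman_dims:
  fixes M :: "('r, 'm) module"
  assumes "fg_module A M" "higman M"
  shows "proj_dim A M \<le> enat (poset_dim P r)" "inj_dim A M \<le> enat (poset_dim P r)"
proof -
  obtain N :: "'r std_module" and i j where N: "fg_module A N" "lin (carrier A) M N i" "lin (carrier A) N M j"
    "bij_betw i (carrier M) (carrier N)" "bij_betw j (carrier N) (carrier M)"
    "\<And>x. x \<in> carrier M \<Longrightarrow> j (i x) = x" "\<And>y. y \<in> carrier N \<Longrightarrow> i (j y) = y"
    using std_copy[OF assms(1)] by metis
  have M: "left_module A M" and N': "left_module A N" using assms(1) N(1) by (auto intro: fg_module_left)
  have hN: "higman N"
    by (rule higman_retract[OF N' M assms(2) lin_AB[OF N(3)] lin_AB[OF N(2)]]) (rule N(7))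
  obtain Q d \<epsilon> where "projective_resolution A N (poset_dim P r) Q d \<epsilon>"
    using higman_projective_resolution[OF N(1) hN, of "poset_dim P r"] no_long_chain(1) by blast
  from projective_resolution_iso[OF this N' M N(3,5)]
  show "proj_dim A M \<le> enat (poset_dim P r)" by (intro proj_dim_leI) blast
  obtain Q d \<eta> where "injective_resolution A N (poset_dim P r) Q d \<eta>"
    using higman_injective_resolution[OF N(1) hN, of "poset_dim P r"] no_long_chain(2) by blast
  from injective_resolution_iso[OF this N(2,4)]
  show "inj_dim A M \<le> enat (poset_dim P r)" by (intro inj_dim_leI) blast
qed

section \<open>Finite homological dimension implies Higman\<close>

lemma higman_zero:
  assumes "left_module A M" "carrier M = {\<zero>\<^bsub>M\<^esub>}"
  shows "higman M"
proof -
  interpret M: left_module A M by fact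
  have "lin D_gens M M (\<lambda>x. x)" by (rule lin_id)
  moreover have "tr M M (\<lambda>x. x) m = m" if "m \<in> carrier M" for m
    using lin_closed[OF tr_lin[OF assms(1,1) lin_id] that] that assms(2) by simp
  ultimately show ?thesis unfolding higman_def by blast
qed

text \<open>Work along the resolution from its far end. The image of \<open>d n\<close> is 0, the
  image of \<open>d i\<close> is the cokernel of the image of \<open>d (Suc i)\<close> in
  \<open>Q (Suc i)\<close>, and \<open>M\<close> is the cokernel of the image of \<open>d 0\<close>;
  \<open>higman_cokernel\<close> applies each time.\<close>

lemma proj_dim_higman:
  fixes M :: "('r, 'm) module"
  assumes M: "left_module A M" and fin: "proj_dim A M < \<infinity>"
  shows "higman M"
proof -
  obtain n Q d \<epsilon> where res: "projective_resolution A M n Q d \<epsilon>" using proj_dim_finiteE[OF fin] .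
  have Q: "projective_module A (Q i)" and d: "lin (carrier A) (Q (Suc i)) (Q i) (d i)"
    and ker: "module_kernel (Q (Suc i)) (Q i) (d i) = d (Suc i) ` carrier (Q (Suc (Suc i)))"
    and van: "i > n \<Longrightarrow> carrier (Q i) = {\<zero>\<^bsub>Q i\<^esub>}" for i
    using res by (auto simp: projective_resolution_def module_hom_iff_lin)
  have \<epsilon>: "lin (carrier A) (Q 0) M \<epsilon>" "\<epsilon> ` carrier (Q 0) = carrier M"
    "module_kernel (Q 0) M \<epsilon> = d 0 ` carrier (Q 1)"
    using res by (auto simp: projective_resolution_def module_hom_iff_lin)
  have Qfg: "fg_module A (Q i)" and Ql: "left_module A (Q i)" and Qh: "higman (Q i)" for i
    using projective_module_fg[OF Q] fg_module_left[OF projective_module_fg[OF Q]] projective_higman[OF Q] by auto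
  let ?Z = "\<lambda>i. (Q i)\<lparr>carrier := d i ` carrier (Q (Suc i))\<rparr>"
  have Z: "left_module A (?Z i)" for i by (rule image_module[OF Ql Ql d])
  have incl: "lin (carrier A) (?Z i) (Q i) (\<lambda>x. x)" for i using lin_closed[OF d[of i]] by (auto simp: lin_def)
  have onto: "lin (carrier A) (Q (Suc i)) (?Z i) (d i)" for i using d[of i] by (auto simp: lin_def)
  have step: "higman (?Z i)" if h: "higman (?Z (Suc i))" for i
    by (rule higman_cokernel[OF Z h Qfg Qh Z incl _ onto])
      (use ker[of i] in \<open>auto simp: module_kernel_def\<close>)
  have top: "higman (?Z n)"
  proof (rule higman_zero[OF Z])
    have "d n ` carrier (Q (Suc n)) = {\<zero>\<^bsub>Q n\<^esub>}"
      using van[of "Suc n"] additive_zero[OF left_module_group[OF Ql] left_module_group[OF Ql] d] by simp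
    then show "carrier (?Z n) = {\<zero>\<^bsub>?Z n\<^esub>}" by simp
  qed
  \<comment> \<open>Descending induction from n to 0, run upwards on the distance \<open>k\<close>
    from n.\<close>
  have "higman (?Z (n - k))" if "k \<le> n" for k
    using that
  proof (induction k)
    case (Suc k)
    then have "n - k = Suc (n - Suc k)" by simp
    then show ?case using Suc step[of "n - Suc k"] by simp
  qed (simp add: top)
  from this[of n] have h0: "higman (?Z 0)" by simp
  show ?thesis
    by (rule higman_cokernel[OF Z h0 Qfg Qh M incl _ \<epsilon>(1,2)]) (use \<epsilon>(3) in auto)
qed

text \<open>The same with kernels: the image of \<open>d i\<close> is the kernel of the map from
  \<open>Q (Suc i)\<close> onto the image of \<open>d (Suc i)\<close>, and \<open>M\<close> is the
  kernel of the map from \<open>Q 0\<close> onto the image of \<open>d 0\<close>.\<close>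

lemma inj_dim_higman:
  fixes M :: "('r, 'm) module"
  assumes M: "left_module A M" and fin: "inj_dim A M < \<infinity>"
  shows "higman M"
proof -
  obtain n Q d \<eta> where res: "injective_resolution A M n Q d \<eta>" using inj_dim_finiteE[OF fin] .
  have Q: "injective_module A (Q i)" and d: "lin (carrier A) (Q i) (Q (Suc i)) (d i)"
    and ker: "module_kernel (Q (Suc i)) (Q (Suc (Suc i))) (d (Suc i)) = d i ` carrier (Q i)"
    and van: "i > n \<Longrightarrow> carrier (Q i) = {\<zero>\<^bsub>Q i\<^esub>}" for i
    using res by (auto simp: injective_resolution_def module_hom_iff_lin)
  have \<eta>: "lin (carrier A) M (Q 0) \<eta>" "inj_on \<eta> (carrier M)"
    "module_kernel (Q 0) (Q 1) (d 0) = \<eta> ` carrier M"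
    using res by (auto simp: injective_resolution_def module_hom_iff_lin)
  have Qfg: "fg_module A (Q i)" and Ql: "left_module A (Q i)" and Qh: "higman (Q i)" for i
    using injective_module_fg[OF Q] fg_module_left[OF injective_module_fg[OF Q]] injective_higman[OF Q] by auto
  let ?Z = "\<lambda>i. (Q (Suc i))\<lparr>carrier := d i ` carrier (Q i)\<rparr>"
  have Z: "left_module A (?Z i)" for i by (rule image_module[OF Ql Ql d])
  have incl: "lin (carrier A) (?Z i) (Q (Suc i)) (\<lambda>x. x)" for i using lin_closed[OF d[of i]] by (auto simp: lin_def)
  have onto: "lin (carrier A) (Q i) (?Z i) (d i)" for i using d[of i] by (auto simp: lin_def)
  have step: "higman (?Z i)" if h: "higman (?Z (Suc i))" for i
    by (rule higman_kernel[OF Z Qfg Qh Z h incl _ onto])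
      (use ker[of i] in \<open>auto simp: module_kernel_def\<close>)
  have top: "higman (?Z n)"
  proof (rule higman_zero[OF Z])
    have "d n ` carrier (Q n) = {\<zero>\<^bsub>Q (Suc n)\<^esub>}"
    proof -
      have "d n x = \<zero>\<^bsub>Q (Suc n)\<^esub>" if "x \<in> carrier (Q n)" for x
        using lin_closed[OF d that] van[of "Suc n"] by simp
      moreover have "\<zero>\<^bsub>Q n\<^esub> \<in> carrier (Q n)"
        by (rule abelian_groupE(2)[OF left_module_group[OF Ql]])
      ultimately show ?thesis by (auto simp: image_iff)
    qed
    then show "carrier (?Z n) = {\<zero>\<^bsub>?Z n\<^esub>}" by simp
  qed
  have "higman (?Z (n - k))" if "k \<le> n" for k
    using that
  proof (induction k)
    case (Suc k)
    then have "n - k = Suc (n - Suc k)" by simp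
    then show ?case using Suc step[of "n - Suc k"] by simp
  qed (simp add: top)
  from this[of n] have h0: "higman (?Z 0)" by simp
  show ?thesis
    by (rule higman_kernel[OF M Qfg Qh Z h0 \<eta>(1,2) onto]) (use \<eta>(3) in \<open>auto simp: module_kernel_def\<close>)
qed

section \<open>Restriction to orbits\<close>

text \<open>The truncation of \<open>M\<close> to the objects in \<open>S\<close>, described by the
  fixed points of the idempotent \<open>es S\<close> instead of its image, which makes membership an
  equation.\<close>

definition restr :: "'p set \<Rightarrow> ('r, 'm) module \<Rightarrow> ('r, 'm) module" where
  "restr S M = M\<lparr>carrier := {m \<in> carrier M. es S \<odot>\<^bsub>M\<^esub> m = m}\<rparr>"

lemma restr_simps [simp]:
  "m \<in> carrier (restr S M) \<longleftrightarrow> m \<in> carrier M \<and> es S \<odot>\<^bsub>M\<^esub> m = m"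
  "zero (restr S M) = zero M" "add (restr S M) = add M" "smult (restr S M) = smult M"
  by (simp_all add: restr_def)

lemma restr_group:
  assumes "left_module A M"
  shows "abelian_group (restr S M)"
proof -
  interpret M: left_module A M by fact
  show ?thesis
  proof (rule abelian_groupI)
    fix x assume "x \<in> carrier (restr S M)"
    then show "\<exists>y\<in>carrier (restr S M). y \<oplus>\<^bsub>restr S M\<^esub> x = \<zero>\<^bsub>restr S M\<^esub>"
      by (intro bexI[of _ "\<ominus>\<^bsub>M\<^esub> x"]) (auto simp: M.M.l_neg M.smult_uminus)
  qed (auto simp: M.M.a_assoc M.smult_r_distr M.smult_zero_right intro: M.M.a_comm)
qed

lemma restr_finsum:
  assumes "left_module A M" "\<And>i. i \<in> I \<Longrightarrow> u i \<in> carrier (restr S M)"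
  shows "finsum (restr S M) u I = finsum M u I"
  using restr_group[OF assms(1), of S] assms(2)
  unfolding restr_def
  by (intro finsum_update_carrier left_module_group[OF assms(1)]) auto

text \<open>The Higman condition for the truncation to \<open>S\<close>, but expressed through
  operators of A on \<open>M\<close>, so that it can be compared with \<open>higman M\<close>
  without changing the algebra.\<close>

definition orbit_higman :: "'p set \<Rightarrow> ('r, 'm) module \<Rightarrow> bool" where
  "orbit_higman S M \<longleftrightarrow> (\<exists>\<theta>. lin (range \<kappa> \<union> (\<lambda>y. t y y) ` S) (restr S M) (restr S M) \<theta> \<and>
     (\<forall>m\<in>carrier (restr S M). tr M M \<theta> m = m))"

lemma restr_hat:
  assumes M: "left_module A M" and S: "S \<subseteq> P" "\<And>g y. g \<in> carrier G \<Longrightarrow> y \<in> S \<Longrightarrow> \<phi> g y \<in> S"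
    and g: "g \<in> carrier G" and m: "m \<in> carrier (restr S M)"
  shows "hat g \<odot>\<^bsub>M\<^esub> m \<in> carrier (restr S M)"
proof -
  interpret M: left_module A M by fact
  have "z \<in> S \<longleftrightarrow> \<phi> g z \<in> S" if "z \<in> P" for z
    using S(2)[OF g, of z] S(2)[OF inv_closed[OF g], of "\<phi> g z"] act_inv[OF g that] by auto
  then have c: "hat g \<otimes>\<^bsub>A\<^esub> es S = es S \<otimes>\<^bsub>A\<^esub> hat g" by (intro hat_es g)
  have "es S \<odot>\<^bsub>M\<^esub> (hat g \<odot>\<^bsub>M\<^esub> m) = (hat g \<otimes>\<^bsub>A\<^esub> es S) \<odot>\<^bsub>M\<^esub> m"
    unfolding c using m g by (simp add: M.smult_assoc)
  also have "\<dots> = hat g \<odot>\<^bsub>M\<^esub> (es S \<odot>\<^bsub>M\<^esub> m)" using m g by (intro M.smult_assoc) auto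
  finally have "es S \<odot>\<^bsub>M\<^esub> (hat g \<odot>\<^bsub>M\<^esub> m) = hat g \<odot>\<^bsub>M\<^esub> m" using m by simp
  then show ?thesis using m g by (simp add: M.smult_closed)
qed

lemma restr_t:
  assumes "left_module A M" "y \<in> S" "m \<in> carrier M"
  shows "t y y \<odot>\<^bsub>M\<^esub> m \<in> carrier (restr S M)"
proof -
  interpret M: left_module A M by fact
  show ?thesis using assms(2,3) by (simp add: M.smult_closed M.smult_assoc[symmetric] es_t)
qed

text \<open>A graded map commutes with \<open>es S\<close>, so the same \<open>\<theta>\<close>
  restricts to the truncation.\<close>

lemma higman_orbit:
  assumes M: "left_module A M" and h: "higman M" and S: "S \<subseteq> P"
  shows "orbit_higman S M"
proof -
  interpret M: left_module A M by fact
  obtain \<theta> where \<theta>: "lin D_gens M M \<theta>" "\<And>m. m \<in> carrier M \<Longrightarrow> tr M M \<theta> m = m"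
    using h by (auto simp: higman_def)
  have c: "\<theta> m \<in> carrier (restr S M)" if "m \<in> carrier (restr S M)" for m
    using that lin_closed[OF \<theta>(1)] lin_es[OF M M \<theta>(1), of m S] by simp
  have "lin (range \<kappa> \<union> (\<lambda>y. t y y) ` S) (restr S M) (restr S M) \<theta>"
  proof (rule linI)
    fix a m assume a: "a \<in> range \<kappa> \<union> (\<lambda>y. t y y) ` S" and m: "m \<in> carrier (restr S M)"
    have "a \<in> D_gens" using a S by auto
    then show "\<theta> (a \<odot>\<^bsub>restr S M\<^esub> m) = a \<odot>\<^bsub>restr S M\<^esub> \<theta> m" using lin_smult[OF \<theta>(1)] m by simp
  qed (use c in \<open>auto simp: lin_add[OF \<theta>(1)]\<close>)
  then show ?thesis unfolding orbit_higman_def using \<theta>(2) by (intro exI[of _ \<theta>]) simp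
qed

lemma orbit_higman_zero:
  assumes M: "left_module A M" and "\<And>y. y \<in> S \<Longrightarrow> \<not> supp M y"
  shows "orbit_higman S M"
proof -
  interpret M: left_module A M by fact
  have "m = \<zero>\<^bsub>M\<^esub>" if m: "m \<in> carrier (restr S M)" for m
  proof -
    have "m = es S \<odot>\<^bsub>M\<^esub> m" using m by simp
    also have "\<dots> = (\<Oplus>\<^bsub>M\<^esub>z\<in>S \<inter> P. t z z \<odot>\<^bsub>M\<^esub> m)" using m unfolding es_sum by (intro M.finsum_smult) auto
    also have "\<dots> = (\<Oplus>\<^bsub>M\<^esub>z\<in>S \<inter> P. \<zero>\<^bsub>M\<^esub>)"
      using m assms(2) by (intro M.M.finsum_cong') (auto simp: supp_def)
    finally show ?thesis by simp
  qed
  moreover have "tr M M (\<lambda>x. x) \<zero>\<^bsub>M\<^esub> = \<zero>\<^bsub>M\<^esub>"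
  proof -
    have "tr M M (\<lambda>x. x) \<zero>\<^bsub>M\<^esub> = (\<Oplus>\<^bsub>M\<^esub>g\<in>carrier G. \<zero>\<^bsub>M\<^esub>)"
      unfolding tr_def by (intro M.M.finsum_cong') (auto simp: M.smult_zero_right)
    then show ?thesis by simp
  qed
  ultimately show ?thesis unfolding orbit_higman_def by (intro exI[of _ "\<lambda>x. x"] conjI lin_id ballI) metis
qed

text \<open>Glue the maps given on the orbits along the grading: at the object y use the map of its
  orbit. The trace of the glued map is then the sum over y of the traces on the components at
  y.\<close>

lemma orbits_higman:
  assumes M: "left_module A M"
    and Ob: "\<And>x. x \<in> P \<Longrightarrow> x \<in> Ob x \<and> Ob x \<subseteq> P" "\<And>g x. g \<in> carrier G \<Longrightarrow> x \<in> P \<Longrightarrow> Ob (\<phi> g x) = Ob x"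
    and h: "\<And>x. x \<in> P \<Longrightarrow> orbit_higman (Ob x) M"
  shows "higman M"
proof -
  interpret M: left_module A M by fact
  \<comment> \<open>The choice depends on the orbit as a set, so all objects of one orbit share the
    same map and conjugation by \<open>g\<close> matches the pieces at y and at gy.\<close>
  define \<Theta> where "\<Theta> S = (SOME \<theta>. lin (range \<kappa> \<union> (\<lambda>y. t y y) ` S) (restr S M) (restr S M) \<theta> \<and>
     (\<forall>m\<in>carrier (restr S M). tr M M \<theta> m = m))" for S
  have \<Theta>: "lin (range \<kappa> \<union> (\<lambda>y. t y y) ` Ob x) (restr (Ob x) M) (restr (Ob x) M) (\<Theta> (Ob x))"
    "\<And>m. m \<in> carrier (restr (Ob x) M) \<Longrightarrow> tr M M (\<Theta> (Ob x)) m = m" if "x \<in> P" for x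
    using someI_ex[OF h[OF that, unfolded orbit_higman_def]] unfolding \<Theta>_def[symmetric] by auto
  define F where "F y m = \<Theta> (Ob y) (t y y \<odot>\<^bsub>M\<^esub> m)" for y m
  define \<theta> where "\<theta> m = (\<Oplus>\<^bsub>M\<^esub>y\<in>P. F y m)" for m
  have tc: "t y y \<odot>\<^bsub>M\<^esub> m \<in> carrier (restr (Ob y) M)" if "y \<in> P" "m \<in> carrier M" for y m
    using restr_t[OF M] Ob(1) that by blast
  have \<Theta>0: "\<Theta> (Ob y) \<zero>\<^bsub>M\<^esub> = \<zero>\<^bsub>M\<^esub>" if "y \<in> P" for y
    using additive_zero[OF restr_group[OF M] restr_group[OF M] \<Theta>(1)[OF that]] by simp
  have Fr: "F y m \<in> carrier (restr (Ob y) M)" if "y \<in> P" "m \<in> carrier M" for y m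
    unfolding F_def by (rule lin_closed[OF \<Theta>(1)[OF that(1)] tc[OF that]])
  then have Fc: "F y m \<in> carrier M" if "y \<in> P" "m \<in> carrier M" for y m using that by simp
  have F_t: "t y y \<odot>\<^bsub>M\<^esub> F y m = F y m" if "y \<in> P" "m \<in> carrier M" for y m
    using lin_smult[OF \<Theta>(1)[OF that(1)], of "t y y" "t y y \<odot>\<^bsub>M\<^esub> m"] tc[OF that] Ob(1)[OF that(1)] that(2)
    by (auto simp: F_def M.smult_assoc[symmetric])
  have F_lin: "lin (range \<kappa>) M M (F y)" if y: "y \<in> P" for y
  proof (rule linI)
    fix m n assume m: "m \<in> carrier M" and n: "n \<in> carrier M"
    show "F y (m \<oplus>\<^bsub>M\<^esub> n) = F y m \<oplus>\<^bsub>M\<^esub> F y n"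
      using lin_add[OF \<Theta>(1)[OF y] tc[OF y m] tc[OF y n]] m n by (simp add: F_def M.smult_r_distr)
  next
    fix a m assume a: "a \<in> range \<kappa>" and m: "m \<in> carrier M"
    have "t y y \<odot>\<^bsub>M\<^esub> (a \<odot>\<^bsub>M\<^esub> m) = a \<odot>\<^bsub>M\<^esub> (t y y \<odot>\<^bsub>M\<^esub> m)"
      using a m by (auto simp: M.smult_assoc[symmetric] \<kappa>_central)
    then show "F y (a \<odot>\<^bsub>M\<^esub> m) = a \<odot>\<^bsub>M\<^esub> F y m"
      using lin_smult[OF \<Theta>(1)[OF y] _ tc[OF y m], of a] a by (simp add: F_def)
  qed (rule Fc[OF y])
  have "lin D_gens M M \<theta>"
  proof (rule linI)
    show "\<theta> m \<in> carrier M" if "m \<in> carrier M" for m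
      using Fc that by (auto simp: \<theta>_def intro: M.M.finsum_closed)
    fix m n assume m: "m \<in> carrier M" and n: "n \<in> carrier M"
    have "\<theta> (m \<oplus>\<^bsub>M\<^esub> n) = (\<Oplus>\<^bsub>M\<^esub>y\<in>P. F y m \<oplus>\<^bsub>M\<^esub> F y n)"
      unfolding \<theta>_def using m n Fc by (intro M.M.finsum_cong') (auto simp: lin_add[OF F_lin])
    then show "\<theta> (m \<oplus>\<^bsub>M\<^esub> n) = \<theta> m \<oplus>\<^bsub>M\<^esub> \<theta> n"
      using m n Fc by (simp add: \<theta>_def M.M.finsum_addf Pi_iff)
  next
    fix a m assume a: "a \<in> D_gens" and m: "m \<in> carrier M"
    have aA: "a \<in> carrier A" using a by auto
    have "F y (a \<odot>\<^bsub>M\<^esub> m) = a \<odot>\<^bsub>M\<^esub> F y m" if y: "y \<in> P" for y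
    proof (cases "a \<in> range \<kappa>")
      case True
      then show ?thesis using lin_smult[OF F_lin[OF y]] m by simp
    next
      case False
      then obtain z where z: "a = t z z" "z \<in> P" using a by auto
      have "a \<odot>\<^bsub>M\<^esub> F y m = (if z = y then F y m else \<zero>\<^bsub>M\<^esub>)"
      proof (cases "z = y")
        case False
        then have "t z z \<odot>\<^bsub>M\<^esub> (t y y \<odot>\<^bsub>M\<^esub> F y m) = \<zero>\<^bsub>M\<^esub>"
          using Fc[OF y m] by (simp add: M.smult_assoc[symmetric] t_orth M.smult_zero_left)
        then show ?thesis using F_t[OF y m] False z by simp
      qed (simp add: z F_t y m)
      moreover have "F y (a \<odot>\<^bsub>M\<^esub> m) = (if z = y then F y m else \<zero>\<^bsub>M\<^esub>)"
        using m y z by (auto simp: F_def M.smult_assoc[symmetric] t_orth M.smult_zero_left \<Theta>0)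
      ultimately show ?thesis by simp
    qed
    then show "\<theta> (a \<odot>\<^bsub>M\<^esub> m) = a \<odot>\<^bsub>M\<^esub> \<theta> m"
      unfolding \<theta>_def using Fc m aA M.smult_closed by (subst M.smult_finsum) (auto intro!: M.M.finsum_cong')
  qed
  moreover have "tr M M \<theta> m = m" if m: "m \<in> carrier M" for m
  proof -
    note [simp] = M.smult_closed
    have Oc: "\<Theta> (Ob y) (hat g \<odot>\<^bsub>M\<^esub> (t y y \<odot>\<^bsub>M\<^esub> m)) \<in> carrier M" if "y \<in> P" "g \<in> carrier G" for y g
    proof -
      have "hat g \<odot>\<^bsub>M\<^esub> (t y y \<odot>\<^bsub>M\<^esub> m) = t (\<phi> g y) (\<phi> g y) \<odot>\<^bsub>M\<^esub> (hat g \<odot>\<^bsub>M\<^esub> m)"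
        using that m by (simp add: M.smult_assoc[symmetric] hat_t)
      then show ?thesis
        using that m Ob(2)[OF that(2,1)] Fc[of "\<phi> g y" "hat g \<odot>\<^bsub>M\<^esub> m"] by (simp add: F_def act_closed)
    qed
    have "tr M M \<theta> m = (\<Oplus>\<^bsub>M\<^esub>g\<in>carrier G. \<Oplus>\<^bsub>M\<^esub>y\<in>P. hat g \<odot>\<^bsub>M\<^esub> \<Theta> (Ob y) (hat (inv g) \<odot>\<^bsub>M\<^esub> (t y y \<odot>\<^bsub>M\<^esub> m)))"
      unfolding tr_def
    proof (rule M.M.finsum_cong'[OF refl])
      fix g assume g: "g \<in> carrier G"
      have ig: "inv g \<in> carrier G" using g by simp
      have gm: "hat (inv g) \<odot>\<^bsub>M\<^esub> m \<in> carrier M" using g m by simp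
      \<comment> \<open>Reindexing by \<open>inv g\<close> turns the piece at
        \<open>\<phi> (inv g) y\<close> into one that depends on the component of \<open>m\<close>
        at y.\<close>
      have "\<theta> (hat (inv g) \<odot>\<^bsub>M\<^esub> m) = (\<Oplus>\<^bsub>M\<^esub>y\<in>\<phi> (inv g) ` P. F y (hat (inv g) \<odot>\<^bsub>M\<^esub> m))"
        unfolding \<theta>_def using act_bij[OF ig] by (simp add: bij_betw_def)
      also have "\<dots> = (\<Oplus>\<^bsub>M\<^esub>y\<in>P. F (\<phi> (inv g) y) (hat (inv g) \<odot>\<^bsub>M\<^esub> m))"
        using act_bij[OF ig] Fc gm by (intro M.M.finsum_reindex) (auto simp: bij_betw_def)
      also have "\<dots> = (\<Oplus>\<^bsub>M\<^esub>y\<in>P. \<Theta> (Ob y) (hat (inv g) \<odot>\<^bsub>M\<^esub> (t y y \<odot>\<^bsub>M\<^esub> m)))"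
      proof (rule M.M.finsum_cong'[OF refl])
        fix y assume y: "y \<in> P"
        have "hat (inv g) \<odot>\<^bsub>M\<^esub> (t y y \<odot>\<^bsub>M\<^esub> m) = t (\<phi> (inv g) y) (\<phi> (inv g) y) \<odot>\<^bsub>M\<^esub> (hat (inv g) \<odot>\<^bsub>M\<^esub> m)"
          using ig y m by (simp add: M.smult_assoc[symmetric] hat_t)
        then show "F (\<phi> (inv g) y) (hat (inv g) \<odot>\<^bsub>M\<^esub> m) = \<Theta> (Ob y) (hat (inv g) \<odot>\<^bsub>M\<^esub> (t y y \<odot>\<^bsub>M\<^esub> m))"
          using Ob(2)[OF ig y] by (simp add: F_def)
      qed (use Oc ig in auto)
      finally show "hat g \<odot>\<^bsub>M\<^esub> \<theta> (hat (inv g) \<odot>\<^bsub>M\<^esub> m) =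
          (\<Oplus>\<^bsub>M\<^esub>y\<in>P. hat g \<odot>\<^bsub>M\<^esub> \<Theta> (Ob y) (hat (inv g) \<odot>\<^bsub>M\<^esub> (t y y \<odot>\<^bsub>M\<^esub> m)))"
        using Oc ig g by (simp add: M.smult_finsum[of "hat g"] Pi_iff)
    qed (use Oc in \<open>auto intro!: M.M.finsum_closed\<close>)
    \<comment> \<open>After the exchange of sums the inner sum is the trace of
      \<open>\<Theta> (Ob y)\<close> at the component of \<open>m\<close> at y, which gives back
      that component.\<close>
    also have "\<dots> = (\<Oplus>\<^bsub>M\<^esub>y\<in>P. \<Oplus>\<^bsub>M\<^esub>g\<in>carrier G. hat g \<odot>\<^bsub>M\<^esub> \<Theta> (Ob y) (hat (inv g) \<odot>\<^bsub>M\<^esub> (t y y \<odot>\<^bsub>M\<^esub> m)))"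
      using Oc by (intro M.M.finsum_swap finite_G finite_P) auto
    also have "\<dots> = (\<Oplus>\<^bsub>M\<^esub>y\<in>P. t y y \<odot>\<^bsub>M\<^esub> m)"
      using \<Theta>(2)[OF _ tc] m by (intro M.M.finsum_cong') (auto simp: tr_def)
    finally show ?thesis using one_act[OF M m] by simp
  qed
  ultimately show ?thesis unfolding higman_def by blast
qed

end

section \<open>Orbits as posets with trivial relations\<close>

context gposet begin

lemma orbit_subset: "x \<in> P \<Longrightarrow> orbit G \<phi> x \<subseteq> P"
  by (auto simp: orbit_def act_closed)

lemma orbit_self: "x \<in> P \<Longrightarrow> x \<in> orbit G \<phi> x"
  unfolding orbit_def using act_one[of x] by (intro CollectI exI[of _ \<one>]) simp

lemma orbit_stable: "x \<in> P \<Longrightarrow> g \<in> carrier G \<Longrightarrow> y \<in> orbit G \<phi> x \<Longrightarrow> \<phi> g y \<in> orbit G \<phi> x"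
  unfolding orbit_def by (auto simp: act_mult[symmetric])

lemma orbit_eq:
  assumes "x \<in> P" "g \<in> carrier G"
  shows "orbit G \<phi> (\<phi> g x) = orbit G \<phi> x"
proof
  show "orbit G \<phi> (\<phi> g x) \<subseteq> orbit G \<phi> x"
    using assms unfolding orbit_def by (auto simp: act_mult[symmetric])
  show "orbit G \<phi> x \<subseteq> orbit G \<phi> (\<phi> g x)"
  proof
    fix y assume "y \<in> orbit G \<phi> x"
    then obtain h where h: "h \<in> carrier G" "y = \<phi> h x" by (auto simp: orbit_def)
    then have "y = \<phi> (h \<otimes> inv g) (\<phi> g x)"
      using assms by (simp add: act_mult[symmetric] m_assoc)
    then show "y \<in> orbit G \<phi> (\<phi> g x)" using h assms by (auto simp: orbit_def)
  qed
qed

lemma orbit_gposet: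
  assumes "x \<in> P"
  shows "gposet G (orbit G \<phi> x) (Id_on (orbit G \<phi> x)) \<phi>"
  using orbit_subset[OF assms] orbit_stable[OF assms]
  by unfold_locales
    (auto simp: finite_G act_mult act_one subset_iff intro: finite_subset[OF _ finite_P])

lemma CA_talg: "talg G P r \<phi> (CA :: (_ \<Rightarrow> 'k::field) ring) (\<lambda>a. a)"
  by (intro talg.intro talg_axioms.intro gposet_axioms CA_ring) (auto simp: ring_hom_def bij_betw_def)

end

text \<open>The opposite algebra is that of the opposite poset: \<open>(g, gx \<le> y)\<close> becomes \<open>(g\<inverse>, g\<inverse>y \<ge> x)\<close>.\<close>

lemma (in talg) opposite:
  "talg G P (r\<inverse>) \<phi> (opposite_ring A) (\<lambda>a (g, x, y). if g \<in> carrier G then \<psi> a (inv g, y, x) else 0)"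
    (is "talg _ _ _ _ _ ?\<psi>")
proof -
  interpret D: gposet G P "r\<inverse>" \<phi> by (rule dual)
  have off: "\<psi> a (g, x, y) = 0" if "a \<in> carrier A" "\<not> (g \<in> carrier G \<and> x \<in> P \<and> y \<in> P \<and> (\<phi> g x, y) \<in> r)" for a g x y
    using that \<psi>_off[of a "(g, x, y)"] by simp
  have rel: "(\<phi> (inv g) y, x) \<in> r \<longleftrightarrow> (y, \<phi> g x) \<in> r" if "g \<in> carrier G" "x \<in> P" "y \<in> P" for g x y
    using act_rel_iff[of "inv g" y x] that by simp
  \<comment> \<open>The guard on \<open>g\<close> keeps the coefficients 0 off the morphisms, since
    \<open>inv\<close> is unspecified outside the carrier.\<close>
  have closed: "?\<psi> a \<in> carrier D.CA" if a: "a \<in> carrier A" for a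
    unfolding D.CA_simps using off[OF a] rel by (auto split: prod.splits)
  have mult: "?\<psi> (b \<otimes>\<^bsub>A\<^esub> a) = ?\<psi> a \<otimes>\<^bsub>D.CA\<^esub> ?\<psi> b" if a: "a \<in> carrier A" and b: "b \<in> carrier A" for a b
  proof (rule D.CA_eqI)
    show "?\<psi> (b \<otimes>\<^bsub>A\<^esub> a) \<in> carrier D.CA" using closed[of "b \<otimes>\<^bsub>A\<^esub> a"] a b by simp
    show "?\<psi> a \<otimes>\<^bsub>D.CA\<^esub> ?\<psi> b \<in> carrier D.CA" by (rule D.CA_closed)
    fix g x z assume *: "g \<in> carrier G" "x \<in> P" "z \<in> P"
    have "?\<psi> (b \<otimes>\<^bsub>A\<^esub> a) (g, x, z) =
        (\<Sum>h\<in>carrier G. \<Sum>y\<in>P. \<psi> b (h, y, x) * \<psi> a (inv h \<otimes> inv g, z, y))"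
      using * a b by (simp add: \<psi>_mult)
    \<comment> \<open>Replacing \<open>h\<close> by \<open>g \<otimes> h\<close> brings the sum into
      the form of \<open>CA_mult\<close> for the reversed order.\<close>
    also have "\<dots> = (\<Sum>h\<in>carrier G. \<Sum>y\<in>P. \<psi> b (inv (inv h \<otimes> g), y, x) * \<psi> a (inv h, z, y))"
    proof (rule sum.reindex_bij_witness[of _ "\<lambda>h. inv g \<otimes> h" "\<lambda>h. g \<otimes> h"])
      fix h assume h: "h \<in> carrier G"
      show "inv g \<otimes> (g \<otimes> h) = h" "g \<otimes> (inv g \<otimes> h) = h" using h * by (simp_all add: m_assoc[symmetric])
      have "inv (inv (g \<otimes> h) \<otimes> g) = h" using h * by (simp add: inv_mult_group m_assoc)
      moreover have "inv (g \<otimes> h) = inv h \<otimes> inv g" using h * by (simp add: inv_mult_group)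
      ultimately show "(\<Sum>y\<in>P. \<psi> b (inv (inv (g \<otimes> h) \<otimes> g), y, x) * \<psi> a (inv (g \<otimes> h), z, y)) =
          (\<Sum>y\<in>P. \<psi> b (h, y, x) * \<psi> a (inv h \<otimes> inv g, z, y))" by simp
    qed (use * in auto)
    also have "\<dots> = (?\<psi> a \<otimes>\<^bsub>D.CA\<^esub> ?\<psi> b) (g, x, z)"
      using * closed[OF a] closed[OF b] by (subst D.CA_mult) (auto simp: mult.commute intro!: sum.cong)
    finally show "?\<psi> (b \<otimes>\<^bsub>A\<^esub> a) (g, x, z) = (?\<psi> a \<otimes>\<^bsub>D.CA\<^esub> ?\<psi> b) (g, x, z)" .
  qed
  have one: "?\<psi> \<one>\<^bsub>A\<^esub> = \<one>\<^bsub>D.CA\<^esub>"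
  proof (rule D.CA_eqI[OF closed D.one_CA_closed])
    fix g x y assume "g \<in> carrier G" "x \<in> P" "y \<in> P"
    moreover have "inv g = \<one> \<longleftrightarrow> g = \<one>" if "g \<in> carrier G" for g using that by (metis inv_inv inv_one)
    ultimately show "?\<psi> \<one>\<^bsub>A\<^esub> (g, x, y) = \<one>\<^bsub>D.CA\<^esub> (g, x, y)" by (auto simp: \<psi>_one one_CA D.one_CA)
  qed simp
  have "?\<psi> \<in> ring_hom (opposite_ring A) D.CA"
  proof (rule ring_hom_memI)
    show "?\<psi> (a \<oplus>\<^bsub>opposite_ring A\<^esub> b) = ?\<psi> a \<oplus>\<^bsub>D.CA\<^esub> ?\<psi> b"
      if "a \<in> carrier (opposite_ring A)" "b \<in> carrier (opposite_ring A)" for a b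
      using that by (auto simp: \<psi>_add D.CA_simps(4) fun_eq_iff)
  qed (use closed mult one in \<open>simp_all only: opposite_ring_simps\<close>)
  moreover have "bij_betw ?\<psi> (carrier (opposite_ring A)) (carrier D.CA)"
  proof (rule bij_betw_imageI)
    show "inj_on ?\<psi> (carrier (opposite_ring A))"
    proof (rule inj_onI)
      fix a b assume ab: "a \<in> carrier (opposite_ring A)" "b \<in> carrier (opposite_ring A)" "?\<psi> a = ?\<psi> b"
      show "a = b"
      proof (rule \<psi>_eqI)
        fix g x y assume "g \<in> carrier G"
        then show "\<psi> a (g, x, y) = \<psi> b (g, x, y)" using fun_cong[OF ab(3), of "(inv g, y, x)"] by simp
      qed (use ab in auto)
    qed
    show "?\<psi> ` carrier (opposite_ring A) = carrier D.CA"
    proof (intro subset_antisym subsetI)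
      fix w assume w: "w \<in> carrier (D.CA :: ('g \<times> 'p \<times> 'p \<Rightarrow> 'k) ring)"
      let ?v = "\<lambda>(g, x, y). if g \<in> carrier G then w (inv g, y, x) else 0"
      have w0: "w (g, x, y) = 0" if "\<not> (g \<in> carrier G \<and> x \<in> P \<and> y \<in> P \<and> (y, \<phi> g x) \<in> r)" for g x y
        using w that by (auto simp: D.CA_simps)
      have v: "?v \<in> carrier CA"
        unfolding CA_simps using w0 act_rel_iff by (auto split: prod.splits)
      have "?\<psi> (el ?v) = w"
        using el(2)[OF v] w0 by (auto simp: fun_eq_iff)
      then show "w \<in> ?\<psi> ` carrier (opposite_ring A)" using el(1)[OF v]
        by (intro image_eqI[of w ?\<psi> "el ?v"]) simp_all
    qed (use closed in auto)
  qed
  ultimately show ?thesis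
    by (intro talg.intro talg_axioms.intro D.gposet_axioms opposite_ring A.ring_axioms)
qed

section \<open>Projectivity of truncations to orbits\<close>

context gposet begin

interpretation T: talg G P r \<phi> CA "\<lambda>a. a" by (rule CA_talg)

text \<open>Over the algebra of one orbit, projective and Higman agree, as the relations are
  trivial. What remains is to see that this algebra sits inside the large one with unit
  \<open>es S\<close>, and that its scalars, group elements and traces act on the truncation as
  those of the large algebra do.\<close>

lemma orbit_projective_iff:
  fixes M :: "('a \<times> 'p \<times> 'p \<Rightarrow> 'k::field, 'm) module"
  assumes x: "x \<in> P" and fg: "fg_module CA M"
  defines "D \<equiv> orbit_category G \<phi> x"
  shows "projective_module (category_algebra D) (truncation D M) \<longleftrightarrow> T.orbit_higman (orbit G \<phi> x) M"
proof -
  define S where "S = orbit G \<phi> x"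
  have S: "S \<subseteq> P" "\<And>g y. g \<in> carrier G \<Longrightarrow> y \<in> S \<Longrightarrow> \<phi> g y \<in> S"
    using orbit_subset[OF x] orbit_stable[OF x] by (auto simp: S_def)
  have D: "D = transporter_category G S (Id_on S) \<phi>" by (simp add: D_def orbit_category_def S_def)
  interpret Oc: gposet G S "Id_on S" \<phi> unfolding S_def by (rule orbit_gposet[OF x])
  interpret To: talg G S "Id_on S" \<phi> "Oc.CA :: ('a \<times> 'p \<times> 'p \<Rightarrow> 'k) ring" "\<lambda>a. a" by (rule Oc.CA_talg)
  have M: "left_module CA M" using fg by (rule fg_module_left)
  interpret M: left_module "CA :: ('a \<times> 'p \<times> 'p \<Rightarrow> 'k) ring" M by (rule M)
  let ?A = "CA :: ('a \<times> 'p \<times> 'p \<Rightarrow> 'k) ring" and ?B = "Oc.CA :: ('a \<times> 'p \<times> 'p \<Rightarrow> 'k) ring"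
  let ?R = "T.restr S M"
  have B0: "a (g, u, v) = 0" if "a \<in> carrier ?B" "\<not> (g \<in> carrier G \<and> u \<in> S \<and> v \<in> S \<and> \<phi> g u = v)" for a g u v
    using that by (auto simp: Oc.CA_simps Id_on_iff)
  have sub: "a \<in> carrier ?A" if a: "a \<in> carrier ?B" for a
  proof -
    have "a f = 0" if "f \<notin> ar" for f
    proof -
      obtain g u v where f: "f = (g, u, v)" by (cases f)
      then have "\<not> (g \<in> carrier G \<and> u \<in> S \<and> v \<in> S \<and> \<phi> g u = v)" using that S rel_refl by auto
      then show ?thesis using B0[OF a] f by simp
    qed
    then show ?thesis unfolding CA_simps by blast
  qed
  \<comment> \<open>The additional summands of the large product, with middle object outside S,
    vanish because \<open>a\<close> is supported on S.\<close>
  have mult: "a \<otimes>\<^bsub>?B\<^esub> b = a \<otimes>\<^bsub>?A\<^esub> b" if a: "a \<in> carrier ?B" and b: "b \<in> carrier ?B" for a b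
  proof (rule CA_eqI)
    show "a \<otimes>\<^bsub>?B\<^esub> b \<in> carrier ?A" by (rule sub[OF Oc.CA_closed])
    show "a \<otimes>\<^bsub>?A\<^esub> b \<in> carrier ?A" by (rule CA_closed)
    fix g u w assume *: "g \<in> carrier G" "u \<in> P" "w \<in> P"
    have A: "(a \<otimes>\<^bsub>?A\<^esub> b) (g, u, w) = (\<Sum>h\<in>carrier G. \<Sum>y\<in>P. a (h, y, w) * b (inv h \<otimes> g, u, y))"
      by (rule CA_mult[OF sub[OF a] sub[OF b] *])
    show "(a \<otimes>\<^bsub>?B\<^esub> b) (g, u, w) = (a \<otimes>\<^bsub>?A\<^esub> b) (g, u, w)"
    proof (cases "u \<in> S \<and> w \<in> S")
      case True
      have "(a \<otimes>\<^bsub>?A\<^esub> b) (g, u, w) = (\<Sum>h\<in>carrier G. \<Sum>y\<in>S. a (h, y, w) * b (inv h \<otimes> g, u, y))"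
        unfolding A by (intro sum.cong[OF refl] sum.mono_neutral_right) (use S finite_P B0[OF a] in auto)
      then show ?thesis using True Oc.CA_mult[OF a b *(1)] by simp
    next
      case False
      then have "(a \<otimes>\<^bsub>?A\<^esub> b) (g, u, w) = 0"
        unfolding A using B0[OF a] B0[OF b] by (intro sum.neutral ballI) auto
      moreover have "(a \<otimes>\<^bsub>?B\<^esub> b) (g, u, w) = 0" using B0[OF Oc.CA_closed] False by blast
      ultimately show ?thesis by simp
    qed
  qed
  have one: "\<one>\<^bsub>?B\<^esub> = T.es S"
  proof
    fix f show "\<one>\<^bsub>?B\<^esub> f = T.es S f"
      using S by (cases f) (auto simp: Oc.CA_simps T.es(2))
  qed
  have es_left: "T.es S \<otimes>\<^bsub>?A\<^esub> a = a" if "a \<in> carrier ?B" for a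
    using mult[OF Oc.one_CA_closed that] To.A.l_one[OF that] by (simp add: one)
  have es_act: "T.es S \<odot>\<^bsub>M\<^esub> (a \<odot>\<^bsub>M\<^esub> m) = a \<odot>\<^bsub>M\<^esub> m" if "a \<in> carrier ?B" "m \<in> carrier M" for a m
    using that sub[OF that(1)] by (simp add: M.smult_assoc[symmetric] es_left)
  have trunc: "truncation D M = ?R"
  proof -
    have "(\<lambda>m. T.es S \<odot>\<^bsub>M\<^esub> m) ` carrier M = {m \<in> carrier M. T.es S \<odot>\<^bsub>M\<^esub> m = m}"
    proof (intro subset_antisym subsetI)
      fix m assume "m \<in> {m \<in> carrier M. T.es S \<odot>\<^bsub>M\<^esub> m = m}"
      then show "m \<in> (\<lambda>m. T.es S \<odot>\<^bsub>M\<^esub> m) ` carrier M" by (auto intro: rev_image_eqI)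
    qed (auto simp: M.smult_closed M.smult_assoc[symmetric] T.es_mult)
    then show ?thesis by (simp add: truncation_def D one T.restr_def)
  qed
  have R: "left_module ?B ?R"
  proof (rule left_moduleI)
    show "a \<odot>\<^bsub>?R\<^esub> m \<in> carrier ?R" if "a \<in> carrier ?B" "m \<in> carrier ?R" for a m
      using that sub[OF that(1)] by (simp add: M.smult_closed es_act)
    show "(a \<oplus>\<^bsub>?B\<^esub> b) \<odot>\<^bsub>?R\<^esub> m = a \<odot>\<^bsub>?R\<^esub> m \<oplus>\<^bsub>?R\<^esub> b \<odot>\<^bsub>?R\<^esub> m"
      if "a \<in> carrier ?B" "b \<in> carrier ?B" "m \<in> carrier ?R" for a b m
      using M.smult_l_distr[OF sub[OF that(1)] sub[OF that(2)]] that(3) by (simp add: CA_simps(4) Oc.CA_simps(4))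
  qed (auto simp: To.A.ring_axioms T.restr_group[OF M] sub M.smult_r_distr M.smult_assoc mult one)
  \<comment> \<open>The generators of the small algebra are those of the large one cut down by
    \<open>es S\<close>; on vectors fixed by \<open>es S\<close> the two act alike.\<close>
  have \<kappa>: "To.\<kappa> c = T.\<kappa> c \<otimes>\<^bsub>?A\<^esub> T.es S" for c
  proof
    fix f show "To.\<kappa> c f = (T.\<kappa> c \<otimes>\<^bsub>?A\<^esub> T.es S) f"
      using S T.\<psi>_\<kappa>_mult[OF T.es(1), of c S f] by (cases f) (auto simp: To.\<kappa>(2) T.es(2))
  qed
  have hat: "To.hat g = T.hat g \<otimes>\<^bsub>?A\<^esub> T.es S" if g: "g \<in> carrier G" for g
  proof (rule T.\<psi>_eqI)
    show "To.hat g \<in> carrier ?A" using g by (intro sub) simp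
    fix h u w assume *: "h \<in> carrier G" "u \<in> P" "w \<in> P"
    have "\<phi> (inv g) w = u \<longleftrightarrow> w = \<phi> g u" using g * by (simp add: T.act_inv_eq_iff)
    then show "To.hat g (h, u, w) = (T.hat g \<otimes>\<^bsub>?A\<^esub> T.es S) (h, u, w)"
      using g * S by (auto simp: T.\<psi>_hat_mult To.hat(2) T.es(2) T.inv_mult_eq)
  qed (use g in auto)
  have t: "To.t y y = T.t y y" if "y \<in> S" for y
  proof
    fix f show "To.t y y f = T.t y y f"
      using that S rel_refl by (cases f) (auto simp: To.t(2) T.t(2))
  qed
  have act: "To.\<kappa> c \<odot>\<^bsub>M\<^esub> m = T.\<kappa> c \<odot>\<^bsub>M\<^esub> m" "g \<in> carrier G \<Longrightarrow> To.hat g \<odot>\<^bsub>M\<^esub> m = T.hat g \<odot>\<^bsub>M\<^esub> m"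
    if "m \<in> carrier ?R" for c g m
    using that by (simp_all add: \<kappa> hat M.smult_assoc)
  have "To.kfin ?R"
  proof -
    obtain F where F: "finite F" "F \<subseteq> carrier M" "carrier M \<subseteq> mspan (range T.\<kappa>) M F"
      using fg by (auto simp: T.fg_iff_kfin T.kfin_def)
    let ?e = "\<lambda>m. T.es S \<odot>\<^bsub>M\<^esub> m"
    have eR: "?e m \<in> carrier ?R" if "m \<in> carrier M" for m
      using that by (simp add: M.smult_closed M.smult_assoc[symmetric] T.es_mult)
    have "?e m \<in> mspan (range To.\<kappa>) ?R (?e ` F)" if "m \<in> mspan (range T.\<kappa>) M F" for m
      using that
    proof induction
      case zero
      have "\<zero>\<^bsub>?R\<^esub> \<in> mspan (range To.\<kappa>) ?R (?e ` F)" by (rule mspan.zero)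
      then show ?case by (simp add: M.smult_zero_right)
    next
      case (add u v)
      then have "u \<in> carrier M" "v \<in> carrier M"
        using mspan_closed[OF M _ F(2)] by blast+
      then show ?case using mspan.add[OF add.IH] by (simp add: M.smult_r_distr)
    next
      case (smult a s)
      then obtain c where c: "a = T.\<kappa> c" by auto
      have s: "s \<in> carrier M" using smult F by auto
      have "?e (a \<odot>\<^bsub>M\<^esub> s) = To.\<kappa> c \<odot>\<^bsub>?R\<^esub> ?e s"
        using s act(1)[OF eR[OF s]] by (simp add: c M.smult_assoc[symmetric] T.\<kappa>_central)
      moreover have "To.\<kappa> c \<odot>\<^bsub>?R\<^esub> ?e s \<in> mspan (range To.\<kappa>) ?R (?e ` F)"
        by (rule mspan.smult) (use smult in auto)
      ultimately show ?case by simp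
    qed
    note span = this
    have "carrier ?R \<subseteq> mspan (range To.\<kappa>) ?R (?e ` F)"
    proof
      fix m assume m: "m \<in> carrier ?R"
      then have "m \<in> mspan (range T.\<kappa>) M F" using F(3) by auto
      from span[OF this] show "m \<in> mspan (range To.\<kappa>) ?R (?e ` F)" using m by simp
    qed
    then show ?thesis unfolding To.kfin_def using F(1,2) eR by (intro exI[of _ "?e ` F"]) auto
  qed
  then have fgR: "fg_module ?B ?R" using R by (simp add: To.fg_iff_kfin)
  have lin_iff: "lin To.D_gens ?R ?R \<theta> \<longleftrightarrow> lin (range T.\<kappa> \<union> (\<lambda>y. T.t y y) ` S) ?R ?R \<theta>" for \<theta>
  proof (cases "\<theta> \<in> carrier ?R \<rightarrow> carrier ?R")
    case True
    then have "\<theta> m \<in> carrier ?R" if "m \<in> carrier ?R" for m using that by auto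
    then show ?thesis unfolding lin_def using True by (simp add: ball_Un act t del: T.restr_simps(1))
  qed (simp add: lin_def)
  have tr: "To.tr ?R ?R \<theta> m = T.tr M M \<theta> m" if \<theta>: "lin To.D_gens ?R ?R \<theta>" and m: "m \<in> carrier ?R" for \<theta> m
  proof -
    have c: "T.hat g \<odot>\<^bsub>M\<^esub> u \<in> carrier ?R" if "g \<in> carrier G" "u \<in> carrier ?R" for g u
      by (rule T.restr_hat[OF M S that])
    have \<theta>c: "\<theta> u \<in> carrier ?R" if "u \<in> carrier ?R" for u using lin_closed[OF \<theta> that] .
    have "To.tr ?R ?R \<theta> m = (\<Oplus>\<^bsub>?R\<^esub>g\<in>carrier G. T.hat g \<odot>\<^bsub>M\<^esub> \<theta> (T.hat (inv g) \<odot>\<^bsub>M\<^esub> m))"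
      unfolding To.tr_def using m c \<theta>c
      by (intro abelian_monoid.finsum_cong'[OF abelian_group.axioms(1)[OF T.restr_group[OF M]]])
        (auto simp: act simp del: T.restr_simps(1))
    also have "\<dots> = T.tr M M \<theta> m"
      unfolding T.tr_def using m c \<theta>c by (intro T.restr_finsum[OF M]) (auto simp del: T.restr_simps(1))
    finally show ?thesis .
  qed
  have "To.higman ?R \<longleftrightarrow> T.orbit_higman S M"
    unfolding To.higman_def T.orbit_higman_def lin_iff[symmetric]
    by (rule ex_cong1, rule conj_cong[OF refl], rule ball_cong[OF refl]) (simp only: tr)
  moreover have "projective_module ?B ?R \<longleftrightarrow> To.higman ?R"
    using To.projective_higman To.higman_discrete_projective[OF _ fgR] by blast
  ultimately show ?thesis unfolding trunc unfolding D S_def[symmetric] by simp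
qed

lemma value_at_supp:
  fixes M :: "('a \<times> 'p \<times> 'p \<Rightarrow> 'k::field, 'm) module"
  assumes "x \<in> P" "left_module CA M"
  shows "value_at cat M x \<noteq> {\<zero>\<^bsub>M\<^esub>} \<longleftrightarrow> T.supp M x"
proof -
  interpret M: left_module "CA :: ('a \<times> 'p \<times> 'p \<Rightarrow> 'k) ring" M by fact
  have "basis_elt (\<one>, x, x) = (T.t x x :: _ \<Rightarrow> 'k)"
  proof
    fix f show "basis_elt (\<one>, x, x) f = (T.t x x f :: 'k)"
      using rel_refl[OF assms(1)] by (cases f) (auto simp: basis_elt_def T.t(2))
  qed
  then have v: "value_at cat M x = (\<lambda>m. T.t x x \<odot>\<^bsub>M\<^esub> m) ` carrier M" by (simp add: value_at_def)
  show ?thesis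
  proof
    assume "T.supp M x"
    then show "value_at cat M x \<noteq> {\<zero>\<^bsub>M\<^esub>}" unfolding v T.supp_def by auto
  next
    assume "value_at cat M x \<noteq> {\<zero>\<^bsub>M\<^esub>}"
    moreover have "\<zero>\<^bsub>M\<^esub> \<in> value_at cat M x"
      unfolding v using M.smult_zero_right[OF T.t(1)] M.M.zero_closed by (metis image_eqI)
    ultimately show "T.supp M x" unfolding v T.supp_def by auto
  qed
qed

text \<open>The element \<open>hat g\<close> maps M(x) isomorphically onto M(gx), so being an
  M-object is a property of the orbit.\<close>

lemma supp_orbit:
  fixes M :: "('a \<times> 'p \<times> 'p \<Rightarrow> 'k::field, 'm) module"
  assumes "x \<in> P" "left_module CA M" "y \<in> orbit G \<phi> x" "T.supp M y"
  shows "T.supp M x"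
proof -
  interpret M: left_module "CA :: ('a \<times> 'p \<times> 'p \<Rightarrow> 'k) ring" M by fact
  obtain g where g: "g \<in> carrier G" "y = \<phi> g x" using assms(3) by (auto simp: orbit_def)
  obtain m where m: "m \<in> carrier M" "T.t y y \<odot>\<^bsub>M\<^esub> m \<noteq> \<zero>\<^bsub>M\<^esub>" using assms(4) by (auto simp: T.supp_def)
  have gm: "T.hat (inv g) \<odot>\<^bsub>M\<^esub> m \<in> carrier M" using g m by (auto intro: M.smult_closed)
  have "T.hat g \<odot>\<^bsub>M\<^esub> (T.t x x \<odot>\<^bsub>M\<^esub> (T.hat (inv g) \<odot>\<^bsub>M\<^esub> m)) = T.t y y \<odot>\<^bsub>M\<^esub> (T.hat g \<odot>\<^bsub>M\<^esub> (T.hat (inv g) \<odot>\<^bsub>M\<^esub> m))"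
    using g assms(1) gm by (simp add: M.smult_assoc[symmetric] T.hat_t)
  also have "\<dots> = T.t y y \<odot>\<^bsub>M\<^esub> m"
    using g m by (simp add: M.smult_assoc[symmetric] T.hat_mult[symmetric] T.hat_one M.smult_one)
  finally have "T.t x x \<odot>\<^bsub>M\<^esub> (T.hat (inv g) \<odot>\<^bsub>M\<^esub> m) \<noteq> \<zero>\<^bsub>M\<^esub>"
    using m g M.smult_zero_right[of "T.hat g"] by auto
  then show ?thesis unfolding T.supp_def using gm by blast
qed

text \<open>The right-hand side speaks of M-objects only. On every other orbit the restriction of
  \<open>M\<close> is 0, for which the Higman condition is trivial.\<close>

lemma higman_iff_truncations:
  fixes M :: "('a \<times> 'p \<times> 'p \<Rightarrow> 'k::field, 'm) module"
  assumes fg: "fg_module CA M"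
  shows "T.higman M \<longleftrightarrow> (\<forall>x\<in>P. value_at cat M x \<noteq> {\<zero>\<^bsub>M\<^esub>} \<longrightarrow>
      projective_module (category_algebra (orbit_category G \<phi> x)) (truncation (orbit_category G \<phi> x) M))"
proof -
  have M: "left_module CA M" using fg by (rule fg_module_left)
  show ?thesis
  proof
    assume "T.higman M"
    then show "\<forall>x\<in>P. value_at cat M x \<noteq> {\<zero>\<^bsub>M\<^esub>} \<longrightarrow>
        projective_module (category_algebra (orbit_category G \<phi> x)) (truncation (orbit_category G \<phi> x) M)"
      using orbit_projective_iff[OF _ fg] T.higman_orbit[OF M _ orbit_subset] by blast
  next
    assume *: "\<forall>x\<in>P. value_at cat M x \<noteq> {\<zero>\<^bsub>M\<^esub>} \<longrightarrow>
        projective_module (category_algebra (orbit_category G \<phi> x)) (truncation (orbit_category G \<phi> x) M)"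
    have "T.orbit_higman (orbit G \<phi> x) M" if x: "x \<in> P" for x
    proof (cases "T.supp M x")
      case True
      then show ?thesis using * x value_at_supp[OF x M] orbit_projective_iff[OF x fg] by blast
    next
      case False
      then show ?thesis using supp_orbit[OF x M] by (intro T.orbit_higman_zero[OF M]) blast
    qed
    then show "T.higman M"
      using orbit_self orbit_subset orbit_eq by (intro T.orbits_higman[OF M, of "orbit G \<phi>"]) auto
  qed
qed

end

lemma finite_G_poset_gposet:
  assumes "finite_G_poset G P r \<phi>"
  shows "gposet G P r \<phi>"
proof -
  interpret finite_G_poset G P r \<phi> by fact
  interpret group_hom G "BijGroup P" \<phi> by (rule group_hom)
  have r: "r \<subseteq> P \<times> P" "refl_on P r" "trans r" "antisym r"
    using poset by (auto simp: partial_order_on_def preorder_on_def)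
  show ?thesis
  proof unfold_locales
    show "\<phi> \<one>\<^bsub>G\<^esub> x = x" if "x \<in> P" for x using id_eq_one that by (metis restrict_apply')
    show "\<phi> g x \<in> P" if "g \<in> carrier G" "x \<in> P" for g x using element_image that by blast
    show "\<phi> (g \<otimes>\<^bsub>G\<^esub> h) x = \<phi> g (\<phi> h x)" if "g \<in> carrier G" "h \<in> carrier G" "x \<in> P" for g h x
      using composition_rule that by blast
  qed (use r act_automorphism finite_group finite_poset in \<open>auto simp: refl_on_def dest: transD antisymD\<close>)
qed

text \<open>Stated for any \<open>talg\<close>, so that \<open>opposite\<close> yields the right
  regular module as well.\<close>

theorem (in talg) regular_inj_dim: "inj_dim A (regular_module A) < \<infinity>"
proof -
  note P = regular_module_projective[OF A.ring_axioms]
  have "inj_dim A (regular_module A) \<le> enat (poset_dim P r)"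
    using higman_dims(2)[OF projective_module_fg[OF P] projective_higman[OF P]] .
  then show ?thesis by (rule le_less_trans) simp
qed

theorem lemma2p3p1:
  fixes G :: "('g, 'e) monoid_scheme"
    and P :: "'p set" and r :: "'p rel" and \<phi> :: "'g \<Rightarrow> 'p \<Rightarrow> 'p"
    and p :: nat
    and C :: "('p, 'g \<times> 'p \<times> 'p) cat"
    and A :: "('g \<times> 'p \<times> 'p \<Rightarrow> 'k::alg_closed_field) ring"
    and Ao :: "'p \<Rightarrow> ('g \<times> 'p \<times> 'p \<Rightarrow> 'k) ring"
    and trunc :: "('g \<times> 'p \<times> 'p \<Rightarrow> 'k, 'm) module \<Rightarrow> 'p \<Rightarrow> ('g \<times> 'p \<times> 'p \<Rightarrow> 'k, 'm) module"
  assumes "finite_G_poset G P r \<phi>"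
    and "CHAR('k) = p" and "p dvd order G"
  defines "C \<equiv> transporter_category G P r \<phi>"
    and "A \<equiv> category_algebra C"
    and "Ao \<equiv> \<lambda>x. category_algebra (orbit_category G \<phi> x)"
    and "trunc \<equiv> \<lambda>M x. truncation (orbit_category G \<phi> x) M"
  shows
    "(\<forall>Q :: ('g \<times> 'p \<times> 'p \<Rightarrow> 'k, 'm) module.
        projective_module A Q \<or> injective_module A Q \<longrightarrow>
        (\<forall>x\<in>P. value_at C Q x \<noteq> {\<zero>\<^bsub>Q\<^esub>} \<longrightarrow> projective_module (Ao x) (trunc Q x)))
     \<and>
     (\<forall>M :: ('g \<times> 'p \<times> 'p \<Rightarrow> 'k, 'm) module. fg_module A M \<longrightarrow>
        (proj_dim A M < \<infinity> \<longleftrightarrow> inj_dim A M < \<infinity>) \<and>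
        (proj_dim A M < \<infinity> \<longleftrightarrow>
          (\<forall>x\<in>P. value_at C M x \<noteq> {\<zero>\<^bsub>M\<^esub>} \<longrightarrow> projective_module (Ao x) (trunc M x))) \<and>
        (proj_dim A M < \<infinity> \<longrightarrow>
          proj_dim A M \<le> enat (poset_dim P r) \<and> inj_dim A M \<le> enat (poset_dim P r)))
     \<and>
     gorenstein A"
proof -
  interpret gposet G P r \<phi> using assms(1) by (rule finite_G_poset_gposet)
  have A: "A = CA" by (simp add: A_def C_def)
  interpret T: talg G P r \<phi> A "\<lambda>a. a" unfolding A by (rule CA_talg)
  \<comment> \<open>Right modules over A are left modules over this algebra, which belongs to the
    reversed poset.\<close>
  interpret Op: talg G P "r\<inverse>" \<phi> "opposite_ring A" "\<lambda>a (g, x, y). if g \<in> carrier G then a (inv\<^bsub>G\<^esub> g, y, x) else 0"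
    by (rule T.opposite)
  have iff: "T.higman M \<longleftrightarrow> (\<forall>x\<in>P. value_at C M x \<noteq> {\<zero>\<^bsub>M\<^esub>} \<longrightarrow> projective_module (Ao x) (trunc M x))"
    if "fg_module A M" for M :: "('g \<times> 'p \<times> 'p \<Rightarrow> 'k, 'm) module"
    using higman_iff_truncations[of M] that unfolding A Ao_def trunc_def C_def .
  have dims: "proj_dim A M \<le> enat (poset_dim P r) \<and> inj_dim A M \<le> enat (poset_dim P r)"
    if "fg_module A M" "T.higman M" for M :: "('g \<times> 'p \<times> 'p \<Rightarrow> 'k, 'm) module"
    using T.higman_dims[OF that] by blast
  \<comment> \<open>Finite projective and finite injective dimension are compared only through the
    Higman condition, which each of them implies and which bounds both.\<close>
  have fin: "(proj_dim A M < \<infinity> \<longleftrightarrow> T.higman M) \<and> (inj_dim A M < \<infinity> \<longleftrightarrow> T.higman M)"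
    if fg: "fg_module A M" for M :: "('g \<times> 'p \<times> 'p \<Rightarrow> 'k, 'm) module"
    using T.proj_dim_higman[OF fg_module_left[OF fg]] T.inj_dim_higman[OF fg_module_left[OF fg]] dims[OF fg]
    by (meson enat_ord_code(4) le_less_trans)
  have "gorenstein A" unfolding gorenstein_def using T.regular_inj_dim Op.regular_inj_dim by blast
  moreover have "projective_module (Ao x) (trunc Q x)"
    if Q: "projective_module A Q \<or> injective_module A Q" and x: "x \<in> P" "value_at C Q x \<noteq> {\<zero>\<^bsub>Q\<^esub>}"
    for Q :: "('g \<times> 'p \<times> 'p \<Rightarrow> 'k, 'm) module" and x
  proof -
    have "fg_module A Q" "T.higman Q"
      using Q by (auto intro: projective_module_fg injective_module_fg T.projective_higman T.injective_higman)
    then show ?thesis using iff x by blast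
  qed
  ultimately show ?thesis using iff fin dims by simp
qed

end
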